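(* Let $G$ be a finite group and let $\rho$ be a finite-dimensional real representation of $G$ (possibly reducible). Fix a non-degenerate symmetric $G$-invariant bilinear form on $\rho$, and for $x\in\mathrm{End}(\rho)$ let $x^\tau$ be the adjoint operator with respect to this form. Let $\boldsymbol{\mu}$ be an invertible element of $Z(\mathbb{R}[G])$ which is invariant under the linear involution $g\mapsto g^{-1}$, i.e. $\boldsymbol{\mu}(g)=\boldsymbol{\mu}(g^{-1})$ for all $g\in G$. Let $A=Z(\mathbb{R}[G])$, with $l_A(x)$ equal to the value of $\boldsymbol{\mu}^2x/|G|$ at the unit element (the coefficient of the unit element). Let $B=\mathrm{End}_G(\rho)$ be the algebra of intertwining operators, with $l_B(x)=\mathrm{Tr}_\rho(\boldsymbol{\mu}x/|G|)$. Let $\phi:A\to B$ be the map given by the action of $A$ on $\rho$. Let $\star$ on $A$ be the linear involution induced by $g\mapsto g^{-1}$, let $\star$ on $B$ be $x\mapsto x^\tau$, and let $U=\sum_{g\in G}g^2\in A$. Then $H^\rho_{\boldsymbol{\mu}}=((A,l_A),(B,l_B),\phi,U,\star)$ is a semi-simple real equipped Cardy--Frobenius algebra. Moreover, one has $\rho\cong\bigoplus_{\pi\in\mathrm{Ir}(G)}n_\pi\pi$, where $\mathrm{Ir}(G)$ is the set of isomorphism classes of irreducible real representations of $G$ and $n_\pi\ge 0$, and $$H^\rho_{\boldsymbol{\mu}}\otimes\mathbb{C}\cong\bigoplus_{\mathbb{D}=\mathbb{R},\mathbb{C},\mathbb{H}}\ \bigoplus_{\pi\in\mathrm{Ir}_{\mathbb{D}}(G)}H^{\mathbb{D}}_{n_\pi,\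 \boldsymbol{\mu}(\pi)\frac{\dim\pi}{|G|}}\otimes\mathbb{C}$$ as equipped Cardy--Frobenius algebras, where $\mathrm{Ir}_{\mathbb{D}}(G)\subset\mathrm{Ir}(G)$ consists of those $\pi$ with $\mathrm{End}_G(\pi)\cong\mathbb{D}$, and $\boldsymbol{\mu}(\pi)$ is the scalar by which $\boldsymbol{\mu}$ acts on $\pi$.
   Context: All algebras are finite-dimensional, associative and unital over a field $\mathbb{K}$ (here $\mathbb{R}$ or $\mathbb{C}$); the zero algebra is allowed, and $\mathrm{Mat}_0=0$. $Z(\cdot)$ denotes the center, and $\mathbb{R}[G]$ is the group algebra. A Frobenius pair $(C,l_C)$ is an algebra $C$ with a linear functional $l_C$ such that the bilinear form $(c_1,c_2)_C=l_C(c_1c_2)$ is symmetric and non-degenerate. A Cardy--Frobenius algebra $((A,l_A),(B,l_B),\phi)$ consists of: (1) a commutative Frobenius pair $(A,l_A)$; (2) an arbitrary Frobenius pair $(B,l_B)$, not necessarily commutative; (3) an algebra homomorphism $\phi:A\to B$ whose image is contained in the center of $B$ and which satisfies the Cardy condition $(\phi^*(b'),\phi^*(b''))_A=\mathrm{Tr}\,W^B_{b'b''}$ for all $b',b''\in B$. Here $\phi^*:B\to A$ is the dual map, defined by $(\phi^*(b),a)_A=(b,\phi(a))_B$, and $W^B_{b'b''}:B\to B$ is the linear operator $b\mapsto b'bb''$. An equipped Cardy--Frobenius algebra $((A,l_A),(B,l_B),\phi,U,\star)$ is a Cardy--Frobenius algebra together with: involutive linear anti-automorphisms $\star:A\to A$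 and $\star:B\to B$ such that $l_A(x^\star)=l_A(x)$, $l_B(x^\star)=l_B(x)$, $\phi(x^\star)=\phi(x)^\star$; and an element $U\in A$ such that $U^2=K_A^\star$ and $\phi(U)=K_B^\star$. Here, for a Frobenius pair $(C,l_C)$ with basis $\gamma_1,\dots,\gamma_N$ and with $(F_C^{ij})$ the inverse of the matrix $((\gamma_i,\gamma_j)_C)$, one puts $K_C^\star=\sum_{i,j}F_C^{ij}\gamma_i\gamma_j^\star$. It is semi-simple if $A$ and $B$ are semi-simple, and real if $\mathbb{K}=\mathbb{R}$. Direct sums are taken componentwise (in $A$, $B$, $l_A$, $l_B$, $\phi$, $U$, $\star$). An isomorphism is a pair of algebra isomorphisms of the $A$- and $B$-parts compatible with $l_A,l_B,\phi,U,\star$. For a real equipped Cardy--Frobenius algebra $H$, $H\otimes\mathbb{C}$ denotes its complexification (tensor $A$ and $B$ with $\mathbb{C}$ over $\mathbb{R}$, extend all maps $\mathbb{C}$-linearly, and replace $U$ by $U\otimes 1$). The algebras $H^{\mathbb{D}}_{n,\mu}$: let $\mathbb{D}\in\{\mathbb{R},\mathbb{C},\mathbb{H}\}$, $d=\dim_{\mathbb{R}}\mathbb{D}$, $n$ an integer, $\mu\in\mathbb{C}\setminus 0$. The $A$-part is $A_R=Z(\mathbb{D})$ with $l_{A_R}(a)=\mu^2\,\mathrm{Re}(a)/d$; the $B$-part is $B_R=\mathrm{Mat}_n(\mathbb{D})$ with $l_{B_R}(x)=\mu\,\mathrm{Re}\,\mathrm{Tr}(x)$; $\phi_R(a)=a\,\mathrm{Id}$;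 $a^{\star_R}=\overline{a}$, $x^{\star_R}=\overline{x}^{\,t}$ (standard conjugation of $\mathbb{D}$ and matrix transposition); $U_R=(2-d)/\mu$.
   Formalization: The element U is taken to be μ^{-1}·Σ_{g∈G} g² (inverse in Z(R[G])) instead of Σ g²; with the printed U the claim fails, e.g. for G trivial and μ=2, where K_A^*=1/4 but U²=1. *)

theory Defs
  imports
    "HOL-Algebra.Group"
    "HOL-Library.Function_Algebras"
    "HOL-Analysis.Product_Vector"
begin

section \<open>Linear algebra on subspaces\<close>

text \<open>
  Vector spaces and algebras of varying dimension are carried by subsets of an ambient type.
  Addition is that of the ambient type. Functions are a real vector space under the pointwise
  operations.
\<close>

instantiation "fun" :: (type, real_vector) real_vector
begin

definition scaleR_fun :: "real \<Rightarrow> ('a \<Rightarrow> 'b) \<Rightarrow> 'a \<Rightarrow> 'b" where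
  "scaleR_fun c f = (\<lambda>x. c *\<^sub>R f x)"

instance
  by standard (simp_all add: fun_eq_iff scaleR_fun_def algebra_simps)

end

lemma scaleR_fun_apply [simp]: "(c *\<^sub>R f) x = c *\<^sub>R f x"
  by (simp add: scaleR_fun_def)

definition fin_dim_on :: "('k::field \<Rightarrow> 'a::ab_group_add \<Rightarrow> 'a) \<Rightarrow> 'a set \<Rightarrow> bool" where
  "fin_dim_on s V \<longleftrightarrow> module.subspace s V \<and> (\<exists>\<Gamma>. finite \<Gamma> \<and> module.span s \<Gamma> = V)"

definition basis_on :: "('k::field \<Rightarrow> 'a::ab_group_add \<Rightarrow> 'a) \<Rightarrow> 'a set \<Rightarrow> 'a set \<Rightarrow> bool" where
  "basis_on s V \<Gamma> \<longleftrightarrow> finite \<Gamma> \<and> \<not> module.dependent s \<Gamma> \<and> module.span s \<Gamma> = V"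

definition linear_on ::
  "('k::field \<Rightarrow> 'a::ab_group_add \<Rightarrow> 'a) \<Rightarrow> ('k \<Rightarrow> 'b::ab_group_add \<Rightarrow> 'b) \<Rightarrow>
    'a set \<Rightarrow> 'b set \<Rightarrow> ('a \<Rightarrow> 'b) \<Rightarrow> bool" where
  "linear_on s t V W f \<longleftrightarrow>
     f \<in> V \<rightarrow> W \<and>
     (\<forall>x\<in>V. \<forall>y\<in>V. f (x + y) = f x + f y) \<and>
     (\<forall>c. \<forall>x\<in>V. f (s c x) = t c (f x))"

text \<open>The trace does not depend on the basis that is chosen.\<close>

definition trace_on :: "('k::field \<Rightarrow> 'a::ab_group_add \<Rightarrow> 'a) \<Rightarrow> 'a set \<Rightarrow> ('a \<Rightarrow> 'a) \<Rightarrow> 'k" where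
  "trace_on s V f =
     (let \<Gamma> = (SOME \<Gamma>. basis_on s V \<Gamma>) in \<Sum>x\<in>\<Gamma>. module.representation s \<Gamma> (f x) x)"


section \<open>Finite-dimensional algebras and Frobenius pairs\<close>

record ('k, 'a) alg = "'a monoid" +
  scale :: "'k \<Rightarrow> 'a \<Rightarrow> 'a"

locale fin_dim_algebra = monoid C
  for C :: "('k::field, 'a::ab_group_add) alg" (structure) +
  assumes vector_space_scale: "vector_space (scale C)"
    and fin_dim: "fin_dim_on (scale C) (carrier C)"
    and distrib_left:
      "\<lbrakk>x \<in> carrier C; y \<in> carrier C; z \<in> carrier C\<rbrakk> \<Longrightarrow> x \<otimes> (y + z) = x \<otimes> y + x \<otimes> z"
    and distrib_right:
      "\<lbrakk>x \<in> carrier C; y \<in> carrier C; z \<in> carrier C\<rbrakk> \<Longrightarrow> (x + y) \<otimes> z = x \<otimes> z + y \<otimes> z"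
    and scale_mult_left:
      "\<lbrakk>x \<in> carrier C; y \<in> carrier C\<rbrakk> \<Longrightarrow> scale C c x \<otimes> y = scale C c (x \<otimes> y)"
    and scale_mult_right:
      "\<lbrakk>x \<in> carrier C; y \<in> carrier C\<rbrakk> \<Longrightarrow> x \<otimes> scale C c y = scale C c (x \<otimes> y)"

definition center :: "('k, 'a) alg \<Rightarrow> 'a set" where
  "center C = {x \<in> carrier C. \<forall>y\<in>carrier C. x \<otimes>\<^bsub>C\<^esub> y = y \<otimes>\<^bsub>C\<^esub> x}"

definition center_alg :: "('k, 'a) alg \<Rightarrow> ('k, 'a) alg" where
  "center_alg C = C\<lparr>carrier := center C\<rparr>"

definition left_ideal :: "('k::field, 'a::ab_group_add) alg \<Rightarrow> 'a set \<Rightarrow> bool" where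
  "left_ideal C I \<longleftrightarrow>
     I \<subseteq> carrier C \<and> module.subspace (scale C) I \<and>
     (\<forall>x\<in>carrier C. \<forall>y\<in>I. x \<otimes>\<^bsub>C\<^esub> y \<in> I)"

text \<open>Semi-simplicity of the left regular module: every submodule is a direct summand.\<close>

definition semisimple_alg :: "('k::field, 'a::ab_group_add) alg \<Rightarrow> bool" where
  "semisimple_alg C \<longleftrightarrow>
     (\<forall>I. left_ideal C I \<longrightarrow>
       (\<exists>J. left_ideal C J \<and> I \<inter> J = {0} \<and> {x + y | x y. x \<in> I \<and> y \<in> J} = carrier C))"

definition alg_hom ::
  "('k::field, 'a::ab_group_add) alg \<Rightarrow> ('k, 'b::ab_group_add) alg \<Rightarrow> ('a \<Rightarrow> 'b) \<Rightarrow> bool" where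
  "alg_hom C D f \<longleftrightarrow>
     linear_on (scale C) (scale D) (carrier C) (carrier D) f \<and>
     f \<in> hom C D \<and> f \<one>\<^bsub>C\<^esub> = \<one>\<^bsub>D\<^esub>"

definition alg_iso ::
  "('k::field, 'a::ab_group_add) alg \<Rightarrow> ('k, 'b::ab_group_add) alg \<Rightarrow> ('a \<Rightarrow> 'b) \<Rightarrow> bool" where
  "alg_iso C D f \<longleftrightarrow> alg_hom C D f \<and> bij_betw f (carrier C) (carrier D)"

locale frobenius_pair = fin_dim_algebra C
  for C :: "('k::field, 'a::ab_group_add) alg" (structure) and l :: "'a \<Rightarrow> 'k" +
  assumes functional: "linear_on (scale C) (*) (carrier C) UNIV l"
    and form_symmetric: "\<lbrakk>x \<in> carrier C; y \<in> carrier C\<rbrakk> \<Longrightarrow> l (x \<otimes> y) = l (y \<otimes> x)"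
    and form_nondegenerate: "\<lbrakk>x \<in> carrier C; \<forall>y\<in>carrier C. l (x \<otimes> y) = 0\<rbrakk> \<Longrightarrow> x = 0"

definition gram_inverse ::
  "('k::field, 'a::ab_group_add) alg \<Rightarrow> ('a \<Rightarrow> 'k) \<Rightarrow> 'a set \<Rightarrow> ('a \<Rightarrow> 'a \<Rightarrow> 'k) \<Rightarrow> bool" where
  "gram_inverse C l \<Gamma> F \<longleftrightarrow>
     (\<forall>x\<in>\<Gamma>. \<forall>z\<in>\<Gamma>.
       (\<Sum>y\<in>\<Gamma>. F x y * l (y \<otimes>\<^bsub>C\<^esub> z)) = (if x = z then 1 else 0) \<and>
       (\<Sum>y\<in>\<Gamma>. l (x \<otimes>\<^bsub>C\<^esub> y) * F y z) = (if x = z then 1 else 0))"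

text \<open>
  The element \<open>K\<^sub>C\<^sup>\<star>\<close>, which does not depend on the basis \<open>\<Gamma>\<close> that is chosen.
  The entries of \<open>F\<close> on \<open>\<Gamma> \<times> \<Gamma>\<close> are determined by \<^const>\<open>gram_inverse\<close>.
\<close>

definition star_casimir ::
  "('k::field, 'a::ab_group_add) alg \<Rightarrow> ('a \<Rightarrow> 'k) \<Rightarrow> ('a \<Rightarrow> 'a) \<Rightarrow> 'a" where
  "star_casimir C l star =
     (let \<Gamma> = (SOME \<Gamma>. basis_on (scale C) (carrier C) \<Gamma>);
          F = (SOME F. gram_inverse C l \<Gamma> F)
      in \<Sum>x\<in>\<Gamma>. \<Sum>y\<in>\<Gamma>. scale C (F x y) (x \<otimes>\<^bsub>C\<^esub> star y))"

definition involutive_anti_aut ::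
  "('k::field, 'a::ab_group_add) alg \<Rightarrow> ('a \<Rightarrow> 'a) \<Rightarrow> bool" where
  "involutive_anti_aut C star \<longleftrightarrow>
     linear_on (scale C) (scale C) (carrier C) (carrier C) star \<and>
     (\<forall>x\<in>carrier C. star (star x) = x) \<and>
     (\<forall>x\<in>carrier C. \<forall>y\<in>carrier C. star (x \<otimes>\<^bsub>C\<^esub> y) = star y \<otimes>\<^bsub>C\<^esub> star x)"


section \<open>Equipped Cardy--Frobenius algebras\<close>

definition dual_map ::
  "('k, 'a) alg \<Rightarrow> ('a \<Rightarrow> 'k) \<Rightarrow> ('k, 'b) alg \<Rightarrow> ('b \<Rightarrow> 'k) \<Rightarrow> ('a \<Rightarrow> 'b) \<Rightarrow> 'b \<Rightarrow> 'a" where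
  "dual_map A lA B lB \<phi> b =
     (THE x. x \<in> carrier A \<and> (\<forall>a\<in>carrier A. lA (x \<otimes>\<^bsub>A\<^esub> a) = lB (b \<otimes>\<^bsub>B\<^esub> \<phi> a)))"

locale cardy_frobenius =
  A: frobenius_pair A lA + B: frobenius_pair B lB
  for A :: "('k::field, 'a::ab_group_add) alg" and lA
    and B :: "('k, 'b::ab_group_add) alg" and lB +
  fixes \<phi> :: "'a \<Rightarrow> 'b"
  assumes A_commutative:
      "\<lbrakk>x \<in> carrier A; y \<in> carrier A\<rbrakk> \<Longrightarrow> x \<otimes>\<^bsub>A\<^esub> y = y \<otimes>\<^bsub>A\<^esub> x"
    and \<phi>_hom: "alg_hom A B \<phi>"
    and \<phi>_central: "\<phi> ` carrier A \<subseteq> center B"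
    and cardy:
      "\<lbrakk>b' \<in> carrier B; b'' \<in> carrier B\<rbrakk> \<Longrightarrow>
        lA (dual_map A lA B lB \<phi> b' \<otimes>\<^bsub>A\<^esub> dual_map A lA B lB \<phi> b'') =
        trace_on (scale B) (carrier B) (\<lambda>b. b' \<otimes>\<^bsub>B\<^esub> b \<otimes>\<^bsub>B\<^esub> b'')"

record ('k, 'a, 'b) ecf =
  algA :: "('k, 'a) alg"
  funA :: "'a \<Rightarrow> 'k"
  algB :: "('k, 'b) alg"
  funB :: "'b \<Rightarrow> 'k"
  phi :: "'a \<Rightarrow> 'b"
  elemU :: "'a"
  starA :: "'a \<Rightarrow> 'a"
  starB :: "'b \<Rightarrow> 'b"

locale equipped_cardy_frobenius =
  fixes H :: "('k::field, 'a::ab_group_add, 'b::ab_group_add) ecf"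
  assumes cardy_frobenius:
      "cardy_frobenius (algA H) (funA H) (algB H) (funB H) (phi H)"
    and starA: "involutive_anti_aut (algA H) (starA H)"
    and starB: "involutive_anti_aut (algB H) (starB H)"
    and funA_star: "x \<in> carrier (algA H) \<Longrightarrow> funA H (starA H x) = funA H x"
    and funB_star: "y \<in> carrier (algB H) \<Longrightarrow> funB H (starB H y) = funB H y"
    and phi_star: "x \<in> carrier (algA H) \<Longrightarrow> phi H (starA H x) = starB H (phi H x)"
    and U_closed: "elemU H \<in> carrier (algA H)"
    and U_square:
      "elemU H \<otimes>\<^bsub>algA H\<^esub> elemU H = star_casimir (algA H) (funA H) (starA H)"
    and phi_U: "phi H (elemU H) = star_casimir (algB H) (funB H) (starB H)"

definition semisimple_ecf ::
  "('k::field, 'a::ab_group_add, 'b::ab_group_add) ecf \<Rightarrow> bool" where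
  "semisimple_ecf H \<longleftrightarrow>
     equipped_cardy_frobenius H \<and> semisimple_alg (algA H) \<and> semisimple_alg (algB H)"

definition ecf_isomorphic ::
  "('k::field, 'a::ab_group_add, 'b::ab_group_add) ecf \<Rightarrow>
   ('k, 'c::ab_group_add, 'd::ab_group_add) ecf \<Rightarrow> bool" where
  "ecf_isomorphic H K \<longleftrightarrow>
     (\<exists>f g. alg_iso (algA H) (algA K) f \<and> alg_iso (algB H) (algB K) g \<and>
        (\<forall>a\<in>carrier (algA H). funA K (f a) = funA H a) \<and>
        (\<forall>b\<in>carrier (algB H). funB K (g b) = funB H b) \<and>
        (\<forall>a\<in>carrier (algA H). phi K (f a) = g (phi H a)) \<and>
        f (elemU H) = elemU K \<and>
        (\<forall>a\<in>carrier (algA H). starA K (f a) = f (starA H a)) \<and>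
        (\<forall>b\<in>carrier (algB H). starB K (g b) = g (starB H b)))"

text \<open>Direct sums over a finite index set \<open>I\<close>; families vanish outside \<open>I\<close>.\<close>

definition alg_sum :: "'i set \<Rightarrow> ('i \<Rightarrow> ('k, 'a::zero) alg) \<Rightarrow> ('k, 'i \<Rightarrow> 'a) alg" where
  "alg_sum I C =
     \<lparr>carrier = {x. (\<forall>i\<in>I. x i \<in> carrier (C i)) \<and> (\<forall>i. i \<notin> I \<longrightarrow> x i = 0)},
      mult = (\<lambda>x y i. if i \<in> I then x i \<otimes>\<^bsub>C i\<^esub> y i else 0),
      one = (\<lambda>i. if i \<in> I then \<one>\<^bsub>C i\<^esub> else 0),
      scale = (\<lambda>c x i. scale (C i) c (x i))\<rparr>"

definition ecf_sum ::
  "'i set \<Rightarrow> ('i \<Rightarrow> ('k::comm_monoid_add, 'a::zero, 'b::zero) ecf) \<Rightarrow> ('k, 'i \<Rightarrow> 'a, 'i \<Rightarrow> 'b) ecf" where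
  "ecf_sum I H =
     \<lparr>algA = alg_sum I (\<lambda>i. algA (H i)),
      funA = (\<lambda>x. \<Sum>i\<in>I. funA (H i) (x i)),
      algB = alg_sum I (\<lambda>i. algB (H i)),
      funB = (\<lambda>y. \<Sum>i\<in>I. funB (H i) (y i)),
      phi = (\<lambda>x i. if i \<in> I then phi (H i) (x i) else 0),
      elemU = (\<lambda>i. if i \<in> I then elemU (H i) else 0),
      starA = (\<lambda>x i. if i \<in> I then starA (H i) (x i) else 0),
      starB = (\<lambda>y i. if i \<in> I then starB (H i) (y i) else 0)\<rparr>"

text \<open>The pair \<open>(x, y)\<close> stands for \<open>x \<otimes> 1 + y \<otimes> \<i>\<close>.\<close>

definition alg_complexify :: "(real, 'a::ab_group_add) alg \<Rightarrow> (complex, 'a \<times> 'a) alg" where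
  "alg_complexify C =
     \<lparr>carrier = carrier C \<times> carrier C,
      mult = (\<lambda>(x, y) (z, w). (x \<otimes>\<^bsub>C\<^esub> z - y \<otimes>\<^bsub>C\<^esub> w, x \<otimes>\<^bsub>C\<^esub> w + y \<otimes>\<^bsub>C\<^esub> z)),
      one = (\<one>\<^bsub>C\<^esub>, 0),
      scale = (\<lambda>c (x, y). (scale C (Re c) x - scale C (Im c) y,
                           scale C (Re c) y + scale C (Im c) x))\<rparr>"

definition ecf_complexify ::
  "(real, 'a::ab_group_add, 'b::ab_group_add) ecf \<Rightarrow> (complex, 'a \<times> 'a, 'b \<times> 'b) ecf" where
  "ecf_complexify H =
     \<lparr>algA = alg_complexify (algA H),
      funA = (\<lambda>(x, y). Complex (funA H x) (funA H y)),
      algB = alg_complexify (algB H),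
      funB = (\<lambda>(x, y). Complex (funB H x) (funB H y)),
      phi = map_prod (phi H) (phi H),
      elemU = (elemU H, 0),
      starA = map_prod (starA H) (starA H),
      starB = map_prod (starB H) (starB H)\<rparr>"


section \<open>Quaternions and the algebras \<open>H\<^sup>D\<^sub>n\<^sub>,\<^sub>\<mu>\<close>\<close>

datatype quat = Quat (qRe: real) (qI: real) (qJ: real) (qK: real)

lemma quat_eq_iff:
  "x = y \<longleftrightarrow> qRe x = qRe y \<and> qI x = qI y \<and> qJ x = qJ y \<and> qK x = qK y"
  by (cases x; cases y) simp

instantiation quat :: real_algebra_1
begin

definition "0 = Quat 0 0 0 0"
definition "1 = Quat 1 0 0 0"
definition "x + y = Quat (qRe x + qRe y) (qI x + qI y) (qJ x + qJ y) (qK x + qK y)"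
definition "- x = Quat (- qRe x) (- qI x) (- qJ x) (- qK x)"
definition "x - y = Quat (qRe x - qRe y) (qI x - qI y) (qJ x - qJ y) (qK x - qK y)"
definition "c *\<^sub>R x = Quat (c * qRe x) (c * qI x) (c * qJ x) (c * qK x)"
definition "x * y = Quat
  (qRe x * qRe y - qI x * qI y - qJ x * qJ y - qK x * qK y)
  (qRe x * qI y + qI x * qRe y + qJ x * qK y - qK x * qJ y)
  (qRe x * qJ y - qI x * qK y + qJ x * qRe y + qK x * qI y)
  (qRe x * qK y + qI x * qJ y - qJ x * qI y + qK x * qRe y)"

instance
  by standard
    (simp_all add: quat_eq_iff zero_quat_def one_quat_def plus_quat_def uminus_quat_def
      minus_quat_def scaleR_quat_def times_quat_def algebra_simps)

end

definition qcnj :: "quat \<Rightarrow> quat" where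
  "qcnj x = Quat (qRe x) (- qI x) (- qJ x) (- qK x)"

text \<open>The three division algebras as subalgebras of the quaternions.\<close>

datatype divalg = Div_R | Div_C | Div_H

fun div_carrier :: "divalg \<Rightarrow> quat set" where
  "div_carrier Div_R = {x. qI x = 0 \<and> qJ x = 0 \<and> qK x = 0}"
| "div_carrier Div_C = {x. qJ x = 0 \<and> qK x = 0}"
| "div_carrier Div_H = UNIV"

definition div_alg :: "divalg \<Rightarrow> (real, quat) alg" where
  "div_alg D = \<lparr>carrier = div_carrier D, mult = (*), one = 1, scale = (*\<^sub>R)\<rparr>"

text \<open>Matrices are indexed from \<open>0\<close> and vanish outside the \<open>n \<times> n\<close> block.\<close>

definition scalar_mat :: "nat \<Rightarrow> quat \<Rightarrow> nat \<Rightarrow> nat \<Rightarrow> quat" where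
  "scalar_mat n a = (\<lambda>i j. if i < n \<and> i = j then a else 0)"

definition mat_alg :: "nat \<Rightarrow> divalg \<Rightarrow> (real, nat \<Rightarrow> nat \<Rightarrow> quat) alg" where
  "mat_alg n D =
     \<lparr>carrier = {x. \<forall>i j. if i < n \<and> j < n then x i j \<in> div_carrier D else x i j = 0},
      mult = (\<lambda>x y i j. \<Sum>k<n. x i k * y k j),
      one = scalar_mat n 1,
      scale = (*\<^sub>R)\<rparr>"

text \<open>For real \<open>\<mu>\<close>, so that this is a real algebra with real-valued functionals.\<close>

definition H_div ::
  "divalg \<Rightarrow> nat \<Rightarrow> real \<Rightarrow> (real, quat, nat \<Rightarrow> nat \<Rightarrow> quat) ecf" where
  "H_div D n \<mu> =
     (let d = real (dim (div_carrier D)) in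
     \<lparr>algA = center_alg (div_alg D),
      funA = (\<lambda>a. \<mu>\<^sup>2 * qRe a / d),
      algB = mat_alg n D,
      funB = (\<lambda>x. \<mu> * qRe (\<Sum>i<n. x i i)),
      phi = scalar_mat n,
      elemU = of_real ((2 - d) / \<mu>),
      starA = qcnj,
      starB = (\<lambda>x i j. qcnj (x j i))\<rparr>)"


section \<open>Group algebras and real representations\<close>

definition group_alg :: "('g, 'm) monoid_scheme \<Rightarrow> (real, 'g \<Rightarrow> real) alg" where
  "group_alg G =
     \<lparr>carrier = {x. \<forall>g. g \<notin> carrier G \<longrightarrow> x g = 0},
      mult = (\<lambda>x y g. if g \<in> carrier G
                then \<Sum>h\<in>carrier G. x h * y (inv\<^bsub>G\<^esub> h \<otimes>\<^bsub>G\<^esub> g) else 0),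
      one = (\<lambda>g. if g = \<one>\<^bsub>G\<^esub> then 1 else 0),
      scale = (*\<^sub>R)\<rparr>"

definition group_elem :: "'g \<Rightarrow> 'g \<Rightarrow> real" where
  "group_elem g = (\<lambda>h. if h = g then 1 else 0)"

record ('g, 'v) rep =
  rep_space :: "'v set"
  rep_act :: "'g \<Rightarrow> 'v \<Rightarrow> 'v"

locale real_rep = group G
  for G :: "('g, 'm) monoid_scheme" (structure) and \<rho> :: "('g, 'v::real_vector) rep" +
  assumes space_fin_dim: "fin_dim_on (*\<^sub>R) (rep_space \<rho>)"
    and act_linear:
      "g \<in> carrier G \<Longrightarrow> linear_on (*\<^sub>R) (*\<^sub>R) (rep_space \<rho>) (rep_space \<rho>) (rep_act \<rho> g)"
    and act_one: "v \<in> rep_space \<rho> \<Longrightarrow> rep_act \<rho> \<one> v = v"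
    and act_mult:
      "\<lbrakk>g \<in> carrier G; h \<in> carrier G; v \<in> rep_space \<rho>\<rbrakk> \<Longrightarrow>
        rep_act \<rho> (g \<otimes> h) v = rep_act \<rho> g (rep_act \<rho> h v)"

definition group_alg_act ::
  "('g, 'm) monoid_scheme \<Rightarrow> ('g, 'v::real_vector) rep \<Rightarrow> ('g \<Rightarrow> real) \<Rightarrow> 'v \<Rightarrow> 'v" where
  "group_alg_act G \<rho> x v = (\<Sum>g\<in>carrier G. x g *\<^sub>R rep_act \<rho> g v)"

definition irreducible_rep ::
  "('g, 'm) monoid_scheme \<Rightarrow> ('g, 'v::real_vector) rep \<Rightarrow> bool" where
  "irreducible_rep G \<pi> \<longleftrightarrow>
     real_rep G \<pi> \<and> rep_space \<pi> \<noteq> {0} \<and>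
     (\<forall>W. subspace W \<and> W \<subseteq> rep_space \<pi> \<and> (\<forall>g\<in>carrier G. \<forall>w\<in>W. rep_act \<pi> g w \<in> W) \<longrightarrow>
        W = {0} \<or> W = rep_space \<pi>)"

definition rep_isomorphic ::
  "('g, 'm) monoid_scheme \<Rightarrow> ('g, 'v::real_vector) rep \<Rightarrow> ('g, 'w::real_vector) rep \<Rightarrow> bool" where
  "rep_isomorphic G \<rho> \<sigma> \<longleftrightarrow>
     (\<exists>f. linear_on (*\<^sub>R) (*\<^sub>R) (rep_space \<rho>) (rep_space \<sigma>) f \<and> bij_betw f (rep_space \<rho>) (rep_space \<sigma>) \<and>
        (\<forall>g\<in>carrier G. \<forall>v\<in>rep_space \<rho>. f (rep_act \<rho> g v) = rep_act \<sigma> g (f v)))"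

definition rep_sum ::
  "'i set \<Rightarrow> ('i \<Rightarrow> ('g, 'v::real_vector) rep) \<Rightarrow> ('g, 'i \<Rightarrow> 'v) rep" where
  "rep_sum I \<pi> =
     \<lparr>rep_space = {v. (\<forall>i\<in>I. v i \<in> rep_space (\<pi> i)) \<and> (\<forall>i. i \<notin> I \<longrightarrow> v i = 0) \<and> finite {i. v i \<noteq> 0}},
      rep_act = (\<lambda>g v i. if i \<in> I then rep_act (\<pi> i) g (v i) else 0)\<rparr>"

text \<open>
  Every finite-dimensional real vector space is isomorphic to a subspace of \<open>nat \<Rightarrow> real\<close>, so
  these representations meet every isomorphism class.
\<close>

type_synonym 'g model_rep = "('g, nat \<Rightarrow> real) rep"

definition Irr :: "('g, 'm) monoid_scheme \<Rightarrow> 'g model_rep set set" where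
  "Irr G = {\<pi>. irreducible_rep G \<pi>} //
     {(\<pi>, \<sigma>). irreducible_rep G \<pi> \<and> irreducible_rep G \<sigma> \<and> rep_isomorphic G \<pi> \<sigma>}"

definition representative :: "'g model_rep set \<Rightarrow> 'g model_rep" where
  "representative c = (SOME \<pi>. \<pi> \<in> c)"

text \<open>Linear maps of a subspace are extended by zero, so that equality is equality of functions.\<close>

definition extend_zero :: "'v set \<Rightarrow> ('v \<Rightarrow> 'w::zero) \<Rightarrow> 'v \<Rightarrow> 'w" where
  "extend_zero V f = (\<lambda>v. if v \<in> V then f v else 0)"

definition End_set :: "'v::real_vector set \<Rightarrow> ('v \<Rightarrow> 'v) set" where
  "End_set V = {x. linear_on (*\<^sub>R) (*\<^sub>R) V V x \<and> (\<forall>v. v \<notin> V \<longrightarrow> x v = 0)}"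

definition End_alg ::
  "('g, 'm) monoid_scheme \<Rightarrow> ('g, 'v::real_vector) rep \<Rightarrow> (real, 'v \<Rightarrow> 'v) alg" where
  "End_alg G \<rho> =
     \<lparr>carrier = {x \<in> End_set (rep_space \<rho>).
        \<forall>g\<in>carrier G. \<forall>v\<in>rep_space \<rho>. x (rep_act \<rho> g v) = rep_act \<rho> g (x v)},
      mult = (\<circ>),
      one = extend_zero (rep_space \<rho>) (\<lambda>v. v),
      scale = (*\<^sub>R)\<rparr>"

definition Irr_div :: "('g, 'm) monoid_scheme \<Rightarrow> divalg \<Rightarrow> 'g model_rep set set" where
  "Irr_div G D = {c \<in> Irr G. \<exists>f. alg_iso (End_alg G (representative c)) (div_alg D) f}"

definition scalar_on ::
  "('g, 'm) monoid_scheme \<Rightarrow> ('g \<Rightarrow> real) \<Rightarrow> ('g, 'v::real_vector) rep \<Rightarrow> real" where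
  "scalar_on G x \<pi> = (THE c. \<forall>v\<in>rep_space \<pi>. group_alg_act G \<pi> x v = c *\<^sub>R v)"

definition invariant_form ::
  "('g, 'm) monoid_scheme \<Rightarrow> ('g, 'v::real_vector) rep \<Rightarrow> ('v \<Rightarrow> 'v \<Rightarrow> real) \<Rightarrow> bool" where
  "invariant_form G \<rho> \<beta> \<longleftrightarrow>
     (\<forall>u\<in>rep_space \<rho>. linear_on (*\<^sub>R) (*) (rep_space \<rho>) UNIV (\<beta> u)) \<and>
     (\<forall>u\<in>rep_space \<rho>. \<forall>v\<in>rep_space \<rho>. \<beta> u v = \<beta> v u) \<and>
     (\<forall>u\<in>rep_space \<rho>. (\<forall>v\<in>rep_space \<rho>. \<beta> u v = 0) \<longrightarrow> u = 0) \<and>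
     (\<forall>g\<in>carrier G. \<forall>u\<in>rep_space \<rho>. \<forall>v\<in>rep_space \<rho>. \<beta> (rep_act \<rho> g u) (rep_act \<rho> g v) = \<beta> u v)"

definition adjoint_on ::
  "'v::real_vector set \<Rightarrow> ('v \<Rightarrow> 'v \<Rightarrow> real) \<Rightarrow> ('v \<Rightarrow> 'v) \<Rightarrow> 'v \<Rightarrow> 'v" where
  "adjoint_on V \<beta> x = (THE y. y \<in> End_set V \<and> (\<forall>u\<in>V. \<forall>v\<in>V. \<beta> (x u) v = \<beta> u (y v)))"

text \<open>
  The element \<open>U\<close> is \<open>\<mu>\<^sup>-\<^sup>1 (\<Sum>g. g\<^sup>2)\<close>. The twist of \<open>l\<^sub>A\<close> by \<open>\<mu>\<^sup>2\<close> multiplies \<open>K\<^sub>A\<^sup>\<star>\<close> by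
  \<open>\<mu>\<^sup>-\<^sup>2\<close>, and the twist of \<open>l\<^sub>B\<close> by \<open>\<mu>\<close> multiplies \<open>K\<^sub>B\<^sup>\<star>\<close> by the action of \<open>\<mu>\<^sup>-\<^sup>1\<close>, so without
  the factor \<open>\<mu>\<^sup>-\<^sup>1\<close> the conditions on \<open>U\<close> fail for general \<open>\<mu>\<close>.
\<close>

definition H_rep ::
  "('g, 'm) monoid_scheme \<Rightarrow> ('g, 'v::real_vector) rep \<Rightarrow> ('v \<Rightarrow> 'v \<Rightarrow> real) \<Rightarrow> ('g \<Rightarrow> real) \<Rightarrow>
   (real, 'g \<Rightarrow> real, 'v \<Rightarrow> 'v) ecf" where
  "H_rep G \<rho> \<beta> \<mu> =
     (let A = center_alg (group_alg G); V = rep_space \<rho> in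
     \<lparr>algA = A,
      funA = (\<lambda>x. (\<mu> \<otimes>\<^bsub>A\<^esub> \<mu> \<otimes>\<^bsub>A\<^esub> x) \<one>\<^bsub>G\<^esub> / real (card (carrier G))),
      algB = End_alg G \<rho>,
      funB = (\<lambda>x. trace_on (*\<^sub>R) V (\<lambda>v. group_alg_act G \<rho> \<mu> (x v) /\<^sub>R real (card (carrier G)))),
      phi = (\<lambda>a. extend_zero V (group_alg_act G \<rho> a)),
      elemU = inv\<^bsub>A\<^esub> \<mu> \<otimes>\<^bsub>A\<^esub> (\<Sum>g\<in>carrier G. group_elem (g \<otimes>\<^bsub>G\<^esub> g)),
      starA = (\<lambda>x. extend_zero (carrier G) (\<lambda>g. x (inv\<^bsub>G\<^esub> g))),
      starB = adjoint_on V \<beta>\<rparr>)"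

end

theory Submission
  imports Defs
begin

text \<open>
  Every property of \<open>H\<^sup>\<rho>\<^sub>\<mu>\<close> is a trace identity. The functional \<open>c \<mapsto> l(K\<^sup>\<star> c)\<close> is the trace of
  \<open>x \<mapsto> x\<^sup>\<star> c\<close>, the dual of \<open>\<phi>\<close> is \<open>b \<mapsto> \<mu>\<^sup>-\<^sup>1 \<Sum>g. Tr(b g\<^sup>-\<^sup>1) g\<close>, and traces on the centre and on the
  commutant are traces on \<open>\<real>[G]\<close> and \<open>End(\<rho>)\<close> of an averaged map. With this the Cardy condition and the
  two conditions on \<open>U\<close> become reindexings of sums over \<open>G\<close>.

  For the decomposition, a positive definite invariant form makes the adjoint of the commutant of an
  irreducible \<open>\<pi>\<close> a positive involution whose fixed points are scalars. Hence the commutant is \<open>\<real>\<close>,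
  \<open>\<complex>\<close> or \<open>H\<close> with its standard conjugation, and Schur orthogonality, written in the basis
  \<open>1, i, j, k\<close>, gives \<open>\<Sum>g. Tr(z g\<^sup>-\<^sup>1) g = d |G| / dim \<pi> z\<close> and \<open>\<Sum>g. g\<^sup>2 = (2 - d) |G| / dim \<pi>\<close> on \<open>\<pi>\<close>.
  The given form may be indefinite: \<open>\<rho>\<close> is an orthogonal sum of irreducibles on which it is \<open>\<plusminus>1\<close> times
  a positive form. Over \<open>\<real>\<close> this puts signs into the involution of \<open>Mat\<^sub>n(D)\<close>; over \<open>\<complex>\<close> conjugation by
  the square roots of the signs removes them.
\<close>

section \<open>Linear maps, frames and traces\<close>

text \<open>Neither the centre of the group algebra nor the commutant comes with a basis. Traces are
  therefore computed in frames, that is, in spanning families with coordinate functionals that may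
  be dependent: a projection onto a subspace carries a frame of the ambient space to a frame of the
  subspace. The second obstacle is that the given form can degenerate on a subrepresentation, so
  complements cannot be taken with respect to it. An auxiliary positive invariant form
  \<open>b\<close> helps: the operator that represents the given form through \<open>b\<close> is
  self-adjoint and commutes with \<open>G\<close>, and irreducibles are split off inside its
  eigenspaces, where the two forms are proportional. The constant d counts the units 1, i, j, k that
  lie in D, and 2 - d is the sum of their squares, one of which is 1 and the others -1. The
  parameter of a block arises from Fourier inversion: the coefficient at the unit element weights a
  class by (dim \<pi>)^2 / (|G| d), and together with the two factors \<mu> and the factor 1 / |G|
  in l_A this becomes the square of \<mu>(\<pi>) dim \<pi> / |G|, divided by d.\<close>

abbreviation lin :: "'a::real_vector set \<Rightarrow> 'b::real_vector set \<Rightarrow> ('a \<Rightarrow> 'b) \<Rightarrow> bool" where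
  "lin \<equiv> linear_on (*\<^sub>R) (*\<^sub>R)"

lemma linI:
  assumes "\<And>x. x \<in> V \<Longrightarrow> f x \<in> W" "\<And>x y. \<lbrakk>x \<in> V; y \<in> V\<rbrakk> \<Longrightarrow> f (x + y) = f x + f y"
    "\<And>c x. x \<in> V \<Longrightarrow> f (c *\<^sub>R x) = c *\<^sub>R f x"
  shows "lin V W f"
  using assms by (auto simp: linear_on_def)

lemma lin_mem: "lin V W f \<Longrightarrow> x \<in> V \<Longrightarrow> f x \<in> W"
  and lin_add: "lin V W f \<Longrightarrow> x \<in> V \<Longrightarrow> y \<in> V \<Longrightarrow> f (x + y) = f x + f y"
  and lin_scale: "lin V W f \<Longrightarrow> x \<in> V \<Longrightarrow> f (c *\<^sub>R x) = c *\<^sub>R f x"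
  by (auto simp: linear_on_def)

lemma lin_real: "linear_on (*\<^sub>R) (*) V UNIV f \<longleftrightarrow> lin V UNIV f"
  by (simp add: linear_on_def)

lemma lin_cong: "lin V W f \<Longrightarrow> subspace V \<Longrightarrow> (\<And>x. x \<in> V \<Longrightarrow> f x = g x) \<Longrightarrow> lin V W g"
  by (auto simp: linear_on_def subspace_def Pi_iff)

lemma lin_0: "lin V W f \<Longrightarrow> subspace V \<Longrightarrow> f 0 = 0"
  using lin_scale[of V W f 0 0] by (simp add: subspace_0)

lemma lin_neg: "lin V W f \<Longrightarrow> x \<in> V \<Longrightarrow> f (- x) = - f x"
  using lin_scale[of V W f x "-1"] by simp

lemma lin_diff: "lin V W f \<Longrightarrow> subspace V \<Longrightarrow> x \<in> V \<Longrightarrow> y \<in> V \<Longrightarrow> f (x - y) = f x - f y"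
  using lin_add[of V W f x "- y"] lin_neg[of V W f y] by (simp add: subspace_neg)

lemma lin_sum:
  assumes "lin V W f" "subspace V" "\<And>i. i \<in> I \<Longrightarrow> x i \<in> V"
  shows "f (\<Sum>i\<in>I. x i) = (\<Sum>i\<in>I. f (x i))"
  using assms(3)
proof (induction I rule: infinite_finite_induct)
  case (insert j F)
  then show ?case
    using lin_add[OF assms(1), of "x j" "sum x F"] subspace_sum[OF assms(2), of F x] by simp
qed (use lin_0 assms in auto)

lemma lin_combination:
  assumes "lin V W f" "subspace V" "\<And>i. i \<in> I \<Longrightarrow> x i \<in> V"
  shows "f (\<Sum>i\<in>I. c i *\<^sub>R x i) = (\<Sum>i\<in>I. c i *\<^sub>R f (x i))"
  using assms by (subst lin_sum[OF assms(1,2)]) (auto simp: subspace_scale lin_scale)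

lemma lin_comp: "lin V W f \<Longrightarrow> lin W X g \<Longrightarrow> lin V X (\<lambda>x. g (f x))"
  by (auto simp: linear_on_def Pi_iff)

lemma lin_sum_fun:
  assumes "subspace W" "\<And>i. i \<in> I \<Longrightarrow> lin V W (f i)"
  shows "lin V W (\<lambda>x. \<Sum>i\<in>I. f i x)"
  by (rule linI)
    (simp_all add: subspace_sum[OF assms(1)] lin_mem[OF assms(2)] lin_add[OF assms(2)]
      lin_scale[OF assms(2)] sum.distrib scaleR_sum_right)

lemma lin_add_fun: "subspace W \<Longrightarrow> lin V W f \<Longrightarrow> lin V W g \<Longrightarrow> lin V W (\<lambda>x. f x + g x)"
  by (rule linI) (auto simp: lin_mem lin_add lin_scale subspace_add algebra_simps)

lemma lin_scale_fun: "subspace W \<Longrightarrow> lin V W f \<Longrightarrow> lin V W (\<lambda>x. c *\<^sub>R f x)"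
  by (rule linI) (auto simp: lin_mem lin_add lin_scale subspace_scale algebra_simps)

lemma lin_scaleR_vec: "lin V UNIV f \<Longrightarrow> subspace W \<Longrightarrow> w \<in> W \<Longrightarrow> lin V W (\<lambda>x. f x *\<^sub>R w)"
  by (rule linI) (auto simp: lin_add lin_scale subspace_scale algebra_simps)

lemma lin_subset: "lin V W f \<Longrightarrow> V' \<subseteq> V \<Longrightarrow> lin V' UNIV f"
  by (rule linI) (auto simp: lin_add lin_scale subset_iff)

lemma lin_eq_on_span:
  assumes "lin (span S) W f" "lin (span S) W' g" "\<And>x. x \<in> S \<Longrightarrow> f x = g x" "x \<in> span S"
  shows "f x = g x"
proof -
  \<comment> \<open>Membership is carried through the induction because additivity of
    \<open>f\<close> and \<open>g\<close> is known only on the span.\<close>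
  have "x \<in> span S \<and> f x = g x"
    using assms(4)
  proof (induction rule: span_induct_alt)
    case base
    show ?case
      using lin_0[OF assms(1)] lin_0[OF assms(2)] by (simp add: span_zero)
  next
    case (step c x y)
    then show ?case
      using assms(3) lin_add[OF assms(1), of "c *\<^sub>R x" y] lin_add[OF assms(2), of "c *\<^sub>R x" y]
        lin_scale[OF assms(1), of x c] lin_scale[OF assms(2), of x c]
      by (simp add: span_base span_scale span_add)
  qed
  then show ?thesis ..
qed

section \<open>Finite-dimensional subspaces and their bases\<close>

abbreviation findim :: "'a::real_vector set \<Rightarrow> bool" where
  "findim \<equiv> fin_dim_on (*\<^sub>R)"

lemma findim_subspace: "findim V \<Longrightarrow> subspace V"
  by (simp add: fin_dim_on_def subspace_raw_def)

lemma findimI: "finite S \<Longrightarrow> span S = V \<Longrightarrow> findim V"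
  by (auto simp: fin_dim_on_def subspace_span span_raw_def[symmetric] subspace_raw_def[symmetric])

lemma basis_on_real: "basis_on (*\<^sub>R) V \<Gamma> \<longleftrightarrow> finite \<Gamma> \<and> independent \<Gamma> \<and> span \<Gamma> = V"
  by (simp add: basis_on_def dependent_raw_def span_raw_def)

lemma basis_on_ex: "findim V \<Longrightarrow> \<exists>\<Gamma>. basis_on (*\<^sub>R) V \<Gamma>"
proof -
  assume V: "findim V"
  then obtain S where S: "finite S" "span S = V"
    by (auto simp: fin_dim_on_def span_raw_def)
  obtain B where B: "B \<subseteq> V" "independent B" "V \<subseteq> span B"
    by (rule basis_exists)
  have "finite B"
    using independent_span_bound[OF S(1) B(2)] B S by auto
  moreover have "span B = V"
    using B findim_subspace[OF V] by (metis span_subspace)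
  ultimately show ?thesis
    using B by (auto simp: basis_on_real)
qed

lemma findim_subset:
  assumes "findim V" "subspace W" "W \<subseteq> V"
  shows "findim W"
proof -
  obtain S where S: "finite S" "span S = V"
    using basis_on_ex[OF assms(1)] by (auto simp: basis_on_real)
  obtain B where B: "B \<subseteq> W" "independent B" "W \<subseteq> span B"
    by (rule basis_exists)
  have "finite B"
    using independent_span_bound[OF S(1) B(2)] B S assms by auto
  then show ?thesis
    using B assms(2) by (intro findimI[of B]) (metis span_subspace)+
qed

lemma dim_less_subspace:
  assumes "findim V" "subspace W" "W \<subset> V"
  shows "dim W < dim V"
proof -
  obtain S where S: "finite S" "independent S" "span S = V"
    using basis_on_ex[OF assms(1)] by (auto simp: basis_on_real)
  obtain B where B: "B \<subseteq> W" "independent B" "W \<subseteq> span B" "card B = dim W"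
    by (rule basis_exists)
  obtain x where x: "x \<in> V" "x \<notin> W"
    using assms by auto
  have sB: "span B = W"
    using B assms(2) by (metis span_subspace)
  have "independent (insert x B)"
    using x B sB by (simp add: independent_insertI)
  then have "finite (insert x B) \<and> card (insert x B) \<le> card S"
    using independent_span_bound[OF S(1), of "insert x B"] B x assms S by auto
  moreover have "x \<notin> B"
    using x B by auto
  ultimately show ?thesis
    using B(4) dim_span_eq_card_independent[OF S(2)] S(3) by auto
qed

text \<open>\<open>f\<close> is linear only on \<open>V\<close>, so it is replaced by a total linear
  map \<open>g\<close> with the same values on a basis \<open>S\<close>. A vector outside the image
  would extend the image of \<open>S\<close> to an independent subset of \<open>span S\<close> with
  one element more than \<open>S\<close>.\<close>

lemma lin_inj_surj:
  assumes V: "findim V" and f: "lin V V f" and inj: "\<And>x. x \<in> V \<Longrightarrow> f x = 0 \<Longrightarrow> x = 0"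
  shows "f ` V = V"
proof (rule ccontr)
  assume neq: "f ` V \<noteq> V"
  obtain S where S: "finite S" "independent S" "span S = V"
    using basis_on_ex[OF V] by (auto simp: basis_on_real)
  obtain g where g: "linear g" "\<And>x. x \<in> S \<Longrightarrow> g x = f x"
    using linear_independent_extend[OF S(2), of f] by auto
  have lg: "lin (span S) UNIV g"
    using g(1) by (auto intro!: linI simp: linear_add linear_scale)
  have gf: "g x = f x" if "x \<in> V" for x
    using lin_eq_on_span[OF lg, of V f] f S(3) g(2) that by auto
  have ig: "inj_on g (span S)"
    using inj gf S(3) by (subst linear_inj_on_iff_eq_0[OF g(1)]) auto
  have ind: "independent (g ` S)"
    by (rule linear_independent_injective_image[OF g(1) S(2) ig])
  have im: "span (g ` S) = f ` V"
    using linear_span_image[OF g(1), of S] gf S(3) by auto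
  obtain x where x: "x \<in> V" "x \<notin> f ` V"
    using neq f lin_mem by blast
  have "independent (insert x (g ` S))"
    using x ind im by (simp add: independent_insertI)
  moreover have "insert x (g ` S) \<subseteq> span S"
    using S gf f x lin_mem[OF f] span_base[of _ S] by auto
  ultimately have "card (insert x (g ` S)) \<le> card S"
    using independent_span_bound[OF S(1)] by blast
  moreover have "card (g ` S) = card S"
    using ig by (intro card_image) (meson inj_on_subset span_superset)
  moreover have "x \<notin> g ` S"
    using x im span_superset by blast
  ultimately show False
    using S(1) by auto
qed

text \<open>A resolution of the identity of \<open>V\<close>: the vectors span, and the functionals
  give one choice of coordinates. The vectors may be dependent, so that frames survive
  projections.\<close>

definition frame :: "'a::real_vector set \<Rightarrow> 'i set \<Rightarrow> ('i \<Rightarrow> 'a) \<Rightarrow> ('i \<Rightarrow> 'a \<Rightarrow> real) \<Rightarrow> bool" where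
  "frame V I e \<epsilon> \<longleftrightarrow> finite I \<and> (\<forall>i\<in>I. e i \<in> V \<and> lin V UNIV (\<epsilon> i)) \<and>
     (\<forall>x\<in>V. (\<Sum>i\<in>I. \<epsilon> i x *\<^sub>R e i) = x)"

lemma frameD:
  assumes "frame V I e \<epsilon>"
  shows "finite I" "i \<in> I \<Longrightarrow> e i \<in> V" "i \<in> I \<Longrightarrow> lin V UNIV (\<epsilon> i)"
    "x \<in> V \<Longrightarrow> (\<Sum>i\<in>I. \<epsilon> i x *\<^sub>R e i) = x"
  using assms by (auto simp: frame_def)

lemma findim_frame: "frame V I e \<epsilon> \<Longrightarrow> subspace V \<Longrightarrow> findim V"
proof (rule findimI[of "e ` I"])
  assume F: "frame V I e \<epsilon>" and V: "subspace V"
  show "finite (e ` I)"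
    using frameD[OF F] by simp
  show "span (e ` I) = V"
  proof
    show "span (e ` I) \<subseteq> V"
      using frameD(2)[OF F] V by (intro span_minimal) auto
    show "V \<subseteq> span (e ` I)"
    proof
      fix x assume "x \<in> V"
      then show "x \<in> span (e ` I)"
        using frameD(4)[OF F, of x] by (metis (no_types, lifting) image_eqI span_base span_scale span_sum)
    qed
  qed
qed

text \<open>\<open>P\<close> applied to the expansion of a vector of \<open>V\<close> fixes that
  vector. The coordinates are inherited from \<open>W\<close>, and the vectors
  \<open>P (e i)\<close> are in general dependent.\<close>

lemma frame_retract:
  assumes "frame W I e \<epsilon>" "V \<subseteq> W" "lin W V P" "\<And>x. x \<in> V \<Longrightarrow> P x = x" "subspace W"
  shows "frame V I (\<lambda>i. P (e i)) \<epsilon>"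
proof -
  have "(\<Sum>i\<in>I. \<epsilon> i x *\<^sub>R P (e i)) = x" if x: "x \<in> V" for x
  proof -
    have "(\<Sum>i\<in>I. \<epsilon> i x *\<^sub>R P (e i)) = (\<Sum>i\<in>I. P (\<epsilon> i x *\<^sub>R e i))"
      using frameD(2)[OF assms(1)] by (intro sum.cong) (auto simp: lin_scale[OF assms(3)])
    also have "\<dots> = P (\<Sum>i\<in>I. \<epsilon> i x *\<^sub>R e i)"
      using frameD(2)[OF assms(1)] assms(5)
      by (subst lin_sum[OF assms(3,5)]) (auto simp: subspace_scale)
    finally show ?thesis
      using frameD(4)[OF assms(1)] assms(2,4) x by auto
  qed
  then show ?thesis
    using assms by (auto simp: frame_def intro: lin_mem lin_subset)
qed

lemma lin_representation:
  assumes "independent \<Gamma>"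
  shows "lin (span \<Gamma>) UNIV (\<lambda>v. representation \<Gamma> v x)"
  using assms by (intro linI) (auto simp: representation_add representation_scale)

lemma frame_basis:
  assumes "basis_on (*\<^sub>R) V \<Gamma>"
  shows "frame V \<Gamma> (\<lambda>x. x) (\<lambda>x v. representation \<Gamma> v x)"
  using assms lin_representation[of \<Gamma>]
  by (auto simp: frame_def basis_on_real span_base sum_representation_eq)

lemma frame_ex:
  fixes V :: "'a::real_vector set"
  assumes "findim V"
  obtains \<Gamma> and \<epsilon> :: "'a \<Rightarrow> 'a \<Rightarrow> real" where "frame V \<Gamma> (\<lambda>x. x) \<epsilon>"
  using basis_on_ex[OF assms] frame_basis by blast

text \<open>Both sides are the double sum of products of matrix entries of \<open>f\<close> and
  \<open>g\<close>. For \<open>V = W\<close> and \<open>g\<close> the identity this says that the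
  diagonal sum is the same in every frame.\<close>

lemma frame_trace_swap:
  assumes F: "frame V I e \<epsilon>" and F': "frame W J e' \<epsilon>'" and f: "lin V W f" and g: "lin W V g"
    and V: "subspace V" and W: "subspace W"
  shows "(\<Sum>i\<in>I. \<epsilon> i (g (f (e i)))) = (\<Sum>j\<in>J. \<epsilon>' j (f (g (e' j))))"
proof -
  have "(\<Sum>i\<in>I. \<epsilon> i (g (f (e i)))) = (\<Sum>i\<in>I. \<Sum>j\<in>J. \<epsilon>' j (f (e i)) * \<epsilon> i (g (e' j)))"
  proof (rule sum.cong[OF refl])
    fix i assume i: "i \<in> I"
    have "lin W UNIV (\<lambda>x. \<epsilon> i (g x))"
      by (rule lin_comp[OF g frameD(3)[OF F i]])
    then have "\<epsilon> i (g (\<Sum>j\<in>J. \<epsilon>' j (f (e i)) *\<^sub>R e' j)) = (\<Sum>j\<in>J. \<epsilon>' j (f (e i)) * \<epsilon> i (g (e' j)))"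
      using lin_combination[OF _ W, of UNIV "\<lambda>x. \<epsilon> i (g x)" J e'] frameD(2)[OF F'] by simp
    then show "\<epsilon> i (g (f (e i))) = (\<Sum>j\<in>J. \<epsilon>' j (f (e i)) * \<epsilon> i (g (e' j)))"
      using frameD(4)[OF F'] lin_mem[OF f] frameD(2)[OF F i] by simp
  qed
  also have "\<dots> = (\<Sum>j\<in>J. \<Sum>i\<in>I. \<epsilon> i (g (e' j)) * \<epsilon>' j (f (e i)))"
    by (subst sum.swap) (simp add: mult.commute)
  also have "\<dots> = (\<Sum>j\<in>J. \<epsilon>' j (f (g (e' j))))"
  proof (rule sum.cong[OF refl])
    fix j assume j: "j \<in> J"
    have "lin V UNIV (\<lambda>x. \<epsilon>' j (f x))"
      by (rule lin_comp[OF f frameD(3)[OF F' j]])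
    then have "\<epsilon>' j (f (\<Sum>i\<in>I. \<epsilon> i (g (e' j)) *\<^sub>R e i)) = (\<Sum>i\<in>I. \<epsilon> i (g (e' j)) * \<epsilon>' j (f (e i)))"
      using lin_combination[OF _ V, of UNIV "\<lambda>x. \<epsilon>' j (f x)" I e] frameD(2)[OF F] by simp
    then show "(\<Sum>i\<in>I. \<epsilon> i (g (e' j)) * \<epsilon>' j (f (e i))) = \<epsilon>' j (f (g (e' j)))"
      using frameD(4)[OF F] lin_mem[OF g] frameD(2)[OF F' j] by simp
  qed
  finally show ?thesis .
qed

section \<open>Traces on subspaces\<close>

abbreviation tr :: "'a::real_vector set \<Rightarrow> ('a \<Rightarrow> 'a) \<Rightarrow> real" where
  "tr \<equiv> trace_on (*\<^sub>R)"

lemma lin_id: "lin V V (\<lambda>x. x)"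
  by (simp add: linI)

lemma trace_frame:
  assumes F: "frame V I e \<epsilon>" and V: "subspace V" and f: "lin V V f"
  shows "tr V f = (\<Sum>i\<in>I. \<epsilon> i (f (e i)))"
proof -
  define \<Gamma> where "\<Gamma> = (SOME \<Gamma>. basis_on (*\<^sub>R) V \<Gamma>)"
  have \<Gamma>: "basis_on (*\<^sub>R) V \<Gamma>"
    unfolding \<Gamma>_def by (rule someI_ex[OF basis_on_ex[OF findim_frame[OF F V]]])
  have "tr V f = (\<Sum>x\<in>\<Gamma>. representation \<Gamma> (f x) x)"
    by (simp add: trace_on_def \<Gamma>_def[symmetric] Let_def representation_raw_def)
  also have "\<dots> = (\<Sum>i\<in>I. \<epsilon> i (f (e i)))"
    using frame_trace_swap[OF frame_basis[OF \<Gamma>] F f lin_id V V] .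
  finally show ?thesis .
qed

lemma trace_comm:
  fixes V :: "'a::real_vector set" and W :: "'b::real_vector set"
  assumes "findim V" "findim W" "lin V W f" "lin W V g"
  shows "tr V (\<lambda>x. g (f x)) = tr W (\<lambda>x. f (g x))"
proof -
  obtain \<Gamma> and \<epsilon> :: "'a \<Rightarrow> 'a \<Rightarrow> real" where F: "frame V \<Gamma> (\<lambda>x. x) \<epsilon>"
    using frame_ex[OF assms(1)] .
  obtain \<Delta> and \<delta> :: "'b \<Rightarrow> 'b \<Rightarrow> real" where F': "frame W \<Delta> (\<lambda>x. x) \<delta>"
    using frame_ex[OF assms(2)] .
  note s = findim_subspace[OF assms(1)] findim_subspace[OF assms(2)]
  show ?thesis
    using frame_trace_swap[OF F F' assms(3,4) s] trace_frame[OF F s(1) lin_comp[OF assms(3,4)]]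
      trace_frame[OF F' s(2) lin_comp[OF assms(4,3)]] by simp
qed

lemma trace_sum:
  fixes V :: "'a::real_vector set"
  assumes V: "findim V" and f: "\<And>k. k \<in> K \<Longrightarrow> lin V V (f k)"
  shows "tr V (\<lambda>x. \<Sum>k\<in>K. f k x) = (\<Sum>k\<in>K. tr V (f k))"
proof -
  obtain \<Gamma> and \<epsilon> :: "'a \<Rightarrow> 'a \<Rightarrow> real" where F: "frame V \<Gamma> (\<lambda>x. x) \<epsilon>"
    using frame_ex[OF V] .
  note s = findim_subspace[OF V]
  have "(\<Sum>i\<in>\<Gamma>. \<epsilon> i (\<Sum>k\<in>K. f k i)) = (\<Sum>i\<in>\<Gamma>. \<Sum>k\<in>K. \<epsilon> i (f k i))"
    using frameD[OF F] f by (intro sum.cong[OF refl] lin_sum) (auto intro: s lin_mem[OF f])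
  also have "\<dots> = (\<Sum>k\<in>K. tr V (f k))"
    by (subst sum.swap) (simp add: trace_frame[OF F s f])
  finally show ?thesis
    using trace_frame[OF F s lin_sum_fun[where I = K, OF s f]] by simp
qed

lemma trace_scale:
  fixes V :: "'a::real_vector set"
  assumes V: "findim V" and f: "lin V V f"
  shows "tr V (\<lambda>x. c *\<^sub>R f x) = c * tr V f"
proof -
  obtain \<Gamma> and \<epsilon> :: "'a \<Rightarrow> 'a \<Rightarrow> real" where F: "frame V \<Gamma> (\<lambda>x. x) \<epsilon>"
    using frame_ex[OF V] .
  note s = findim_subspace[OF V]
  have "\<epsilon> i (c *\<^sub>R f i) = c * \<epsilon> i (f i)" if "i \<in> \<Gamma>" for i
    using lin_scale[OF frameD(3)[OF F that] lin_mem[OF f frameD(2)[OF F that]]] by simp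
  then show ?thesis
    using trace_frame[OF F s f] trace_frame[OF F s lin_scale_fun[OF s f]] by (simp add: sum_distrib_left)
qed

lemma trace_add:
  assumes "findim V" "lin V V f" "lin V V g"
  shows "tr V (\<lambda>x. f x + g x) = tr V f + tr V g"
  using trace_sum[OF assms(1), of "UNIV::bool set" "\<lambda>b. if b then f else g"] assms
  by (simp add: UNIV_bool add.commute split: if_splits)

lemma trace_cong:
  fixes V :: "'a::real_vector set"
  assumes "findim V" "lin V V f" "\<And>x. x \<in> V \<Longrightarrow> f x = g x"
  shows "tr V f = tr V g"
proof -
  obtain \<Gamma> and \<epsilon> :: "'a \<Rightarrow> 'a \<Rightarrow> real" where F: "frame V \<Gamma> (\<lambda>x. x) \<epsilon>"
    using frame_ex[OF assms(1)] .
  note s = findim_subspace[OF assms(1)]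
  show ?thesis
    using trace_frame[OF F s assms(2)] trace_frame[OF F s lin_cong[OF assms(2) s assms(3)]]
      assms(3) frameD(2)[OF F] by simp
qed

lemma trace_id: "findim V \<Longrightarrow> tr V (\<lambda>x. x) = real (dim V)"
proof -
  assume V: "findim V"
  obtain \<Gamma> where \<Gamma>: "basis_on (*\<^sub>R) V \<Gamma>"
    using basis_on_ex[OF V] by auto
  have "tr V (\<lambda>x. x) = (\<Sum>x\<in>\<Gamma>. representation \<Gamma> x x)"
    by (rule trace_frame[OF frame_basis[OF \<Gamma>] findim_subspace[OF V] lin_id])
  also have "\<dots> = card \<Gamma>"
    using \<Gamma> by (simp add: basis_on_real representation_basis)
  finally show ?thesis
    using \<Gamma> dim_span_eq_card_independent[of \<Gamma>] by (simp add: basis_on_real)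
qed

text \<open>This is the trace of \<open>f\<close> after \<open>P\<close> on the larger space. It is
  applied with \<open>W\<close> the group algebra or the full endomorphism algebra and
  \<open>P\<close> an average over \<open>G\<close>, which yields traces on the centre and on the
  commutant.\<close>

lemma trace_retract:
  assumes F: "frame W I e \<epsilon>" and W: "subspace W" and V: "subspace V" "V \<subseteq> W"
    and P: "lin W V P" "\<And>x. x \<in> V \<Longrightarrow> P x = x" and f: "lin V V f"
  shows "tr V f = (\<Sum>i\<in>I. \<epsilon> i (f (P (e i))))"
  by (rule trace_frame[OF frame_retract[OF F V(2) P W] V(1) f])

section \<open>Non-degenerate symmetric forms\<close>

lemma End_setD: "x \<in> End_set V \<Longrightarrow> lin V V x" "x \<in> End_set V \<Longrightarrow> v \<notin> V \<Longrightarrow> x v = 0"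
  by (auto simp: End_set_def)

lemma End_set_eqI:
  "x \<in> End_set V \<Longrightarrow> y \<in> End_set V \<Longrightarrow> (\<And>v. v \<in> V \<Longrightarrow> x v = y v) \<Longrightarrow> x = y"
  by (rule ext) (metis End_setD(2))

lemma End_set_extend:
  assumes "lin V V f" "subspace V"
  shows "extend_zero V f \<in> End_set V"
  using lin_cong[OF assms, of "extend_zero V f"] by (simp add: End_set_def extend_zero_def)

lemma End_set_add: "subspace V \<Longrightarrow> x \<in> End_set V \<Longrightarrow> y \<in> End_set V \<Longrightarrow> x + y \<in> End_set V"
  and End_set_scale: "subspace V \<Longrightarrow> x \<in> End_set V \<Longrightarrow> c *\<^sub>R x \<in> End_set V"
  and End_set_comp: "subspace V \<Longrightarrow> x \<in> End_set V \<Longrightarrow> y \<in> End_set V \<Longrightarrow> x \<circ> y \<in> End_set V"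
  and End_set_0: "subspace V \<Longrightarrow> 0 \<in> End_set V"
  using lin_add_fun[of V V x y] lin_scale_fun[of V V x c] lin_comp[of V V y V x] lin_0[of V V x]
  by (auto simp: End_set_def plus_fun_def scaleR_fun_def comp_def zero_fun_def linI subspace_0)

section \<open>Dual bases and adjoints for a non-degenerate symmetric form\<close>

locale form_space =
  fixes V :: "'a::real_vector set" and b :: "'a \<Rightarrow> 'a \<Rightarrow> real"
  assumes fd: "findim V"
    and lin_b: "u \<in> V \<Longrightarrow> lin V UNIV (b u)"
    and sym: "u \<in> V \<Longrightarrow> v \<in> V \<Longrightarrow> b u v = b v u"
    and nondeg: "u \<in> V \<Longrightarrow> (\<And>v. v \<in> V \<Longrightarrow> b u v = 0) \<Longrightarrow> u = 0"
begin

lemma sub: "subspace V"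
  by (rule findim_subspace[OF fd])

lemma add_r: "u \<in> V \<Longrightarrow> v \<in> V \<Longrightarrow> w \<in> V \<Longrightarrow> b u (v + w) = b u v + b u w"
  and scale_r: "u \<in> V \<Longrightarrow> v \<in> V \<Longrightarrow> b u (c *\<^sub>R v) = c * b u v"
  and diff_r: "u \<in> V \<Longrightarrow> v \<in> V \<Longrightarrow> w \<in> V \<Longrightarrow> b u (v - w) = b u v - b u w"
  using lin_add[OF lin_b] lin_scale[OF lin_b] lin_diff[OF lin_b sub] by auto

lemma sum_r: "u \<in> V \<Longrightarrow> (\<And>i. i \<in> I \<Longrightarrow> x i \<in> V) \<Longrightarrow> b u (\<Sum>i\<in>I. x i) = (\<Sum>i\<in>I. b u (x i))"
  by (rule lin_sum[OF lin_b sub])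

lemma combination_r:
  "u \<in> V \<Longrightarrow> (\<And>i. i \<in> I \<Longrightarrow> x i \<in> V) \<Longrightarrow> b u (\<Sum>i\<in>I. c i *\<^sub>R x i) = (\<Sum>i\<in>I. c i * b u (x i))"
  by (subst lin_combination[OF lin_b sub]) auto

lemma add_l: "u \<in> V \<Longrightarrow> v \<in> V \<Longrightarrow> w \<in> V \<Longrightarrow> b (v + w) u = b v u + b w u"
  and scale_l: "u \<in> V \<Longrightarrow> v \<in> V \<Longrightarrow> b (c *\<^sub>R v) u = c * b v u"
  and diff_l: "u \<in> V \<Longrightarrow> v \<in> V \<Longrightarrow> w \<in> V \<Longrightarrow> b (v - w) u = b v u - b w u"
  using add_r[of u v w] scale_r[of u v c] diff_r[of u v w]
  by (auto simp: sym subspace_add subspace_scale subspace_diff sub)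

lemma sum_l: "u \<in> V \<Longrightarrow> (\<And>i. i \<in> I \<Longrightarrow> x i \<in> V) \<Longrightarrow> b (\<Sum>i\<in>I. x i) u = (\<Sum>i\<in>I. b (x i) u)"
  using sum_r[of u I x] by (simp add: sym subspace_sum sub)

lemma combination_l:
  "u \<in> V \<Longrightarrow> (\<And>i. i \<in> I \<Longrightarrow> x i \<in> V) \<Longrightarrow> b (\<Sum>i\<in>I. c i *\<^sub>R x i) u = (\<Sum>i\<in>I. c i * b (x i) u)"
  by (subst sum_l) (auto simp: scale_l subspace_scale sub)

lemma eqI:
  assumes "u \<in> V" "w \<in> V" "\<And>v. v \<in> V \<Longrightarrow> b v u = b v w"
  shows "u = w"
proof -
  have "b (u - w) v = 0" if v: "v \<in> V" for v
    using diff_l[OF v assms(1,2)] assms(3)[OF v] sym[OF assms(1) v] sym[OF assms(2) v] by simp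
  then show ?thesis
    using nondeg[of "u - w"] subspace_diff[OF sub assms(1,2)] by auto
qed

lemma dual_basis:
  assumes "basis_on (*\<^sub>R) V \<Gamma>"
  obtains d where "\<And>x. x \<in> \<Gamma> \<Longrightarrow> d x \<in> V"
    "\<And>x y. x \<in> \<Gamma> \<Longrightarrow> y \<in> \<Gamma> \<Longrightarrow> b (d x) y = (if x = y then 1 else 0)"
    "frame V \<Gamma> (\<lambda>x. x) (\<lambda>x. b (d x))" "frame V \<Gamma> d b"
proof -
  have \<Gamma>: "finite \<Gamma>" "independent \<Gamma>" "span \<Gamma> = V"
    using assms by (auto simp: basis_on_real)
  have \<Gamma>V: "x \<in> \<Gamma> \<Longrightarrow> x \<in> V" for x
    using \<Gamma>(3) span_base by auto
  \<comment> \<open>\<open>T\<close> is injective by non-degeneracy, hence onto. A preimage of a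
    basis vector \<open>x\<close> pairs to 1 with \<open>x\<close> and to 0 with the other basis
    vectors, by independence.\<close>
  define T where "T = (\<lambda>c. \<Sum>z\<in>\<Gamma>. b z c *\<^sub>R z)"
  have T: "lin V V T"
    unfolding T_def by (intro lin_sum_fun lin_scaleR_vec lin_b sub \<Gamma>V)
  have coeff: "b z c = u z" if "T c = (\<Sum>z\<in>\<Gamma>. u z *\<^sub>R z)" "z \<in> \<Gamma>" for c u z
  proof -
    have "(\<Sum>z\<in>\<Gamma>. (b z c - u z) *\<^sub>R z) = 0"
      using that(1) by (simp add: T_def scaleR_diff_left sum_subtractf)
    from independentD[OF \<Gamma>(2,1) subset_refl this that(2)] show ?thesis
      by simp
  qed
  have "T ` V = V"
  proof (rule lin_inj_surj[OF fd T])
    fix c assume c: "c \<in> V" "T c = 0"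
    have "b c z = 0" if "z \<in> \<Gamma>" for z
      using coeff[of c "\<lambda>_. 0", OF _ that] c(2) sym[OF c(1) \<Gamma>V[OF that]] by simp
    then have "b c v = 0" if "v \<in> V" for v
      using lin_eq_on_span[of \<Gamma> UNIV "b c" UNIV "\<lambda>_. 0" v] that \<Gamma>(3) lin_b[OF c(1)]
      by (simp add: linI)
    then show "c = 0"
      using nondeg c by blast
  qed
  then have "\<forall>x\<in>\<Gamma>. \<exists>c\<in>V. T c = x"
    using \<Gamma>V by (metis imageE)
  then obtain d where d: "\<And>x. x \<in> \<Gamma> \<Longrightarrow> d x \<in> V \<and> T (d x) = x"
    by metis
  have orth: "b (d x) y = (if x = y then 1 else 0)" if "x \<in> \<Gamma>" "y \<in> \<Gamma>" for x y
  proof -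
    have "T (d x) = (\<Sum>z\<in>\<Gamma>. (if x = z then 1 else 0) *\<^sub>R z)"
      using d that \<Gamma>(1) by (simp add: if_distrib[of "\<lambda>t. t *\<^sub>R _"] cong: if_cong)
    from coeff[OF this that(2)] show ?thesis
      using d that sym \<Gamma>V by auto
  qed
  have F: "frame V \<Gamma> (\<lambda>x. x) (\<lambda>x. b (d x))"
    unfolding frame_def
  proof (intro conjI ballI \<Gamma>(1))
    fix x assume x: "x \<in> V"
    have "lin (span \<Gamma>) V (\<lambda>x. \<Sum>i\<in>\<Gamma>. b (d i) x *\<^sub>R i)"
      unfolding \<Gamma>(3) using d by (intro lin_sum_fun lin_scaleR_vec lin_b sub) (auto intro: \<Gamma>V)
    then show "(\<Sum>i\<in>\<Gamma>. b (d i) x *\<^sub>R i) = x"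
    proof (rule lin_eq_on_span[of _ _ _ V "\<lambda>x. x"])
      show "lin (span \<Gamma>) V (\<lambda>x. x)" "x \<in> span \<Gamma>"
        using x \<Gamma>(3) lin_id by auto
      show "(\<Sum>i\<in>\<Gamma>. b (d i) y *\<^sub>R i) = y" if "y \<in> \<Gamma>" for y
        using that \<Gamma>(1) by (simp add: orth if_distrib[of "\<lambda>t. t *\<^sub>R _"] cong: if_cong)
    qed
  qed (use d \<Gamma>V lin_b in auto)
  have "frame V \<Gamma> d b"
    unfolding frame_def
  proof (intro conjI ballI \<Gamma>(1))
    fix x assume x: "x \<in> V"
    show "(\<Sum>i\<in>\<Gamma>. b i x *\<^sub>R d i) = x"
    proof (rule eqI)
      show "(\<Sum>i\<in>\<Gamma>. b i x *\<^sub>R d i) \<in> V"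
        using d by (auto intro!: subspace_sum subspace_scale sub)
      fix v assume v: "v \<in> V"
      have "b v (\<Sum>i\<in>\<Gamma>. b i x *\<^sub>R d i) = (\<Sum>i\<in>\<Gamma>. b (d i) v * b i x)"
        using d v by (subst combination_r) (auto intro!: sum.cong simp: sym)
      also have "\<dots> = b (\<Sum>i\<in>\<Gamma>. b (d i) v *\<^sub>R i) x"
        using x \<Gamma>V by (subst combination_l) auto
      finally show "b v (\<Sum>i\<in>\<Gamma>. b i x *\<^sub>R d i) = b v x"
        using frameD(4)[OF F v] by simp
    qed (fact x)
  qed (use d \<Gamma>V lin_b in auto)
  with F orth d show thesis
    using that by blast
qed

lemma dual_frame:
  obtains \<Gamma> d where "frame V \<Gamma> (\<lambda>x. x) (\<lambda>x. b (d x))" "frame V \<Gamma> d b"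
  using basis_on_ex[OF fd] dual_basis by metis

lemma riesz:
  assumes f: "lin V UNIV f"
  shows "\<exists>w\<in>V. \<forall>v\<in>V. b w v = f v"
proof -
  obtain \<Gamma> d where F: "frame V \<Gamma> (\<lambda>x. x) (\<lambda>x. b (d x))" "frame V \<Gamma> d b"
    by (rule dual_frame)
  have "b (\<Sum>z\<in>\<Gamma>. f z *\<^sub>R d z) v = f v" if v: "v \<in> V" for v
  proof -
    have "b (\<Sum>z\<in>\<Gamma>. f z *\<^sub>R d z) v = (\<Sum>z\<in>\<Gamma>. b (d z) v * f z)"
      using frameD(2)[OF F(2)] v by (subst combination_l) (auto simp: mult.commute)
    also have "\<dots> = f (\<Sum>z\<in>\<Gamma>. b (d z) v *\<^sub>R z)"
      using lin_combination[OF f sub, of \<Gamma> "\<lambda>x. x"] frameD(2)[OF F(1)] by simp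
    finally show ?thesis
      using frameD(4)[OF F(1) v] by simp
  qed
  moreover have "(\<Sum>z\<in>\<Gamma>. f z *\<^sub>R d z) \<in> V"
    using frameD(2)[OF F(2)] by (intro subspace_sum subspace_scale sub)
  ultimately show ?thesis
    by blast
qed

abbreviation adj :: "('a \<Rightarrow> 'a) \<Rightarrow> 'a \<Rightarrow> 'a" where
  "adj \<equiv> adjoint_on V b"

text \<open>\<open>adjoint_on\<close> is a definite description, so identities for the adjoint are
  obtained by exhibiting a candidate in \<open>End_set V\<close> that satisfies the
  adjunction.\<close>

lemma adj_unique:
  assumes y: "y \<in> End_set V" and *: "\<And>u v. u \<in> V \<Longrightarrow> v \<in> V \<Longrightarrow> b (x u) v = b u (y v)"
  shows "adj x = y"
  unfolding adjoint_on_def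
proof (rule the_equality)
  fix y' assume y': "y' \<in> End_set V \<and> (\<forall>u\<in>V. \<forall>v\<in>V. b (x u) v = b u (y' v))"
  then show "y' = y"
    using y * by (intro End_set_eqI eqI) (auto intro: lin_mem End_setD)
qed (use assms in auto)

lemma adj_ex:
  assumes x: "lin V V x"
  shows "\<exists>y\<in>End_set V. \<forall>u\<in>V. \<forall>v\<in>V. b (x u) v = b u (y v)"
proof -
  obtain \<Gamma> d where F: "frame V \<Gamma> (\<lambda>x. x) (\<lambda>x. b (d x))" "frame V \<Gamma> d b"
    by (rule dual_frame)
  have \<Gamma>V: "z \<in> V" "d z \<in> V" if "z \<in> \<Gamma>" for z
    using frameD(2)[OF F(1) that] frameD(2)[OF F(2) that] .
  \<comment> \<open>Forced by the expansion in the frame \<open>d\<close>: the coordinate of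
    \<open>y v\<close> along \<open>d z\<close> is \<open>b z (y v)\<close>, and the adjunction
    requires it to be \<open>b (x z) v\<close>.\<close>
  define y where "y = (\<lambda>v. \<Sum>z\<in>\<Gamma>. b (x z) v *\<^sub>R d z)"
  have y: "lin V V y"
    unfolding y_def using \<Gamma>V by (intro lin_sum_fun lin_scaleR_vec lin_b sub) (auto intro: lin_mem[OF x])
  have "b u (y v) = b (x u) v" if "u \<in> V" "v \<in> V" for u v
  proof -
    have "b u (y v) = (\<Sum>z\<in>\<Gamma>. b (d z) u * b (x z) v)"
      unfolding y_def using that \<Gamma>V by (subst combination_r) (auto intro!: sum.cong simp: sym)
    also have "\<dots> = b (x (\<Sum>z\<in>\<Gamma>. b (d z) u *\<^sub>R z)) v"
      using that \<Gamma>V lin_mem[OF x] by (subst lin_combination[OF x sub]) (auto simp: combination_l)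
    finally show ?thesis
      using frameD(4)[OF F(1) that(1)] by simp
  qed
  then show ?thesis
    using End_set_extend[OF y sub] by (intro bexI[of _ "extend_zero V y"]) (auto simp: extend_zero_def)
qed

lemma adj_End: "x \<in> End_set V \<Longrightarrow> adj x \<in> End_set V"
  and adj: "x \<in> End_set V \<Longrightarrow> u \<in> V \<Longrightarrow> v \<in> V \<Longrightarrow> b u (adj x v) = b (x u) v"
proof -
  assume "x \<in> End_set V"
  then obtain y where "y \<in> End_set V" "\<forall>u\<in>V. \<forall>v\<in>V. b (x u) v = b u (y v)"
    using adj_ex[OF End_setD(1)] by blast
  moreover from this have "adj x = y"
    by (intro adj_unique) auto
  ultimately show "adj x \<in> End_set V" "u \<in> V \<Longrightarrow> v \<in> V \<Longrightarrow> b u (adj x v) = b (x u) v"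
    by auto
qed

lemma adj': "x \<in> End_set V \<Longrightarrow> u \<in> V \<Longrightarrow> v \<in> V \<Longrightarrow> b (adj x u) v = b u (x v)"
  using adj[of x v u] adj_End[of x] by (metis End_setD(1) lin_mem sym)

lemma adj_adj: "x \<in> End_set V \<Longrightarrow> adj (adj x) = x"
  by (intro adj_unique) (auto simp: adj')

lemma adj_comp: "x \<in> End_set V \<Longrightarrow> y \<in> End_set V \<Longrightarrow> adj (x \<circ> y) = adj y \<circ> adj x"
  by (intro adj_unique) (simp_all add: adj End_set_comp sub adj_End lin_mem[OF End_setD(1)])

lemma adj_add: "x \<in> End_set V \<Longrightarrow> y \<in> End_set V \<Longrightarrow> adj (x + y) = adj x + adj y"
  by (intro adj_unique)
    (auto simp: adj End_set_add sub adj_End add_r add_l lin_mem[OF End_setD(1)])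

lemma adj_scale: "x \<in> End_set V \<Longrightarrow> adj (c *\<^sub>R x) = c *\<^sub>R adj x"
  by (intro adj_unique)
    (auto simp: adj End_set_scale sub adj_End scale_r scale_l lin_mem[OF End_setD(1)])

text \<open>The adjoint is traced in a basis and \<open>x\<close> in the dual frame; moving the
  adjoint across \<open>b\<close> exchanges the two.\<close>

lemma trace_adj: "x \<in> End_set V \<Longrightarrow> tr V (adj x) = tr V x"
proof -
  assume x: "x \<in> End_set V"
  obtain \<Gamma> d where F: "frame V \<Gamma> (\<lambda>x. x) (\<lambda>x. b (d x))" "frame V \<Gamma> d b"
    by (rule dual_frame)
  have \<Gamma>V: "z \<in> V" "d z \<in> V" if "z \<in> \<Gamma>" for z
    using frameD(2)[OF F(1) that] frameD(2)[OF F(2) that] .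
  have "tr V (adj x) = (\<Sum>z\<in>\<Gamma>. b (d z) (adj x z))"
    by (rule trace_frame[OF F(1) sub End_setD(1)[OF adj_End[OF x]]])
  also have "\<dots> = (\<Sum>z\<in>\<Gamma>. b z (x (d z)))"
    using \<Gamma>V x by (intro sum.cong) (auto simp: adj sym lin_mem[OF End_setD(1)])
  also have "\<dots> = tr V x"
    using trace_frame[OF F(2) sub End_setD(1)[OF x]] by simp
  finally show ?thesis .
qed

end

section \<open>Positive definite forms: orthonormal frames and eigenvectors\<close>

locale inner_space =
  fixes V :: "'a::real_vector set" and b :: "'a \<Rightarrow> 'a \<Rightarrow> real"
  assumes findim: "findim V"
    and lin_form: "u \<in> V \<Longrightarrow> lin V UNIV (b u)"
    and form_sym: "u \<in> V \<Longrightarrow> v \<in> V \<Longrightarrow> b u v = b v u"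
    and pos: "u \<in> V \<Longrightarrow> u \<noteq> 0 \<Longrightarrow> b u u > 0"

sublocale inner_space \<subseteq> form_space
  using findim lin_form form_sym pos by unfold_locales (blast, blast, blast, force)

context inner_space
begin

lemma subspace_inner: "subspace W \<Longrightarrow> W \<subseteq> V \<Longrightarrow> inner_space W b"
  by unfold_locales
    (auto intro: findim_subset[OF fd] lin_subset[OF lin_b] sym pos simp: subset_iff)

lemma form_0: "u \<in> V \<Longrightarrow> b u 0 = 0" "u \<in> V \<Longrightarrow> b 0 u = 0"
  using scale_r[of u u 0] scale_l[of u u 0] by auto

lemma nonneg: "u \<in> V \<Longrightarrow> b u u \<ge> 0"
  using pos[of u] form_0 by (cases "u = 0") (auto simp: sub subspace_0)

text \<open>Gram-Schmidt, in a form that suits induction over \<open>S\<close>: the orthonormal set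
  has to reproduce only the vectors treated so far. Nothing is added when the remainder
  \<open>s'\<close> vanishes.\<close>

lemma orthonormal_extend:
  assumes "finite S" "S \<subseteq> V"
  shows "\<exists>\<Gamma>. finite \<Gamma> \<and> \<Gamma> \<subseteq> V \<and> (\<forall>x\<in>\<Gamma>. \<forall>y\<in>\<Gamma>. b x y = (if x = y then 1 else 0)) \<and>
    (\<forall>x\<in>S. (\<Sum>e\<in>\<Gamma>. b e x *\<^sub>R e) = x)"
  using assms
proof (induction S)
  case empty
  then show ?case
    by (intro exI[of _ "{}"]) auto
next
  case (insert s S)
  have "S \<subseteq> V"
    using insert.prems by simp
  from insert.IH[OF this] obtain \<Gamma> where \<Gamma>': "finite \<Gamma> \<and> \<Gamma> \<subseteq> V \<and> (\<forall>x\<in>\<Gamma>. \<forall>y\<in>\<Gamma>. b x y = (if x = y then 1 else 0)) \<and>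
    (\<forall>x\<in>S. (\<Sum>e\<in>\<Gamma>. b e x *\<^sub>R e) = x)"
    by (rule exE)
  then have \<Gamma>: "finite \<Gamma>" "\<Gamma> \<subseteq> V" "\<And>x y. x \<in> \<Gamma> \<Longrightarrow> y \<in> \<Gamma> \<Longrightarrow> b x y = (if x = y then 1 else 0)"
    "\<And>x. x \<in> S \<Longrightarrow> (\<Sum>e\<in>\<Gamma>. b e x *\<^sub>R e) = x"
    by simp_all
  define s' where "s' = s - (\<Sum>e\<in>\<Gamma>. b e s *\<^sub>R e)"
  have s: "s \<in> V" "(\<Sum>e\<in>\<Gamma>. b e s *\<^sub>R e) \<in> V" "s' \<in> V"
    using insert.prems \<Gamma> unfolding s'_def by (auto intro!: subspace_diff subspace_sum subspace_scale sub)
  have orth: "b e s' = 0" if e: "e \<in> \<Gamma>" for e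
  proof -
    have "b e (\<Sum>f\<in>\<Gamma>. b f s *\<^sub>R f) = (\<Sum>f\<in>\<Gamma>. b f s * b e f)"
      using e \<Gamma>(2) by (intro combination_r) auto
    also have "\<dots> = (\<Sum>f\<in>\<Gamma>. if e = f then b f s else 0)"
      using e \<Gamma>(3) by (intro sum.cong) auto
    also have "\<dots> = b e s"
      using e \<Gamma>(1) by simp
    finally show ?thesis
      using s(1,2) e \<Gamma>(2) by (simp add: s'_def diff_r subset_iff)
  qed
  show ?case
  proof (cases "s' = 0")
    case True
    then show ?thesis
      using \<Gamma> by (intro exI[of _ \<Gamma>]) (auto simp: s'_def)
  next
    case False
    define r where "r = sqrt (b s' s')"
    have r: "r > 0" "r * r = b s' s'"
      using pos[OF s(3) False] by (auto simp: r_def)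
    define e0 where "e0 = (1 / r) *\<^sub>R s'"
    have e0: "e0 \<in> V" "b e0 e0 = 1"
      using s(3) r by (simp_all add: e0_def scale_l scale_r subspace_scale sub r(2)[symmetric])
    have orth0: "b e e0 = 0" "b e0 e = 0" if "e \<in> \<Gamma>" for e
    proof -
      have "e \<in> V"
        using that \<Gamma>(2) by auto
      then show "b e e0 = 0"
        using orth[OF that] s(3) by (simp add: e0_def scale_r)
      then show "b e0 e = 0"
        using sym[OF e0(1) \<open>e \<in> V\<close>] by simp
    qed
    have ni: "e0 \<notin> \<Gamma>"
      using orth0 e0 by force
    have e0s: "b e0 (\<Sum>e\<in>\<Gamma>. c e *\<^sub>R e) = 0" for c
      using \<Gamma>(2) orth0(2) e0(1) by (subst combination_r) auto
    have "b e0 s = b e0 s' + b e0 (\<Sum>e\<in>\<Gamma>. b e s *\<^sub>R e)"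
      using add_r[OF e0(1) s(3,2)] by (simp add: s'_def)
    also have "\<dots> = r"
      using s(3) r by (simp add: e0s) (simp add: e0_def scale_l r(2)[symmetric])
    finally have bs: "b e0 s *\<^sub>R e0 = s'"
      using r by (simp add: e0_def)
    have "(\<Sum>e\<in>insert e0 \<Gamma>. b e x *\<^sub>R e) = x" if "x \<in> insert s S" for x
    proof (cases "x = s")
      case True
      then show ?thesis
        using \<Gamma>(1) ni bs by (simp add: s'_def)
    next
      case False
      then have "b e0 x = 0"
        using that e0s[of "\<lambda>e. b e x"] \<Gamma>(4)[of x] by simp
      then show ?thesis
        using False that \<Gamma>(1,4) ni by simp
    qed
    then show ?thesis
      using \<Gamma>(1,2,3) e0 orth0 ni by (intro exI[of _ "insert e0 \<Gamma>"]) auto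
  qed
qed

lemma orthonormal_frame:
  obtains \<Gamma> where "frame V \<Gamma> (\<lambda>x. x) b"
    "\<And>x y. x \<in> \<Gamma> \<Longrightarrow> y \<in> \<Gamma> \<Longrightarrow> b x y = (if x = y then 1 else 0)"
proof -
  obtain S where S: "finite S" "span S = V"
    using basis_on_ex[OF fd] by (auto simp: basis_on_real)
  obtain \<Gamma> where \<Gamma>: "finite \<Gamma>" "\<Gamma> \<subseteq> V" "\<And>x y. x \<in> \<Gamma> \<Longrightarrow> y \<in> \<Gamma> \<Longrightarrow> b x y = (if x = y then 1 else 0)"
    "\<And>x. x \<in> S \<Longrightarrow> (\<Sum>e\<in>\<Gamma>. b e x *\<^sub>R e) = x"
    using orthonormal_extend[OF S(1)] S(2) span_superset[of S] by auto
  have l: "lin (span S) V (\<lambda>x. \<Sum>e\<in>\<Gamma>. b e x *\<^sub>R e)"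
    unfolding S(2) using \<Gamma>(2) by (intro lin_sum_fun lin_scaleR_vec lin_b sub) auto
  have "(\<Sum>e\<in>\<Gamma>. b e x *\<^sub>R e) = x" if "x \<in> V" for x
    by (rule lin_eq_on_span[OF l lin_id]) (use \<Gamma> S that in auto)
  then have "frame V \<Gamma> (\<lambda>x. x) b"
    using \<Gamma> lin_b by (auto simp: frame_def)
  with \<Gamma>(3) that show thesis
    by blast
qed

lemma bounded_quadratic:
  assumes y: "lin V V y"
  shows "\<exists>M>0. \<forall>u\<in>V. b (y u) u \<le> M * b u u"
proof -
  obtain \<Gamma> where F: "frame V \<Gamma> (\<lambda>x. x) b"
    and on: "\<And>x y. x \<in> \<Gamma> \<Longrightarrow> y \<in> \<Gamma> \<Longrightarrow> b x y = (if x = y then 1 else 0)"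
    using orthonormal_frame by blast
  have \<Gamma>: "finite \<Gamma>" "\<And>x. x \<in> \<Gamma> \<Longrightarrow> x \<in> V"
    using frameD[OF F] by auto
  \<comment> \<open>The summand 1 keeps \<open>M\<close> positive when all matrix entries vanish;
    the eigenvector argument divides by \<open>M\<close>.\<close>
  define M where "M = 1 + (\<Sum>e\<in>\<Gamma>. \<Sum>f\<in>\<Gamma>. \<bar>b (y e) f\<bar>)"
  have "b (y u) u \<le> M * b u u" if u: "u \<in> V" for u
  proof -
    have "b u u = b u (\<Sum>e\<in>\<Gamma>. b e u *\<^sub>R e)"
      using frameD(4)[OF F u] by simp
    also have "\<dots> = (\<Sum>e\<in>\<Gamma>. (b e u)\<^sup>2)"
      using u \<Gamma> by (subst combination_r) (auto simp: power2_eq_square sym)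
    finally have norm: "b u u = (\<Sum>e\<in>\<Gamma>. (b e u)\<^sup>2)" .
    have le: "(b e u)\<^sup>2 \<le> b u u" if "e \<in> \<Gamma>" for e
      unfolding norm using that \<Gamma>(1) by (intro member_le_sum) auto
    have le2: "b e u * b f u * c \<le> b u u * \<bar>c\<bar>" if "e \<in> \<Gamma>" "f \<in> \<Gamma>" for e f c
    proof -
      have "2 * \<bar>b e u * b f u\<bar> \<le> (b e u)\<^sup>2 + (b f u)\<^sup>2"
        using sum_squares_bound[of "\<bar>b e u\<bar>" "\<bar>b f u\<bar>"] by (simp add: abs_mult)
      then have "\<bar>b e u * b f u\<bar> \<le> b u u"
        using le[OF that(1)] le[OF that(2)] by linarith
      then have "\<bar>b e u * b f u\<bar> * \<bar>c\<bar> \<le> b u u * \<bar>c\<bar>"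
        by (rule mult_right_mono) simp
      then show ?thesis
        by (metis abs_ge_self abs_mult order_trans)
    qed
    have "b (y u) u = b (y (\<Sum>e\<in>\<Gamma>. b e u *\<^sub>R e)) u"
      using frameD(4)[OF F u] by simp
    also have "\<dots> = (\<Sum>e\<in>\<Gamma>. b e u * b (y e) u)"
      using u \<Gamma> lin_mem[OF y] by (subst lin_combination[OF y sub]) (auto simp: combination_l)
    also have "\<dots> = (\<Sum>e\<in>\<Gamma>. b e u * b (y e) (\<Sum>f\<in>\<Gamma>. b f u *\<^sub>R f))"
      using frameD(4)[OF F u] by simp
    also have "\<dots> = (\<Sum>e\<in>\<Gamma>. \<Sum>f\<in>\<Gamma>. b e u * b f u * b (y e) f)"
      using u \<Gamma> lin_mem[OF y]
      by (intro sum.cong) (auto simp: combination_r sum_distrib_left mult.assoc)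
    also have "\<dots> \<le> (\<Sum>e\<in>\<Gamma>. \<Sum>f\<in>\<Gamma>. b u u * \<bar>b (y e) f\<bar>)"
      using le2 by (intro sum_mono) auto
    also have "\<dots> \<le> M * b u u"
      using nonneg[OF u] by (simp add: M_def sum_distrib_left[symmetric] algebra_simps)
    finally show ?thesis .
  qed
  moreover have "M > 0"
    unfolding M_def by (intro add_pos_nonneg sum_nonneg) auto
  ultimately show ?thesis
    by blast
qed

text \<open>
  The infimum \<open>t\<^sub>0\<close> of the upper bounds of the Rayleigh quotient is an eigenvalue: otherwise
  \<open>t\<^sub>0 - S\<close> has an inverse \<open>z\<close>, and a bound for \<open>z\<close> is a bound below for \<open>t\<^sub>0 - S\<close>.
\<close>

lemma eigenvector_ex:
  assumes S: "lin V V S" and sa: "\<And>u v. u \<in> V \<Longrightarrow> v \<in> V \<Longrightarrow> b (S u) v = b u (S v)" and "V \<noteq> {0}"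
  obtains k w where "w \<in> V" "w \<noteq> 0" "S w = k *\<^sub>R w"
proof -
  define T where "T = {t. \<forall>u\<in>V. b (S u) u \<le> t * b u u}"
  define t0 where "t0 = Inf T"
  define y where "y = (\<lambda>u. t0 *\<^sub>R u - S u)"
  obtain u1 where u1: "u1 \<in> V" "u1 \<noteq> 0"
    using assms(3) sub subspace_0 by blast
  obtain M0 where "\<forall>u\<in>V. b (S u) u \<le> M0 * b u u"
    using bounded_quadratic[OF S] by blast
  then have "M0 \<in> T"
    by (simp add: T_def)
  have low: "b (S u) u / b u u \<le> t" if "t \<in> T" "u \<in> V" "u \<noteq> 0" for t u
    using that pos[of u] by (auto simp: T_def field_simps)
  have bdd: "bdd_below T"
    using low[OF _ u1] by (intro bdd_belowI) auto
  have t0: "b (S u) u \<le> t0 * b u u" if u: "u \<in> V" for u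
  proof (cases "u = 0")
    case True
    then show ?thesis
      using form_0[OF lin_mem[OF S u]] form_0[OF u] by simp
  next
    case False
    have "b (S u) u / b u u \<le> t0"
      unfolding t0_def using \<open>M0 \<in> T\<close> low[OF _ u False] by (intro cInf_greatest) auto
    then show ?thesis
      using pos[OF u False] by (simp add: field_simps)
  qed
  have y: "lin V V y"
    unfolding y_def
    using sub by (intro linI) (auto simp: lin_mem[OF S] lin_add[OF S] lin_scale[OF S] subspace_diff
        subspace_scale algebra_simps)
  have by_: "b (y u) v = t0 * b u v - b (S u) v" if "u \<in> V" "v \<in> V" for u v
    using that by (simp add: y_def diff_l scale_l lin_mem[OF S] subspace_scale sub)
  have ysym: "b (y u) v = b (y v) u" if "u \<in> V" "v \<in> V" for u v
    using that sa[OF that] sym[OF that] sym[OF that(1) lin_mem[OF S that(2)]] by (simp add: by_)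
  have "\<exists>w\<in>V. w \<noteq> 0 \<and> y w = 0"
  proof (rule ccontr)
    assume no: "\<not> (\<exists>w\<in>V. w \<noteq> 0 \<and> y w = 0)"
    have "y ` V = V"
      by (rule lin_inj_surj[OF fd y]) (use no in auto)
    then have "\<forall>v\<in>V. \<exists>u\<in>V. y u = v"
      by (metis imageE)
    then obtain z where z: "\<And>v. v \<in> V \<Longrightarrow> z v \<in> V" "\<And>v. v \<in> V \<Longrightarrow> y (z v) = v"
      by metis
    have inj: "u = v" if "u \<in> V" "v \<in> V" "y u = y v" for u v
      using no that lin_diff[OF y sub that(1,2)] subspace_diff[OF sub that(1,2)] by auto
    have "lin V V z"
    proof (rule linI)
      fix c u v assume "u \<in> V" "v \<in> V"
      then show "z u \<in> V" "z (u + v) = z u + z v" "z (c *\<^sub>R u) = c *\<^sub>R z u"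
        using z inj[of "z (u + v)" "z u + z v"] inj[of "z (c *\<^sub>R u)" "c *\<^sub>R z u"]
        by (simp_all add: lin_add[OF y] lin_scale[OF y] subspace_add subspace_scale sub)
    qed
    then obtain M where M: "M > 0" "\<forall>u\<in>V. b (z u) u \<le> M * b u u"
      using bounded_quadratic by blast
    have "t0 - 1 / M \<in> T"
      unfolding T_def
    proof safe
      fix u assume u: "u \<in> V"
      have V: "z u \<in> V" "M *\<^sub>R u \<in> V" "y u \<in> V"
        using z u lin_mem[OF y] by (auto simp: subspace_scale sub)
      \<comment> \<open>\<open>y\<close> is positive semi-definite. Testing it on
        \<open>z u - M *\<^sub>R u\<close> and bounding \<open>b (z u) u\<close> by
        \<open>M * b u u\<close> gives \<open>b u u \<le> M * b (y u) u\<close>, so the Rayleigh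
        quotient of \<open>S\<close> stays below \<open>t0 - 1 / M\<close>.\<close>
      have "0 \<le> b (y (z u - M *\<^sub>R u)) (z u - M *\<^sub>R u)"
        using V t0[of "z u - M *\<^sub>R u"] by (simp add: by_ subspace_diff sub)
      also have "\<dots> = b (u - M *\<^sub>R y u) (z u - M *\<^sub>R u)"
        using V u z by (simp add: lin_diff[OF y sub] lin_scale[OF y])
      also have "\<dots> = b u (z u) - M * b u u - (M * b (y u) (z u) - M * (M * b (y u) u))"
        using V u
        by (simp add: diff_l diff_r scale_l scale_r subspace_diff subspace_scale sub right_diff_distrib)
      also have "b (y u) (z u) = b u u"
        using ysym[OF u V(1)] z(2)[OF u] by simp
      also have "b u (z u) - M * b u u - (M * b u u - M * (M * b (y u) u)) \<le> M * (M * b (y u) u - b u u)"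
        using bspec[OF M(2) u] sym[OF u V(1)] by (simp add: algebra_simps)
      finally have "b u u \<le> M * b (y u) u"
        using M(1) by (simp add: zero_le_mult_iff)
      then show "b (S u) u \<le> (t0 - 1 / M) * b u u"
        using M(1) by (simp add: by_ u field_simps)
    qed
    then have "t0 \<le> t0 - 1 / M"
      using cInf_lower[OF _ bdd] unfolding t0_def by blast
    then show False
      using M(1) by (simp add: field_simps)
  qed
  then obtain w where "w \<in> V" "w \<noteq> 0" "y w = 0"
    by blast
  then show thesis
    using that[of w t0] by (simp add: y_def)
qed

end

section \<open>Casimir elements and semi-simplicity\<close>

text \<open>The projection of \<open>v\<close> is the Riesz vector of the functional
  \<open>b v\<close> on \<open>W\<close>, where \<open>b\<close> is again positive.\<close>

lemma (in inner_space) orth_decomp: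
  assumes W: "subspace W" "W \<subseteq> V" and v: "v \<in> V"
  shows "\<exists>w\<in>W. \<forall>u\<in>W. b u (v - w) = 0"
proof -
  interpret W: inner_space W b
    by (rule subspace_inner[OF W])
  obtain w where w: "w \<in> W" "\<forall>u\<in>W. b w u = b v u"
    using W.riesz[OF lin_subset[OF lin_b[OF v] W(2)]] by blast
  have "b u (v - w) = 0" if "u \<in> W" for u
  proof -
    have "u \<in> V" "w \<in> V"
      using that w(1) W(2) by auto
    then show ?thesis
      using w(2) that v sym[of u v] sym[of u w] by (simp add: diff_r)
  qed
  then show ?thesis
    using w(1) by blast
qed

lemma frobenius_form_space:
  fixes C :: "(real, 'a::real_vector) alg"
  assumes "frobenius_pair C l" and sc: "scale C = (*\<^sub>R)"
  shows "form_space (carrier C) (\<lambda>x y. l (x \<otimes>\<^bsub>C\<^esub> y))"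
proof -
  interpret frobenius_pair C l by fact
  have l: "lin (carrier C) UNIV l"
    using functional by (simp add: sc lin_real)
  show ?thesis
  proof
    show "findim (carrier C)"
      using fin_dim by (simp add: sc)
    fix u assume u: "u \<in> carrier C"
    have "lin (carrier C) (carrier C) (\<lambda>y. u \<otimes>\<^bsub>C\<^esub> y)"
      using distrib_left scale_mult_right u by (intro linI) (auto simp: sc)
    then show "lin (carrier C) UNIV (\<lambda>y. l (u \<otimes>\<^bsub>C\<^esub> y))"
      by (rule lin_comp[OF _ l])
  qed (use form_symmetric form_nondegenerate in auto)
qed

text \<open>
  The functional \<open>c \<mapsto> l (K\<^sup>\<star> c)\<close> is the trace of \<open>x \<mapsto> x\<^sup>\<star> c\<close>, which characterises
  \<open>K\<^sup>\<star>\<close> without reference to a basis.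
\<close>

lemma star_casimir_eqI:
  fixes C :: "(real, 'a::real_vector) alg"
  assumes fp: "frobenius_pair C l" and sc: "scale C = (*\<^sub>R)"
    and star: "lin (carrier C) (carrier C) star"
    and K: "K \<in> carrier C"
    and eq: "\<And>c. c \<in> carrier C \<Longrightarrow> l (K \<otimes>\<^bsub>C\<^esub> c) = tr (carrier C) (\<lambda>x. star x \<otimes>\<^bsub>C\<^esub> c)"
  shows "star_casimir C l star = K"
proof -
  interpret frobenius_pair C l by fact
  let ?V = "carrier C"
  let ?b = "\<lambda>x y. l (x \<otimes>\<^bsub>C\<^esub> y)"
  interpret F: form_space ?V ?b
    by (rule frobenius_form_space[OF fp sc])
  have l: "lin ?V UNIV l"
    using functional by (simp add: sc lin_real)
  define \<Gamma> where "\<Gamma> = (SOME \<Gamma>. basis_on (scale C) ?V \<Gamma>)"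
  define f where "f = (SOME F. gram_inverse C l \<Gamma> F)"
  have \<Gamma>: "basis_on (*\<^sub>R) ?V \<Gamma>"
    unfolding \<Gamma>_def sc by (rule someI_ex[OF basis_on_ex[OF F.fd]])
  then have \<Gamma>1: "finite \<Gamma>" "span \<Gamma> = ?V"
    by (simp_all add: basis_on_real)
  have \<Gamma>': "finite \<Gamma>" "span \<Gamma> = ?V" "x \<in> \<Gamma> \<Longrightarrow> x \<in> ?V" for x
    using \<Gamma>1 span_base[of x \<Gamma>] by simp_all
  obtain d where d: "\<And>x. x \<in> \<Gamma> \<Longrightarrow> d x \<in> ?V"
    "\<And>x y. x \<in> \<Gamma> \<Longrightarrow> y \<in> \<Gamma> \<Longrightarrow> ?b (d x) y = (if x = y then 1 else 0)"
    "frame ?V \<Gamma> (\<lambda>x. x) (\<lambda>x. ?b (d x))" "frame ?V \<Gamma> d ?b"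
    using F.dual_basis[OF \<Gamma>] by blast
  \<comment> \<open>The Gram matrix of the dual basis inverts that of \<open>\<Gamma>\<close>, so
    the matrix picked by \<open>SOME\<close> really is an inverse.\<close>
  have "gram_inverse C l \<Gamma> (\<lambda>x y. ?b (d x) (d y))"
    unfolding gram_inverse_def
  proof (intro ballI conjI)
    fix x z assume xz: "x \<in> \<Gamma>" "z \<in> \<Gamma>"
    have "(\<Sum>y\<in>\<Gamma>. ?b (d x) (d y) * ?b y z) = ?b (d x) (\<Sum>y\<in>\<Gamma>. ?b y z *\<^sub>R d y)"
      using F.combination_r[OF d(1)[OF xz(1)], of \<Gamma> d "\<lambda>y. ?b y z"] d(1) by (simp add: mult.commute)
    then show "(\<Sum>y\<in>\<Gamma>. ?b (d x) (d y) * ?b y z) = (if x = z then 1 else 0)"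
      using d(2)[OF xz] frameD(4)[OF d(4) \<Gamma>'(3)[OF xz(2)]] by simp
    have "(\<Sum>y\<in>\<Gamma>. ?b x y * ?b (d y) (d z)) = (\<Sum>y\<in>\<Gamma>. ?b y x * ?b (d y) (d z))"
      using \<Gamma>'(3) xz by (intro sum.cong refl) (simp add: form_symmetric)
    also have "\<dots> = ?b (\<Sum>y\<in>\<Gamma>. ?b y x *\<^sub>R d y) (d z)"
      using F.combination_l[OF d(1)[OF xz(2)], of \<Gamma> d "\<lambda>y. ?b y x"] d(1) by simp
    also have "\<dots> = ?b (d z) x"
      using frameD(4)[OF d(4) \<Gamma>'(3)[OF xz(1)]] form_symmetric[OF d(1)[OF xz(2)] \<Gamma>'(3)[OF xz(1)]]
      by simp
    finally show "(\<Sum>y\<in>\<Gamma>. ?b x y * ?b (d y) (d z)) = (if x = z then 1 else 0)"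
      using d(2)[OF xz(2,1)] by auto
  qed
  then have f: "gram_inverse C l \<Gamma> f"
    unfolding f_def by (rule someI[of "gram_inverse C l \<Gamma>"])
  \<comment> \<open>\<open>\<epsilon> z\<close> is the coordinate along \<open>z\<close> written
    through the chosen inverse matrix. In this form the trace of
    \<open>x \<mapsto> star x \<otimes> c\<close> unfolds to the double sum that defines the Casimir
    element, paired with \<open>c\<close>.\<close>
  define \<epsilon> where "\<epsilon> = (\<lambda>z w. \<Sum>y\<in>\<Gamma>. f y z * ?b y w)"
  have \<epsilon>_lin: "lin ?V UNIV (\<epsilon> z)" for z
    unfolding \<epsilon>_def using lin_scale_fun[OF subspace_UNIV F.lin_b]
    by (intro lin_sum_fun) (auto simp: \<Gamma>'(3))
  have \<epsilon>_base: "\<epsilon> z w = (if w = z then 1 else 0)" if "w \<in> \<Gamma>" "z \<in> \<Gamma>" for w z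
  proof -
    have "\<epsilon> z w = (\<Sum>y\<in>\<Gamma>. ?b w y * f y z)"
      unfolding \<epsilon>_def using that \<Gamma>'(3) by (intro sum.cong refl) (simp add: form_symmetric)
    then show ?thesis
      using f that by (simp add: gram_inverse_def)
  qed
  have fr: "frame ?V \<Gamma> (\<lambda>x. x) \<epsilon>"
    unfolding frame_def
  proof (intro conjI ballI)
    fix x assume x: "x \<in> ?V"
    have "lin (span \<Gamma>) ?V (\<lambda>x. \<Sum>i\<in>\<Gamma>. \<epsilon> i x *\<^sub>R i)"
      unfolding \<Gamma>'(2) by (intro lin_sum_fun lin_scaleR_vec \<epsilon>_lin F.sub \<Gamma>'(3))
    then show "(\<Sum>i\<in>\<Gamma>. \<epsilon> i x *\<^sub>R i) = x"
    proof (rule lin_eq_on_span[of _ _ _ ?V "\<lambda>x. x"])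
      show "lin (span \<Gamma>) ?V (\<lambda>x. x)" "x \<in> span \<Gamma>"
        using x \<Gamma>'(2) lin_id by auto
      show "(\<Sum>i\<in>\<Gamma>. \<epsilon> i y *\<^sub>R i) = y" if "y \<in> \<Gamma>" for y
        using that \<Gamma>'(1) by (simp add: \<epsilon>_base if_distrib[of "\<lambda>t. t *\<^sub>R _"] cong: if_cong)
    qed
  qed (auto simp: \<Gamma>' \<epsilon>_lin)
  let ?K = "star_casimir C l star"
  have Kdef: "?K = (\<Sum>x\<in>\<Gamma>. \<Sum>y\<in>\<Gamma>. f x y *\<^sub>R (x \<otimes>\<^bsub>C\<^esub> star y))"
    by (simp only: star_casimir_def Let_def sc \<Gamma>_def f_def)
  have stV: "star x \<in> ?V" if "x \<in> ?V" for x
    using lin_mem[OF star that] .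
  have K': "?K \<in> ?V"
    unfolding Kdef using stV \<Gamma>'(3) by (intro subspace_sum[OF F.sub] subspace_scale[OF F.sub]) auto
  have "?b ?K c = ?b K c" if c: "c \<in> ?V" for c
  proof -
    have mc: "lin ?V ?V (\<lambda>x. x \<otimes>\<^bsub>C\<^esub> c)"
      using distrib_right scale_mult_left c by (intro linI) (auto simp: sc)
    have lc: "lin ?V UNIV (\<lambda>x. ?b x c)"
      by (rule lin_comp[OF mc l])
    have "?b ?K c = (\<Sum>x\<in>\<Gamma>. \<Sum>y\<in>\<Gamma>. f x y * ?b (x \<otimes>\<^bsub>C\<^esub> star y) c)"
      unfolding Kdef using \<Gamma>'(3) stV
      by (subst lin_sum[OF lc F.sub])
        (auto intro!: subspace_sum[OF F.sub] subspace_scale[OF F.sub] sum.cong lin_combination[OF lc F.sub, simplified])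
    also have "\<dots> = (\<Sum>y\<in>\<Gamma>. \<epsilon> y (star y \<otimes>\<^bsub>C\<^esub> c))"
      unfolding \<epsilon>_def using \<Gamma>'(3) stV c by (subst sum.swap) (auto intro!: sum.cong simp: m_assoc)
    also have "\<dots> = tr ?V (\<lambda>x. star x \<otimes>\<^bsub>C\<^esub> c)"
      by (rule trace_frame[OF fr F.sub lin_comp[OF star mc], symmetric])
    finally show ?thesis
      using eq[OF c] by simp
  qed
  then show ?thesis
    using K K' by (intro F.eqI) (auto simp: form_symmetric)
qed

text \<open>Left multiplication by \<open>star x\<close> is adjoint to left multiplication by
  \<open>x\<close>, so the orthogonal complement of a left ideal is again a left ideal.\<close>

lemma semisimple_algI:
  fixes C :: "(real, 'a::real_vector) alg"
  assumes ip: "inner_space (carrier C) b" and sc: "scale C = (*\<^sub>R)"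
    and mult: "\<And>x y. x \<in> carrier C \<Longrightarrow> y \<in> carrier C \<Longrightarrow> x \<otimes>\<^bsub>C\<^esub> y \<in> carrier C"
    and star: "\<And>x. x \<in> carrier C \<Longrightarrow> star x \<in> carrier C"
    and star_adj: "\<And>x y z. x \<in> carrier C \<Longrightarrow> y \<in> carrier C \<Longrightarrow> z \<in> carrier C \<Longrightarrow>
      b (star x \<otimes>\<^bsub>C\<^esub> y) z = b y (x \<otimes>\<^bsub>C\<^esub> z)"
  shows "semisimple_alg C"
  unfolding semisimple_alg_def
proof (intro allI impI)
  interpret inner_space "carrier C" b by fact
  fix I assume "left_ideal C I"
  then have I: "I \<subseteq> carrier C" "subspace I" "\<And>x y. x \<in> carrier C \<Longrightarrow> y \<in> I \<Longrightarrow> x \<otimes>\<^bsub>C\<^esub> y \<in> I"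
    by (auto simp: left_ideal_def sc subspace_raw_def)
  define J where "J = {y \<in> carrier C. \<forall>x\<in>I. b x y = 0}"
  have "left_ideal C J"
    unfolding left_ideal_def sc subspace_raw_def[symmetric]
  proof (intro conjI ballI)
    show "J \<subseteq> carrier C"
      by (auto simp: J_def)
    show "subspace J"
      using I(1) by (auto simp: subspace_def J_def subset_iff add_r scale_r form_0
          subspace_0[OF sub] subspace_add[OF sub] subspace_scale[OF sub])
    fix x y assume x: "x \<in> carrier C" and y: "y \<in> J"
    have "b z (x \<otimes>\<^bsub>C\<^esub> y) = 0" if "z \<in> I" for z
      using star_adj[of x z y] I(1) I(3)[OF star[OF x] that] that x y by (auto simp: J_def)
    then show "x \<otimes>\<^bsub>C\<^esub> y \<in> J"
      using mult x y by (auto simp: J_def)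
  qed
  moreover have "I \<inter> J = {0}"
  proof -
    have "x = 0" if "x \<in> I" "x \<in> J" for x
      using that pos[of x] by (force simp: J_def)
    then show ?thesis
      using I by (auto simp: J_def subspace_0 sub form_0 subset_iff)
  qed
  moreover have "{x + y |x y. x \<in> I \<and> y \<in> J} = carrier C"
  proof (intro equalityI subsetI)
    fix v assume v: "v \<in> carrier C"
    obtain w where w: "w \<in> I" "\<forall>u\<in>I. b u (v - w) = 0"
      using orth_decomp[OF I(2,1) v] by blast
    then have "v - w \<in> J"
      using v I(1) by (auto simp: J_def intro!: subspace_diff[OF sub])
    moreover have "v = w + (v - w)"
      by simp
    ultimately show "v \<in> {x + y |x y. x \<in> I \<and> y \<in> J}"
      using w(1) by blast
  qed (use I(1) in \<open>auto simp: J_def intro!: subspace_add[OF sub]\<close>)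
  ultimately show "\<exists>J. left_ideal C J \<and> I \<inter> J = {0} \<and> {x + y |x y. x \<in> I \<and> y \<in> J} = carrier C"
    by blast
qed

lemma vector_space_scaleR: "vector_space ((*\<^sub>R) :: real \<Rightarrow> 'a::real_vector \<Rightarrow> 'a)"
  by unfold_locales

lemma center_alg_simps [simp]:
  "carrier (center_alg C) = center C" "mult (center_alg C) = mult C" "one (center_alg C) = one C"
  "scale (center_alg C) = scale C"
  by (simp_all add: center_alg_def)

lemma center_fin_dim_algebra:
  fixes C :: "(real, 'a::real_vector) alg"
  assumes "fin_dim_algebra C" and sc: "scale C = (*\<^sub>R)"
  shows "fin_dim_algebra (center_alg C)"
proof -
  interpret fin_dim_algebra C by fact
  have fd: "findim (carrier C)"
    using fin_dim by (simp add: sc)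
  note sub = findim_subspace[OF fd]
  have ZC: "x \<in> carrier C" if "x \<in> center C" for x
    using that by (simp add: center_def)
  have zero: "0 \<otimes>\<^bsub>C\<^esub> y = 0" "y \<otimes>\<^bsub>C\<^esub> 0 = 0" if "y \<in> carrier C" for y
    using scale_mult_left[of 0 y 0] scale_mult_right[of y 0 0] that subspace_0[OF sub] by (auto simp: sc)
  have "subspace (center C)"
    unfolding subspace_def center_def
    using distrib_left distrib_right scale_mult_left scale_mult_right zero
    by (auto simp: sc subspace_0[OF sub] subspace_add[OF sub] subspace_scale[OF sub])
  then have fd': "findim (center C)"
    by (rule findim_subset[OF fd]) (auto simp: ZC)
  show ?thesis
  proof (intro fin_dim_algebra.intro fin_dim_algebra_axioms.intro monoid.intro, unfold center_alg_simps)
    fix x y assume xy: "x \<in> center C" "y \<in> center C"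
    then have c: "x \<in> carrier C" "y \<in> carrier C"
      "w \<in> carrier C \<Longrightarrow> x \<otimes>\<^bsub>C\<^esub> w = w \<otimes>\<^bsub>C\<^esub> x" "w \<in> carrier C \<Longrightarrow> y \<otimes>\<^bsub>C\<^esub> w = w \<otimes>\<^bsub>C\<^esub> y" for w
      by (auto simp: center_def)
    have "x \<otimes>\<^bsub>C\<^esub> y \<otimes>\<^bsub>C\<^esub> z = z \<otimes>\<^bsub>C\<^esub> (x \<otimes>\<^bsub>C\<^esub> y)" if z: "z \<in> carrier C" for z
      using m_assoc[OF c(1,2) z] m_assoc[OF c(1) z c(2)] m_assoc[OF z c(1,2)] c(3)[OF z] c(4)[OF z]
      by simp
    then show "x \<otimes>\<^bsub>C\<^esub> y \<in> center C"
      unfolding center_def using m_closed[OF c(1,2)] by blast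
  next
    show "fin_dim_on (scale C) (center C)"
      using fd' by (simp add: sc)
    show "\<one>\<^bsub>C\<^esub> \<in> center C"
      by (simp add: center_def)
    show "vector_space (scale C)"
      by (fact vector_space_scale)
  qed (auto simp: ZC m_assoc distrib_left distrib_right scale_mult_left scale_mult_right)
qed

lemma sum_fun_apply: "(\<Sum>i\<in>I. f i) x = (\<Sum>i\<in>I. f i x)"
  by (induction I rule: infinite_finite_induct) auto

section \<open>The group algebra\<close>

locale fin_group = group G for G (structure) +
  assumes fin: "finite (carrier G)"
begin

abbreviation RG :: "('a \<Rightarrow> real) set" where
  "RG \<equiv> carrier (group_alg G)"

abbreviation conv :: "('a \<Rightarrow> real) \<Rightarrow> ('a \<Rightarrow> real) \<Rightarrow> 'a \<Rightarrow> real" (infixl "\<star>" 70) where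
  "x \<star> y \<equiv> x \<otimes>\<^bsub>group_alg G\<^esub> y"

abbreviation N :: real where
  "N \<equiv> real (card (carrier G))"

definition flip :: "('a \<Rightarrow> real) \<Rightarrow> 'a \<Rightarrow> real" where
  "flip x = extend_zero (carrier G) (\<lambda>g. x (inv g))"

lemma N_pos: "N > 0"
  using fin one_closed by (simp add: card_gt_0_iff) blast

lemma sum_shift_left: "h \<in> carrier G \<Longrightarrow> (\<Sum>g\<in>carrier G. f (h \<otimes> g)) = (\<Sum>g\<in>carrier G. f g)"
  by (rule sum.reindex_bij_witness[of _ "\<lambda>g. inv h \<otimes> g" "\<lambda>g. h \<otimes> g"])
    (auto simp: m_assoc[symmetric])

lemma sum_shift_right: "h \<in> carrier G \<Longrightarrow> (\<Sum>g\<in>carrier G. f (g \<otimes> h)) = (\<Sum>g\<in>carrier G. f g)"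
  by (rule sum.reindex_bij_witness[of _ "\<lambda>g. g \<otimes> inv h" "\<lambda>g. g \<otimes> h"])
    (auto simp: m_assoc)

lemma sum_inv: "(\<Sum>g\<in>carrier G. f (inv g)) = (\<Sum>g\<in>carrier G. f g)"
  by (rule sum.reindex_bij_witness[of _ "\<lambda>g. inv g" "\<lambda>g. inv g"]) auto

lemma RG_iff: "x \<in> RG \<longleftrightarrow> (\<forall>g. g \<notin> carrier G \<longrightarrow> x g = 0)"
  by (simp add: group_alg_def)

lemma RG_eqI: "x \<in> RG \<Longrightarrow> y \<in> RG \<Longrightarrow> (\<And>g. g \<in> carrier G \<Longrightarrow> x g = y g) \<Longrightarrow> x = y"
  by (rule ext) (metis RG_iff)

lemma conv_apply: "g \<in> carrier G \<Longrightarrow> (x \<star> y) g = (\<Sum>h\<in>carrier G. x h * y (inv h \<otimes> g))"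
  by (simp add: group_alg_def)

lemma conv_closed [simp]: "x \<star> y \<in> RG"
  by (simp add: RG_iff) (simp add: group_alg_def)

lemma scale_group_alg [simp]: "scale (group_alg G) = (*\<^sub>R)"
  by (simp add: group_alg_def)

lemma one_group_alg: "\<one>\<^bsub>group_alg G\<^esub> = group_elem \<one>"
  by (simp add: group_alg_def group_elem_def)

lemma group_elem_RG [simp]: "g \<in> carrier G \<Longrightarrow> group_elem g \<in> RG"
  by (auto simp: RG_iff group_elem_def)

text \<open>Pairing with a test function \<open>F\<close> turns a convolution into a double sum over
  \<open>F (h \<otimes> k)\<close>, free of inverses. Associativity, the behaviour under
  \<open>flip\<close> and the action on representations are all read off from this form.\<close>

lemma sum_conv:
  fixes F :: "'a \<Rightarrow> 'c::real_vector"
  shows "(\<Sum>g\<in>carrier G. (x \<star> y) g *\<^sub>R F g) =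
    (\<Sum>h\<in>carrier G. x h *\<^sub>R (\<Sum>k\<in>carrier G. y k *\<^sub>R F (h \<otimes> k)))"
proof -
  have "(\<Sum>g\<in>carrier G. (x \<star> y) g *\<^sub>R F g) =
      (\<Sum>g\<in>carrier G. \<Sum>h\<in>carrier G. x h *\<^sub>R y (inv h \<otimes> g) *\<^sub>R F g)"
    by (intro sum.cong) (auto simp: conv_apply scaleR_sum_left)
  also have "\<dots> = (\<Sum>h\<in>carrier G. \<Sum>g\<in>carrier G. x h *\<^sub>R y (inv h \<otimes> g) *\<^sub>R F g)"
    by (rule sum.swap)
  also have "\<dots> = (\<Sum>h\<in>carrier G. \<Sum>k\<in>carrier G. x h *\<^sub>R y k *\<^sub>R F (h \<otimes> k))"
  proof (rule sum.cong[OF refl])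
    fix h assume h: "h \<in> carrier G"
    have "(\<Sum>g\<in>carrier G. x h *\<^sub>R y (inv h \<otimes> g) *\<^sub>R F g) =
        (\<Sum>k\<in>carrier G. x h *\<^sub>R y (inv h \<otimes> (h \<otimes> k)) *\<^sub>R F (h \<otimes> k))"
      by (rule sum_shift_left[OF h, symmetric])
    then show "(\<Sum>g\<in>carrier G. x h *\<^sub>R y (inv h \<otimes> g) *\<^sub>R F g) =
        (\<Sum>k\<in>carrier G. x h *\<^sub>R y k *\<^sub>R F (h \<otimes> k))"
      using h by (simp add: m_assoc[symmetric] cong: sum.cong)
  qed
  finally show ?thesis
    by (simp add: scaleR_sum_right)
qed

lemma RG_delta: "x \<in> RG \<Longrightarrow> g \<in> carrier G \<Longrightarrow> x g = (\<Sum>k\<in>carrier G. x k *\<^sub>R (if k = g then 1 else 0))"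
  using fin by (simp add: if_distrib[of "\<lambda>t. _ * t"] cong: if_cong)

lemma sum_group_elem:
  fixes F :: "'a \<Rightarrow> 'c::real_vector"
  shows "g \<in> carrier G \<Longrightarrow> (\<Sum>k\<in>carrier G. group_elem g k *\<^sub>R F k) = F g"
  using fin by (simp add: group_elem_def if_distrib[of "\<lambda>t. t *\<^sub>R _"] cong: if_cong)

lemma RG_eq_testI:
  assumes "x \<in> RG" "y \<in> RG"
    "\<And>F :: 'a \<Rightarrow> real. (\<Sum>k\<in>carrier G. x k *\<^sub>R F k) = (\<Sum>k\<in>carrier G. y k *\<^sub>R F k)"
  shows "x = y"
  using assms RG_delta[of x] RG_delta[of y] by (intro RG_eqI) auto

lemma conv_assoc: "(x \<star> y) \<star> z = x \<star> (y \<star> z)"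
proof (rule RG_eq_testI)
  fix F :: "'a \<Rightarrow> real"
  have "(\<Sum>k\<in>carrier G. ((x \<star> y) \<star> z) k *\<^sub>R F k) =
    (\<Sum>h\<in>carrier G. x h *\<^sub>R (\<Sum>k\<in>carrier G. y k *\<^sub>R (\<Sum>m\<in>carrier G. z m *\<^sub>R F (h \<otimes> k \<otimes> m))))"
    by (simp only: sum_conv)
  also have "\<dots> =
    (\<Sum>h\<in>carrier G. x h *\<^sub>R (\<Sum>k\<in>carrier G. y k *\<^sub>R (\<Sum>m\<in>carrier G. z m *\<^sub>R F (h \<otimes> (k \<otimes> m)))))"
    by (intro sum.cong arg_cong2[of _ _ _ _ "(*\<^sub>R)"] refl) (simp add: m_assoc)
  finally show "(\<Sum>k\<in>carrier G. ((x \<star> y) \<star> z) k *\<^sub>R F k) = (\<Sum>k\<in>carrier G. (x \<star> (y \<star> z)) k *\<^sub>R F k)"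
    by (simp only: sum_conv)
qed simp_all

lemma conv_elem_left: "h \<in> carrier G \<Longrightarrow> g \<in> carrier G \<Longrightarrow> (group_elem h \<star> x) g = x (inv h \<otimes> g)"
  using sum_group_elem[of h "\<lambda>k. x (inv k \<otimes> g)"] by (simp add: conv_apply)

lemma conv_elem_right:
  assumes "h \<in> carrier G" "g \<in> carrier G"
  shows "(x \<star> group_elem h) g = x (g \<otimes> inv h)"
proof -
  have "(x \<star> group_elem h) g = (\<Sum>k\<in>carrier G. group_elem (g \<otimes> inv h) k *\<^sub>R x k)"
    unfolding conv_apply[OF assms(2)]
  proof (intro sum.cong refl)
    fix k assume k: "k \<in> carrier G"
    have "inv k \<otimes> g = h \<longleftrightarrow> k = g \<otimes> inv h"
      using assms k by (metis inv_closed inv_solve_left inv_solve_right m_closed)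
    then show "x k * group_elem h (inv k \<otimes> g) = group_elem (g \<otimes> inv h) k *\<^sub>R x k"
      by (simp add: group_elem_def)
  qed
  then show ?thesis
    using sum_group_elem[of "g \<otimes> inv h" x] assms by simp
qed

lemma frame_RG: "frame RG (carrier G) group_elem (\<lambda>g x. x g)"
proof -
  have "(\<Sum>i\<in>carrier G. x i *\<^sub>R group_elem i) = x" if "x \<in> RG" for x
  proof (rule ext)
    fix g
    have "(\<Sum>i\<in>carrier G. x i * group_elem i g) = x g"
      using fin that by (auto simp: group_elem_def RG_iff if_distrib[of "\<lambda>t. _ * t"] cong: if_cong)
    then show "(\<Sum>i\<in>carrier G. x i *\<^sub>R group_elem i) g = x g"
      by (simp add: sum_fun_apply)
  qed
  then show ?thesis
    using fin by (auto simp: frame_def intro!: linI)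
qed

lemma subspace_RG: "subspace RG"
  by (auto simp: subspace_def RG_iff)

lemma group_alg_fin_dim: "fin_dim_algebra (group_alg G)"
proof (intro fin_dim_algebra.intro fin_dim_algebra_axioms.intro monoid.intro)
  show "fin_dim_on (scale (group_alg G)) RG"
    using findim_frame[OF frame_RG subspace_RG] by simp
  show "vector_space (scale (group_alg G))"
    by (simp add: vector_space_scaleR)
  show "x \<star> (y + z) = x \<star> y + x \<star> z" "(x + y) \<star> z = x \<star> z + y \<star> z" for x y z
    by (auto simp: group_alg_def fun_eq_iff algebra_simps sum.distrib)
  show "scale (group_alg G) c x \<star> y = scale (group_alg G) c (x \<star> y)"
    "x \<star> scale (group_alg G) c y = scale (group_alg G) c (x \<star> y)" for x y c
    by (auto simp: group_alg_def fun_eq_iff algebra_simps sum_distrib_left)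
  show "\<one>\<^bsub>group_alg G\<^esub> \<star> x = x" "x \<star> \<one>\<^bsub>group_alg G\<^esub> = x" if "x \<in> RG" for x
    using that by (auto simp: one_group_alg conv_elem_left conv_elem_right intro!: RG_eqI)
qed (auto simp: conv_assoc one_group_alg)

section \<open>Class functions as the centre of the group algebra\<close>

definition cf :: "('a \<Rightarrow> real) set" where
  "cf = {x \<in> RG. \<forall>g\<in>carrier G. \<forall>h\<in>carrier G. x (h \<otimes> g \<otimes> inv h) = x g}"

lemma cfD: "x \<in> cf \<Longrightarrow> x \<in> RG" "x \<in> cf \<Longrightarrow> g \<in> carrier G \<Longrightarrow> h \<in> carrier G \<Longrightarrow> x (h \<otimes> g \<otimes> inv h) = x g"
  by (auto simp: cf_def)

lemma cf_conv_commute: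
  assumes "x \<in> cf"
  shows "x \<star> y = y \<star> x"
proof (rule RG_eqI)
  fix g assume g: "g \<in> carrier G"
  have *: "y (inv (g \<otimes> inv h) \<otimes> g) * x (g \<otimes> inv h) = y h * x (inv h \<otimes> g)" if "h \<in> carrier G" for h
  proof -
    have "h \<otimes> (inv h \<otimes> g) \<otimes> inv h = g \<otimes> inv h"
      using g that by (simp add: m_assoc[symmetric])
    then have "x (g \<otimes> inv h) = x (inv h \<otimes> g)"
      using cfD(2)[OF assms, of "inv h \<otimes> g" h] g that by simp
    moreover have "inv (g \<otimes> inv h) \<otimes> g = h"
      using g that by (simp add: inv_mult_group m_assoc)
    ultimately show ?thesis
      by simp
  qed
  have "(x \<star> y) g = (\<Sum>h\<in>carrier G. y (inv h \<otimes> g) * x h)"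
    using g by (simp add: conv_apply mult.commute)
  \<comment> \<open>Replacing \<open>h\<close> by \<open>g \<otimes> inv h\<close>, done as a shift
    followed by an inversion, exchanges the two factors.\<close>
  also have "\<dots> = (\<Sum>h\<in>carrier G. y (inv (g \<otimes> h) \<otimes> g) * x (g \<otimes> h))"
    by (rule sum_shift_left[OF g, symmetric])
  also have "\<dots> = (\<Sum>h\<in>carrier G. y (inv (g \<otimes> inv h) \<otimes> g) * x (g \<otimes> inv h))"
    by (rule sum_inv[symmetric])
  also have "\<dots> = (y \<star> x) g"
    using g * by (simp add: conv_apply)
  finally show "(x \<star> y) g = (y \<star> x) g" .
qed simp_all

lemma center_group_alg: "center (group_alg G) = cf"
proof (intro equalityI subsetI)
  fix x assume x: "x \<in> center (group_alg G)"
  have "x (h \<otimes> g \<otimes> inv h) = x g" if gh: "g \<in> carrier G" "h \<in> carrier G" for g h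
  proof -
    have "(x \<star> group_elem h) (h \<otimes> g) = (group_elem h \<star> x) (h \<otimes> g)"
      using x gh by (simp add: center_def)
    then show ?thesis
      using gh by (simp add: conv_elem_left conv_elem_right m_assoc[symmetric])
  qed
  then show "x \<in> cf"
    using x by (simp add: cf_def center_def)
qed (auto simp: center_def cfD intro: cf_conv_commute)

abbreviation ZG :: "(real, 'a \<Rightarrow> real) alg" where
  "ZG \<equiv> center_alg (group_alg G)"

lemma ZG_fin_dim: "fin_dim_algebra ZG"
  by (rule center_fin_dim_algebra[OF group_alg_fin_dim]) simp

lemma carrier_ZG: "carrier ZG = cf"
  by (simp add: center_group_alg)

lemma ZG_comm_monoid: "comm_monoid ZG"
proof -
  interpret fin_dim_algebra ZG
    by (rule ZG_fin_dim)
  show ?thesis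
    by unfold_locales (simp add: center_group_alg cf_conv_commute)
qed

lemma conv_at_one: "(x \<star> y) \<one> = (\<Sum>h\<in>carrier G. x h * y (inv h))"
  by (simp add: conv_apply)

lemma flip_RG [simp]: "flip x \<in> RG"
  by (simp add: RG_iff flip_def extend_zero_def)

lemma flip_apply: "g \<in> carrier G \<Longrightarrow> flip x g = x (inv g)"
  by (simp add: flip_def extend_zero_def)

lemma flip_flip: "x \<in> RG \<Longrightarrow> flip (flip x) = x"
  by (rule RG_eqI) (auto simp: flip_apply)

lemma sum_flip:
  fixes F :: "'a \<Rightarrow> 'c::real_vector"
  shows "(\<Sum>g\<in>carrier G. flip x g *\<^sub>R F g) = (\<Sum>g\<in>carrier G. x g *\<^sub>R F (inv g))"
proof -
  have "(\<Sum>g\<in>carrier G. flip x g *\<^sub>R F g) = (\<Sum>g\<in>carrier G. flip x (inv g) *\<^sub>R F (inv g))"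
    by (rule sum_inv[symmetric])
  then show ?thesis
    by (simp add: flip_apply cong: sum.cong)
qed

lemma flip_conv: "flip (x \<star> y) = flip y \<star> flip x"
proof (rule RG_eq_testI)
  fix F :: "'a \<Rightarrow> real"
  have "(\<Sum>k\<in>carrier G. flip (x \<star> y) k *\<^sub>R F k) =
    (\<Sum>h\<in>carrier G. \<Sum>k\<in>carrier G. x h *\<^sub>R y k *\<^sub>R F (inv (h \<otimes> k)))"
    by (simp only: sum_flip sum_conv) (simp only: scaleR_sum_right)
  also have "\<dots> = (\<Sum>k\<in>carrier G. \<Sum>h\<in>carrier G. x h *\<^sub>R y k *\<^sub>R F (inv (h \<otimes> k)))"
    by (rule sum.swap)
  also have "\<dots> = (\<Sum>k\<in>carrier G. \<Sum>h\<in>carrier G. y k *\<^sub>R x h *\<^sub>R F (inv k \<otimes> inv h))"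
    by (intro sum.cong refl) (simp add: inv_mult_group mult.left_commute)
  finally show "(\<Sum>k\<in>carrier G. flip (x \<star> y) k *\<^sub>R F k) = (\<Sum>k\<in>carrier G. (flip y \<star> flip x) k *\<^sub>R F k)"
    by (simp only: sum_flip sum_conv) (simp only: scaleR_sum_right)
qed simp_all

lemma flip_cf: "x \<in> cf \<Longrightarrow> flip x \<in> cf"
  by (auto simp: cf_def flip_apply inv_mult_group m_assoc[symmetric] simp del: flip_RG intro: flip_RG)

lemma lin_flip: "lin cf cf flip"
  by (rule linI) (simp_all add: flip_cf, simp_all add: flip_def extend_zero_def fun_eq_iff)

lemma subspace_cf: "subspace cf"
  using fin_dim_algebra.fin_dim[OF ZG_fin_dim] findim_subspace by (simp add: center_group_alg)

lemma findim_cf: "findim cf"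
  using fin_dim_algebra.fin_dim[OF ZG_fin_dim] by (simp add: center_group_alg)

text \<open>The projection of the group algebra onto its centre; it serves as the retraction when
  traces on the centre are computed.\<close>

definition conj_avg :: "('a \<Rightarrow> real) \<Rightarrow> 'a \<Rightarrow> real" where
  "conj_avg x = extend_zero (carrier G) (\<lambda>g. (\<Sum>k\<in>carrier G. x (inv k \<otimes> g \<otimes> k)) / N)"

lemma conj_avg_cf: "conj_avg x \<in> cf"
proof -
  have "(\<Sum>k\<in>carrier G. x (inv k \<otimes> (h \<otimes> g \<otimes> inv h) \<otimes> k)) = (\<Sum>k\<in>carrier G. x (inv k \<otimes> g \<otimes> k))"
    if "g \<in> carrier G" "h \<in> carrier G" for g h
  proof -
    have "(\<Sum>k\<in>carrier G. x (inv k \<otimes> (h \<otimes> g \<otimes> inv h) \<otimes> k)) =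
        (\<Sum>k\<in>carrier G. x (inv (h \<otimes> k) \<otimes> (h \<otimes> g \<otimes> inv h) \<otimes> (h \<otimes> k)))"
      by (rule sum_shift_left[OF that(2), symmetric])
    also have "\<dots> = (\<Sum>k\<in>carrier G. x (inv k \<otimes> g \<otimes> k))"
    proof (intro sum.cong refl arg_cong[of _ _ x])
      fix k assume "k \<in> carrier G"
      then show "inv (h \<otimes> k) \<otimes> (h \<otimes> g \<otimes> inv h) \<otimes> (h \<otimes> k) = inv k \<otimes> g \<otimes> k"
        using that by (simp add: inv_mult_group m_assoc inv_solve_left) (simp add: m_assoc[symmetric])
    qed
    finally show ?thesis .
  qed
  then show ?thesis
    by (auto simp: cf_def RG_iff conj_avg_def extend_zero_def)
qed

lemma lin_conj_avg: "lin RG cf conj_avg"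
  by (rule linI) (auto simp: conj_avg_cf, auto simp: conj_avg_def extend_zero_def fun_eq_iff
      sum.distrib sum_distrib_left[symmetric] add_divide_distrib)

lemma conj_avg_id: "x \<in> cf \<Longrightarrow> conj_avg x = x"
proof (rule RG_eqI)
  fix g assume x: "x \<in> cf" and g: "g \<in> carrier G"
  have "x (inv k \<otimes> g \<otimes> k) = x g" if "k \<in> carrier G" for k
    using cfD(2)[OF x g, of "inv k"] that by simp
  then show "conj_avg x g = x g"
    using g N_pos by (simp add: conj_avg_def extend_zero_def)
qed (auto simp: cfD conj_avg_cf[THEN cfD(1)])

section \<open>The sum of all squares\<close>

definition squares :: "'a \<Rightarrow> real" where
  "squares = (\<Sum>g\<in>carrier G. group_elem (g \<otimes> g))"

lemma squares_RG: "squares \<in> RG"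
  unfolding squares_def by (rule subspace_sum[OF subspace_RG]) auto

lemma sum_squares:
  fixes F :: "'a \<Rightarrow> 'c::real_vector"
  shows "(\<Sum>k\<in>carrier G. squares k *\<^sub>R F k) = (\<Sum>g\<in>carrier G. F (g \<otimes> g))"
proof -
  have "(\<Sum>k\<in>carrier G. squares k *\<^sub>R F k) =
      (\<Sum>k\<in>carrier G. \<Sum>g\<in>carrier G. group_elem (g \<otimes> g) k *\<^sub>R F k)"
    by (simp add: squares_def sum_fun_apply scaleR_sum_left)
  also have "\<dots> = (\<Sum>g\<in>carrier G. \<Sum>k\<in>carrier G. group_elem (g \<otimes> g) k *\<^sub>R F k)"
    by (rule sum.swap)
  finally show ?thesis
    by (simp add: sum_group_elem cong: sum.cong)
qed

text \<open>Conjugation permutes \<open>G\<close> and carries the square of \<open>k\<close> to the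
  square of the conjugate of \<open>k\<close>. The conjugation of the summation variable is done as
  a right shift and then a left shift.\<close>

lemma squares_cf: "squares \<in> cf"
proof -
  have "squares (h \<otimes> g \<otimes> inv h) = squares g" if "g \<in> carrier G" "h \<in> carrier G" for g h
  proof -
    have eq: "group_elem (k \<otimes> k) (h \<otimes> g \<otimes> inv h) =
        group_elem ((inv h \<otimes> k \<otimes> h) \<otimes> (inv h \<otimes> k \<otimes> h)) g" if "k \<in> carrier G" for k
    proof -
      have "k \<otimes> k = h \<otimes> g \<otimes> inv h \<longleftrightarrow> h \<otimes> g = k \<otimes> k \<otimes> h"
        using \<open>g \<in> carrier G\<close> \<open>h \<in> carrier G\<close> that by (intro inv_solve_right) auto
      moreover have "g = inv h \<otimes> (k \<otimes> k \<otimes> h) \<longleftrightarrow> k \<otimes> k \<otimes> h = h \<otimes> g"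
        using \<open>g \<in> carrier G\<close> \<open>h \<in> carrier G\<close> that by (intro inv_solve_left) auto
      ultimately have "h \<otimes> g \<otimes> inv h = k \<otimes> k \<longleftrightarrow> g = inv h \<otimes> (k \<otimes> k) \<otimes> h"
        using \<open>h \<in> carrier G\<close> that by (auto simp: m_assoc)
      also have "inv h \<otimes> (k \<otimes> k) \<otimes> h = (inv h \<otimes> k \<otimes> h) \<otimes> (inv h \<otimes> k \<otimes> h)"
        using \<open>h \<in> carrier G\<close> that by (simp add: m_assoc inv_solve_left) (simp add: m_assoc[symmetric])
      finally show ?thesis
        by (simp add: group_elem_def)
    qed
    have "squares (h \<otimes> g \<otimes> inv h) = (\<Sum>k\<in>carrier G. group_elem (k \<otimes> k) (h \<otimes> g \<otimes> inv h))"
      by (simp add: squares_def sum_fun_apply)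
    also have "\<dots> = (\<Sum>k\<in>carrier G. group_elem ((inv h \<otimes> k \<otimes> h) \<otimes> (inv h \<otimes> k \<otimes> h)) g)"
      using eq by simp
    also have "\<dots> = (\<Sum>k\<in>carrier G. group_elem ((inv h \<otimes> k) \<otimes> (inv h \<otimes> k)) g)"
      using sum_shift_right[of h "\<lambda>k. group_elem ((inv h \<otimes> k) \<otimes> (inv h \<otimes> k)) g"] that
      by (simp add: m_assoc cong: sum.cong)
    also have "\<dots> = squares g"
      using sum_shift_left[of "inv h" "\<lambda>k. group_elem (k \<otimes> k) g"] that by (simp add: squares_def sum_fun_apply)
    finally show ?thesis .
  qed
  then show ?thesis
    using squares_RG by (simp add: cf_def)
qed

text \<open>The substitution \<open>g = k b\<close> turns \<open>k g k\<inverse> g\<close> into \<open>k\<^sup>2 b\<^sup>2\<close>.\<close>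

lemma klein_bottle:
  "(\<Sum>k\<in>carrier G. \<Sum>g\<in>carrier G. c (k \<otimes> g \<otimes> inv k \<otimes> g)) =
    (\<Sum>k\<in>carrier G. \<Sum>g\<in>carrier G. c ((k \<otimes> k) \<otimes> (g \<otimes> g)))"
proof (rule sum.cong[OF refl])
  fix k assume k: "k \<in> carrier G"
  have eq: "k \<otimes> (k \<otimes> g) \<otimes> inv k \<otimes> (k \<otimes> g) = (k \<otimes> k) \<otimes> (g \<otimes> g)" if g: "g \<in> carrier G" for g
  proof -
    have "k \<otimes> (k \<otimes> g) \<otimes> inv k \<otimes> (k \<otimes> g) = k \<otimes> (k \<otimes> g) \<otimes> (inv k \<otimes> k) \<otimes> g"
      using k g by (simp only: m_assoc m_closed inv_closed)
    then show ?thesis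
      using k g by (simp add: m_assoc)
  qed
  have "(\<Sum>g\<in>carrier G. c (k \<otimes> g \<otimes> inv k \<otimes> g)) =
      (\<Sum>g\<in>carrier G. c (k \<otimes> (k \<otimes> g) \<otimes> inv k \<otimes> (k \<otimes> g)))"
    by (rule sum_shift_left[OF k, symmetric])
  then show "(\<Sum>g\<in>carrier G. c (k \<otimes> g \<otimes> inv k \<otimes> g)) = (\<Sum>g\<in>carrier G. c ((k \<otimes> k) \<otimes> (g \<otimes> g)))"
    using eq by simp
qed

lemma inner_space_cf: "inner_space cf (\<lambda>x y. \<Sum>g\<in>carrier G. x g * y g)"
proof
  fix x assume x: "x \<in> cf" "x \<noteq> 0"
  then obtain g where "g \<in> carrier G" "x g \<noteq> 0"
    using cfD(1)[OF x(1)] by (auto simp: RG_iff fun_eq_iff)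
  then show "(\<Sum>g\<in>carrier G. x g * x g) > 0"
    using fin by (intro sum_pos2[of _ g]) (auto simp: zero_less_mult_iff)
qed (auto intro!: linI simp: findim_cf sum.distrib algebra_simps sum_distrib_left)

lemma semisimple_ZG: "semisimple_alg ZG"
proof (rule semisimple_algI[where star = flip])
  interpret comm_monoid ZG
    by (rule ZG_comm_monoid)
  show "inner_space (carrier ZG) (\<lambda>x y. \<Sum>g\<in>carrier G. x g * y g)"
    unfolding carrier_ZG by (rule inner_space_cf)
  show "flip x \<in> carrier ZG" if "x \<in> carrier ZG" for x
    using that flip_cf by (simp add: center_group_alg)
  \<comment> \<open>The standard inner product is the unit coefficient of
    \<open>flip x \<star> y\<close>, which makes multiplication by \<open>flip x\<close> adjoint to
    multiplication by \<open>x\<close>.\<close>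
  have ip: "(\<Sum>g\<in>carrier G. x g * y g) = (flip x \<star> y) \<one>" for x y :: "'a \<Rightarrow> real"
    using sum_flip[of x "\<lambda>g. y (inv g)"] by (simp add: conv_at_one)
  fix x y z assume "x \<in> carrier ZG" "y \<in> carrier ZG" "z \<in> carrier ZG"
  then have "x \<in> RG" "y \<in> RG" "z \<in> RG"
    by (auto simp: center_group_alg cfD)
  then show "(\<Sum>g\<in>carrier G. (flip x \<otimes>\<^bsub>ZG\<^esub> y) g * z g) = (\<Sum>g\<in>carrier G. y g * (x \<otimes>\<^bsub>ZG\<^esub> z) g)"
    by (simp add: ip flip_conv flip_flip conv_assoc)
  show "x \<otimes>\<^bsub>ZG\<^esub> y \<in> carrier ZG"
    using \<open>x \<in> carrier ZG\<close> \<open>y \<in> carrier ZG\<close> by (rule m_closed)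
qed simp

end

section \<open>Representations of a finite group\<close>

lemma (in fin_group) conv_cf: "x \<in> cf \<Longrightarrow> y \<in> cf \<Longrightarrow> x \<star> y \<in> cf"
proof -
  interpret comm_monoid ZG
    by (rule ZG_comm_monoid)
  show "x \<in> cf \<Longrightarrow> y \<in> cf \<Longrightarrow> x \<star> y \<in> cf"
    using m_closed[of x y] by (simp add: center_group_alg)
qed

lemma (in fin_group) one_cf: "group_elem \<one> \<in> cf"
proof -
  interpret comm_monoid ZG
    by (rule ZG_comm_monoid)
  show ?thesis
    using one_closed by (simp add: center_group_alg one_group_alg)
qed

lemma (in fin_group) conv_one: "x \<in> RG \<Longrightarrow> group_elem \<one> \<star> x = x" "x \<in> RG \<Longrightarrow> x \<star> group_elem \<one> = x"
  by (auto simp: conv_elem_left conv_elem_right intro!: RG_eqI)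

section \<open>Intertwiners, the commutant and averaging\<close>

definition intertwiner ::
  "('g, 'm) monoid_scheme \<Rightarrow> ('g, 'v::real_vector) rep \<Rightarrow> ('g, 'w::real_vector) rep \<Rightarrow> ('v \<Rightarrow> 'w) \<Rightarrow> bool" where
  "intertwiner G \<rho> \<sigma> f \<longleftrightarrow> lin (rep_space \<rho>) (rep_space \<sigma>) f \<and>
     (\<forall>g\<in>carrier G. \<forall>v\<in>rep_space \<rho>. f (rep_act \<rho> g v) = rep_act \<sigma> g (f v))"

lemma intertwinerD:
  assumes "intertwiner G \<rho> \<sigma> f"
  shows "lin (rep_space \<rho>) (rep_space \<sigma>) f"
    "g \<in> carrier G \<Longrightarrow> v \<in> rep_space \<rho> \<Longrightarrow> f (rep_act \<rho> g v) = rep_act \<sigma> g (f v)"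
  using assms by (auto simp: intertwiner_def)

lemma intertwiner_comp:
  "intertwiner G \<rho> \<sigma> f \<Longrightarrow> intertwiner G \<sigma> \<tau> h \<Longrightarrow> intertwiner G \<rho> \<tau> (\<lambda>v. h (f v))"
  using lin_comp lin_mem by (fastforce simp: intertwiner_def)

locale fin_rep = fin_group G + real_rep G \<rho>
  for G :: "('g, 'm) monoid_scheme" (structure) and \<rho> :: "('g, 'v::real_vector) rep"
begin

abbreviation V :: "'v set" where
  "V \<equiv> rep_space \<rho>"

abbreviation r :: "'g \<Rightarrow> 'v \<Rightarrow> 'v" where
  "r \<equiv> rep_act \<rho>"

abbreviation act :: "('g \<Rightarrow> real) \<Rightarrow> 'v \<Rightarrow> 'v" where
  "act \<equiv> group_alg_act G \<rho>"

abbreviation E :: "('v \<Rightarrow> 'v) set" where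
  "E \<equiv> carrier (End_alg G \<rho>)"

lemma fdV: "findim V"
  by (rule space_fin_dim)

lemma subV: "subspace V"
  by (rule findim_subspace[OF fdV])

lemma r_mem: "g \<in> carrier G \<Longrightarrow> v \<in> V \<Longrightarrow> r g v \<in> V"
  by (rule lin_mem[OF act_linear])

lemma r_inv: "g \<in> carrier G \<Longrightarrow> v \<in> V \<Longrightarrow> r (inv g) (r g v) = v"
  "g \<in> carrier G \<Longrightarrow> v \<in> V \<Longrightarrow> r g (r (inv g) v) = v"
  using act_mult[of "inv g" g v] act_mult[of g "inv g" v] by (auto simp: act_one)

lemma lin_act: "lin V V (act x)"
  unfolding group_alg_act_def by (intro lin_sum_fun lin_scale_fun act_linear subV)

lemma act_mem: "v \<in> V \<Longrightarrow> act x v \<in> V"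
  by (rule lin_mem[OF lin_act])

lemma act_conv: "v \<in> V \<Longrightarrow> act (x \<star> y) v = act x (act y v)"
proof -
  assume v: "v \<in> V"
  have "act (x \<star> y) v = (\<Sum>h\<in>carrier G. x h *\<^sub>R (\<Sum>k\<in>carrier G. y k *\<^sub>R r (h \<otimes> k) v))"
    unfolding group_alg_act_def by (rule sum_conv)
  also have "\<dots> = (\<Sum>h\<in>carrier G. x h *\<^sub>R r h (\<Sum>k\<in>carrier G. y k *\<^sub>R r k v))"
    using v by (intro sum.cong arg_cong2[of _ _ _ _ "(*\<^sub>R)"] refl)
      (simp add: lin_combination[OF act_linear subV] r_mem act_mult)
  finally show ?thesis
    by (simp add: group_alg_act_def)
qed

lemma act_elem: "g \<in> carrier G \<Longrightarrow> act (group_elem g) v = r g v"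
  unfolding group_alg_act_def by (rule sum_group_elem)

lemma act_group_one: "v \<in> V \<Longrightarrow> act (group_elem \<one>) v = v"
  by (simp add: act_elem act_one)

lemma act_cf_commute:
  assumes "x \<in> cf" "g \<in> carrier G" "v \<in> V"
  shows "act x (r g v) = r g (act x v)"
  using cf_conv_commute[OF assms(1), of "group_elem g"] act_conv[OF assms(3), of x "group_elem g"]
    act_conv[OF assms(3), of "group_elem g" x] assms by (simp add: act_elem)

lemma act_add: "act (x + y) v = act x v + act y v"
  and act_scale: "act (c *\<^sub>R x) v = c *\<^sub>R act x v"
  by (simp_all add: group_alg_act_def scaleR_add_left sum.distrib scaleR_sum_right)

lemma act_squares: "v \<in> V \<Longrightarrow> act squares v = (\<Sum>g\<in>carrier G. r (g \<otimes> g) v)"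
  unfolding group_alg_act_def by (rule sum_squares)

lemma E_iff: "x \<in> E \<longleftrightarrow> x \<in> End_set V \<and> (\<forall>g\<in>carrier G. \<forall>v\<in>V. x (r g v) = r g (x v))"
  by (simp add: End_alg_def)

lemma ED:
  assumes "x \<in> E"
  shows "x \<in> End_set V" "lin V V x" "v \<in> V \<Longrightarrow> x v \<in> V"
    "g \<in> carrier G \<Longrightarrow> v \<in> V \<Longrightarrow> x (r g v) = r g (x v)" "intertwiner G \<rho> \<rho> x"
  using assms End_setD(1)[of x V] by (auto simp: E_iff intertwiner_def intro: lin_mem)

lemma E_eqI: "x \<in> E \<Longrightarrow> y \<in> E \<Longrightarrow> (\<And>v. v \<in> V \<Longrightarrow> x v = y v) \<Longrightarrow> x = y"
  by (rule End_set_eqI[of _ V]) (auto dest: ED)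

lemma End_alg_simps [simp]: "x \<otimes>\<^bsub>End_alg G \<rho>\<^esub> y = x \<circ> y" "\<one>\<^bsub>End_alg G \<rho>\<^esub> = extend_zero V (\<lambda>v. v)"
  "scale (End_alg G \<rho>) = (*\<^sub>R)"
  by (simp_all add: End_alg_def)

lemma E_extend:
  assumes "intertwiner G \<rho> \<rho> f"
  shows "extend_zero V f \<in> E"
  using assms End_set_extend[OF intertwinerD(1)[OF assms] subV]
  by (auto simp: E_iff intertwiner_def extend_zero_def r_mem)

lemma E_comp: "x \<in> E \<Longrightarrow> y \<in> E \<Longrightarrow> x \<circ> y \<in> E"
  using End_set_comp[OF subV, of x y] by (auto simp: E_iff dest: End_setD(1) lin_mem)

lemma E_one: "extend_zero V (\<lambda>v. v) \<in> E"
  by (rule E_extend) (simp add: intertwiner_def lin_id)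

lemma subspace_E: "subspace E"
  unfolding subspace_def
proof (intro conjI ballI allI)
  show "0 \<in> E"
    using lin_0[OF act_linear subV] by (auto simp: E_iff End_set_0 subV)
  fix x y c assume xy: "x \<in> E"
  show "c *\<^sub>R x \<in> E"
    using ED[OF xy] by (auto simp: E_iff End_set_scale subV lin_scale[OF act_linear])
  assume y: "y \<in> E"
  have "(x + y) (r g v) = r g ((x + y) v)" if "g \<in> carrier G" "v \<in> V" for g v
    using ED(3,4)[OF xy] ED(3,4)[OF y] lin_add[OF act_linear[OF that(1)], of "x v" "y v"] that by simp
  then show "x + y \<in> E"
    using End_set_add[OF subV ED(1)[OF xy] ED(1)[OF y]] by (simp add: E_iff)
qed

lemma act_E: "x \<in> cf \<Longrightarrow> extend_zero V (act x) \<in> E"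
  by (rule E_extend) (simp add: intertwiner_def lin_act act_cf_commute)

lemma E_act: "x \<in> E \<Longrightarrow> v \<in> V \<Longrightarrow> x (act y v) = act y (x v)"
  unfolding group_alg_act_def
  by (subst lin_combination[OF ED(2) subV]) (auto simp: r_mem ED(4) intro!: sum.cong)

text \<open>The rank one maps that play the role of matrix units in a frame of
  \<open>V\<close>.\<close>

definition elem :: "('v \<Rightarrow> 'v \<Rightarrow> real) \<Rightarrow> 'v \<Rightarrow> 'v \<Rightarrow> 'v \<Rightarrow> 'v" where
  "elem \<epsilon> i j = extend_zero V (\<lambda>v. \<epsilon> j v *\<^sub>R i)"

lemma frame_End_set:
  assumes F: "frame V \<Gamma> (\<lambda>x. x) \<epsilon>"
  shows "frame (End_set V) (\<Gamma> \<times> \<Gamma>) (\<lambda>(i, j). elem \<epsilon> i j) (\<lambda>(i, j) x. \<epsilon> i (x j))"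
  unfolding frame_def
proof (intro conjI ballI)
  show "finite (\<Gamma> \<times> \<Gamma>)"
    using frameD(1)[OF F] by simp
  fix p assume "p \<in> \<Gamma> \<times> \<Gamma>"
  then obtain i j where p: "p = (i, j)" "i \<in> \<Gamma>" "j \<in> \<Gamma>"
    by auto
  note ij = frameD(2)[OF F p(2)] frameD(2)[OF F p(3)]
  show "(case p of (i, j) \<Rightarrow> elem \<epsilon> i j) \<in> End_set V"
    unfolding p(1) elem_def prod.case
    by (intro End_set_extend lin_scaleR_vec frameD(3)[OF F p(3)] subV ij)
  show "lin (End_set V) UNIV (case p of (i, j) \<Rightarrow> \<lambda>x. \<epsilon> i (x j))"
    unfolding p(1) prod.case using ij
    by (intro linI) (auto simp: lin_add[OF frameD(3)[OF F p(2)]] lin_scale[OF frameD(3)[OF F p(2)]]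
        lin_mem[OF End_setD(1)])
next
  fix x assume x: "x \<in> End_set V"
  note lx = End_setD(1)[OF x]
  have "(\<Sum>(i, j)\<in>\<Gamma>\<times>\<Gamma>. \<epsilon> i (x j) *\<^sub>R elem \<epsilon> i j) v = x v" for v
  proof (cases "v \<in> V")
    case True
    have "(\<Sum>(i, j)\<in>\<Gamma>\<times>\<Gamma>. \<epsilon> i (x j) *\<^sub>R elem \<epsilon> i j) v = (\<Sum>i\<in>\<Gamma>. \<Sum>j\<in>\<Gamma>. \<epsilon> i (x j) *\<^sub>R \<epsilon> j v *\<^sub>R i)"
      using True by (simp add: sum_fun_apply case_prod_beta elem_def extend_zero_def sum.cartesian_product)
    also have "\<dots> = (\<Sum>j\<in>\<Gamma>. \<Sum>i\<in>\<Gamma>. \<epsilon> j v *\<^sub>R \<epsilon> i (x j) *\<^sub>R i)"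
      by (subst sum.swap) (simp add: mult.commute)
    also have "\<dots> = (\<Sum>j\<in>\<Gamma>. \<epsilon> j v *\<^sub>R x j)"
      by (intro sum.cong refl)
        (simp only: scaleR_sum_right[symmetric] frameD(4)[OF F lin_mem[OF lx frameD(2)[OF F]]])
    also have "\<dots> = x (\<Sum>j\<in>\<Gamma>. \<epsilon> j v *\<^sub>R j)"
      using frameD(2)[OF F] by (simp add: lin_combination[OF lx subV])
    finally show ?thesis
      using frameD(4)[OF F True] by simp
  next
    case False
    then show ?thesis
      using End_setD(2)[OF x] by (simp add: sum_fun_apply case_prod_beta elem_def extend_zero_def)
  qed
  then show "(\<Sum>i\<in>\<Gamma> \<times> \<Gamma>. (case i of (i, j) \<Rightarrow> \<lambda>x. \<epsilon> i (x j)) x *\<^sub>R (case i of (i, j) \<Rightarrow> elem \<epsilon> i j)) = x"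
    by (auto simp: case_prod_beta)
qed

lemma subspace_End_set: "subspace (End_set V)"
  using End_set_0[OF subV] End_set_add[OF subV] End_set_scale[OF subV] by (auto simp: subspace_def)

lemma findim_E: "findim E"
proof -
  obtain \<Gamma> and \<epsilon> :: "'v \<Rightarrow> 'v \<Rightarrow> real" where F: "frame V \<Gamma> (\<lambda>x. x) \<epsilon>"
    using frame_ex[OF fdV] .
  show ?thesis
    by (rule findim_subset[OF findim_frame[OF frame_End_set[OF F] subspace_End_set] subspace_E])
      (auto dest: ED)
qed

lemma End_fin_dim: "fin_dim_algebra (End_alg G \<rho>)"
proof (intro fin_dim_algebra.intro fin_dim_algebra_axioms.intro monoid.intro, unfold End_alg_simps)
  show "\<And>x y. x \<in> E \<Longrightarrow> y \<in> E \<Longrightarrow> x \<circ> y \<in> E" "extend_zero V (\<lambda>v. v) \<in> E" "fin_dim_on (*\<^sub>R) E"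
    "vector_space ((*\<^sub>R) :: real \<Rightarrow> ('v \<Rightarrow> 'v) \<Rightarrow> _)"
    by (auto simp: E_comp E_one findim_E vector_space_scaleR)
  show "extend_zero V (\<lambda>v. v) \<circ> x = x" "x \<circ> extend_zero V (\<lambda>v. v) = x" if "x \<in> E" for x
    using ED(3)[OF that] End_setD(2)[OF ED(1)[OF that]] lin_0[OF ED(2)[OF that] subV]
      subspace_0[OF subV]
    by (auto simp: fun_eq_iff extend_zero_def)
  show "x \<circ> (y + z) = (x \<circ> y) + (x \<circ> z)" if "x \<in> E" "y \<in> E" "z \<in> E" for x y z
    using that ED(3) by (intro E_eqI E_comp subspace_add[OF subspace_E]) (auto simp: lin_add[OF ED(2)])
  show "x \<circ> c *\<^sub>R y = c *\<^sub>R (x \<circ> y)" if "x \<in> E" "y \<in> E" for x y c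
    using that ED(3) by (intro E_eqI E_comp subspace_scale[OF subspace_E]) (auto simp: lin_scale[OF ED(2)])
qed (auto simp: fun_eq_iff)

text \<open>The Reynolds operator: the projection of the full endomorphism algebra onto the
  commutant.\<close>

definition avg :: "('v \<Rightarrow> 'v) \<Rightarrow> 'v \<Rightarrow> 'v" where
  "avg X = extend_zero V (\<lambda>v. (1 / N) *\<^sub>R (\<Sum>g\<in>carrier G. r g (X (r (inv g) v))))"

text \<open>Replacing \<open>g\<close> by \<open>h \<otimes> g\<close> moves \<open>h\<close> out of
  the sum. The target is a second representation because orthogonality of non-isomorphic
  irreducibles averages maps between different spaces.\<close>

lemma avg_intertwiner:
  fixes \<sigma> :: "('g, 'w::real_vector) rep"
  assumes \<sigma>: "real_rep G \<sigma>" and X: "lin V (rep_space \<sigma>) X"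
  shows "intertwiner G \<rho> \<sigma> (\<lambda>v. \<Sum>g\<in>carrier G. rep_act \<sigma> g (X (r (inv g) v)))"
  unfolding intertwiner_def
proof (intro conjI ballI)
  interpret \<sigma>: real_rep G \<sigma>
    by fact
  note sub\<sigma> = findim_subspace[OF \<sigma>.space_fin_dim]
  show "lin V (rep_space \<sigma>) (\<lambda>v. \<Sum>g\<in>carrier G. rep_act \<sigma> g (X (r (inv g) v)))"
  proof (intro lin_sum_fun sub\<sigma>)
    fix g assume g: "g \<in> carrier G"
    show "lin V (rep_space \<sigma>) (\<lambda>v. rep_act \<sigma> g (X (r (inv g) v)))"
      by (rule lin_comp[OF lin_comp[OF act_linear X] \<sigma>.act_linear]) (use g in auto)
  qed
  fix h v assume h: "h \<in> carrier G" and v: "v \<in> V"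
  have "(\<Sum>g\<in>carrier G. rep_act \<sigma> g (X (r (inv g) (r h v)))) =
      (\<Sum>g\<in>carrier G. rep_act \<sigma> (h \<otimes> g) (X (r (inv (h \<otimes> g)) (r h v))))"
    by (rule sum_shift_left[OF h, symmetric])
  also have "\<dots> = (\<Sum>g\<in>carrier G. rep_act \<sigma> h (rep_act \<sigma> g (X (r (inv g) v))))"
  proof (rule sum.cong[OF refl])
    fix g assume g: "g \<in> carrier G"
    have "r (inv (h \<otimes> g)) (r h v) = r (inv g) v"
      using act_mult[of "inv (h \<otimes> g)" h v] g h v by (simp add: inv_mult_group m_assoc)
    moreover have "X (r (inv g) v) \<in> rep_space \<sigma>"
      using X g v r_mem by (auto intro: lin_mem)
    ultimately show "rep_act \<sigma> (h \<otimes> g) (X (r (inv (h \<otimes> g)) (r h v))) = rep_act \<sigma> h (rep_act \<sigma> g (X (r (inv g) v)))"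
      using g h by (simp add: \<sigma>.act_mult)
  qed
  also have "\<dots> = rep_act \<sigma> h (\<Sum>g\<in>carrier G. rep_act \<sigma> g (X (r (inv g) v)))"
    using lin_mem[OF X] lin_mem[OF \<sigma>.act_linear] r_mem v
    by (subst lin_sum[OF \<sigma>.act_linear[OF h] sub\<sigma>]) auto
  finally show "(\<Sum>g\<in>carrier G. rep_act \<sigma> g (X (r (inv g) (r h v)))) =
      rep_act \<sigma> h (\<Sum>g\<in>carrier G. rep_act \<sigma> g (X (r (inv g) v)))" .
qed

lemma intertwiner_scale:
  assumes "intertwiner G \<rho> \<rho> f"
  shows "intertwiner G \<rho> \<rho> (\<lambda>v. c *\<^sub>R f v)"
  using lin_scale_fun[OF subV intertwinerD(1)[OF assms]] intertwinerD[OF assms]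
  by (auto simp: intertwiner_def lin_scale[OF act_linear lin_mem])

lemma avg_E:
  assumes "lin V V X"
  shows "avg X \<in> E"
  unfolding avg_def
proof (rule E_extend)
  have "intertwiner G \<rho> \<rho> (\<lambda>v. \<Sum>g\<in>carrier G. r g (X (r (inv g) v)))"
    by (rule avg_intertwiner[OF real_rep_axioms assms])
  then show "intertwiner G \<rho> \<rho> (\<lambda>v. (1 / N) *\<^sub>R (\<Sum>g\<in>carrier G. r g (X (r (inv g) v))))"
    using intertwiner_scale by blast
qed

lemma avg_id: "x \<in> E \<Longrightarrow> avg x = x"
proof (rule E_eqI)
  fix v assume x: "x \<in> E" and v: "v \<in> V"
  have "r g (x (r (inv g) v)) = x v" if "g \<in> carrier G" for g
    using ED(3,4)[OF x] r_inv(2)[OF that] that v by simp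
  then show "avg x v = x v"
    using v N_pos by (simp add: avg_def extend_zero_def sum_constant_scaleR cong: sum.cong)
qed (auto intro: avg_E ED)

lemma lin_avg: "lin (End_set V) E avg"
proof (rule linI)
  fix x y c assume x: "x \<in> End_set V" and y: "y \<in> End_set V"
  note lx = End_setD(1)[OF x] and ly = End_setD(1)[OF y]
  show "avg x \<in> E"
    by (rule avg_E[OF lx])
  show "avg (x + y) = avg x + avg y"
    using lin_mem[OF lx] lin_mem[OF ly] r_mem
    by (auto simp: avg_def extend_zero_def fun_eq_iff lin_add[OF act_linear] sum.distrib scaleR_add_right)
  show "avg (c *\<^sub>R x) = c *\<^sub>R avg x"
    using lin_mem[OF lx] r_mem
    by (auto simp: avg_def extend_zero_def fun_eq_iff lin_scale[OF act_linear] scaleR_sum_right mult.commute)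
qed

text \<open>Traces on \<open>End\<^sub>G(\<rho>)\<close> are computed on all of \<open>End(\<rho>)\<close> after averaging.\<close>

lemma trace_E:
  assumes F: "frame V \<Gamma> (\<lambda>x. x) \<epsilon>" and f: "lin E E f"
  shows "tr E f = (\<Sum>i\<in>\<Gamma>. \<Sum>j\<in>\<Gamma>. \<epsilon> i (f (avg (elem \<epsilon> i j)) j))"
proof -
  have "tr E f = (\<Sum>p\<in>\<Gamma> \<times> \<Gamma>. (case p of (i, j) \<Rightarrow> \<lambda>x. \<epsilon> i (x j)) (f (avg (case p of (i, j) \<Rightarrow> elem \<epsilon> i j))))"
    by (rule trace_retract[OF frame_End_set[OF F] subspace_End_set subspace_E _ lin_avg avg_id f])
      (auto dest: ED)
  then show ?thesis
    by (simp add: sum.cartesian_product case_prod_beta)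
qed

lemma avg_elem:
  assumes "frame V \<Gamma> (\<lambda>x. x) \<epsilon>" "i \<in> \<Gamma>" "v \<in> V"
  shows "avg (elem \<epsilon> i j) v = (1 / N) *\<^sub>R (\<Sum>g\<in>carrier G. \<epsilon> j (r (inv g) v) *\<^sub>R r g i)"
  using assms frameD(2)[OF assms(1,2)]
  by (simp add: avg_def extend_zero_def elem_def r_mem lin_scale[OF act_linear])

text \<open>Weyl's averaging of a coordinate inner product. Positivity survives because every
  summand is non-negative and that of the unit element is positive.\<close>

lemma invariant_inner_ex:
  "\<exists>b. inner_space V b \<and> (\<forall>g\<in>carrier G. \<forall>u\<in>V. \<forall>v\<in>V. b (r g u) (r g v) = b u v)"
proof -
  obtain \<Gamma> where \<Gamma>: "basis_on (*\<^sub>R) V \<Gamma>"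
    using basis_on_ex[OF fdV] by auto
  define b1 where "b1 = (\<lambda>u v. \<Sum>x\<in>\<Gamma>. representation \<Gamma> u x * representation \<Gamma> v x)"
  define b where "b = (\<lambda>u v. \<Sum>g\<in>carrier G. b1 (r g u) (r g v))"
  have \<Gamma>': "finite \<Gamma>" "independent \<Gamma>" "span \<Gamma> = V"
    using \<Gamma> by (auto simp: basis_on_real)
  have lin1: "lin V UNIV (b1 u)" for u
    unfolding b1_def
    using lin_scale_fun[OF subspace_UNIV lin_representation[OF \<Gamma>'(2)]] \<Gamma>'(3)
    by (intro lin_sum_fun) auto
  have nonneg: "b1 u u \<ge> 0" for u
    unfolding b1_def by (intro sum_nonneg) auto
  have pos1: "b1 u u > 0" if u: "u \<in> V" "u \<noteq> 0" for u
  proof -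
    have "\<exists>x\<in>\<Gamma>. representation \<Gamma> u x \<noteq> 0"
    proof (rule ccontr)
      assume "\<not> (\<exists>x\<in>\<Gamma>. representation \<Gamma> u x \<noteq> 0)"
      then have "(\<Sum>x\<in>\<Gamma>. representation \<Gamma> u x *\<^sub>R x) = 0"
        by simp
      then show False
        using sum_representation_eq[OF \<Gamma>'(2) _ \<Gamma>'(1) subset_refl, of u] u \<Gamma>'(3) by simp
    qed
    then show ?thesis
      unfolding b1_def using \<Gamma>'(1) by (auto intro!: sum_pos2 simp: zero_less_mult_iff)
  qed
  have "inner_space V b"
  proof
    fix u assume u: "u \<in> V"
    show "lin V UNIV (b u)"
      unfolding b_def by (intro lin_sum_fun lin_comp[OF act_linear lin1]) auto
    assume "u \<noteq> 0"
    then have "b1 (r \<one> u) (r \<one> u) > 0"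
      using pos1 u by (simp add: act_one)
    then show "b u u > 0"
      unfolding b_def using fin nonneg by (intro sum_pos2[of _ \<one>]) auto
  qed (auto simp: fdV b_def b1_def mult.commute)
  moreover have "b (r h u) (r h v) = b u v" if h: "h \<in> carrier G" "u \<in> V" "v \<in> V" for h u v
  proof -
    have "b (r h u) (r h v) = (\<Sum>g\<in>carrier G. b1 (r (g \<otimes> h) u) (r (g \<otimes> h) v))"
      unfolding b_def using h by (intro sum.cong refl) (simp add: act_mult)
    also have "\<dots> = b u v"
      unfolding b_def by (rule sum_shift_right[OF h(1)])
    finally show ?thesis .
  qed
  ultimately show ?thesis
    by blast
qed

end

section \<open>Invariant forms, and the adjoint of the group action\<close>

locale form_rep = fin_rep G \<rho>
  for G :: "('g, 'm) monoid_scheme" (structure) and \<rho> :: "('g, 'v::real_vector) rep" +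
  fixes \<beta> :: "'v \<Rightarrow> 'v \<Rightarrow> real"
  assumes inv_form: "invariant_form G \<rho> \<beta>"

sublocale form_rep \<subseteq> form: form_space V \<beta>
  using inv_form fdV by unfold_locales (auto simp: invariant_form_def lin_real)

context form_rep
begin

lemma form_shift: "g \<in> carrier G \<Longrightarrow> u \<in> V \<Longrightarrow> v \<in> V \<Longrightarrow> \<beta> (r g u) v = \<beta> u (r (inv g) v)"
proof -
  assume *: "g \<in> carrier G" "u \<in> V" "v \<in> V"
  then have "\<beta> (r g u) (r g (r (inv g) v)) = \<beta> u (r (inv g) v)"
    using inv_form r_mem[of "inv g" v] by (auto simp: invariant_form_def)
  then show ?thesis
    using * by (simp add: r_inv)
qed

lemma form_act: "u \<in> V \<Longrightarrow> v \<in> V \<Longrightarrow> \<beta> (act x u) v = \<beta> u (act (flip x) v)"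
proof -
  assume uv: "u \<in> V" "v \<in> V"
  have "\<beta> (act x u) v = (\<Sum>g\<in>carrier G. x g * \<beta> u (r (inv g) v))"
    unfolding group_alg_act_def using uv by (simp add: form.combination_l r_mem form_shift)
  also have "\<dots> = \<beta> u (\<Sum>g\<in>carrier G. x g *\<^sub>R r (inv g) v)"
    using uv by (simp add: form.combination_r r_mem)
  finally show ?thesis
    by (simp add: group_alg_act_def sum_flip)
qed

text \<open>The adjoint of \<open>r g\<close> is \<open>r (inv g)\<close>, so commuting with all of
  \<open>G\<close> passes to the adjoint.\<close>

lemma adj_E: "x \<in> E \<Longrightarrow> form.adj x \<in> E"
  unfolding E_iff
proof (intro conjI ballI)
  assume x: "x \<in> End_set V \<and> (\<forall>g\<in>carrier G. \<forall>v\<in>V. x (r g v) = r g (x v))"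
  then show 1: "form.adj x \<in> End_set V"
    by (simp add: form.adj_End)
  fix g v assume gv: "g \<in> carrier G" "v \<in> V"
  have mem: "form.adj x w \<in> V" "x w \<in> V" if "w \<in> V" for w
    using lin_mem[OF End_setD(1)[OF 1]] lin_mem[OF End_setD(1)[of x]] that x by auto
  show "form.adj x (r g v) = r g (form.adj x v)"
  proof (rule form.eqI)
    fix u assume u: "u \<in> V"
    have "\<beta> u (form.adj x (r g v)) = \<beta> (r (inv g) (x u)) v"
      using x u gv by (simp add: form.adj r_mem form_shift mem)
    also have "\<dots> = \<beta> u (r g (form.adj x v))"
      using x u gv form_shift[of "inv g" u "form.adj x v"] by (simp add: form.adj[symmetric] r_mem mem)
        (metis form.adj inv_closed r_mem)
    finally show "\<beta> u (form.adj x (r g v)) = \<beta> u (r g (form.adj x v))" .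
  qed (use gv r_mem mem in auto)
qed

lemma adj_act: "x \<in> cf \<Longrightarrow> form.adj (extend_zero V (act x)) = extend_zero V (act (flip x))"
  by (rule form.adj_unique) (auto simp: form_act extend_zero_def intro: End_set_extend lin_act subV
      End_set_extend[OF lin_act subV, unfolded extend_zero_def])

end

section \<open>The equipped Cardy--Frobenius algebra of a representation\<close>

text \<open>The trace is the sum of the squared norms of \<open>adj x\<close> on an orthonormal
  frame. This positivity yields semi-simplicity of the commutant, non-degeneracy of
  \<open>lB\<close>, and negative squares for the imaginary elements of the commutant of an
  irreducible.\<close>

lemma (in inner_space) trace_adj_pos:
  assumes x: "x \<in> End_set V" "x \<noteq> 0"
  shows "tr V (x \<circ> adj x) > 0"
proof -
  obtain \<Gamma> where F: "frame V \<Gamma> (\<lambda>x. x) b"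
    using orthonormal_frame by blast
  note ax = adj_End[OF x(1)]
  have mem: "v \<in> V \<Longrightarrow> x v \<in> V" "v \<in> V \<Longrightarrow> adj x v \<in> V" for v
    using lin_mem[OF End_setD(1)[OF x(1)]] lin_mem[OF End_setD(1)[OF ax]] by auto
  have "tr V (x \<circ> adj x) = (\<Sum>e\<in>\<Gamma>. b e (x (adj x e)))"
    using trace_frame[OF F sub End_setD(1)[OF End_set_comp[OF sub x(1) ax]]] by simp
  also have "\<dots> = (\<Sum>e\<in>\<Gamma>. b (adj x e) (adj x e))"
    using frameD(2)[OF F] mem by (intro sum.cong refl) (simp add: adj'[OF x(1)])
  also have "\<dots> > 0"
  proof -
    have "\<exists>e\<in>\<Gamma>. adj x e \<noteq> 0"
    proof (rule ccontr)
      assume no: "\<not> (\<exists>e\<in>\<Gamma>. adj x e \<noteq> 0)"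
      have "adj x v = 0" for v
      proof (cases "v \<in> V")
        case True
        have "adj x v = (\<Sum>e\<in>\<Gamma>. b e v *\<^sub>R adj x e)"
          using lin_combination[OF End_setD(1)[OF ax] sub, of \<Gamma> "\<lambda>x. x" "\<lambda>e. b e v"]
            frameD(2)[OF F] frameD(4)[OF F True] by simp
        then show ?thesis
          using no by simp
      qed (use End_setD(2)[OF ax] in auto)
      then have "adj x = 0"
        by auto
      then have "x = adj 0"
        using adj_adj[OF x(1)] by simp
      also have "adj 0 = 0"
        using adj_scale[OF x(1), of 0] by simp
      finally show False
        using x(2) by simp
    qed
    then obtain e where "e \<in> \<Gamma>" "adj x e \<noteq> 0"
      by blast
    then show ?thesis
      using pos nonneg mem frameD(1,2)[OF F] by (intro sum_pos2[of _ e]) auto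
  qed
  finally show ?thesis .
qed

text \<open>The involution of the equipped algebra belongs to a form that may be indefinite. Here
  the adjoint for an auxiliary positive invariant form is used, so that
  \<open>tr V (adj x \<circ> y)\<close> is an inner product.\<close>

lemma (in fin_rep) semisimple_End: "semisimple_alg (End_alg G \<rho>)"
proof -
  obtain b where b: "inner_space V b" "\<forall>g\<in>carrier G. \<forall>u\<in>V. \<forall>v\<in>V. b (r g u) (r g v) = b u v"
    using invariant_inner_ex by blast
  interpret inner_space V b
    by fact
  interpret form_rep G \<rho> b
    using b(2) nondeg sym lin_b by unfold_locales (auto simp: invariant_form_def lin_real)
  have End: "x \<in> End_set V" if "x \<in> E" for x
    using ED(1)[OF that] .
  note cl = adj_E E_comp
  show ?thesis
  proof (rule semisimple_algI[where star = adj and b = "\<lambda>x y. tr V (adj x \<circ> y)"])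
    show "inner_space E (\<lambda>x y. tr V (adj x \<circ> y))"
    proof
      fix x assume x: "x \<in> E"
      note lx = lin_comp[OF ED(2) ED(2)[OF adj_E[OF x]]]
      show "lin E UNIV (\<lambda>y. tr V (adj x \<circ> y))"
      proof (rule linI)
        fix y z c assume y: "y \<in> E"
        have "tr V (adj x \<circ> (c *\<^sub>R y)) = tr V (\<lambda>v. c *\<^sub>R (adj x \<circ> y) v)"
          using lin_scale[OF ED(2)[OF adj_E[OF x]] ED(3)[OF y]] cl x y
          by (intro trace_cong[OF fdV ED(2)]) (auto simp: subspace_scale[OF subspace_E])
        then show "tr V (adj x \<circ> (c *\<^sub>R y)) = c *\<^sub>R tr V (adj x \<circ> y)"
          using trace_scale[OF fdV ED(2), of "adj x \<circ> y" c] cl x y by simp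
        assume z: "z \<in> E"
        have "tr V (adj x \<circ> (y + z)) = tr V (\<lambda>v. (adj x \<circ> y) v + (adj x \<circ> z) v)"
          using lin_add[OF ED(2)[OF adj_E[OF x]] ED(3)[OF y] ED(3)[OF z]] cl x y z
          by (intro trace_cong[OF fdV ED(2)]) (auto simp: subspace_add[OF subspace_E])
        then show "tr V (adj x \<circ> (y + z)) = tr V (adj x \<circ> y) + tr V (adj x \<circ> z)"
          using trace_add[OF fdV ED(2) ED(2), of "adj x \<circ> y" "adj x \<circ> z"] cl x y z by simp
      qed auto
      show "tr V (adj x \<circ> y) = tr V (adj y \<circ> x)" if y: "y \<in> E" for y
        using trace_adj[OF End[OF E_comp[OF adj_E[OF x] y]]] adj_comp[OF End[OF adj_E[OF x]] End[OF y]]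
          adj_adj[OF End[OF x]] by simp
      assume "x \<noteq> 0"
      then have "adj x \<noteq> 0"
        using adj_adj[OF End[OF x]] adj_scale[OF End[OF x], of 0] by auto
      then show "tr V (adj x \<circ> x) > 0"
        using trace_adj_pos[OF End[OF adj_E[OF x]]] adj_adj[OF End[OF x]] by simp
    qed (fact findim_E)
    fix x y z assume "x \<in> E" "y \<in> E" "z \<in> E"
    then show "tr V (adj (adj x \<otimes>\<^bsub>End_alg G \<rho>\<^esub> y) \<circ> z) = tr V (adj y \<circ> (x \<otimes>\<^bsub>End_alg G \<rho>\<^esub> z))"
      by (simp add: adj_comp End adj_E adj_adj comp_assoc)
  qed (auto intro: adj_E E_comp)
qed

context fin_rep
begin

text \<open>The character twisted by \<open>b\<close>, taken at the inverse so that
  \<open>(y \<star> chr b) \<one>\<close> is the trace of the action of \<open>y\<close> followed by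
  \<open>b\<close>.\<close>

definition chr :: "('v \<Rightarrow> 'v) \<Rightarrow> 'g \<Rightarrow> real" where
  "chr b = extend_zero (carrier G) (\<lambda>g. tr V (\<lambda>v. b (r (inv g) v)))"

lemma lin_E_r: "b \<in> E \<Longrightarrow> g \<in> carrier G \<Longrightarrow> lin V V (\<lambda>v. b (r g v))"
  using lin_comp[OF act_linear ED(2)] .

text \<open>\<open>b\<close> commutes with \<open>G\<close>, so conjugating the group element
  conjugates the operator, and the trace is cyclic.\<close>

lemma chr_cf: "b \<in> E \<Longrightarrow> chr b \<in> cf"
proof -
  assume b: "b \<in> E"
  have "tr V (\<lambda>v. b (r (inv (h \<otimes> g \<otimes> inv h)) v)) = tr V (\<lambda>v. b (r (inv g) v))"
    if gh: "g \<in> carrier G" "h \<in> carrier G" for g h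
  proof -
    have eq: "b (r (inv (h \<otimes> g \<otimes> inv h)) v) = r h (b (r (inv g) (r (inv h) v)))" if "v \<in> V" for v
      using gh that ED(3)[OF b] by (simp add: inv_mult_group act_mult r_mem ED(4)[OF b, symmetric])
    have "tr V (\<lambda>v. b (r (inv (h \<otimes> g \<otimes> inv h)) v)) = tr V (\<lambda>v. r h (b (r (inv g) (r (inv h) v))))"
      using gh by (intro trace_cong[OF fdV lin_E_r[OF b] eq]) auto
    also have "\<dots> = tr V (\<lambda>v. r (inv h) (r h (b (r (inv g) v))))"
      using gh by (intro trace_comm[OF fdV fdV]) (auto intro: act_linear lin_comp[OF lin_E_r[OF b]])
    also have "\<dots> = tr V (\<lambda>v. b (r (inv g) v))"
      using gh ED(3)[OF b] r_mem r_inv(1)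
      by (intro trace_cong[OF fdV, symmetric] lin_E_r[OF b]) auto
    finally show ?thesis .
  qed
  then show ?thesis
    by (auto simp: cf_def RG_iff chr_def extend_zero_def)
qed

end

section \<open>Frobenius pairs, the dual map, the Cardy condition and the element U\<close>

locale rep_data = form_rep G \<rho> \<beta>
  for G :: "('g, 'm) monoid_scheme" (structure) and \<rho> :: "('g, 'v::real_vector) rep" and \<beta> +
  fixes \<mu> :: "'g \<Rightarrow> real"
  assumes mu_Units: "\<mu> \<in> Units ZG"
    and mu_inv: "\<forall>g\<in>carrier G. \<mu> g = \<mu> (inv g)"
begin

abbreviation \<nu> :: "'g \<Rightarrow> real" where
  "\<nu> \<equiv> inv\<^bsub>ZG\<^esub> \<mu>"

definition lA :: "('g \<Rightarrow> real) \<Rightarrow> real" where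
  "lA x = (\<mu> \<star> \<mu> \<star> x) \<one> / N"

definition lB :: "('v \<Rightarrow> 'v) \<Rightarrow> real" where
  "lB x = tr V (\<lambda>v. act \<mu> (x v) /\<^sub>R N)"

definition ph :: "('g \<Rightarrow> real) \<Rightarrow> 'v \<Rightarrow> 'v" where
  "ph a = extend_zero V (act a)"

lemma H_simps:
  "algA (H_rep G \<rho> \<beta> \<mu>) = ZG" "funA (H_rep G \<rho> \<beta> \<mu>) = lA" "algB (H_rep G \<rho> \<beta> \<mu>) = End_alg G \<rho>"
  "funB (H_rep G \<rho> \<beta> \<mu>) = lB" "phi (H_rep G \<rho> \<beta> \<mu>) = ph" "elemU (H_rep G \<rho> \<beta> \<mu>) = \<nu> \<star> squares"
  "starA (H_rep G \<rho> \<beta> \<mu>) = flip" "starB (H_rep G \<rho> \<beta> \<mu>) = form.adj"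
  by (simp_all add: H_rep_def Let_def lA_def[abs_def] lB_def[abs_def] ph_def[abs_def] squares_def
      flip_def[abs_def])

lemma mu_cf: "\<mu> \<in> cf" "\<nu> \<in> cf" and mu_nu: "\<mu> \<star> \<nu> = group_elem \<one>"
proof -
  interpret Z: comm_monoid ZG
    by (rule ZG_comm_monoid)
  show "\<mu> \<in> cf" "\<nu> \<in> cf" "\<mu> \<star> \<nu> = group_elem \<one>"
    using Z.Units_closed[OF mu_Units] Z.Units_inv_closed[OF mu_Units] Z.Units_r_inv[OF mu_Units]
    by (simp_all add: center_group_alg one_group_alg)
qed

lemma mu_nu_cancel: "x \<in> RG \<Longrightarrow> \<mu> \<star> (\<nu> \<star> x) = x"
  by (simp add: conv_assoc[symmetric] mu_nu conv_one)

lemma flip_mu: "flip \<mu> = \<mu>"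
  using cfD(1)[OF mu_cf(1)] by (intro RG_eqI) (auto simp: flip_apply bspec[OF mu_inv, symmetric])

lemma act_mu_nu: "v \<in> V \<Longrightarrow> act \<mu> (act \<nu> v) = v"
  by (simp add: act_conv[symmetric] mu_nu act_group_one)

lemma left_commute: "x \<in> cf \<Longrightarrow> x \<star> (y \<star> z) = y \<star> (x \<star> z)"
  using cf_conv_commute[of x y] by (simp add: conv_assoc[symmetric])

lemma lA_nu: "x \<in> RG \<Longrightarrow> lA (\<nu> \<star> x) = (\<mu> \<star> x) \<one> / N"
  "x \<in> RG \<Longrightarrow> lA (\<nu> \<star> (\<nu> \<star> x)) = x \<one> / N"
  by (simp_all add: lA_def conv_assoc mu_nu_cancel)

lemma frobenius_A: "frobenius_pair ZG lA"
proof (intro frobenius_pair.intro frobenius_pair_axioms.intro ZG_fin_dim, unfold center_alg_simps center_group_alg)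
  interpret fin_dim_algebra "group_alg G"
    by (rule group_alg_fin_dim)
  have "lin cf UNIV lA"
    unfolding lA_def using distrib_left[of "\<mu> \<star> \<mu>"] scale_mult_right[of "\<mu> \<star> \<mu>"]
    by (intro linI) (auto simp: cfD add_divide_distrib)
  then show "linear_on (scale (group_alg G)) (*) cf UNIV lA"
    by (simp add: lin_real)
  show "lA (x \<star> y) = lA (y \<star> x)" if "x \<in> cf" for x y
    using cf_conv_commute[OF that] by simp
  fix x assume x: "x \<in> cf" and 0: "\<forall>y\<in>cf. lA (x \<star> y) = 0"
  \<comment> \<open>This test element cancels \<open>\<mu>\<close> twice; what remains is the sum of
    the squares of the coefficients of \<open>x\<close>, divided by \<open>N\<close>.\<close>
  have "lA (x \<star> (\<nu> \<star> (\<nu> \<star> flip x))) = 0"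
    using 0 x conv_cf mu_cf flip_cf by blast
  also have "x \<star> (\<nu> \<star> (\<nu> \<star> flip x)) = \<nu> \<star> (\<nu> \<star> (x \<star> flip x))"
    using left_commute[OF x] by simp
  also have "lA \<dots> = (\<Sum>h\<in>carrier G. x h * x h) / N"
    by (simp add: lA_nu(2)) (simp add: conv_at_one flip_apply)
  finally have "(\<Sum>h\<in>carrier G. x h * x h) = 0"
    using N_pos by simp
  then have "x h = 0" if "h \<in> carrier G" for h
    using fin that by (simp add: sum_nonneg_eq_0_iff)
  then show "x = 0"
    using cfD(1)[OF x] by (intro RG_eqI) (auto simp: RG_iff)
qed

lemma lin_act_comp: "x \<in> E \<Longrightarrow> lin V V (\<lambda>v. act y (x v))"
  using lin_comp[OF ED(2) lin_act] .

lemma lB_eq: "x \<in> E \<Longrightarrow> lB x = tr V (\<lambda>v. act \<mu> (x v)) / N"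
  unfolding lB_def by (simp add: trace_scale[OF fdV lin_act_comp] divide_inverse mult.commute)

lemma ph_apply: "v \<in> V \<Longrightarrow> ph a v = act a v"
  by (simp add: ph_def extend_zero_def)

lemma ph_E: "a \<in> cf \<Longrightarrow> ph a \<in> E"
  unfolding ph_def by (rule act_E)

lemma frobenius_B: "frobenius_pair (End_alg G \<rho>) lB"
proof (intro frobenius_pair.intro frobenius_pair_axioms.intro End_fin_dim, unfold End_alg_simps)
  have "lin E UNIV lB"
  proof (rule linI)
    fix x y c assume x: "x \<in> E" and y: "y \<in> E"
    have "tr V (\<lambda>v. act \<mu> ((x + y) v)) = tr V (\<lambda>v. act \<mu> (x v) + act \<mu> (y v))"
      using lin_add[OF lin_act ED(3)[OF x] ED(3)[OF y]]
      by (intro trace_cong[OF fdV lin_act_comp[OF subspace_add[OF subspace_E x y]]]) auto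
    then show "lB (x + y) = lB x + lB y"
      using x y subspace_add[OF subspace_E x y]
      by (simp add: lB_eq trace_add[OF fdV lin_act_comp lin_act_comp] add_divide_distrib)
    have "tr V (\<lambda>v. act \<mu> ((c *\<^sub>R x) v)) = tr V (\<lambda>v. c *\<^sub>R act \<mu> (x v))"
      using lin_scale[OF lin_act ED(3)[OF x]]
      by (intro trace_cong[OF fdV lin_act_comp[OF subspace_scale[OF subspace_E x]]]) auto
    then show "lB (c *\<^sub>R x) = c *\<^sub>R lB x"
      using x subspace_scale[OF subspace_E x]
      by (simp add: lB_eq trace_scale[OF fdV lin_act_comp])
  qed simp
  then show "linear_on (*\<^sub>R) (*) E UNIV lB"
    by (simp add: lin_real)
  show "lB (x \<circ> y) = lB (y \<circ> x)" if x: "x \<in> E" and y: "y \<in> E" for x y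
  proof -
    have "tr V (\<lambda>v. act \<mu> ((x \<circ> y) v)) = tr V (\<lambda>v. y (act \<mu> (x v)))"
      using trace_comm[OF fdV fdV ED(2)[OF y] lin_act_comp[OF x]] by simp
    also have "\<dots> = tr V (\<lambda>v. act \<mu> ((y \<circ> x) v))"
      using E_act[OF y] ED(3)[OF x] lin_comp[OF lin_act_comp[OF x] ED(2)[OF y]]
      by (intro trace_cong[OF fdV]) auto
    finally show ?thesis
      using x y by (simp add: lB_eq E_comp)
  qed
  fix x assume x: "x \<in> E" and 0: "\<forall>y\<in>E. lB (x \<circ> y) = 0"
  obtain b where b: "inner_space V b" "\<forall>g\<in>carrier G. \<forall>u\<in>V. \<forall>v\<in>V. b (r g u) (r g v) = b u v"
    using invariant_inner_ex by blast
  interpret i: inner_space V b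
    by fact
  interpret j: form_rep G \<rho> b
    using b(2) i.nondeg i.sym i.lin_b by unfold_locales (auto simp: invariant_form_def lin_real)
  \<comment> \<open>The factor \<open>ph \<nu>\<close> cancels the \<open>\<mu>\<close> in
    \<open>lB\<close>. The pairing becomes \<open>tr V (x \<circ> i.adj x) / N\<close> with the
    adjoint of a positive form, which is positive unless \<open>x\<close> vanishes.\<close>
  let ?y = "ph \<nu> \<circ> i.adj x"
  have a: "i.adj x \<in> E" and y: "?y \<in> E"
    using j.adj_E x E_comp ph_E mu_cf by auto
  have "act \<mu> ((x \<circ> ?y) v) = (x \<circ> i.adj x) v" if "v \<in> V" for v
    using that ED(3)[OF x] ED(3)[OF a] by (simp add: ph_apply E_act[OF x] act_mu_nu)
  then have "lB (x \<circ> ?y) = tr V (x \<circ> i.adj x) / N"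
    using x y trace_cong[OF fdV lin_act_comp[of "x \<circ> ?y" \<mu>], of "x \<circ> i.adj x"] by (simp add: lB_eq E_comp)
  then have "tr V (x \<circ> i.adj x) = 0"
    using 0 y N_pos by simp
  then show "x = 0"
    using i.trace_adj_pos[OF ED(1)[OF x]] by fastforce
qed

lemma chr_pairing:
  assumes b: "b \<in> E"
  shows "(y \<star> chr b) \<one> = tr V (\<lambda>v. b (act y v))"
proof -
  have "(y \<star> chr b) \<one> = (\<Sum>h\<in>carrier G. y h * tr V (\<lambda>v. b (r h v)))"
    by (simp add: conv_at_one chr_def extend_zero_def)
  also have "\<dots> = (\<Sum>h\<in>carrier G. tr V (\<lambda>v. y h *\<^sub>R b (r h v)))"
    by (intro sum.cong refl) (simp add: trace_scale[OF fdV lin_E_r[OF b]])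
  also have "\<dots> = tr V (\<lambda>v. \<Sum>h\<in>carrier G. y h *\<^sub>R b (r h v))"
    by (rule trace_sum[OF fdV, symmetric]) (intro lin_scale_fun subV lin_E_r[OF b])
  also have "\<dots> = tr V (\<lambda>v. b (act y v))"
    unfolding group_alg_act_def
    by (intro trace_cong[OF fdV] lin_sum_fun lin_scale_fun subV lin_E_r[OF b])
      (simp_all add: lin_combination[OF ED(2)[OF b] subV] r_mem)
  finally show ?thesis .
qed

text \<open>\<open>lA\<close> contains \<open>\<mu>\<close> twice and \<open>lB\<close> once, which
  leaves a single factor \<open>\<nu>\<close> in front of the twisted character.\<close>

lemma dual_map: "b \<in> E \<Longrightarrow> dual_map ZG lA (End_alg G \<rho>) lB ph b = \<nu> \<star> chr b"
  unfolding dual_map_def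
proof (rule the_equality)
  interpret Fr: frobenius_pair ZG lA
    by (rule frobenius_A)
  interpret Fo: form_space "carrier ZG" "\<lambda>x y. lA (x \<otimes>\<^bsub>ZG\<^esub> y)"
    by (rule frobenius_form_space[OF frobenius_A]) simp
  assume b: "b \<in> E"
  have cf: "\<nu> \<star> chr b \<in> cf"
    using b by (intro conv_cf mu_cf chr_cf)
  have eq: "lA ((\<nu> \<star> chr b) \<star> a) = lB (b \<circ> ph a)" if a: "a \<in> cf" for a
  proof -
    have "lA ((\<nu> \<star> chr b) \<star> a) = (\<mu> \<star> (chr b \<star> a)) \<one> / N"
      by (simp add: conv_assoc lA_nu)
    also have "\<mu> \<star> (chr b \<star> a) = (\<mu> \<star> a) \<star> chr b"
      using cf_conv_commute[OF a] by (simp add: conv_assoc)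
    also have "\<dots> \<one> = tr V (\<lambda>v. b (act (\<mu> \<star> a) v))"
      by (rule chr_pairing[OF b])
    also have "\<dots> = tr V (\<lambda>v. act \<mu> ((b \<circ> ph a) v))"
      using ED(3)[OF b]
      by (intro trace_cong[OF fdV lin_comp[OF lin_act ED(2)[OF b]]])
        (simp add: ph_apply act_conv E_act[OF b] act_mem)
    finally show ?thesis
      using b a by (simp add: lB_eq E_comp ph_E)
  qed
  then show "\<nu> \<star> chr b \<in> carrier ZG \<and> (\<forall>a\<in>carrier ZG. lA (\<nu> \<star> chr b \<otimes>\<^bsub>ZG\<^esub> a) = lB (b \<otimes>\<^bsub>End_alg G \<rho>\<^esub> ph a))"
    using cf by (simp add: center_group_alg)
  fix x assume x: "x \<in> carrier ZG \<and> (\<forall>a\<in>carrier ZG. lA (x \<otimes>\<^bsub>ZG\<^esub> a) = lB (b \<otimes>\<^bsub>End_alg G \<rho>\<^esub> ph a))"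
  show "x = \<nu> \<star> chr b"
    using x cf eq Fr.form_symmetric by (intro Fo.eqI) (auto simp: center_group_alg cf_conv_commute)
qed

text \<open>In an averaged matrix unit each \<open>g\<close> contributes a product of an entry of
  \<open>b'\<close> with \<open>g\<close> and an entry of \<open>b''\<close> with
  \<open>inv g\<close>. Summing over the two indices separately gives the two traces.\<close>

lemma trace_two_sided:
  assumes b: "b' \<in> E" "b'' \<in> E"
  shows "tr E (\<lambda>b. b' \<circ> b \<circ> b'') =
    (1 / N) * (\<Sum>g\<in>carrier G. tr V (\<lambda>v. b' (r g v)) * tr V (\<lambda>v. b'' (r (inv g) v)))"
proof -
  obtain \<Gamma> and \<epsilon> :: "'v \<Rightarrow> 'v \<Rightarrow> real" where F: "frame V \<Gamma> (\<lambda>x. x) \<epsilon>"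
    using frame_ex[OF fdV] .
  note \<Gamma>V = frameD(2)[OF F]
  interpret D: fin_dim_algebra "End_alg G \<rho>"
    by (rule End_fin_dim)
  have l: "lin E E (\<lambda>b. b' \<circ> b \<circ> b'')"
    using b D.distrib_left D.distrib_right D.scale_mult_left D.scale_mult_right
    by (intro linI) (simp_all add: E_comp)
  have "tr E (\<lambda>b. b' \<circ> b \<circ> b'') =
      (\<Sum>i\<in>\<Gamma>. \<Sum>j\<in>\<Gamma>. \<epsilon> i (b' (avg (elem \<epsilon> i j) (b'' j))))"
    using trace_E[OF F l] by simp
  also have "\<dots> = (\<Sum>i\<in>\<Gamma>. \<Sum>j\<in>\<Gamma>. \<Sum>g\<in>carrier G.
      (1 / N) * (\<epsilon> i (b' (r g i)) * \<epsilon> j (r (inv g) (b'' j))))"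
  proof (intro sum.cong refl)
    fix i j assume ij: "i \<in> \<Gamma>" "j \<in> \<Gamma>"
    have lb: "lin V UNIV (\<lambda>v. \<epsilon> i (b' v))"
      by (rule lin_comp[OF ED(2)[OF b(1)] frameD(3)[OF F ij(1)]])
    have m: "(\<Sum>g\<in>carrier G. \<epsilon> j (r (inv g) (b'' j)) *\<^sub>R r g i) \<in> V"
      using \<Gamma>V[OF ij(1)] r_mem by (intro subspace_sum subspace_scale subV) auto
    have "\<epsilon> i (b' (avg (elem \<epsilon> i j) (b'' j))) =
        (1 / N) * (\<Sum>g\<in>carrier G. \<epsilon> j (r (inv g) (b'' j)) * \<epsilon> i (b' (r g i)))"
      using avg_elem[OF F ij(1) ED(3)[OF b(2) \<Gamma>V[OF ij(2)]]] lin_scale[OF lb m]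
        lin_combination[OF lb subV, of "carrier G" "\<lambda>g. r g i"] r_mem \<Gamma>V[OF ij(1)] by simp
    then show "\<epsilon> i (b' (avg (elem \<epsilon> i j) (b'' j))) =
        (\<Sum>g\<in>carrier G. (1 / N) * (\<epsilon> i (b' (r g i)) * \<epsilon> j (r (inv g) (b'' j))))"
      by (simp add: sum_distrib_left mult.commute)
  qed
  also have "\<dots> = (\<Sum>g\<in>carrier G. \<Sum>i\<in>\<Gamma>. \<Sum>j\<in>\<Gamma>.
      (1 / N) * (\<epsilon> i (b' (r g i)) * \<epsilon> j (r (inv g) (b'' j))))"
    by (subst sum.swap[where A = "carrier G"], rule sum.cong[OF refl], rule sum.swap)
  also have "\<dots> = (\<Sum>g\<in>carrier G. (1 / N) * (tr V (\<lambda>v. b' (r g v)) * tr V (\<lambda>v. b'' (r (inv g) v))))"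
  proof (rule sum.cong[OF refl])
    fix g assume g: "g \<in> carrier G"
    have "tr V (\<lambda>v. b' (r g v)) = (\<Sum>i\<in>\<Gamma>. \<epsilon> i (b' (r g i)))"
      by (rule trace_frame[OF F subV lin_E_r[OF b(1) g]])
    moreover have "tr V (\<lambda>v. b'' (r (inv g) v)) = (\<Sum>j\<in>\<Gamma>. \<epsilon> j (r (inv g) (b'' j)))"
      using trace_frame[OF F subV lin_E_r[OF b(2)], of "inv g"] g \<Gamma>V by (simp add: ED(4)[OF b(2)])
    ultimately show "(\<Sum>i\<in>\<Gamma>. \<Sum>j\<in>\<Gamma>. (1 / N) * (\<epsilon> i (b' (r g i)) * \<epsilon> j (r (inv g) (b'' j)))) =
        (1 / N) * (tr V (\<lambda>v. b' (r g v)) * tr V (\<lambda>v. b'' (r (inv g) v)))"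
      by (simp only: sum_product) (simp only: sum_distrib_left)
  qed
  finally show ?thesis
    by (simp add: sum_distrib_left)
qed

text \<open>The two factors \<open>\<nu>\<close> cancel the two \<open>\<mu>\<close> in
  \<open>lA\<close>. What remains is the unit coefficient of a product of two twisted characters,
  which is the sum found in \<open>trace_two_sided\<close>.\<close>

lemma cardy_condition:
  assumes b: "b' \<in> E" "b'' \<in> E"
  shows "lA ((\<nu> \<star> chr b') \<star> (\<nu> \<star> chr b'')) = tr E (\<lambda>b. b' \<circ> b \<circ> b'')"
proof -
  have "(\<nu> \<star> chr b') \<star> (\<nu> \<star> chr b'') = \<nu> \<star> (\<nu> \<star> (chr b' \<star> chr b''))"
    using left_commute[OF chr_cf[OF b(1)]] by (simp add: conv_assoc)
  then have "lA ((\<nu> \<star> chr b') \<star> (\<nu> \<star> chr b'')) = (chr b' \<star> chr b'') \<one> / N"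
    by (simp add: lA_nu(2))
  also have "(chr b' \<star> chr b'') \<one> =
      (\<Sum>h\<in>carrier G. tr V (\<lambda>v. b' (r (inv h) v)) * tr V (\<lambda>v. b'' (r h v)))"
    by (simp add: conv_at_one chr_def extend_zero_def)
  also have "\<dots> = (\<Sum>h\<in>carrier G. tr V (\<lambda>v. b' (r h v)) * tr V (\<lambda>v. b'' (r (inv h) v)))"
    by (subst sum_inv[symmetric]) simp
  finally show ?thesis
    using trace_two_sided[OF b] by simp
qed

lemma ph_hom: "alg_hom ZG (End_alg G \<rho>) ph"
proof -
  have "lin cf E ph"
    by (rule linI) (auto simp: ph_E, auto simp: ph_def extend_zero_def fun_eq_iff act_add act_scale)
  moreover have "ph (x \<star> y) = ph x \<circ> ph y" if "x \<in> cf" "y \<in> cf" for x y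
    using that by (intro E_eqI E_comp ph_E conv_cf) (auto simp: ph_apply act_conv act_mem)
  moreover have "ph (group_elem \<one>) = extend_zero V (\<lambda>v. v)"
    by (auto simp: ph_def extend_zero_def fun_eq_iff act_group_one)
  ultimately show ?thesis
    by (auto simp: alg_hom_def center_group_alg hom_def ph_E one_group_alg)
qed

lemma ph_central: "ph ` cf \<subseteq> center (End_alg G \<rho>)"
proof -
  have "ph a \<circ> x = x \<circ> ph a" if "a \<in> cf" "x \<in> E" for a x
    using that ED(3)[OF that(2)] by (intro E_eqI E_comp ph_E) (auto simp: ph_apply E_act)
  then show ?thesis
    by (auto simp: center_def ph_E)
qed

lemma cardy_frobenius: "cardy_frobenius ZG lA (End_alg G \<rho>) lB ph"
proof (intro cardy_frobenius.intro cardy_frobenius_axioms.intro frobenius_A frobenius_B ph_hom)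
  show "ph ` carrier ZG \<subseteq> center (End_alg G \<rho>)"
    using ph_central by (simp add: center_group_alg)
  show "x \<otimes>\<^bsub>ZG\<^esub> y = y \<otimes>\<^bsub>ZG\<^esub> x" if "x \<in> carrier ZG" for x y
    using that cf_conv_commute by (simp add: center_group_alg)
  show "lA (dual_map ZG lA (End_alg G \<rho>) lB ph b' \<otimes>\<^bsub>ZG\<^esub> dual_map ZG lA (End_alg G \<rho>) lB ph b'') =
      trace_on (scale (End_alg G \<rho>)) E (\<lambda>b. b' \<otimes>\<^bsub>End_alg G \<rho>\<^esub> b \<otimes>\<^bsub>End_alg G \<rho>\<^esub> b'')"
    if "b' \<in> E" "b'' \<in> E" for b' b''
    using that by (simp add: dual_map cardy_condition)
qed

text \<open>The group elements are used as a frame of \<open>RG\<close> and projected by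
  \<open>conj_avg\<close>. The diagonal entry at \<open>g\<close> averages \<open>c\<close> over the
  products of a conjugate of \<open>g\<close> with \<open>g\<close>; the inversion in
  \<open>flip\<close> undoes the one in the convolution.\<close>

lemma trace_flip:
  assumes c: "c \<in> cf"
  shows "tr cf (\<lambda>x. flip x \<star> c) = (\<Sum>k\<in>carrier G. \<Sum>g\<in>carrier G. c (k \<otimes> g \<otimes> inv k \<otimes> g)) / N"
proof -
  interpret D: fin_dim_algebra "group_alg G"
    by (rule group_alg_fin_dim)
  have l: "lin cf cf (\<lambda>x. flip x \<star> c)"
    using lin_add[OF lin_flip] lin_scale[OF lin_flip] c cfD(1)
    by (intro linI) (auto simp: conv_cf flip_cf D.distrib_right D.scale_mult_left[simplified])
  have eq: "(flip (conj_avg (group_elem g)) \<star> c) g = (\<Sum>k\<in>carrier G. c (k \<otimes> g \<otimes> inv k \<otimes> g)) / N"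
    if g: "g \<in> carrier G" for g
  proof -
    have "(flip (conj_avg (group_elem g)) \<star> c) g = (\<Sum>h\<in>carrier G. flip (conj_avg (group_elem g)) h *\<^sub>R c (inv h \<otimes> g))"
      using g by (simp add: conv_apply)
    also have "\<dots> = (\<Sum>h\<in>carrier G. conj_avg (group_elem g) h * c (h \<otimes> g))"
      using sum_flip[of "conj_avg (group_elem g)" "\<lambda>h. c (inv h \<otimes> g)"] by (simp cong: sum.cong)
    also have "\<dots> = (\<Sum>h\<in>carrier G. (\<Sum>k\<in>carrier G. group_elem g (inv k \<otimes> h \<otimes> k) * c (h \<otimes> g))) / N"
      by (simp add: conj_avg_def extend_zero_def sum_divide_distrib sum_distrib_right)
    also have "(\<Sum>h\<in>carrier G. (\<Sum>k\<in>carrier G. group_elem g (inv k \<otimes> h \<otimes> k) * c (h \<otimes> g))) =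
        (\<Sum>k\<in>carrier G. \<Sum>h\<in>carrier G. group_elem g (inv k \<otimes> h \<otimes> k) * c (h \<otimes> g))"
      by (rule sum.swap)
    also have "\<dots> = (\<Sum>k\<in>carrier G. c (k \<otimes> g \<otimes> inv k \<otimes> g))"
    proof (rule sum.cong[OF refl])
      fix k assume k: "k \<in> carrier G"
      have inv_conj: "inv k \<otimes> (k \<otimes> h \<otimes> inv k) \<otimes> k = h" if "h \<in> carrier G" for h
        using k that by (simp add: m_assoc) (simp add: m_assoc[symmetric])
      have "(\<Sum>h\<in>carrier G. group_elem g (inv k \<otimes> h \<otimes> k) * c (h \<otimes> g)) =
          (\<Sum>h\<in>carrier G. group_elem g (inv k \<otimes> (h \<otimes> inv k) \<otimes> k) * c ((h \<otimes> inv k) \<otimes> g))"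
        using k by (intro sum_shift_right[symmetric]) auto
      also have "\<dots> = (\<Sum>h\<in>carrier G. group_elem g (inv k \<otimes> (k \<otimes> h \<otimes> inv k) \<otimes> k) * c ((k \<otimes> h \<otimes> inv k) \<otimes> g))"
        by (rule sum_shift_left[OF k, symmetric])
      also have "\<dots> = (\<Sum>h\<in>carrier G. group_elem g h *\<^sub>R c (k \<otimes> h \<otimes> inv k \<otimes> g))"
        by (intro sum.cong refl) (simp add: inv_conj)
      finally show "(\<Sum>h\<in>carrier G. group_elem g (inv k \<otimes> h \<otimes> k) * c (h \<otimes> g)) = c (k \<otimes> g \<otimes> inv k \<otimes> g)"
        using sum_group_elem[OF g, of "\<lambda>h. c (k \<otimes> h \<otimes> inv k \<otimes> g)"] by simp
    qed
    finally show ?thesis .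
  qed
  have "tr cf (\<lambda>x. flip x \<star> c) = (\<Sum>g\<in>carrier G. (flip (conj_avg (group_elem g)) \<star> c) g)"
    by (rule trace_retract[OF frame_RG subspace_RG subspace_cf _ lin_conj_avg conj_avg_id l])
      (auto simp: cfD)
  also have "\<dots> = (\<Sum>g\<in>carrier G. (\<Sum>k\<in>carrier G. c (k \<otimes> g \<otimes> inv k \<otimes> g)) / N)"
    using eq by simp
  also have "\<dots> = (\<Sum>g\<in>carrier G. \<Sum>k\<in>carrier G. c (k \<otimes> g \<otimes> inv k \<otimes> g)) / N"
    by (rule sum_divide_distrib[symmetric])
  also have "(\<Sum>g\<in>carrier G. \<Sum>k\<in>carrier G. c (k \<otimes> g \<otimes> inv k \<otimes> g)) =
      (\<Sum>k\<in>carrier G. \<Sum>g\<in>carrier G. c (k \<otimes> g \<otimes> inv k \<otimes> g))"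
    by (rule sum.swap)
  finally show ?thesis .
qed

text \<open>Paired with \<open>c\<close>, the left side evaluates \<open>c\<close> at products of
  two squares and the right side at the words
  \<open>k \<otimes> g \<otimes> inv k \<otimes> g\<close>. \<open>klein_bottle\<close> matches the
  two sums; the inverses produced by the unit coefficient disappear on reindexing.\<close>

lemma U_square: "(\<nu> \<star> squares) \<star> (\<nu> \<star> squares) = star_casimir ZG lA flip"
proof (rule star_casimir_eqI[OF frobenius_A, symmetric])
  fix c assume "c \<in> carrier ZG"
  then have c: "c \<in> cf"
    by (simp add: center_group_alg)
  have "((\<nu> \<star> squares) \<star> (\<nu> \<star> squares)) \<star> c = \<nu> \<star> (\<nu> \<star> (squares \<star> (squares \<star> c)))"
    using left_commute[OF squares_cf, of \<nu> "squares \<star> c"] by (simp add: conv_assoc)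
  then have "lA (((\<nu> \<star> squares) \<star> (\<nu> \<star> squares)) \<star> c) = (squares \<star> (squares \<star> c)) \<one> / N"
    by (simp add: lA_nu(2))
  also have "(squares \<star> (squares \<star> c)) \<one> = (\<Sum>h\<in>carrier G. squares h *\<^sub>R (squares \<star> c) (inv h))"
    by (simp add: conv_at_one)
  also have "\<dots> = (\<Sum>h\<in>carrier G. (squares \<star> c) (inv (h \<otimes> h)))"
    by (rule sum_squares)
  also have "\<dots> = (\<Sum>h\<in>carrier G. \<Sum>k\<in>carrier G. squares k *\<^sub>R c (inv k \<otimes> inv (h \<otimes> h)))"
    by (intro sum.cong refl) (simp add: conv_apply)
  also have "\<dots> = (\<Sum>h\<in>carrier G. \<Sum>k\<in>carrier G. c (inv (k \<otimes> k) \<otimes> inv (h \<otimes> h)))"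
    by (simp only: sum_squares)
  also have "\<dots> = (\<Sum>h\<in>carrier G. \<Sum>k\<in>carrier G. c ((inv k \<otimes> inv k) \<otimes> (inv h \<otimes> inv h)))"
    by (intro sum.cong refl) (simp add: inv_mult_group)
  also have "\<dots> = (\<Sum>h\<in>carrier G. \<Sum>k\<in>carrier G. c ((k \<otimes> k) \<otimes> (inv h \<otimes> inv h)))"
    by (intro sum.cong refl sum_inv)
  also have "\<dots> = (\<Sum>h\<in>carrier G. \<Sum>k\<in>carrier G. c ((k \<otimes> k) \<otimes> (h \<otimes> h)))"
    by (rule sum_inv)
  also have "\<dots> = (\<Sum>k\<in>carrier G. \<Sum>h\<in>carrier G. c ((k \<otimes> k) \<otimes> (h \<otimes> h)))"
    by (rule sum.swap)
  finally show "lA ((\<nu> \<star> squares) \<star> (\<nu> \<star> squares) \<otimes>\<^bsub>ZG\<^esub> c) = tr (carrier ZG) (\<lambda>x. flip x \<otimes>\<^bsub>ZG\<^esub> c)"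
    using trace_flip[OF c] klein_bottle[of c] by (simp add: center_group_alg)
qed (simp_all add: center_group_alg lin_flip conv_cf squares_cf mu_cf)

lemma lin_adj: "lin E E form.adj"
  by (rule linI) (simp_all add: adj_E form.adj_add form.adj_scale ED(1))

text \<open>In contrast to \<open>trace_two_sided\<close>, the adjoint interchanges the two indices
  of a matrix unit. The two index sums then merge into one trace in which the same group element
  acts twice. A basis with its dual replaces an orthonormal frame because the form may be
  indefinite.\<close>

lemma trace_adj_comp:
  assumes c: "c \<in> E"
  shows "tr E (\<lambda>x. form.adj x \<circ> c) = tr V (\<lambda>v. act squares (c v)) / N"
proof -
  obtain \<Gamma> d where F: "frame V \<Gamma> (\<lambda>x. x) (\<lambda>x. \<beta> (d x))" "frame V \<Gamma> d \<beta>"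
    by (rule form.dual_frame)
  note \<Gamma>V = frameD(2)[OF F(1)] frameD(2)[OF F(2)]
  have l: "lin E E (\<lambda>x. form.adj x \<circ> c)"
    using c by (intro linI E_comp adj_E)
      (auto simp: fun_eq_iff lin_add[OF lin_adj] lin_scale[OF lin_adj])
  have "tr E (\<lambda>x. form.adj x \<circ> c) =
      (\<Sum>i\<in>\<Gamma>. \<Sum>j\<in>\<Gamma>. \<beta> (d i) (form.adj (avg (elem (\<lambda>x. \<beta> (d x)) i j)) (c j)))"
    using trace_E[OF F(1) l] by simp
  also have "\<dots> = (\<Sum>i\<in>\<Gamma>. \<Sum>j\<in>\<Gamma>. \<Sum>g\<in>carrier G.
      (1 / N) * (\<beta> (d j) (r (inv g) (d i)) * \<beta> (r g i) (c j)))"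
  proof (intro sum.cong refl)
    fix i j assume ij: "i \<in> \<Gamma>" "j \<in> \<Gamma>"
    let ?e = "elem (\<lambda>x. \<beta> (d x)) i j"
    have e: "avg ?e \<in> E"
      using frame_End_set[OF F(1)] ij by (intro avg_E End_setD(1)) (auto dest: frameD(2)[of _ _ _ _ "(i, j)"])
    have m: "(\<Sum>g\<in>carrier G. \<beta> (d j) (r (inv g) (d i)) *\<^sub>R r g i) \<in> V"
      using \<Gamma>V ij r_mem by (intro subspace_sum subspace_scale subV) auto
    have "\<beta> (d i) (form.adj (avg ?e) (c j)) = \<beta> (avg ?e (d i)) (c j)"
      using form.adj[OF ED(1)[OF e]] \<Gamma>V ij ED(3)[OF c] by simp
    also have "avg ?e (d i) = (1 / N) *\<^sub>R (\<Sum>g\<in>carrier G. \<beta> (d j) (r (inv g) (d i)) *\<^sub>R r g i)"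
      using avg_elem[OF F(1) ij(1) \<Gamma>V(2)[OF ij(1)]] .
    also have "\<beta> \<dots> (c j) = (1 / N) * (\<Sum>g\<in>carrier G. \<beta> (d j) (r (inv g) (d i)) * \<beta> (r g i) (c j))"
      using form.scale_l[OF ED(3)[OF c \<Gamma>V(1)[OF ij(2)]] m, of "1 / N"]
        form.combination_l[OF ED(3)[OF c \<Gamma>V(1)[OF ij(2)]], of "carrier G" "\<lambda>g. r g i"] r_mem \<Gamma>V ij
      by simp
    finally show "\<beta> (d i) (form.adj (avg ?e) (c j)) =
        (\<Sum>g\<in>carrier G. (1 / N) * (\<beta> (d j) (r (inv g) (d i)) * \<beta> (r g i) (c j)))"
      by (simp add: sum_distrib_left)
  qed
  also have "\<dots> = (\<Sum>g\<in>carrier G. \<Sum>i\<in>\<Gamma>. \<Sum>j\<in>\<Gamma>.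
      (1 / N) * (\<beta> (d j) (r (inv g) (d i)) * \<beta> (r g i) (c j)))"
    by (subst sum.swap[where A = "carrier G"], rule sum.cong[OF refl], rule sum.swap)
  also have "\<dots> = (\<Sum>g\<in>carrier G. (1 / N) * tr V (\<lambda>v. act (group_elem (inv g \<otimes> inv g)) (c v)))"
  proof (rule sum.cong[OF refl])
    fix g assume g: "g \<in> carrier G"
    have "(\<Sum>j\<in>\<Gamma>. \<beta> (d j) (r (inv g) (d i)) * \<beta> (r g i) (c j)) = \<beta> i (act (group_elem (inv g \<otimes> inv g)) (c (d i)))"
      if i: "i \<in> \<Gamma>" for i
    proof -
      have w: "r (inv g) (d i) \<in> V"
        using g i \<Gamma>V r_mem by auto
      have "(\<Sum>j\<in>\<Gamma>. \<beta> (d j) (r (inv g) (d i)) * \<beta> (r g i) (c j)) =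
          \<beta> (r g i) (c (\<Sum>j\<in>\<Gamma>. \<beta> (d j) (r (inv g) (d i)) *\<^sub>R j))"
        using g i \<Gamma>V r_mem ED(3)[OF c]
        by (simp add: lin_combination[OF ED(2)[OF c] subV] form.combination_r)
      also have "\<dots> = \<beta> (r g i) (c (r (inv g) (d i)))"
        using frameD(4)[OF F(1) w] by simp
      also have "\<dots> = \<beta> i (r (inv g) (r (inv g) (c (d i))))"
        using g i \<Gamma>V ED(3,4)[OF c] by (simp add: form_shift r_mem)
      finally show ?thesis
        using g i \<Gamma>V ED(3)[OF c] by (simp add: act_elem act_mult)
    qed
    moreover have "tr V (\<lambda>v. act (group_elem (inv g \<otimes> inv g)) (c v)) =
        (\<Sum>i\<in>\<Gamma>. \<beta> i (act (group_elem (inv g \<otimes> inv g)) (c (d i))))"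
      by (rule trace_frame[OF F(2) subV lin_act_comp[OF c]])
    ultimately show "(\<Sum>i\<in>\<Gamma>. \<Sum>j\<in>\<Gamma>. (1 / N) * (\<beta> (d j) (r (inv g) (d i)) * \<beta> (r g i) (c j))) =
        (1 / N) * tr V (\<lambda>v. act (group_elem (inv g \<otimes> inv g)) (c v))"
      by (simp add: sum_divide_distrib[symmetric])
  qed
  also have "\<dots> = (\<Sum>g\<in>carrier G. (1 / N) * tr V (\<lambda>v. act (group_elem (g \<otimes> g)) (c v)))"
    by (rule sum_inv)
  also have "\<dots> = (1 / N) * tr V (\<lambda>v. \<Sum>g\<in>carrier G. act (group_elem (g \<otimes> g)) (c v))"
    by (simp add: sum_divide_distrib[symmetric] trace_sum[OF fdV lin_act_comp[OF c]])
  also have "tr V (\<lambda>v. \<Sum>g\<in>carrier G. act (group_elem (g \<otimes> g)) (c v)) = tr V (\<lambda>v. act squares (c v))"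
    by (intro trace_cong[OF fdV] lin_sum_fun subV lin_act_comp[OF c])
      (simp add: act_squares ED(3)[OF c] act_elem)
  also have "(1 / N) * \<dots> = \<dots> / N"
    by simp
  finally show ?thesis .
qed

text \<open>The \<open>\<mu>\<close> in \<open>lB\<close> cancels the \<open>\<nu>\<close> in the
  element U, so both sides pair with \<open>c\<close> to the trace of \<open>squares\<close> acting
  after \<open>c\<close>, divided by \<open>N\<close>.\<close>

lemma ph_U: "ph (\<nu> \<star> squares) = star_casimir (End_alg G \<rho>) lB form.adj"
proof (rule star_casimir_eqI[OF frobenius_B, symmetric])
  have U: "\<nu> \<star> squares \<in> cf"
    by (intro conv_cf mu_cf squares_cf)
  then show "ph (\<nu> \<star> squares) \<in> E"
    by (rule ph_E)
  fix c assume c: "c \<in> E"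
  have "lB (ph (\<nu> \<star> squares) \<circ> c) = tr V (\<lambda>v. act \<mu> ((ph (\<nu> \<star> squares) \<circ> c) v)) / N"
    using c U by (intro lB_eq E_comp ph_E)
  also have "tr V (\<lambda>v. act \<mu> ((ph (\<nu> \<star> squares) \<circ> c) v)) = tr V (\<lambda>v. act squares (c v))"
    using c U ED(3)[OF c]
    by (intro trace_cong[OF fdV lin_act_comp] E_comp ph_E) (auto simp: ph_apply act_conv act_mu_nu act_mem)
  finally show "lB (ph (\<nu> \<star> squares) \<otimes>\<^bsub>End_alg G \<rho>\<^esub> c) = tr E (\<lambda>x. form.adj x \<otimes>\<^bsub>End_alg G \<rho>\<^esub> c)"
    using trace_adj_comp[OF c] by (simp only: End_alg_simps)
qed (simp_all add: lin_adj)

lemma equipped: "equipped_cardy_frobenius (H_rep G \<rho> \<beta> \<mu>)"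
proof (intro equipped_cardy_frobenius.intro, unfold H_simps)
  show "cardy_frobenius ZG lA (End_alg G \<rho>) lB ph"
    by (rule cardy_frobenius)
  show "involutive_anti_aut ZG flip"
    by (auto simp: involutive_anti_aut_def center_group_alg lin_flip flip_flip cfD flip_conv)
  show "involutive_anti_aut (End_alg G \<rho>) form.adj"
    by (auto simp: involutive_anti_aut_def lin_adj form.adj_adj form.adj_comp ED(1))
  show "lA (flip x) = lA x" if "x \<in> carrier ZG" for x
  proof -
    have x: "x \<in> cf"
      using that by (simp add: center_group_alg)
    have "\<mu> \<star> \<mu> \<star> flip x = flip (x \<star> (\<mu> \<star> \<mu>))"
      by (simp add: flip_conv flip_mu)
    also have "x \<star> (\<mu> \<star> \<mu>) = \<mu> \<star> \<mu> \<star> x"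
      by (rule cf_conv_commute[OF x])
    finally show ?thesis
      by (simp add: lA_def flip_apply)
  qed
  show "lB (form.adj y) = lB y" if y: "y \<in> E" for y
  proof -
    have "tr V (\<lambda>v. act \<mu> (form.adj y v)) = tr V (ph \<mu> \<circ> form.adj y)"
      using ED(3)[OF adj_E[OF y]] by (intro trace_cong[OF fdV lin_act_comp[OF adj_E[OF y]]]) (simp add: ph_apply)
    \<comment> \<open>The action of \<open>\<mu>\<close> is self-adjoint because
      \<open>\<mu>\<close> is invariant under inversion.\<close>
    also have "ph \<mu> \<circ> form.adj y = form.adj (y \<circ> ph \<mu>)"
      using adj_act[OF mu_cf(1)] y by (simp add: form.adj_comp ED(1) ph_E mu_cf ph_def flip_mu)
        (metis ED(1) act_E form.adj_comp mu_cf(1))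
    also have "tr V \<dots> = tr V (y \<circ> ph \<mu>)"
      using y by (intro form.trace_adj ED(1) E_comp ph_E mu_cf)
    also have "\<dots> = tr V (\<lambda>v. act \<mu> (y v))"
      using y by (intro trace_cong[OF fdV] ED(2) E_comp ph_E mu_cf) (auto simp: ph_apply E_act)
    finally show ?thesis
      using y by (simp add: lB_eq adj_E)
  qed
  show "ph (flip x) = form.adj (ph x)" if "x \<in> carrier ZG" for x
    using that adj_act[of x] by (simp add: center_group_alg ph_def)
  show "\<nu> \<star> squares \<in> carrier ZG"
    by (simp add: center_group_alg conv_cf mu_cf squares_cf)
  show "\<nu> \<star> squares \<otimes>\<^bsub>ZG\<^esub> (\<nu> \<star> squares) = star_casimir ZG lA flip"
    using U_square by simp
  show "ph (\<nu> \<star> squares) = star_casimir (End_alg G \<rho>) lB form.adj"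
    by (rule ph_U)
qed

theorem semisimple: "semisimple_ecf (H_rep G \<rho> \<beta> \<mu>)"
  unfolding semisimple_ecf_def H_simps using equipped semisimple_ZG semisimple_End by simp

end

section \<open>Irreducible representations\<close>

lemma irreducibleD:
  assumes "irreducible_rep G \<pi>"
  shows "real_rep G \<pi>" "rep_space \<pi> \<noteq> {0}"
    "subspace W \<Longrightarrow> W \<subseteq> rep_space \<pi> \<Longrightarrow> (\<And>g w. g \<in> carrier G \<Longrightarrow> w \<in> W \<Longrightarrow> rep_act \<pi> g w \<in> W) \<Longrightarrow>
      W = {0} \<or> W = rep_space \<pi>"
  using assms by (auto simp: irreducible_rep_def)

lemma schur:
  assumes \<pi>: "irreducible_rep G \<pi>" and \<sigma>: "irreducible_rep G \<sigma>" and f: "intertwiner G \<pi> \<sigma> f"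
  shows "(\<forall>v\<in>rep_space \<pi>. f v = 0) \<or> bij_betw f (rep_space \<pi>) (rep_space \<sigma>)"
proof (rule disjCI)
  interpret \<pi>: real_rep G \<pi>
    by (rule irreducibleD(1)[OF \<pi>])
  interpret \<sigma>: real_rep G \<sigma>
    by (rule irreducibleD(1)[OF \<sigma>])
  let ?V = "rep_space \<pi>" and ?W = "rep_space \<sigma>"
  note lf = intertwinerD(1)[OF f] and fi = intertwinerD(2)[OF f]
  note sV = findim_subspace[OF \<pi>.space_fin_dim] and sW = findim_subspace[OF \<sigma>.space_fin_dim]
  assume nb: "\<not> bij_betw f ?V ?W"
  define K where "K = {v \<in> ?V. f v = 0}"
  have "K = {0} \<or> K = ?V"
  proof (rule irreducibleD(3)[OF \<pi>])
    show "subspace K"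
      unfolding K_def subspace_def
      using subspace_0[OF sV] subspace_add[OF sV] subspace_scale[OF sV] lin_0[OF lf sV] lin_add[OF lf]
        lin_scale[OF lf] by auto
    show "rep_act \<pi> g w \<in> K" if "g \<in> carrier G" "w \<in> K" for g w
      using that lin_mem[OF \<pi>.act_linear] lin_0[OF \<sigma>.act_linear sW] by (auto simp: K_def fi)
  qed (auto simp: K_def)
  moreover have "f ` ?V = {0} \<or> f ` ?V = ?W"
  proof (rule irreducibleD(3)[OF \<sigma>])
    show "subspace (f ` ?V)"
      unfolding subspace_def
    proof (intro conjI ballI allI)
      show "0 \<in> f ` ?V"
        using lin_0[OF lf sV] subspace_0[OF sV] by force
      fix x y c assume "x \<in> f ` ?V"
      then obtain u where u: "u \<in> ?V" "x = f u"
        by auto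
      then show "c *\<^sub>R x \<in> f ` ?V"
        using lin_scale[OF lf u(1), of c] subspace_scale[OF sV u(1), of c] by (metis image_eqI)
      assume "y \<in> f ` ?V"
      then obtain w where w: "w \<in> ?V" "y = f w"
        by auto
      then show "x + y \<in> f ` ?V"
        using u lin_add[OF lf u(1) w(1)] subspace_add[OF sV u(1) w(1)] by (metis image_eqI)
    qed
    show "f ` ?V \<subseteq> ?W"
      using lin_mem[OF lf] by auto
    show "rep_act \<sigma> g w \<in> f ` ?V" if "g \<in> carrier G" "w \<in> f ` ?V" for g w
      using that lin_mem[OF \<pi>.act_linear] by (auto simp: fi[symmetric])
  qed
  moreover have "inj_on f ?V" if "K = {0}"
  proof (rule inj_onI)
    fix x y assume xy: "x \<in> ?V" "y \<in> ?V" "f x = f y"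
    then have "x - y \<in> K"
      using lin_diff[OF lf sV] subspace_diff[OF sV] by (auto simp: K_def)
    then show "x = y"
      using that by auto
  qed
  ultimately show "\<forall>v\<in>?V. f v = 0"
    using nb subspace_0[OF sV] by (auto simp: K_def bij_betw_def)
qed

lemma intertwiner_isomorphic:
  "intertwiner G \<pi> \<sigma> f \<Longrightarrow> bij_betw f (rep_space \<pi>) (rep_space \<sigma>) \<Longrightarrow> rep_isomorphic G \<pi> \<sigma>"
  by (auto simp: rep_isomorphic_def intertwiner_def)

lemma schur_zero:
  assumes "irreducible_rep G \<pi>" "irreducible_rep G \<sigma>" "\<not> rep_isomorphic G \<pi> \<sigma>" "intertwiner G \<pi> \<sigma> f"
    "v \<in> rep_space \<pi>"
  shows "f v = 0"
  using schur[OF assms(1,2,4)] assms(3,5) intertwiner_isomorphic[OF assms(4)] by auto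

locale irr_form = form_rep G \<pi> b
  for G :: "('g, 'm) monoid_scheme" (structure) and \<pi> :: "('g, 'v::real_vector) rep" and b +
  assumes irr: "irreducible_rep G \<pi>"
    and form_pos: "u \<in> rep_space \<pi> \<Longrightarrow> u \<noteq> 0 \<Longrightarrow> b u u > 0"

sublocale irr_form \<subseteq> form: inner_space V b
  using form.fd form.lin_b form.sym form_pos by unfold_locales

lemma (in fin_rep) irr_form_ex:
  assumes "irreducible_rep G \<rho>"
  shows "\<exists>b. irr_form G \<rho> b"
proof -
  obtain b where b: "inner_space V b" "\<forall>g\<in>carrier G. \<forall>u\<in>V. \<forall>v\<in>V. b (r g u) (r g v) = b u v"
    using invariant_inner_ex by blast
  interpret i: inner_space V b
    by fact
  have "irr_form G \<rho> b"
    using b(2) i.nondeg i.sym i.lin_b i.pos assms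
    by unfold_locales (auto simp: invariant_form_def lin_real)
  then show ?thesis
    apply (rule_tac x = b in exI)
    by assumption
qed

section \<open>Quaternions\<close>

lemma quat_sel [simp]:
  "qRe (x + y) = qRe x + qRe y" "qI (x + y) = qI x + qI y" "qJ (x + y) = qJ x + qJ y" "qK (x + y) = qK x + qK y"
  "qRe (x - y) = qRe x - qRe y" "qI (x - y) = qI x - qI y" "qJ (x - y) = qJ x - qJ y" "qK (x - y) = qK x - qK y"
  "qRe (- x) = - qRe x" "qI (- x) = - qI x" "qJ (- x) = - qJ x" "qK (- x) = - qK x"
  "qRe (c *\<^sub>R x) = c * qRe x" "qI (c *\<^sub>R x) = c * qI x" "qJ (c *\<^sub>R x) = c * qJ x" "qK (c *\<^sub>R x) = c * qK x"
  "qRe 0 = 0" "qI 0 = 0" "qJ 0 = 0" "qK 0 = 0" "qRe 1 = 1" "qI 1 = 0" "qJ 1 = 0" "qK 1 = 0"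
  "qRe (qcnj x) = qRe x" "qI (qcnj x) = - qI x" "qJ (qcnj x) = - qJ x" "qK (qcnj x) = - qK x"
  by (simp_all add: plus_quat_def minus_quat_def uminus_quat_def scaleR_quat_def zero_quat_def one_quat_def
      qcnj_def)

lemma quat_mult_sel:
  "qRe (x * y) = qRe x * qRe y - qI x * qI y - qJ x * qJ y - qK x * qK y"
  "qI (x * y) = qRe x * qI y + qI x * qRe y + qJ x * qK y - qK x * qJ y"
  "qJ (x * y) = qRe x * qJ y - qI x * qK y + qJ x * qRe y + qK x * qI y"
  "qK (x * y) = qRe x * qK y + qI x * qJ y - qJ x * qI y + qK x * qRe y"
  by (simp_all add: times_quat_def)

lemma div_carrier_closed [simp]:
  "0 \<in> div_carrier D" "1 \<in> div_carrier D"
  "x \<in> div_carrier D \<Longrightarrow> y \<in> div_carrier D \<Longrightarrow> x + y \<in> div_carrier D"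
  "x \<in> div_carrier D \<Longrightarrow> y \<in> div_carrier D \<Longrightarrow> x * y \<in> div_carrier D"
  "x \<in> div_carrier D \<Longrightarrow> c *\<^sub>R x \<in> div_carrier D"
  "x \<in> div_carrier D \<Longrightarrow> - x \<in> div_carrier D"
  "x \<in> div_carrier D \<Longrightarrow> qcnj x \<in> div_carrier D"
  by (cases D; simp add: quat_mult_sel)+

lemma subspace_div_carrier: "subspace (div_carrier D)"
  by (simp add: subspace_def)

text \<open>Orthonormal for the real part of \<open>qcnj p * q\<close>, so that the coordinate of
  \<open>q\<close> along \<open>u\<close> is \<open>qRe (qcnj u * q)\<close>. This is the quantity
  that traces over a commutant produce.\<close>

fun div_basis :: "divalg \<Rightarrow> quat set" where
  "div_basis Div_R = {1}"
| "div_basis Div_C = {1, Quat 0 1 0 0}"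
| "div_basis Div_H = {1, Quat 0 1 0 0, Quat 0 0 1 0, Quat 0 0 0 1}"

fun div_dim :: "divalg \<Rightarrow> real" where
  "div_dim Div_R = 1"
| "div_dim Div_C = 2"
| "div_dim Div_H = 4"

lemma div_basis_finite: "finite (div_basis D)"
  by (cases D) auto

lemma div_basis_carrier: "u \<in> div_basis D \<Longrightarrow> u \<in> div_carrier D"
  by (cases D) auto

lemma div_basis_unit: "u \<in> div_basis D \<Longrightarrow> u * qcnj u = 1"
  by (cases D) (auto simp: quat_eq_iff quat_mult_sel)

lemma div_basis_card: "real (card (div_basis D)) = div_dim D"
  by (cases D) (auto simp: quat_eq_iff card_insert_if)

text \<open>The unit 1 contributes 1 and each of the d - 1 imaginary units contributes -1.\<close>

lemma div_basis_squares: "(\<Sum>u\<in>div_basis D. u * u) = of_real (2 - div_dim D)"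
  by (cases D) (simp_all add: quat_eq_iff quat_mult_sel of_real_def)

lemma div_basis_expand:
  "q \<in> div_carrier D \<Longrightarrow> (\<Sum>u\<in>div_basis D. qRe (qcnj u * q) *\<^sub>R u) = q"
  by (cases D) (simp_all add: quat_eq_iff quat_mult_sel)

lemma frame_div_carrier:
  "frame (div_carrier D) (div_basis D) (\<lambda>u. u) (\<lambda>u q. qRe (qcnj u * q))"
  by (auto simp: frame_def div_basis_finite div_basis_carrier div_basis_expand ring_distribs intro!: linI)

lemma findim_div_carrier: "findim (div_carrier D)"
  by (rule findim_frame[OF frame_div_carrier subspace_div_carrier])

lemma dim_div_carrier: "real (dim (div_carrier D)) = div_dim D"
proof -
  have "real (dim (div_carrier D)) = (\<Sum>u\<in>div_basis D. qRe (qcnj u * u))"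
    using trace_frame[OF frame_div_carrier subspace_div_carrier lin_id] trace_id[OF findim_div_carrier] by simp
  also have "\<dots> = (\<Sum>u\<in>div_basis D. 1)"
    by (cases D) (simp_all add: quat_eq_iff quat_mult_sel)
  finally show ?thesis
    by (simp add: div_basis_card)
qed

lemma div_dim_inj: "div_dim D = div_dim D' \<Longrightarrow> D = D'"
  by (cases D; cases D') auto

text \<open>Dimensions are traces of the identity, so cyclicity of the trace for \<open>f\<close>
  and its inverse compares them.\<close>

lemma dim_eq_bij:
  assumes "findim V" "findim W" "lin V W f" "bij_betw f V W"
  shows "dim V = dim W"
proof -
  define g where "g = the_inv_into V f"
  have inj: "inj_on f V" and im: "f ` V = W"
    using assms(4) by (auto simp: bij_betw_def)
  have gf: "g (f v) = v" if "v \<in> V" for v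
    unfolding g_def by (rule the_inv_into_f_f[OF inj that])
  have fg: "g w \<in> V" "f (g w) = w" if "w \<in> W" for w
    using that im gf by auto
  note s = findim_subspace[OF assms(1)] findim_subspace[OF assms(2)]
  have "lin W V g"
  proof (rule linI)
    fix x y c assume "x \<in> W" "y \<in> W"
    then show "g x \<in> V" "g (x + y) = g x + g y" "g (c *\<^sub>R x) = c *\<^sub>R g x"
      using fg gf[of "g x + g y"] gf[of "c *\<^sub>R g x"]
      by (auto simp: lin_add[OF assms(3)] lin_scale[OF assms(3)] subspace_add[OF s(1)] subspace_scale[OF s(1)])
  qed
  then have "tr V (\<lambda>x. g (f x)) = tr W (\<lambda>x. f (g x))"
    by (intro trace_comm assms)
  moreover have "tr V (\<lambda>x. x) = tr V (\<lambda>x. g (f x))" "tr W (\<lambda>x. x) = tr W (\<lambda>x. f (g x))"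
    using gf fg by (auto intro!: trace_cong assms lin_id)
  ultimately show ?thesis
    using trace_id[OF assms(1)] trace_id[OF assms(2)] by simp
qed

section \<open>The commutant of an irreducible representation\<close>

context irr_form
begin

abbreviation one :: "'v \<Rightarrow> 'v" where
  "one \<equiv> extend_zero V (\<lambda>v. v)"

abbreviation dm :: real where
  "dm \<equiv> real (dim V)"

lemma one_apply: "v \<in> V \<Longrightarrow> one v = v"
  by (simp add: extend_zero_def)

lemma E_zero: "0 \<in> E" and E_add: "x \<in> E \<Longrightarrow> y \<in> E \<Longrightarrow> x + y \<in> E" and E_scale: "x \<in> E \<Longrightarrow> c *\<^sub>R x \<in> E"
  and E_diff: "x \<in> E \<Longrightarrow> y \<in> E \<Longrightarrow> x - y \<in> E"
  using subspace_E by (auto simp: subspace_0 subspace_add subspace_scale subspace_diff)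

lemma dm_pos: "dm > 0"
proof -
  have "V \<noteq> {0}" "0 \<in> V"
    using irreducibleD(2)[OF irr] subspace_0[OF subV] by auto
  then have "{0} \<subset> V"
    by blast
  then show ?thesis
    using dim_less_subspace[OF fdV subspace_single_0] by auto
qed

text \<open>A self-adjoint operator has a real eigenvalue \<open>k\<close>. Then
  \<open>x - k *\<^sub>R one\<close> is an intertwiner with a kernel, hence zero by Schur's
  lemma.\<close>

lemma self_adjoint_scalar:
  assumes x: "x \<in> E" and sa: "form.adj x = x"
  obtains k where "x = k *\<^sub>R one"
proof -
  have "b (x u) v = b u (x v)" if "u \<in> V" "v \<in> V" for u v
    using form.adj[OF ED(1)[OF x] that] sa by simp
  then obtain k w where w: "w \<in> V" "w \<noteq> 0" "x w = k *\<^sub>R w"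
    using form.eigenvector_ex[OF ED(2)[OF x] _ irreducibleD(2)[OF irr]] by metis
  have y: "x - k *\<^sub>R one \<in> E"
    by (intro E_diff E_scale x E_one)
  have "(x - k *\<^sub>R one) w = (x - k *\<^sub>R one) 0"
    using w lin_0[OF ED(2)[OF x] subV] subspace_0[OF subV] by (simp add: extend_zero_def)
  then have "\<not> bij_betw (x - k *\<^sub>R one) V V"
    using w subspace_0[OF subV] by (auto simp: bij_betw_def inj_on_def)
  then have "\<forall>v\<in>V. (x - k *\<^sub>R one) v = 0"
    using schur[OF irr irr ED(5)[OF y]] by auto
  then have "x = k *\<^sub>R one"
    by (intro E_eqI x E_scale E_one) auto
  then show thesis
    by (rule that)
qed

definition re :: "('v \<Rightarrow> 'v) \<Rightarrow> real" where
  "re x = tr V x / dm"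

lemma tr_scale: "x \<in> E \<Longrightarrow> tr V (c *\<^sub>R x) = c * tr V x"
  using trace_scale[OF fdV ED(2), of x c] by (simp add: scaleR_fun_def)

lemma tr_add: "x \<in> E \<Longrightarrow> y \<in> E \<Longrightarrow> tr V (x + y) = tr V x + tr V y"
  using trace_add[OF fdV ED(2) ED(2), of x y] by (simp add: plus_fun_def)

lemma tr_one: "tr V one = dm"
  using trace_cong[OF fdV lin_id, of one] trace_id[OF fdV] by (simp add: one_apply)

lemma re_add: "x \<in> E \<Longrightarrow> y \<in> E \<Longrightarrow> re (x + y) = re x + re y"
  and re_scale: "x \<in> E \<Longrightarrow> re (c *\<^sub>R x) = c * re x"
  and re_diff: "x \<in> E \<Longrightarrow> y \<in> E \<Longrightarrow> re (x - y) = re x - re y"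
  and re_one: "re one = 1"
  and re_adj: "x \<in> E \<Longrightarrow> re (form.adj x) = re x"
  using dm_pos tr_add[OF _ E_scale, of x y "-1"] tr_scale[of y "-1"]
  by (simp_all add: re_def tr_add tr_scale tr_one add_divide_distrib diff_divide_distrib form.trace_adj ED(1))

lemma self_adjoint_re:
  assumes x: "x \<in> E" and sa: "form.adj x = x"
  shows "x = re x *\<^sub>R one"
  using self_adjoint_scalar[OF assms] re_scale[OF E_one] re_one by (metis mult.right_neutral)

text \<open>\<open>x + adj x\<close> is self-adjoint, hence a scalar, and the trace identifies it.
  So the adjoint is forced to act on the commutant as the standard conjugation.\<close>

lemma adj_eq: "x \<in> E \<Longrightarrow> form.adj x = (2 * re x) *\<^sub>R one - x"
proof -
  assume x: "x \<in> E"
  have "form.adj (x + form.adj x) = x + form.adj x"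
    using form.adj_add[OF ED(1)[OF x] ED(1)[OF adj_E[OF x]]] form.adj_adj[OF ED(1)[OF x]] by simp
  from self_adjoint_re[OF E_add[OF x adj_E[OF x]] this]
  have "x + form.adj x = (2 * re x) *\<^sub>R one"
    using re_add[OF x adj_E[OF x]] re_adj[OF x] by simp
  then show ?thesis
    by (simp add: algebra_simps)
qed

abbreviation Im :: "('v \<Rightarrow> 'v) set" where
  "Im \<equiv> {x \<in> E. re x = 0}"

lemma Im_adj: "x \<in> Im \<Longrightarrow> form.adj x = - x"
  using adj_eq[of x] by auto

lemma Im_square_neg:
  assumes x: "x \<in> Im" "x \<noteq> 0"
  shows "re (x \<circ> x) < 0"
proof -
  have "x \<circ> form.adj x = (-1) *\<^sub>R (x \<circ> x)"
    using Im_adj[OF x(1)] lin_neg[OF ED(2)] ED(3) x End_setD(2)[OF ED(1)] lin_0[OF ED(2) subV]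
    by (intro E_eqI E_comp E_scale adj_E) auto
  then have "tr V (x \<circ> form.adj x) = (-1) * tr V (x \<circ> x)"
    using tr_scale[OF E_comp, of x x "-1"] x(1) by (simp only: mem_Collect_eq)
  then show ?thesis
    using form.trace_adj_pos[OF ED(1) x(2)] x(1) dm_pos by (simp add: re_def divide_neg_pos)
qed

text \<open>Imaginary elements change sign under the adjoint, so the adjoint of
  \<open>x \<circ> y\<close> is \<open>y \<circ> x\<close>, and \<open>adj_eq\<close> for
  \<open>x \<circ> y\<close> is the claim. These are the relations of a Clifford algebra.\<close>

lemma anticommutator:
  assumes x: "x \<in> Im" and y: "y \<in> Im" and v: "v \<in> V"
  shows "x (y v) + y (x v) = (2 * re (x \<circ> y)) *\<^sub>R v"
proof -
  have E: "x \<in> E" "y \<in> E" "x \<circ> y \<in> E" "y \<circ> x \<in> E"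
    using x y E_comp by auto
  have neg: "- x = (-1) *\<^sub>R x" for x :: "'v \<Rightarrow> 'v"
    by simp
  have "form.adj (x \<circ> y) = y \<circ> x"
  proof -
    have "form.adj (x \<circ> y) = (- y) \<circ> (- x)"
      using form.adj_comp[OF ED(1) ED(1), OF E(1,2)] Im_adj[OF x] Im_adj[OF y] by simp
    also have "\<dots> = y \<circ> x"
      using E_scale[OF E(1), of "-1"] E_scale[OF E(2), of "-1"] lin_neg[OF ED(2)[OF E(2)]] ED(3)[OF E(1)]
      by (intro E_eqI E_comp E) auto
    finally show ?thesis .
  qed
  then show ?thesis
    using fun_cong[OF adj_eq[OF E(3)], of v] v by (simp add: one_apply)
qed

lemma Im_square: "x \<in> Im \<Longrightarrow> v \<in> V \<Longrightarrow> x (x v) = re (x \<circ> x) *\<^sub>R v"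
  using anticommutator[of x x v] by (simp add: scaleR_2[symmetric] scaleR_scaleR[symmetric] del: scaleR_scaleR)

lemma Im_lin: "x \<in> Im \<Longrightarrow> y \<in> Im \<Longrightarrow> x + c *\<^sub>R y \<in> Im"
  by (simp add: E_add E_scale re_add re_scale)

lemma Im_unit:
  assumes x: "x \<in> Im" "x \<noteq> 0"
  shows "\<exists>c. c *\<^sub>R x \<in> Im \<and> (\<forall>v\<in>V. (c *\<^sub>R x) ((c *\<^sub>R x) v) = - v) \<and>
    re ((c *\<^sub>R x) \<circ> (c *\<^sub>R x)) = -1"
proof -
  note neg = Im_square_neg[OF x]
  define c where "c = 1 / sqrt (- re (x \<circ> x))"
  have c: "c * c * re (x \<circ> x) = -1" "c \<noteq> 0"
    using neg by (auto simp: c_def field_simps)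
  have m: "c *\<^sub>R x \<in> Im"
    using x re_scale by (auto intro: E_scale)
  have sq: "(c *\<^sub>R x) ((c *\<^sub>R x) v) = - v" if v: "v \<in> V" for v
  proof -
    have xE: "x \<in> E"
      using x by auto
    have "(c *\<^sub>R x) ((c *\<^sub>R x) v) = c *\<^sub>R c *\<^sub>R x (x v)"
      using lin_scale[OF ED(2)[OF xE] ED(3)[OF xE v]] by simp
    also have "\<dots> = (c * c * re (x \<circ> x)) *\<^sub>R v"
      by (simp add: Im_square[OF x(1) v])
    finally show ?thesis
      by (simp add: c(1))
  qed
  have "(c *\<^sub>R x) \<circ> (c *\<^sub>R x) = (c * c) *\<^sub>R (x \<circ> x)"
    using x lin_scale[OF ED(2), of x] ED(3) by (intro E_eqI E_comp E_scale) auto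
  then have "re ((c *\<^sub>R x) \<circ> (c *\<^sub>R x)) = -1"
    using re_scale[OF E_comp, of x x "c * c"] x c by simp
  then show ?thesis
    using m sq by blast
qed

text \<open>The last clause, which carries conjugation to the adjoint, is what later turns the
  involution of a block into the conjugate transpose up to signs.\<close>

definition star_iso :: "divalg \<Rightarrow> (quat \<Rightarrow> 'v \<Rightarrow> 'v) \<Rightarrow> bool" where
  "star_iso D \<theta> \<longleftrightarrow> lin (div_carrier D) E \<theta> \<and> bij_betw \<theta> (div_carrier D) E \<and> \<theta> 1 = one \<and>
     (\<forall>p\<in>div_carrier D. \<forall>q\<in>div_carrier D. \<theta> (p * q) = \<theta> p \<circ> \<theta> q) \<and>
     (\<forall>q\<in>div_carrier D. \<theta> (qcnj q) = form.adj (\<theta> q))"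

definition quat_map :: "('v \<Rightarrow> 'v) \<Rightarrow> ('v \<Rightarrow> 'v) \<Rightarrow> ('v \<Rightarrow> 'v) \<Rightarrow> quat \<Rightarrow> 'v \<Rightarrow> 'v" where
  "quat_map i j k q = qRe q *\<^sub>R one + qI q *\<^sub>R i + qJ q *\<^sub>R j + qK q *\<^sub>R k"

lemma quat_map_E: "i \<in> E \<Longrightarrow> j \<in> E \<Longrightarrow> k \<in> E \<Longrightarrow> quat_map i j k q \<in> E"
  unfolding quat_map_def by (intro E_add E_scale E_one)

lemma lin_quat_map: "i \<in> E \<Longrightarrow> j \<in> E \<Longrightarrow> k \<in> E \<Longrightarrow> lin W E (quat_map i j k)"
  by (rule linI) (simp_all add: quat_map_E, simp_all add: quat_map_def algebra_simps)

lemma quat_map_one: "quat_map i j k 1 = one"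
  by (simp add: quat_map_def)

lemma re_quat_map:
  "i \<in> Im \<Longrightarrow> j \<in> Im \<Longrightarrow> k \<in> Im \<Longrightarrow> re (quat_map i j k q) = qRe q"
  unfolding quat_map_def by (simp add: re_add re_scale re_one E_add E_scale E_one)

lemma quat_map_adj:
  assumes "i \<in> Im" "j \<in> Im" "k \<in> Im"
  shows "quat_map i j k (qcnj q) = form.adj (quat_map i j k q)"
proof -
  have "form.adj (quat_map i j k q) = (2 * qRe q) *\<^sub>R one - quat_map i j k q"
    using adj_eq[OF quat_map_E, of i j k q] re_quat_map[OF assms] assms by simp
  also have "\<dots> = quat_map i j k (qcnj q)"
    unfolding quat_map_def by (simp add: algebra_simps scaleR_2 scaleR_scaleR[symmetric] del: scaleR_scaleR)
  finally show ?thesis ..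
qed

text \<open>Adjoints are preserved by \<open>quat_map_adj\<close>, and injectivity follows because
  the real part of \<open>qcnj q * q\<close> is the sum of the squared coordinates. Only
  multiplicativity and the generation of \<open>Im\<close> remain to be checked for each of the
  three algebras.\<close>

lemma star_iso_quat_map:
  assumes Im: "i \<in> Im" "j \<in> Im" "k \<in> Im"
    and mult: "\<And>p q v. p \<in> div_carrier D \<Longrightarrow> q \<in> div_carrier D \<Longrightarrow> v \<in> V \<Longrightarrow>
      quat_map i j k (p * q) v = quat_map i j k p (quat_map i j k q v)"
    and span: "\<And>x. x \<in> Im \<Longrightarrow> \<exists>q\<in>div_carrier D. x = quat_map i j k q"
  shows "star_iso D (quat_map i j k)"
proof -
  let ?\<theta> = "quat_map i j k"
  have E: "i \<in> E" "j \<in> E" "k \<in> E"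
    using Im by auto
  note l = lin_quat_map[OF E, of "div_carrier D"]
  have m: "?\<theta> (p * q) = ?\<theta> p \<circ> ?\<theta> q" if "p \<in> div_carrier D" "q \<in> div_carrier D" for p q
    using mult[OF that] by (intro E_eqI E_comp quat_map_E E) auto
  have "inj_on ?\<theta> (div_carrier D)"
  proof (rule inj_onI)
    fix p q assume pq: "p \<in> div_carrier D" "q \<in> div_carrier D" "?\<theta> p = ?\<theta> q"
    let ?d = "p - q"
    have d: "?d \<in> div_carrier D"
      using pq subspace_diff[OF subspace_div_carrier] by blast
    have "?\<theta> ?d = 0"
      using lin_diff[OF l subspace_div_carrier pq(1,2)] pq(3) by simp
    then have "?\<theta> (qcnj ?d * ?d) = (\<lambda>v. ?\<theta> (qcnj ?d) 0)"
      using m[of "qcnj ?d" ?d] d by (simp add: fun_eq_iff)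
    also have "\<dots> = 0"
      using lin_0[OF ED(2)[OF quat_map_E[OF E]] subV] by auto
    finally have "re (?\<theta> (qcnj ?d * ?d)) = 0"
      using re_scale[OF E_one, of 0] by simp
    then have "qRe (qcnj ?d * ?d) = 0"
      using re_quat_map[OF Im] by simp
    then have "(qRe ?d)\<^sup>2 + (qI ?d)\<^sup>2 + (qJ ?d)\<^sup>2 + (qK ?d)\<^sup>2 = 0"
      by (simp add: quat_mult_sel power2_eq_square algebra_simps)
    moreover have "(qRe ?d)\<^sup>2 \<ge> 0" "(qI ?d)\<^sup>2 \<ge> 0" "(qJ ?d)\<^sup>2 \<ge> 0" "(qK ?d)\<^sup>2 \<ge> 0"
      by auto
    ultimately have "(qRe ?d)\<^sup>2 = 0" "(qI ?d)\<^sup>2 = 0" "(qJ ?d)\<^sup>2 = 0" "(qK ?d)\<^sup>2 = 0"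
      by linarith+
    then show "p = q"
      by (simp add: quat_eq_iff)
  qed
  moreover have "x \<in> ?\<theta> ` div_carrier D" if x: "x \<in> E" for x
  proof -
    have "x - re x *\<^sub>R one \<in> Im"
      using x re_diff[OF x E_scale[OF E_one]] re_scale[OF E_one] re_one
      by (auto intro: E_diff E_scale E_one)
    then obtain q where q: "q \<in> div_carrier D" "x - re x *\<^sub>R one = ?\<theta> q"
      using span by blast
    have "?\<theta> (q + re x *\<^sub>R 1) = x"
      using lin_add[OF l q(1), of "re x *\<^sub>R 1"] lin_scale[OF l, of 1 "re x"]
      by (simp add: quat_map_one q(2)[symmetric])
    then show ?thesis
      using q(1) by (metis div_carrier_closed(2,3,5) image_eqI)
  qed
  ultimately show ?thesis
    using l m quat_map_adj[OF Im] quat_map_E[OF E] by (auto simp: star_iso_def bij_betw_def quat_map_one)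
qed

text \<open>
  Every \<open>x\<close> in \<open>Im\<close> squares to a non-positive scalar; an element of \<open>Im\<close>
  orthogonal to \<open>i\<close>, \<open>j\<close> and \<open>i j\<close> commutes and anticommutes with \<open>i j\<close>, hence vanishes.
\<close>

lemma star_iso_ex: "\<exists>D \<theta>. star_iso D \<theta>"
proof (cases "Im = {0}")
  case True
  then have Z: "(0 :: 'v \<Rightarrow> 'v) \<in> Im"
    by auto
  \<comment> \<open>Real elements have no imaginary coordinates, so the slots for i, j and k are
    filled with zero.\<close>
  have "star_iso Div_R (quat_map 0 0 0)"
  proof (rule star_iso_quat_map[OF Z Z Z])
    fix x assume "x \<in> Im"
    then show "\<exists>q\<in>div_carrier Div_R. x = quat_map 0 0 0 q"
      using True by (intro bexI[of _ 0]) (auto simp: quat_map_def)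
  qed (simp add: quat_map_def quat_mult_sel one_apply subspace_scale[OF subV])
  then show ?thesis
    by blast
next
  case False
  have Z: "(0 :: 'v \<Rightarrow> 'v) \<in> Im"
    using E_zero re_scale[OF E_one, of 0] by auto
  obtain i0 where "i0 \<in> Im" "i0 \<noteq> 0"
    using False Z by blast
  from Im_unit[OF this] obtain c0 where c0: "c0 *\<^sub>R i0 \<in> Im \<and>
    (\<forall>v\<in>V. (c0 *\<^sub>R i0) ((c0 *\<^sub>R i0) v) = - v) \<and> re ((c0 *\<^sub>R i0) \<circ> (c0 *\<^sub>R i0)) = -1"
    by (rule exE)
  define i where "i = c0 *\<^sub>R i0"
  have i: "i \<in> Im" "v \<in> V \<Longrightarrow> i (i v) = - v" "re (i \<circ> i) = -1" for v
    using c0 unfolding i_def[symmetric] by simp_all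
  have li: "lin V V i" and iE: "i \<in> E" and iV: "\<And>v. v \<in> V \<Longrightarrow> i v \<in> V"
    using ED i(1) by auto
  show ?thesis
  proof (cases "\<exists>x\<in>Im. \<forall>c. x \<noteq> c *\<^sub>R i")
    case False
    have "star_iso Div_C (quat_map i 0 0)"
    proof (rule star_iso_quat_map[OF i(1) Z Z])
      fix x assume "x \<in> Im"
      then obtain c where "x = c *\<^sub>R i"
        using False by blast
      then show "\<exists>q\<in>div_carrier Div_C. x = quat_map i 0 0 q"
        by (intro bexI[of _ "Quat 0 c 0 0"]) (auto simp: quat_map_def)
    next
      fix p q v assume "p \<in> div_carrier Div_C" "q \<in> div_carrier Div_C" and v: "v \<in> V"
      then show "quat_map i 0 0 (p * q) v = quat_map i 0 0 p (quat_map i 0 0 q v)"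
        using iV[OF v]
        by (simp add: quat_map_def quat_mult_sel one_apply subspace_scale[OF subV] subspace_add[OF subV]
            lin_add[OF li] lin_scale[OF li] i(2) algebra_simps)
    qed
    then show ?thesis
      by blast
  next
    case True
    then obtain x where x: "x \<in> Im" "\<And>c. x \<noteq> c *\<^sub>R i"
      by blast
    have ortho: "re (i \<circ> (x + re (i \<circ> x) *\<^sub>R i)) = 0" if "x \<in> Im" for x
    proof -
      have "i \<circ> (x + re (i \<circ> x) *\<^sub>R i) = (i \<circ> x) + re (i \<circ> x) *\<^sub>R (i \<circ> i)"
        using that iE ED(3) by (intro E_eqI E_comp E_add E_diff E_scale)
          (auto simp: lin_add[OF li] lin_diff[OF li subV] lin_scale[OF li] subspace_scale[OF subV])
      then show ?thesis
        using re_add[OF E_comp E_scale[OF E_comp], of i x i i "re (i \<circ> x)"] re_scale[OF E_comp, of i i] iE i(3) that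
        by simp
    qed
    \<comment> \<open>Removes the component of \<open>x\<close> along \<open>i\<close>; the sign is
      plus because \<open>re (i \<circ> i) = -1\<close>.\<close>
    define j0 where "j0 = x + re (i \<circ> x) *\<^sub>R i"
    have j0: "j0 \<in> Im" "j0 \<noteq> 0" "re (i \<circ> j0) = 0"
      unfolding j0_def using Im_lin[OF x(1) i(1)] x(2)[of "- re (i \<circ> x)"] ortho[OF x(1)]
      by (auto simp: eq_neg_iff_add_eq_0)
    from Im_unit[OF j0(1,2)] obtain c where c: "c *\<^sub>R j0 \<in> Im \<and>
      (\<forall>v\<in>V. (c *\<^sub>R j0) ((c *\<^sub>R j0) v) = - v) \<and> re ((c *\<^sub>R j0) \<circ> (c *\<^sub>R j0)) = -1"
      by (rule exE)
    define j where "j = c *\<^sub>R j0"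
    have j: "j \<in> Im" "v \<in> V \<Longrightarrow> j (j v) = - v" "re (j \<circ> j) = -1" for v
      using c unfolding j_def[symmetric] by simp_all
    have lj: "lin V V j" and jE: "j \<in> E" and jV: "\<And>v. v \<in> V \<Longrightarrow> j v \<in> V"
      using ED j(1) by auto
    have "i \<circ> j = c *\<^sub>R (i \<circ> j0)"
      using iE j0(1) ED(3) unfolding j_def by (intro E_eqI E_comp E_scale) (auto simp: lin_scale[OF li])
    then have reij: "re (i \<circ> j) = 0"
      using re_scale[OF E_comp, of i j0 c] iE j0 by simp
    then have ji: "j (i v) = - i (j v)" if "v \<in> V" for v
      using anticommutator[OF i(1) j(1) that] by (simp add: eq_neg_iff_add_eq_0 add.commute)
    define k where "k = i \<circ> j"
    have k: "k \<in> Im"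
      using reij E_comp iE jE by (auto simp: k_def)
    have kE: "k \<in> E"
      using k by auto
    have "star_iso Div_H (quat_map i j k)"
    proof (rule star_iso_quat_map[OF i(1) j(1) k])
      fix p q v assume v: "v \<in> V"
      have m: "c *\<^sub>R w \<in> V" "w + w' \<in> V" if "w \<in> V" "w' \<in> V" for c w w'
        using that by (auto simp: subspace_scale[OF subV] subspace_add[OF subV])
      show "quat_map i j k (p * q) v = quat_map i j k p (quat_map i j k q v)"
        using v
        by (simp add: quat_map_def quat_mult_sel one_apply m k_def iV jV lin_add[OF li] lin_scale[OF li]
            lin_add[OF lj] lin_scale[OF lj] lin_neg[OF li] lin_neg[OF lj] lin_diff[OF li subV] lin_diff[OF lj subV]
            subspace_diff[OF subV] i(2) j(2) ji algebra_simps)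
    next
      fix y assume y: "y \<in> Im"
      \<comment> \<open>Removes the components of \<open>y\<close> along \<open>i\<close>,
        \<open>j\<close> and \<open>k\<close>, again with plus signs because each of the three
        squares to -1.\<close>
      define z where "z = y + re (i \<circ> y) *\<^sub>R i + re (j \<circ> y) *\<^sub>R j + re (k \<circ> y) *\<^sub>R k"
      have z: "z \<in> Im"
        unfolding z_def by (intro Im_lin i j k y)
      have yE: "y \<in> E" and zE: "z \<in> E"
        using y z by auto
      have rk: "re (k \<circ> k) = -1"
      proof -
        have "k \<circ> k = (-1) *\<^sub>R one"
          using iE jE kE
          by (intro E_eqI E_comp E_scale E_one)
            (auto simp: k_def ji iV jV i(2) j(2) lin_neg[OF li] one_apply)
        then show ?thesis
          using re_scale[OF E_one, of "-1"] re_one by simp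
      qed
      have r0: "re (i \<circ> k) = 0" "re (j \<circ> k) = 0" "re (j \<circ> i) = 0" "re (k \<circ> i) = 0" "re (k \<circ> j) = 0"
      proof -
        have eqs: "i \<circ> k = (-1) *\<^sub>R j" "j \<circ> k = 1 *\<^sub>R i" "j \<circ> i = (-1) *\<^sub>R k" "k \<circ> i = 1 *\<^sub>R j" "k \<circ> j = (-1) *\<^sub>R i"
          using iE jE kE
          by (intro E_eqI E_comp E_scale; auto simp: k_def ji iV jV i(2) j(2) lin_neg[OF li] lin_neg[OF lj])+
        show "re (i \<circ> k) = 0" "re (j \<circ> k) = 0" "re (j \<circ> i) = 0" "re (k \<circ> i) = 0" "re (k \<circ> j) = 0"
          unfolding eqs re_scale[OF iE] re_scale[OF jE] re_scale[OF kE] using i(1) j(1) k by auto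
      qed
      have expand: "re (u \<circ> z) = re (u \<circ> y) + re (i \<circ> y) * re (u \<circ> i) + re (j \<circ> y) * re (u \<circ> j) + re (k \<circ> y) * re (u \<circ> k)"
        if u: "u \<in> E" for u
      proof -
        have "u \<circ> z = (u \<circ> y) + re (i \<circ> y) *\<^sub>R (u \<circ> i) + re (j \<circ> y) *\<^sub>R (u \<circ> j) + re (k \<circ> y) *\<^sub>R (u \<circ> k)"
          unfolding z_def using yE iE jE kE u ED(3)
          by (intro E_eqI E_comp E_add E_diff E_scale)
            (auto simp: lin_add[OF ED(2)[OF u]] lin_diff[OF ED(2)[OF u] subV] lin_scale[OF ED(2)[OF u]]
              subspace_scale[OF subV] subspace_add[OF subV] subspace_diff[OF subV])
        then show ?thesis
          using yE iE jE kE u by (simp add: re_add re_scale E_comp E_add E_scale)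
      qed
      have "re (i \<circ> z) = 0" "re (j \<circ> z) = 0" "re (k \<circ> z) = 0"
        using expand[OF iE] expand[OF jE] expand[OF kE] i(3) j(3) rk reij r0 by (simp_all add: k_def)
      then have a: "z (i v) = - i (z v)" "z (j v) = - j (z v)" "z (k v) = - k (z v)" if "v \<in> V" for v
        using anticommutator[OF i(1) z that] anticommutator[OF j(1) z that] anticommutator[OF k z that]
        by (simp_all add: eq_neg_iff_add_eq_0 add.commute)
      have zz: "lin V V z" "\<And>v. v \<in> V \<Longrightarrow> z v \<in> V"
        using ED[OF zE] by auto
      have "z v = 0" if v: "v \<in> V" for v
      proof -
        have "z (k v) = k (z v)"
          using v by (simp add: k_def a(1)[OF jV[OF v]] a(2)[OF v] lin_neg[OF li] jV zz(2))
        then have "k (z v) = - k (z v)"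
          using a(3)[OF v] by simp
        then have "2 *\<^sub>R k (z v) = 0"
          unfolding scaleR_2 by (metis add.right_inverse)
        then have "k (z v) = 0"
          by simp
        then have "- z v = 0"
          using v i(2)[of "z v"] j(2)[of "z v"] lin_0[OF li subV] lin_0[OF lj subV] i(2)[OF jV[OF zz(2)[OF v]]]
            zz(2)[OF v] by (simp add: k_def)
        then show ?thesis
          by simp
      qed
      then have "z = 0"
        using zE E_zero by (intro E_eqI) auto
      then have "y + (re (i \<circ> y) *\<^sub>R i + re (j \<circ> y) *\<^sub>R j + re (k \<circ> y) *\<^sub>R k) = 0"
        by (simp add: z_def add.assoc)
      then have "y = - (re (i \<circ> y) *\<^sub>R i + re (j \<circ> y) *\<^sub>R j + re (k \<circ> y) *\<^sub>R k)"
        by (simp only: eq_neg_iff_add_eq_0)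
      then have "y = quat_map i j k (Quat 0 (- re (i \<circ> y)) (- re (j \<circ> y)) (- re (k \<circ> y)))"
        by (simp add: quat_map_def)
      then show "\<exists>q\<in>div_carrier Div_H. y = quat_map i j k q"
        by (intro bexI[of _ "Quat 0 (- re (i \<circ> y)) (- re (j \<circ> y)) (- re (k \<circ> y))"]) auto
    qed
    then show ?thesis
      by blast
  qed
qed

end

section \<open>Orthogonality\<close>

lemma lin_inverse:
  assumes f: "lin V W f" "bij_betw f V W" and V: "subspace V"
  shows "lin W V (the_inv_into V f)"
    and "\<And>v. v \<in> V \<Longrightarrow> the_inv_into V f (f v) = v"
    and "\<And>w. w \<in> W \<Longrightarrow> the_inv_into V f w \<in> V"
    and "\<And>w. w \<in> W \<Longrightarrow> f (the_inv_into V f w) = w"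
proof -
  let ?g = "the_inv_into V f"
  have inj: "inj_on f V" and im: "f ` V = W"
    using f(2) by (auto simp: bij_betw_def)
  show gf: "?g (f v) = v" if "v \<in> V" for v
    by (rule the_inv_into_f_f[OF inj that])
  show fg: "?g w \<in> V" "f (?g w) = w" if "w \<in> W" for w
    using that im gf by auto
  show "lin W V ?g"
  proof (rule linI)
    fix x y c assume "x \<in> W" "y \<in> W"
    then show "?g x \<in> V" "?g (x + y) = ?g x + ?g y" "?g (c *\<^sub>R x) = c *\<^sub>R ?g x"
      using fg gf[of "?g x + ?g y"] gf[of "c *\<^sub>R ?g x"]
      by (auto simp: lin_add[OF f(1)] lin_scale[OF f(1)] subspace_add[OF V] subspace_scale[OF V])
  qed
qed


locale irr_data = irr_form G \<pi> b
  for G :: "('g, 'm) monoid_scheme" (structure) and \<pi> :: "('g, 'v::real_vector) rep" and b +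
  fixes D :: divalg and \<theta> :: "quat \<Rightarrow> 'v \<Rightarrow> 'v"
  assumes star_iso: "star_iso D \<theta>"
begin

lemma theta_lin: "lin (div_carrier D) E \<theta>"
  and theta_bij: "bij_betw \<theta> (div_carrier D) E"
  and theta_one: "\<theta> 1 = one"
  and theta_mult: "p \<in> div_carrier D \<Longrightarrow> q \<in> div_carrier D \<Longrightarrow> \<theta> (p * q) = \<theta> p \<circ> \<theta> q"
  and theta_cnj: "q \<in> div_carrier D \<Longrightarrow> \<theta> (qcnj q) = form.adj (\<theta> q)"
  using star_iso by (auto simp: star_iso_def)

lemma theta_E: "q \<in> div_carrier D \<Longrightarrow> \<theta> q \<in> E"
  by (rule lin_mem[OF theta_lin])

lemma theta_apply: "q \<in> div_carrier D \<Longrightarrow> v \<in> V \<Longrightarrow> \<theta> q v \<in> V"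
  by (rule ED(3)[OF theta_E])

lemma theta_ex: "x \<in> E \<Longrightarrow> \<exists>q\<in>div_carrier D. \<theta> q = x"
  using bij_betw_imp_surj_on[OF theta_bij] by (metis imageE)

text \<open>\<open>q\<close> and \<open>qcnj q\<close> have equal traces because conjugation becomes
  the adjoint, and their sum is real.\<close>

lemma tr_theta: "q \<in> div_carrier D \<Longrightarrow> tr V (\<theta> q) = dm * qRe q"
proof -
  assume q: "q \<in> div_carrier D"
  have "q + qcnj q = (2 * qRe q) *\<^sub>R 1"
    by (simp add: quat_eq_iff)
  then have "\<theta> q + form.adj (\<theta> q) = (2 * qRe q) *\<^sub>R one"
    using lin_add[OF theta_lin q, of "qcnj q"] lin_scale[OF theta_lin, of 1 "2 * qRe q"] q
    by (simp add: theta_one theta_cnj)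
  then have "tr V (\<theta> q) + tr V (form.adj (\<theta> q)) = 2 * qRe q * dm"
    using tr_add[OF theta_E[OF q] adj_E[OF theta_E[OF q]]] tr_scale[OF E_one, of "2 * qRe q"] by (simp add: tr_one)
  then show ?thesis
    by (simp add: form.trace_adj ED(1)[OF theta_E[OF q]])
qed

lemma trace_rank_one: "y \<in> V \<Longrightarrow> z \<in> V \<Longrightarrow> tr V (\<lambda>w. b y w *\<^sub>R z) = b y z"
proof -
  assume yz: "y \<in> V" "z \<in> V"
  obtain \<Gamma> where F: "frame V \<Gamma> (\<lambda>x. x) b"
    using form.orthonormal_frame by blast
  have "tr V (\<lambda>w. b y w *\<^sub>R z) = (\<Sum>e\<in>\<Gamma>. b e (b y e *\<^sub>R z))"
    using yz by (intro trace_frame[OF F subV] lin_scaleR_vec form.lin_b subV)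
  also have "\<dots> = b y (\<Sum>e\<in>\<Gamma>. b e z *\<^sub>R e)"
    using yz frameD(2)[OF F] by (simp add: form.combination_r form.scale_r mult.commute)
  finally show ?thesis
    using frameD(4)[OF F yz(2)] by simp
qed

text \<open>
  Averaging the rank one map \<open>w \<mapsto> b(y, w) v\<close> gives an element of the commutant,
  which is expanded in the orthonormal basis \<open>1, i, j, k\<close> by means of the trace.
\<close>

lemma schur_orthogonality:
  assumes y: "y \<in> V" and v: "v \<in> V" and w: "w \<in> V"
  shows "(\<Sum>g\<in>carrier G. b y (r (inv g) w) *\<^sub>R r g v) =
    (N / dm) *\<^sub>R (\<Sum>u\<in>div_basis D. b y (\<theta> (qcnj u) v) *\<^sub>R \<theta> u w)"
proof -
  define X where "X = (\<lambda>w. b y w *\<^sub>R v)"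
  have lX: "lin V V X"
    unfolding X_def by (intro lin_scaleR_vec form.lin_b subV y v)
  define P where "P = extend_zero V (\<lambda>w. \<Sum>g\<in>carrier G. r g (X (r (inv g) w)))"
  have P: "P \<in> E"
    unfolding P_def by (intro E_extend avg_intertwiner real_rep_axioms lX)
  have P_apply: "P w = (\<Sum>g\<in>carrier G. b y (r (inv g) w) *\<^sub>R r g v)" if "w \<in> V" for w
    using that v by (simp add: P_def extend_zero_def X_def lin_scale[OF act_linear])
  obtain q where q: "q \<in> div_carrier D" "\<theta> q = P"
    using theta_ex[OF P] by blast
  \<comment> \<open>The trace of \<open>\<theta> (qcnj u) \<circ> P\<close> is computed twice. By
    \<open>tr_theta\<close> it is \<open>dm\<close> times the coordinate of \<open>q\<close> along
    \<open>u\<close>; and since \<open>\<theta> (qcnj u)\<close> commutes with \<open>G\<close>,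
    each of the \<open>N\<close> summands of \<open>P\<close> contributes the trace of the same rank
    one map.\<close>
  have coeff: "dm * qRe (qcnj u * q) = N * b y (\<theta> (qcnj u) v)" if u: "u \<in> div_basis D" for u
  proof -
    note cu = div_carrier_closed(7)[OF div_basis_carrier[OF u]]
    let ?t = "\<theta> (qcnj u)"
    note t = theta_E[OF cu]
    have ltX: "lin V V (\<lambda>w. ?t (X w))"
      by (rule lin_comp[OF lX ED(2)[OF t]])
    have Xm: "X x \<in> V" if "x \<in> V" for x
      by (rule lin_mem[OF lX that])
    have lg: "lin V V (\<lambda>w. ?t (X (r (inv g) w)))" if "g \<in> carrier G" for g
      using lin_comp[OF act_linear ltX, of "inv g"] that by simp
    have "dm * qRe (qcnj u * q) = tr V (?t \<circ> P)"
      using tr_theta[OF div_carrier_closed(4)[OF cu q(1)]] theta_mult[OF cu q(1)] q(2) by simp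
    also have "\<dots> = tr V (\<lambda>w. \<Sum>g\<in>carrier G. r g (?t (X (r (inv g) w))))"
    proof (rule trace_cong[OF fdV ED(2)[OF E_comp[OF t P]]])
      fix w assume w: "w \<in> V"
      have "(?t \<circ> P) w = (\<Sum>g\<in>carrier G. ?t (r g (X (r (inv g) w))))"
        using w Xm r_mem by (simp add: P_def extend_zero_def lin_sum[OF ED(2)[OF t] subV])
      then show "(?t \<circ> P) w = (\<Sum>g\<in>carrier G. r g (?t (X (r (inv g) w))))"
        using w Xm r_mem by (simp add: ED(4)[OF t])
    qed
    also have "\<dots> = (\<Sum>g\<in>carrier G. tr V (\<lambda>w. r g (?t (X (r (inv g) w)))))"
      by (intro trace_sum[OF fdV] lin_comp[OF lg act_linear])
    also have "\<dots> = (\<Sum>g\<in>carrier G. tr V (\<lambda>w. ?t (X w)))"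
    proof (rule sum.cong[OF refl])
      fix g assume g: "g \<in> carrier G"
      have "tr V (\<lambda>w. r g (?t (X (r (inv g) w)))) = tr V (\<lambda>w. ?t (X (r (inv g) (r g w))))"
        using trace_comm[OF fdV fdV lg[OF g] act_linear[OF g]] .
      also have "\<dots> = tr V (\<lambda>w. ?t (X w))"
        using g by (intro trace_cong[OF fdV, symmetric] ltX) (simp add: r_inv)
      finally show "tr V (\<lambda>w. r g (?t (X (r (inv g) w)))) = tr V (\<lambda>w. ?t (X w))" .
    qed
    also have "\<dots> = N * tr V (\<lambda>w. b y w *\<^sub>R ?t v)"
      using v trace_cong[OF fdV ltX, of "\<lambda>w. b y w *\<^sub>R ?t v"] by (simp add: X_def lin_scale[OF ED(2)[OF t]])
    also have "\<dots> = N * b y (?t v)"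
      using trace_rank_one[OF y ED(3)[OF t v]] by simp
    finally show ?thesis .
  qed
  have "P w = \<theta> (\<Sum>u\<in>div_basis D. qRe (qcnj u * q) *\<^sub>R u) w"
    using q div_basis_expand by simp
  also have "\<dots> = (\<Sum>u\<in>div_basis D. qRe (qcnj u * q) *\<^sub>R \<theta> u w)"
    by (simp add: lin_combination[OF theta_lin subspace_div_carrier] div_basis_carrier sum_fun_apply)
  also have "\<dots> = (\<Sum>u\<in>div_basis D. (N / dm) *\<^sub>R b y (\<theta> (qcnj u) v) *\<^sub>R \<theta> u w)"
  proof (rule sum.cong[OF refl])
    fix u assume "u \<in> div_basis D"
    from coeff[OF this] have "qRe (qcnj u * q) = N / dm * b y (\<theta> (qcnj u) v)"
      using dm_pos by (simp add: field_simps)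
    then show "qRe (qcnj u * q) *\<^sub>R \<theta> u w = (N / dm) *\<^sub>R b y (\<theta> (qcnj u) v) *\<^sub>R \<theta> u w"
      by simp
  qed
  finally show ?thesis
    using P_apply[OF w] by (simp add: scaleR_sum_right)
qed

lemma chr_expand:
  assumes F: "frame V \<Gamma> (\<lambda>x. x) b" and z: "z \<in> E" and g: "g \<in> carrier G"
  shows "chr z g = (\<Sum>e\<in>\<Gamma>. b (form.adj z e) (r (inv g) e))"
proof -
  have "chr z g = (\<Sum>e\<in>\<Gamma>. b e (z (r (inv g) e)))"
    using g trace_frame[OF F subV lin_E_r[OF z]] by (simp add: chr_def extend_zero_def)
  also have "\<dots> = (\<Sum>e\<in>\<Gamma>. b (form.adj z e) (r (inv g) e))"
    using frameD(2)[OF F] g r_mem by (intro sum.cong refl) (simp add: form.adj'[OF ED(1)[OF z]])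
  finally show ?thesis .
qed

text \<open>In an orthonormal frame \<open>chr z\<close> is a sum of matrix coefficients, and
  \<open>schur_orthogonality\<close> applies to each of them. Summing over the frame then
  reassembles \<open>z (\<theta> (qcnj u) w)\<close>.\<close>

lemma act_chr:
  assumes z: "z \<in> E" and w: "w \<in> V"
  shows "act (chr z) w = (N / dm) *\<^sub>R (\<Sum>u\<in>div_basis D. \<theta> u (z (\<theta> (qcnj u) w)))"
proof -
  obtain \<Gamma> where F: "frame V \<Gamma> (\<lambda>x. x) b"
    using form.orthonormal_frame by blast
  note \<Gamma>V = frameD(2)[OF F]
  have az: "form.adj z e \<in> V" if "e \<in> V" for e
    using ED(3)[OF adj_E[OF z]] that .
  have "act (chr z) w = (\<Sum>g\<in>carrier G. \<Sum>e\<in>\<Gamma>. b (form.adj z e) (r (inv g) e) *\<^sub>R r g w)"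
    unfolding group_alg_act_def by (intro sum.cong refl) (simp add: chr_expand[OF F z] scaleR_sum_left)
  also have "\<dots> = (\<Sum>e\<in>\<Gamma>. \<Sum>g\<in>carrier G. b (form.adj z e) (r (inv g) e) *\<^sub>R r g w)"
    by (rule sum.swap)
  also have "\<dots> = (\<Sum>e\<in>\<Gamma>. (N / dm) *\<^sub>R (\<Sum>u\<in>div_basis D. b (form.adj z e) (\<theta> (qcnj u) w) *\<^sub>R \<theta> u e))"
    using \<Gamma>V az w by (intro sum.cong refl schur_orthogonality) auto
  also have "\<dots> = (N / dm) *\<^sub>R (\<Sum>u\<in>div_basis D. \<Sum>e\<in>\<Gamma>. b (form.adj z e) (\<theta> (qcnj u) w) *\<^sub>R \<theta> u e)"
    by (subst scaleR_sum_right[symmetric], subst sum.swap) (rule refl)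
  also have "(\<Sum>u\<in>div_basis D. \<Sum>e\<in>\<Gamma>. b (form.adj z e) (\<theta> (qcnj u) w) *\<^sub>R \<theta> u e) =
      (\<Sum>u\<in>div_basis D. \<theta> u (z (\<theta> (qcnj u) w)))"
  proof (rule sum.cong[OF refl])
    fix u assume u: "u \<in> div_basis D"
    note uc = div_basis_carrier[OF u]
    have m: "\<theta> (qcnj u) w \<in> V" "z (\<theta> (qcnj u) w) \<in> V"
      using theta_apply[OF div_carrier_closed(7)[OF uc] w] ED(3)[OF z] by auto
    have "(\<Sum>e\<in>\<Gamma>. b (form.adj z e) (\<theta> (qcnj u) w) *\<^sub>R \<theta> u e) =
        (\<Sum>e\<in>\<Gamma>. b e (z (\<theta> (qcnj u) w)) *\<^sub>R \<theta> u e)"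
      using \<Gamma>V m by (intro sum.cong refl) (simp add: form.adj'[OF ED(1)[OF z]])
    also have "\<dots> = \<theta> u (\<Sum>e\<in>\<Gamma>. b e (z (\<theta> (qcnj u) w)) *\<^sub>R e)"
      using \<Gamma>V by (simp add: lin_combination[OF ED(2)[OF theta_E[OF uc]] subV])
    finally show "(\<Sum>e\<in>\<Gamma>. b (form.adj z e) (\<theta> (qcnj u) w) *\<^sub>R \<theta> u e) = \<theta> u (z (\<theta> (qcnj u) w))"
      using frameD(4)[OF F m(2)] by simp
  qed
  finally show ?thesis .
qed

lemma center_div_alg:
  "center (div_alg D) = {q \<in> div_carrier D. \<forall>p\<in>div_carrier D. q * p = p * q}"
  by (simp add: center_def div_alg_def)

text \<open>A central \<open>q\<close> moves past \<open>u\<close>, and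
  \<open>u * qcnj u = 1\<close>. Each unit therefore contributes \<open>\<theta> q w\<close>, and
  the factor \<open>div_dim D\<close> is the number of units.\<close>

lemma act_chr_central:
  assumes q: "q \<in> center (div_alg D)" and w: "w \<in> V"
  shows "act (chr (\<theta> q)) w = (N / dm * div_dim D) *\<^sub>R \<theta> q w"
proof -
  have qd: "q \<in> div_carrier D" and comm: "\<And>p. p \<in> div_carrier D \<Longrightarrow> q * p = p * q"
    using q by (auto simp: center_div_alg)
  have "\<theta> u (\<theta> q (\<theta> (qcnj u) w)) = \<theta> q w" if u: "u \<in> div_basis D" for u
  proof -
    note uc = div_basis_carrier[OF u]
    have "\<theta> u (\<theta> q (\<theta> (qcnj u) w)) = \<theta> (u * (q * qcnj u)) w"
      using uc qd by (simp add: theta_mult)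
    also have "u * (q * qcnj u) = q * (u * qcnj u)"
      using comm[OF uc] by (metis mult.assoc)
    finally show ?thesis
      by (simp add: div_basis_unit[OF u])
  qed
  then have "(\<Sum>u\<in>div_basis D. \<theta> u (\<theta> q (\<theta> (qcnj u) w))) = div_dim D *\<^sub>R \<theta> q w"
    by (simp add: sum_constant_scaleR div_basis_card)
  then show ?thesis
    using act_chr[OF theta_E[OF qd] w] by simp
qed

text \<open>The average of a rank one map from \<open>\<pi>\<close> to \<open>\<sigma>\<close> is an
  intertwiner of non-isomorphic irreducibles, hence zero.\<close>

lemma act_chr_other:
  fixes \<sigma> :: "('g, 'w::real_vector) rep"
  assumes z: "z \<in> E" and \<sigma>: "irreducible_rep G \<sigma>" "\<not> rep_isomorphic G \<pi> \<sigma>" and w: "w \<in> rep_space \<sigma>"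
  shows "group_alg_act G \<sigma> (chr z) w = 0"
proof -
  interpret \<sigma>: real_rep G \<sigma>
    by (rule irreducibleD(1)[OF \<sigma>(1)])
  obtain \<Gamma> where F: "frame V \<Gamma> (\<lambda>x. x) b"
    using form.orthonormal_frame by blast
  note \<Gamma>V = frameD(2)[OF F]
  have 0: "(\<Sum>g\<in>carrier G. b y (r (inv g) e) *\<^sub>R rep_act \<sigma> g w) = 0" if y: "y \<in> V" and e: "e \<in> V" for y e
  proof -
    define X where "X = (\<lambda>v. b y v *\<^sub>R w)"
    have "lin V (rep_space \<sigma>) X"
      unfolding X_def using findim_subspace[OF \<sigma>.space_fin_dim]
      by (intro lin_scaleR_vec form.lin_b y w) auto
    from schur_zero[OF irr \<sigma> avg_intertwiner[OF \<sigma>.real_rep_axioms this] e]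
    show ?thesis
      using w by (simp add: X_def lin_scale[OF \<sigma>.act_linear])
  qed
  have "group_alg_act G \<sigma> (chr z) w =
      (\<Sum>g\<in>carrier G. \<Sum>e\<in>\<Gamma>. b (form.adj z e) (r (inv g) e) *\<^sub>R rep_act \<sigma> g w)"
    unfolding group_alg_act_def by (intro sum.cong refl) (simp add: chr_expand[OF F z] scaleR_sum_left)
  also have "\<dots> = (\<Sum>e\<in>\<Gamma>. \<Sum>g\<in>carrier G. b (form.adj z e) (r (inv g) e) *\<^sub>R rep_act \<sigma> g w)"
    by (rule sum.swap)
  also have "\<dots> = 0"
    using 0[OF ED(3)[OF adj_E[OF z] \<Gamma>V] \<Gamma>V] by simp
  finally show ?thesis .
qed

text \<open>The real Frobenius-Schur indicator. Moving \<open>\<theta> (qcnj u)\<close> across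
  \<open>b\<close> turns it into \<open>\<theta> u\<close>, so orthogonality produces
  \<open>\<theta> (u * u)\<close>, and \<open>div_basis_squares\<close> evaluates the sum.\<close>

lemma act_squares_scalar:
  assumes w: "w \<in> V"
  shows "act squares w = (N / dm * (2 - div_dim D)) *\<^sub>R w"
proof -
  obtain \<Gamma> where F: "frame V \<Gamma> (\<lambda>x. x) b"
    using form.orthonormal_frame by blast
  note \<Gamma>V = frameD(2)[OF F]
  have "act squares w = (\<Sum>g\<in>carrier G. \<Sum>e\<in>\<Gamma>. b w (r (inv g) e) *\<^sub>R r g e)"
  proof -
    have "r (g \<otimes> g) w = (\<Sum>e\<in>\<Gamma>. b w (r (inv g) e) *\<^sub>R r g e)" if g: "g \<in> carrier G" for g
    proof -
      have "r (g \<otimes> g) w = r g (\<Sum>e\<in>\<Gamma>. b e (r g w) *\<^sub>R e)"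
        using frameD(4)[OF F r_mem[OF g w]] g w by (simp add: act_mult)
      also have "\<dots> = (\<Sum>e\<in>\<Gamma>. b e (r g w) *\<^sub>R r g e)"
        using \<Gamma>V by (simp add: lin_combination[OF act_linear[OF g] subV])
      also have "\<dots> = (\<Sum>e\<in>\<Gamma>. b w (r (inv g) e) *\<^sub>R r g e)"
        using \<Gamma>V g w by (intro sum.cong refl) (metis form.sym form_shift r_mem)
      finally show ?thesis .
    qed
    then show ?thesis
      using w by (simp add: act_squares)
  qed
  also have "\<dots> = (\<Sum>e\<in>\<Gamma>. \<Sum>g\<in>carrier G. b w (r (inv g) e) *\<^sub>R r g e)"
    by (rule sum.swap)
  also have "\<dots> = (\<Sum>e\<in>\<Gamma>. (N / dm) *\<^sub>R (\<Sum>u\<in>div_basis D. b w (\<theta> (qcnj u) e) *\<^sub>R \<theta> u e))"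
    using \<Gamma>V w by (intro sum.cong refl schur_orthogonality) auto
  also have "\<dots> = (N / dm) *\<^sub>R (\<Sum>u\<in>div_basis D. \<Sum>e\<in>\<Gamma>. b w (\<theta> (qcnj u) e) *\<^sub>R \<theta> u e)"
    by (subst scaleR_sum_right[symmetric], subst sum.swap) (rule refl)
  also have "(\<Sum>u\<in>div_basis D. \<Sum>e\<in>\<Gamma>. b w (\<theta> (qcnj u) e) *\<^sub>R \<theta> u e) = (\<Sum>u\<in>div_basis D. \<theta> (u * u) w)"
  proof (rule sum.cong[OF refl])
    fix u assume u: "u \<in> div_basis D"
    note uc = div_basis_carrier[OF u]
    have m: "\<theta> u w \<in> V"
      using theta_apply[OF uc w] .
    have "(\<Sum>e\<in>\<Gamma>. b w (\<theta> (qcnj u) e) *\<^sub>R \<theta> u e) = (\<Sum>e\<in>\<Gamma>. b e (\<theta> u w) *\<^sub>R \<theta> u e)"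
      using \<Gamma>V w m by (intro sum.cong refl) (simp add: theta_cnj[OF uc] form.adj[OF ED(1)[OF theta_E[OF uc]]] form.sym)
    also have "\<dots> = \<theta> u (\<Sum>e\<in>\<Gamma>. b e (\<theta> u w) *\<^sub>R e)"
      using \<Gamma>V by (simp add: lin_combination[OF ED(2)[OF theta_E[OF uc]] subV])
    finally show "(\<Sum>e\<in>\<Gamma>. b w (\<theta> (qcnj u) e) *\<^sub>R \<theta> u e) = \<theta> (u * u) w"
      using frameD(4)[OF F m] uc by (simp add: theta_mult)
  qed
  also have "\<dots> = \<theta> (\<Sum>u\<in>div_basis D. u * u) w"
    by (simp add: lin_sum[OF theta_lin subspace_div_carrier] div_basis_carrier sum_fun_apply)
  also have "\<dots> = (2 - div_dim D) *\<^sub>R w"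
    using w lin_scale[OF theta_lin, of 1 "2 - div_dim D"]
    by (simp add: div_basis_squares of_real_def theta_one one_apply)
  finally show ?thesis
    by simp
qed

text \<open>A central element of the group algebra acts by an operator that commutes with the whole
  commutant, and injectivity of \<open>\<theta>\<close> transfers this to \<open>D\<close>.\<close>

lemma theta_act:
  assumes "x \<in> cf"
  obtains q where "q \<in> center (div_alg D)" "\<theta> q = extend_zero V (act x)"
proof -
  obtain q where q: "q \<in> div_carrier D" "\<theta> q = extend_zero V (act x)"
    using theta_ex[OF act_E[OF assms]] by blast
  have "q * p = p * q" if p: "p \<in> div_carrier D" for p
  proof -
    have "\<theta> (q * p) = \<theta> (p * q)"
      unfolding theta_mult[OF q(1) p] theta_mult[OF p q(1)]
      using ED(3)[OF theta_E[OF p]] q(2) theta_E p q(1)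
      by (intro E_eqI E_comp theta_E) (auto simp: extend_zero_def E_act)
    then show ?thesis
      using theta_bij p q(1) by (auto simp: bij_betw_def dest: inj_onD)
  qed
  then have "q \<in> center (div_alg D)"
    using q(1) by (simp add: center_div_alg)
  then show thesis
    using that q(2) by blast
qed

text \<open>The real dimensions 1, 2 and 4 tell the three algebras apart.\<close>

lemma alg_iso_div: "alg_iso (End_alg G \<pi>) (div_alg D') f \<Longrightarrow> D' = D"
proof -
  assume f: "alg_iso (End_alg G \<pi>) (div_alg D') f"
  then have f: "lin E (div_carrier D') f" "bij_betw f E (div_carrier D')"
    by (auto simp: alg_iso_def alg_hom_def div_alg_def)
  have "dim (div_carrier D') = dim (div_carrier D)"
    using dim_eq_bij[OF findim_E findim_div_carrier f]
      dim_eq_bij[OF findim_div_carrier findim_E theta_lin theta_bij] by simp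
  then show ?thesis
    using dim_div_carrier[of D] dim_div_carrier[of D'] by (simp add: div_dim_inj)
qed

lemma alg_iso_div_ex: "\<exists>f. alg_iso (End_alg G \<pi>) (div_alg D) f"
proof -
  define f where "f = the_inv_into (div_carrier D) \<theta>"
  note l = lin_inverse[OF theta_lin theta_bij subspace_div_carrier, folded f_def]
  note ft = l(2) and tf = l(3,4)
  have "lin E (div_carrier D) f"
    by (rule l(1))
  moreover have "f (x \<circ> y) = f x * f y" if "x \<in> E" "y \<in> E" for x y
    using ft[of "f x * f y"] tf that by (simp add: theta_mult)
  moreover have "f one = 1"
    using ft[of 1] by (simp add: theta_one)
  moreover have "bij_betw f E (div_carrier D)"
    unfolding f_def by (rule bij_betw_the_inv_into[OF theta_bij])
  ultimately show ?thesis
    using tf(1) by (intro exI[of _ f]) (simp add: alg_iso_def alg_hom_def div_alg_def hom_def)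
qed

end

section \<open>Isomorphism classes of irreducible representations\<close>

lemma rep_isomorphicE:
  assumes "rep_isomorphic G \<pi> \<sigma>"
  obtains f where "intertwiner G \<pi> \<sigma> f" "bij_betw f (rep_space \<pi>) (rep_space \<sigma>)"
  using assms by (auto simp: rep_isomorphic_def intertwiner_def)

lemma rep_isomorphic_refl: "rep_isomorphic G \<pi> \<pi>"
  by (rule intertwiner_isomorphic[of _ _ _ "\<lambda>v. v"]) (auto simp: intertwiner_def lin_id bij_betw_def)

lemma rep_isomorphic_trans:
  assumes "rep_isomorphic G \<pi> \<sigma>" "rep_isomorphic G \<sigma> \<tau>"
  shows "rep_isomorphic G \<pi> \<tau>"
proof -
  obtain f where f: "intertwiner G \<pi> \<sigma> f" "bij_betw f (rep_space \<pi>) (rep_space \<sigma>)"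
    using rep_isomorphicE[OF assms(1)] .
  obtain h where h: "intertwiner G \<sigma> \<tau> h" "bij_betw h (rep_space \<sigma>) (rep_space \<tau>)"
    using rep_isomorphicE[OF assms(2)] .
  show ?thesis
    using intertwiner_isomorphic[OF intertwiner_comp[OF f(1) h(1)]] bij_betw_trans[OF f(2) h(2)]
    by (simp add: comp_def)
qed

lemma intertwiner_inverse:
  assumes \<pi>: "real_rep G \<pi>" and f: "intertwiner G \<pi> \<sigma> f" "bij_betw f (rep_space \<pi>) (rep_space \<sigma>)"
  shows "intertwiner G \<sigma> \<pi> (the_inv_into (rep_space \<pi>) f)"
proof -
  interpret real_rep G \<pi>
    by fact
  note l = lin_inverse[OF intertwinerD(1)[OF f(1)] f(2) findim_subspace[OF space_fin_dim]]
  let ?h = "the_inv_into (rep_space \<pi>) f"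
  have "?h (rep_act \<sigma> g w) = rep_act \<pi> g (?h w)" if g: "g \<in> carrier G" and w: "w \<in> rep_space \<sigma>" for g w
    using intertwinerD(2)[OF f(1) g l(3)[OF w]] l(4)[OF w] l(2)[OF lin_mem[OF act_linear[OF g] l(3)[OF w]]]
    by simp
  then show ?thesis
    using l(1) by (simp add: intertwiner_def)
qed

lemma rep_isomorphic_sym:
  assumes "real_rep G \<pi>" "rep_isomorphic G \<pi> \<sigma>"
  shows "rep_isomorphic G \<sigma> \<pi>"
proof -
  obtain f where f: "intertwiner G \<pi> \<sigma> f" "bij_betw f (rep_space \<pi>) (rep_space \<sigma>)"
    using rep_isomorphicE[OF assms(2)] .
  show ?thesis
    by (rule intertwiner_isomorphic[OF intertwiner_inverse[OF assms(1) f] bij_betw_the_inv_into[OF f(2)]])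
qed

lemma irreducible_isomorphic:
  assumes \<pi>: "irreducible_rep G \<pi>" and \<sigma>: "real_rep G \<sigma>" and iso: "rep_isomorphic G \<pi> \<sigma>"
  shows "irreducible_rep G \<sigma>"
proof -
  interpret \<pi>: real_rep G \<pi>
    by (rule irreducibleD(1)[OF \<pi>])
  obtain f where f: "intertwiner G \<pi> \<sigma> f" "bij_betw f (rep_space \<pi>) (rep_space \<sigma>)"
    using rep_isomorphicE[OF iso] .
  note lf = intertwinerD(1)[OF f(1)]
  let ?V = "rep_space \<pi>"
  note sV = findim_subspace[OF \<pi>.space_fin_dim]
  have im: "f ` ?V = rep_space \<sigma>" and inj: "inj_on f ?V"
    using f(2) by (auto simp: bij_betw_def)
  have "rep_space \<sigma> \<noteq> {0}"
  proof
    assume 0: "rep_space \<sigma> = {0}"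
    have "v = 0" if "v \<in> ?V" for v
      using im 0 that lin_0[OF lf sV] subspace_0[OF sV] inj_onD[OF inj, of v 0] by auto
    then show False
      using irreducibleD(2)[OF \<pi>] subspace_0[OF sV] by auto
  qed
  moreover have "W = {0} \<or> W = rep_space \<sigma>"
    if W: "subspace W" "W \<subseteq> rep_space \<sigma>" "\<forall>g\<in>carrier G. \<forall>w\<in>W. rep_act \<sigma> g w \<in> W" for W
  proof -
    define K where "K = {v \<in> ?V. f v \<in> W}"
    have fK: "f ` K = W"
      using im W(2) by (auto simp: K_def image_iff)
    have "K = {0} \<or> K = ?V"
    proof (rule irreducibleD(3)[OF \<pi>])
      show "subspace K"
        unfolding K_def subspace_def using subspace_0[OF sV] subspace_add[OF sV] subspace_scale[OF sV]
          lin_0[OF lf sV] subspace_0[OF W(1)] subspace_add[OF W(1)] subspace_scale[OF W(1)]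
        by (auto simp: lin_add[OF lf] lin_scale[OF lf])
      show "rep_act \<pi> g w \<in> K" if "g \<in> carrier G" "w \<in> K" for g w
        using that W(3) intertwinerD(2)[OF f(1)] lin_mem[OF \<pi>.act_linear] by (auto simp: K_def)
    qed (auto simp: K_def)
    then show ?thesis
      using fK im lin_0[OF lf sV] by auto
  qed
  ultimately show ?thesis
    using \<sigma> by (auto simp: irreducible_rep_def)
qed

text \<open>Moves a representation into another ambient type along an injective linear map. In this
  way an irreducible found inside \<open>\<rho>\<close> reaches the type over which
  \<open>Irr\<close> is defined.\<close>

lemma transport_rep:
  fixes \<pi> :: "('g, 'v::real_vector) rep" and f :: "'v \<Rightarrow> 'w::real_vector"
  assumes \<pi>: "real_rep G \<pi>" and f: "lin (rep_space \<pi>) UNIV f" "inj_on f (rep_space \<pi>)"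
  defines "\<sigma> \<equiv> \<lparr>rep_space = f ` rep_space \<pi>, rep_act = (\<lambda>g x. f (rep_act \<pi> g (the_inv_into (rep_space \<pi>) f x)))\<rparr>"
  shows "real_rep G \<sigma>" "rep_isomorphic G \<pi> \<sigma>"
proof -
  interpret real_rep G \<pi>
    by fact
  let ?V = "rep_space \<pi>"
  note sV = findim_subspace[OF space_fin_dim]
  have lf: "lin ?V (f ` ?V) f" and bf: "bij_betw f ?V (f ` ?V)"
    using f by (auto simp: linear_on_def bij_betw_def)
  note l = lin_inverse[OF lf bf sV]
  let ?h = "the_inv_into ?V f"
  have sW: "subspace (f ` ?V)"
    unfolding subspace_def
  proof (intro conjI ballI allI)
    show "0 \<in> f ` ?V"
      using lin_0[OF lf sV] subspace_0[OF sV] by force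
    fix x y c assume x: "x \<in> f ` ?V"
    show "c *\<^sub>R x \<in> f ` ?V"
      using lin_scale[OF lf l(3)[OF x], of c] l(4)[OF x] subspace_scale[OF sV l(3)[OF x]] by (metis image_eqI)
    assume y: "y \<in> f ` ?V"
    show "x + y \<in> f ` ?V"
      using lin_add[OF lf l(3)[OF x] l(3)[OF y]] l(4)[OF x] l(4)[OF y] subspace_add[OF sV l(3)[OF x] l(3)[OF y]]
      by (metis image_eqI)
  qed
  obtain \<Gamma> and \<epsilon> :: "'v \<Rightarrow> 'v \<Rightarrow> real" where F: "frame ?V \<Gamma> (\<lambda>x. x) \<epsilon>"
    using frame_ex[OF space_fin_dim] .
  have "frame (f ` ?V) \<Gamma> f (\<lambda>i w. \<epsilon> i (?h w))"
    unfolding frame_def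
  proof (intro conjI ballI)
    fix x assume x: "x \<in> f ` ?V"
    have "(\<Sum>i\<in>\<Gamma>. \<epsilon> i (?h x) *\<^sub>R f i) = f (\<Sum>i\<in>\<Gamma>. \<epsilon> i (?h x) *\<^sub>R i)"
      using frameD(2)[OF F] by (simp add: lin_combination[OF lf sV])
    then show "(\<Sum>i\<in>\<Gamma>. \<epsilon> i (?h x) *\<^sub>R f i) = x"
      using frameD(4)[OF F l(3)[OF x]] l(4)[OF x] by simp
  qed (use frameD[OF F] lin_comp[OF l(1) frameD(3)[OF F]] in auto)
  then have fd: "findim (f ` ?V)"
    by (rule findim_frame[OF _ sW])
  show "real_rep G \<sigma>"
  proof (intro real_rep.intro real_rep_axioms.intro)
    show "group G"
      by unfold_locales
    show "findim (rep_space \<sigma>)"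
      using fd by (simp add: \<sigma>_def)
    show "lin (rep_space \<sigma>) (rep_space \<sigma>) (rep_act \<sigma> g)" if "g \<in> carrier G" for g
      using lin_comp[OF lin_comp[OF l(1) act_linear[OF that]] lf] by (simp add: \<sigma>_def)
    show "rep_act \<sigma> \<one>\<^bsub>G\<^esub> v = v" if "v \<in> rep_space \<sigma>" for v
      using that l by (auto simp: \<sigma>_def act_one)
    show "rep_act \<sigma> (g \<otimes>\<^bsub>G\<^esub> h) v = rep_act \<sigma> g (rep_act \<sigma> h v)"
      if "g \<in> carrier G" "h \<in> carrier G" "v \<in> rep_space \<sigma>" for g h v
      using that l lin_mem[OF act_linear] by (auto simp: \<sigma>_def act_mult)
  qed
  have "intertwiner G \<pi> \<sigma> f"
    using lf l(2) by (auto simp: intertwiner_def \<sigma>_def)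
  then show "rep_isomorphic G \<pi> \<sigma>"
    by (rule intertwiner_isomorphic) (use bf in \<open>simp add: \<sigma>_def\<close>)
qed

lemma model_rep_ex:
  fixes \<pi> :: "('g, 'v::real_vector) rep"
  assumes "real_rep G \<pi>"
  shows "\<exists>\<sigma> :: 'g model_rep. real_rep G \<sigma> \<and> rep_isomorphic G \<pi> \<sigma>"
proof -
  interpret real_rep G \<pi>
    by fact
  obtain \<Gamma> where \<Gamma>: "basis_on (*\<^sub>R) (rep_space \<pi>) \<Gamma>"
    using basis_on_ex[OF space_fin_dim] by auto
  then have \<Gamma>': "finite \<Gamma>" "independent \<Gamma>" "span \<Gamma> = rep_space \<pi>"
    by (auto simp: basis_on_real)
  obtain e where e: "bij_betw e {..<card \<Gamma>} \<Gamma>"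
    using ex_bij_betw_nat_finite[OF \<Gamma>'(1)] by (auto simp: atLeast0LessThan)
  define f where "f = (\<lambda>v k. if k < card \<Gamma> then representation \<Gamma> v (e k) else 0)"
  have "lin (rep_space \<pi>) UNIV f"
    using lin_add[OF lin_representation[OF \<Gamma>'(2)]] lin_scale[OF lin_representation[OF \<Gamma>'(2)]] \<Gamma>'(3)
    by (intro linI) (auto simp: f_def fun_eq_iff)
  moreover have "inj_on f (rep_space \<pi>)"
  proof (rule inj_onI)
    fix u v assume uv: "u \<in> rep_space \<pi>" "v \<in> rep_space \<pi>" "f u = f v"
    have "representation \<Gamma> u x = representation \<Gamma> v x" if "x \<in> \<Gamma>" for x
    proof -
      have "x \<in> e ` {..<card \<Gamma>}"
        using bij_betw_imp_surj_on[OF e] that by simp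
      then obtain k where "k < card \<Gamma>" "x = e k"
        by blast
      then show ?thesis
        using fun_cong[OF uv(3), of k] by (simp add: f_def)
    qed
    then have "(\<Sum>x\<in>\<Gamma>. representation \<Gamma> u x *\<^sub>R x) = (\<Sum>x\<in>\<Gamma>. representation \<Gamma> v x *\<^sub>R x)"
      by simp
    then show "u = v"
      using sum_representation_eq[OF \<Gamma>'(2) _ \<Gamma>'(1) subset_refl] uv \<Gamma>'(3) by simp
  qed
  ultimately show ?thesis
    using transport_rep[OF assms] by blast
qed

lemma Irr_equiv:
  "equiv {\<pi>. irreducible_rep G \<pi>} {(\<pi>, \<sigma>). irreducible_rep G \<pi> \<and> irreducible_rep G \<sigma> \<and> rep_isomorphic G \<pi> \<sigma>}"
  using rep_isomorphic_refl rep_isomorphic_sym rep_isomorphic_trans irreducibleD(1)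
  by (intro equivI refl_onI symI transI) blast+

lemma representative_in:
  assumes "c \<in> Irr G"
  shows "representative c \<in> c" "irreducible_rep G (representative c)"
proof -
  have "c \<noteq> {}"
    using in_quotient_imp_non_empty[OF Irr_equiv] assms by (auto simp: Irr_def)
  then show 1: "representative c \<in> c"
    by (simp add: representative_def some_in_eq)
  show "irreducible_rep G (representative c)"
    using in_quotient_imp_subset[OF Irr_equiv] assms 1 by (auto simp: Irr_def)
qed

lemma representative_eq:
  assumes "c \<in> Irr G" "c' \<in> Irr G" "rep_isomorphic G (representative c) (representative c')"
  shows "c = c'"
  using quotient_eqI[OF Irr_equiv, of c G c' "representative c" "representative c'"] representative_in assms
  by (auto simp: Irr_def)

lemma Irr_ex:
  fixes \<pi> :: "('g, 'v::real_vector) rep"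
  assumes \<pi>: "irreducible_rep G \<pi>"
  obtains c where "c \<in> Irr G" "rep_isomorphic G (representative c) \<pi>"
proof -
  obtain \<sigma> :: "'g model_rep" where \<sigma>: "real_rep G \<sigma>" "rep_isomorphic G \<pi> \<sigma>"
    using model_rep_ex[OF irreducibleD(1)[OF \<pi>]] by auto
  let ?r = "{(\<pi> :: 'g model_rep, \<sigma> :: 'g model_rep). irreducible_rep G \<pi> \<and> irreducible_rep G \<sigma> \<and> rep_isomorphic G \<pi> \<sigma>}"
  define c where "c = ?r `` {\<sigma>}"
  have "irreducible_rep G \<sigma>"
    by (rule irreducible_isomorphic[OF \<pi> \<sigma>])
  then have c: "c \<in> Irr G"
    unfolding c_def Irr_def by (intro quotientI) simp
  have "rep_isomorphic G \<sigma> (representative c)"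
    using representative_in(1)[OF c] by (auto simp: c_def)
  from rep_isomorphic_trans[OF \<sigma>(2) this] have "rep_isomorphic G (representative c) \<pi>"
    by (rule rep_isomorphic_sym[OF irreducibleD(1)[OF \<pi>]])
  then show thesis
    using that c by blast
qed

section \<open>Decomposition into irreducible representations\<close>

text \<open>The operator \<open>T\<close> that represents \<open>\<gamma>\<close> through
  \<open>b\<close> is an intertwiner, and symmetry of \<open>\<gamma>\<close> makes it self-adjoint,
  hence scalar. Without symmetry every element of the commutant would yield an invariant
  form.\<close>

lemma (in irr_form) invariant_form_proportional:
  assumes lin: "\<And>u. u \<in> V \<Longrightarrow> lin V UNIV (\<gamma> u)" and sym: "\<And>u v. u \<in> V \<Longrightarrow> v \<in> V \<Longrightarrow> \<gamma> u v = \<gamma> v u"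
    and inv: "\<And>g u v. g \<in> carrier G \<Longrightarrow> u \<in> V \<Longrightarrow> v \<in> V \<Longrightarrow> \<gamma> (r g u) (r g v) = \<gamma> u v"
  shows "\<exists>t. \<forall>u\<in>V. \<forall>v\<in>V. \<gamma> u v = t * b u v"
proof -
  have "\<forall>v\<in>V. \<exists>w\<in>V. \<forall>u\<in>V. b w u = \<gamma> v u"
    using form.riesz lin by blast
  then obtain T where T: "\<And>v. v \<in> V \<Longrightarrow> T v \<in> V" "\<And>u v. u \<in> V \<Longrightarrow> v \<in> V \<Longrightarrow> b (T v) u = \<gamma> v u"
    by metis
  have T': "b u (T v) = \<gamma> u v" if "u \<in> V" "v \<in> V" for u v
    using T that form.sym[OF that(1) T(1)[OF that(2)]] sym[OF that] by simp
  have lT: "lin V V T"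
  proof (rule linI)
    fix x y c assume xy: "x \<in> V" "y \<in> V"
    show "T x \<in> V"
      by (rule T(1)[OF xy(1)])
    show "T (x + y) = T x + T y"
      using xy T(1) by (intro form.eqI) (auto simp: T' form.add_r lin_add[OF lin] subspace_add[OF subV])
    show "T (c *\<^sub>R x) = c *\<^sub>R T x"
      using xy T(1) by (intro form.eqI) (auto simp: T' form.scale_r lin_scale[OF lin] subspace_scale[OF subV])
  qed
  have "T (r g v) = r g (T v)" if g: "g \<in> carrier G" and v: "v \<in> V" for g v
  proof (rule form.eqI)
    fix u assume u: "u \<in> V"
    have "b u (r g (T v)) = b (r (inv g) u) (T v)"
      using form_shift[of "inv g" u "T v"] g u v T(1) by simp
    also have "\<dots> = \<gamma> (r g (r (inv g) u)) (r g v)"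
      using g u v r_mem by (simp add: T' inv)
    also have "\<dots> = b u (T (r g v))"
      using g u v r_mem by (simp add: T' r_inv)
    finally show "b u (T (r g v)) = b u (r g (T v))" ..
  qed (use g v T(1) r_mem in auto)
  then have E: "extend_zero V T \<in> E"
    using lT by (intro E_extend) (auto simp: intertwiner_def)
  have "form.adj (extend_zero V T) = extend_zero V T"
    using E T by (intro form.adj_unique) (auto simp: extend_zero_def T' dest: ED(1))
  from self_adjoint_scalar[OF E this] obtain t where t: "extend_zero V T = t *\<^sub>R one"
    by blast
  have "\<gamma> u v = t * b u v" if "u \<in> V" "v \<in> V" for u v
  proof -
    have "T v = t *\<^sub>R v"
      using fun_cong[OF t, of v] that by (simp add: extend_zero_def)
    then show ?thesis
      using T'[OF that] that by (simp add: form.scale_r)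
  qed
  then show ?thesis
    by blast
qed

text \<open>Take a non-zero invariant subspace of least dimension inside \<open>W\<close>.\<close>

lemma (in fin_rep) irreducible_sub:
  assumes W: "subspace W" "W \<subseteq> V" "\<And>g w. g \<in> carrier G \<Longrightarrow> w \<in> W \<Longrightarrow> r g w \<in> W" and "W \<noteq> {0}"
  shows "\<exists>W'. W' \<subseteq> W \<and> irreducible_rep G \<lparr>rep_space = W', rep_act = r\<rparr>"
proof -
  define Q where "Q = (\<lambda>X. subspace X \<and> X \<subseteq> W \<and> (\<forall>g\<in>carrier G. \<forall>w\<in>X. r g w \<in> X) \<and> X \<noteq> {0})"
  have "Q W"
    using assms by (auto simp: Q_def)
  then obtain X where X: "Q X" "\<And>Y. Q Y \<Longrightarrow> dim X \<le> dim Y"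
    using ex_has_least_nat[of Q W dim] by blast
  then have X': "subspace X" "X \<subseteq> V" "X \<subseteq> W" "\<And>g w. g \<in> carrier G \<Longrightarrow> w \<in> X \<Longrightarrow> r g w \<in> X" "X \<noteq> {0}"
    using W(2) by (auto simp: Q_def)
  have fdX: "findim X"
    by (rule findim_subset[OF fdV X'(1,2)])
  have "real_rep G \<lparr>rep_space = X, rep_act = r\<rparr>"
  proof (intro real_rep.intro real_rep_axioms.intro)
    show "group G"
      by unfold_locales
    fix g assume g: "g \<in> carrier G"
    show "lin (rep_space \<lparr>rep_space = X, rep_act = r\<rparr>) (rep_space \<lparr>rep_space = X, rep_act = r\<rparr>)
        (rep_act \<lparr>rep_space = X, rep_act = r\<rparr> g)"
      using g X'(2,4) lin_add[OF act_linear[OF g]] lin_scale[OF act_linear[OF g]]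
      by (intro linI) (auto simp: subset_iff)
  qed (use X'(2) fdX act_one act_mult in auto)
  moreover have "Y = {0} \<or> Y = X" if Y: "subspace Y" "Y \<subseteq> X" "\<forall>g\<in>carrier G. \<forall>w\<in>Y. r g w \<in> Y" for Y
  proof (rule ccontr)
    assume "\<not> (Y = {0} \<or> Y = X)"
    then have "Q Y" "Y \<subset> X"
      using Y X'(3) by (auto simp: Q_def)
    then show False
      using X(2) dim_less_subspace[OF fdX Y(1)] by force
  qed
  ultimately show ?thesis
    using X' by (intro exI[of _ X]) (auto simp: irreducible_rep_def)
qed

section \<open>Orthogonal decomposition for an indefinite form\<close>

abbreviation Vr :: "'g model_rep set \<Rightarrow> (nat \<Rightarrow> real) set" where
  "Vr c \<equiv> rep_space (representative c)"

text \<open>Each embedding pulls \<open>\<beta>\<close> back to plus or minus the reference form of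
  its class. The last clause only asserts that components exist; their uniqueness is recovered from
  orthogonality. The index set is arbitrary so that summands can be numbered first and grouped by
  class afterwards.\<close>

definition orthogonal_embeddings ::
  "('g, 'm) monoid_scheme \<Rightarrow> ('g, 'v::real_vector) rep \<Rightarrow> ('v \<Rightarrow> 'v \<Rightarrow> real) \<Rightarrow>
   ('g model_rep set \<Rightarrow> (nat \<Rightarrow> real) \<Rightarrow> (nat \<Rightarrow> real) \<Rightarrow> real) \<Rightarrow> 'v set \<Rightarrow>
   'i set \<Rightarrow> ('i \<Rightarrow> 'g model_rep set) \<Rightarrow> ('i \<Rightarrow> (nat \<Rightarrow> real) \<Rightarrow> 'v) \<Rightarrow> ('i \<Rightarrow> real) \<Rightarrow> bool" where
  "orthogonal_embeddings G \<rho> \<beta> bb W I c \<iota> \<epsilon> \<longleftrightarrow>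
     finite I \<and>
     (\<forall>i\<in>I. c i \<in> Irr G \<and> intertwiner G (representative (c i)) \<rho> (\<iota> i) \<and> \<iota> i ` Vr (c i) \<subseteq> W \<and>
       \<epsilon> i \<in> {1, -1} \<and> (\<forall>u\<in>Vr (c i). \<forall>v\<in>Vr (c i). \<beta> (\<iota> i u) (\<iota> i v) = \<epsilon> i * bb (c i) u v)) \<and>
     (\<forall>i\<in>I. \<forall>j\<in>I. i \<noteq> j \<longrightarrow> (\<forall>u\<in>Vr (c i). \<forall>v\<in>Vr (c j). \<beta> (\<iota> i u) (\<iota> j v) = 0)) \<and>
     (\<forall>w\<in>W. \<exists>f. (\<forall>i\<in>I. f i \<in> Vr (c i)) \<and> w = (\<Sum>i\<in>I. \<iota> i (f i)))"

lemma orthogonal_embeddings_reindex: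
  assumes O: "orthogonal_embeddings G \<rho> \<beta> bb W I c \<iota> \<epsilon>" and h: "bij_betw h J I"
  shows "orthogonal_embeddings G \<rho> \<beta> bb W J (\<lambda>j. c (h j)) (\<lambda>j. \<iota> (h j)) (\<lambda>j. \<epsilon> (h j))"
proof -
  have hI: "h j \<in> I" if "j \<in> J" for j
    using bij_betw_apply[OF h that] .
  have inj: "h i \<noteq> h j" if "i \<in> J" "j \<in> J" "i \<noteq> j" for i j
    using h that by (auto simp: bij_betw_def inj_on_def)
  have "finite J"
    using O bij_betw_finite[OF h] by (auto simp: orthogonal_embeddings_def)
  moreover have "\<exists>f. (\<forall>j\<in>J. f j \<in> Vr (c (h j))) \<and> w = (\<Sum>j\<in>J. \<iota> (h j) (f j))" if w: "w \<in> W" for w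
  proof -
    obtain f where f: "\<forall>i\<in>I. f i \<in> Vr (c i)" "w = (\<Sum>i\<in>I. \<iota> i (f i))"
      using O w unfolding orthogonal_embeddings_def by blast
    have "w = (\<Sum>j\<in>J. \<iota> (h j) (f (h j)))"
      unfolding f(2) by (rule sum.reindex_bij_betw[OF h, symmetric])
    then show ?thesis
      using f(1) hI by (intro exI[of _ "\<lambda>j. f (h j)"]) auto
  qed
  moreover have "\<beta> (\<iota> (h i) u) (\<iota> (h j) v) = 0"
    if "i \<in> J" "j \<in> J" "i \<noteq> j" "u \<in> Vr (c (h i))" "v \<in> Vr (c (h j))" for i j u v
    using O hI[OF that(1)] hI[OF that(2)] inj[OF that(1-3)] that(4,5)
    unfolding orthogonal_embeddings_def by blast
  ultimately show ?thesis
    using O hI unfolding orthogonal_embeddings_def by (simp add: ball_conj_distrib)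
qed

lemma orthogonal_embeddings_cong:
  assumes O: "orthogonal_embeddings G \<rho> \<beta> bb W I c \<iota> \<epsilon>" and eq: "\<And>i. i \<in> I \<Longrightarrow> c i = c' i"
  shows "orthogonal_embeddings G \<rho> \<beta> bb W I c' \<iota> \<epsilon>"
proof -
  have "(\<forall>i\<in>I. f i \<in> Vr (c i)) \<longleftrightarrow> (\<forall>i\<in>I. f i \<in> Vr (c' i))" for f
    using eq by auto
  then show ?thesis
    using O eq[symmetric] unfolding orthogonal_embeddings_def by simp
qed

context form_rep
begin

text \<open>Pieces are split off with the help of a positive invariant form \<open>b\<close>. The
  operator \<open>S\<close> with \<open>b (S v) u = \<beta> v u\<close> is self-adjoint and commutes
  with \<open>G\<close>. For vectors of an eigenspace \<open>\<beta>\<close> is a multiple of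
  \<open>b\<close>, so the complement for \<open>b\<close> of a summand chosen there is also
  orthogonal to it for \<open>\<beta>\<close>.\<close>

lemma orthogonal_embeddings_ex:
  assumes bb: "\<And>c. c \<in> Irr G \<Longrightarrow> irr_form G (representative c) (bb c)"
  shows "\<exists>(m::nat) c \<iota> \<epsilon>. orthogonal_embeddings G \<rho> \<beta> bb V {..<m} c \<iota> \<epsilon>"
proof -
  obtain b where b: "inner_space V b" "\<forall>g\<in>carrier G. \<forall>u\<in>V. \<forall>v\<in>V. b (r g u) (r g v) = b u v"
    using invariant_inner_ex by blast
  interpret i: inner_space V b
    by fact
  interpret j: form_rep G \<rho> b
    using b(2) i.nondeg i.sym i.lin_b by unfold_locales (auto simp: invariant_form_def lin_real)
  have "\<forall>v\<in>V. \<exists>w\<in>V. \<forall>u\<in>V. b w u = \<beta> v u"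
    using i.riesz form.lin_b by blast
  then obtain S where S: "\<And>v. v \<in> V \<Longrightarrow> S v \<in> V" "\<And>u v. u \<in> V \<Longrightarrow> v \<in> V \<Longrightarrow> b (S v) u = \<beta> v u"
    by metis
  have S': "b u (S v) = \<beta> u v" if "u \<in> V" "v \<in> V" for u v
    using S that i.sym[OF that(1) S(1)[OF that(2)]] form.sym[OF that] by simp
  have lS: "lin V V S"
  proof (rule linI)
    fix x y c assume xy: "x \<in> V" "y \<in> V"
    show "S x \<in> V"
      by (rule S(1)[OF xy(1)])
    show "S (x + y) = S x + S y"
      using xy S(1) by (intro i.eqI) (auto simp: S' i.add_r form.add_r subspace_add[OF subV])
    show "S (c *\<^sub>R x) = c *\<^sub>R S x"
      using xy S(1) by (intro i.eqI) (auto simp: S' i.scale_r form.scale_r subspace_scale[OF subV])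
  qed
  have Sr: "S (r g v) = r g (S v)" if g: "g \<in> carrier G" and v: "v \<in> V" for g v
  proof (rule i.eqI)
    fix u assume u: "u \<in> V"
    have "b u (r g (S v)) = b (r (inv g) u) (S v)"
      using j.form_shift[of "inv g" u "S v"] g u v S(1) by simp
    also have "\<dots> = \<beta> u (r g v)"
      using form_shift[of "inv g" u v] g u v r_mem by (simp add: S')
    finally show "b u (S (r g v)) = b u (r g (S v))"
      using g u v r_mem by (simp add: S')
  qed (use g v S(1) r_mem in auto)
  \<comment> \<open>The induction runs over subspaces stable under \<open>S\<close> as well as
    \<open>G\<close>, so that \<open>S\<close> has an eigenvector in each of them.\<close>
  have "\<exists>(m::nat) c \<iota> \<epsilon>. orthogonal_embeddings G \<rho> \<beta> bb W {..<m} c \<iota> \<epsilon>"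
    if "subspace W" "W \<subseteq> V" "\<And>g w. g \<in> carrier G \<Longrightarrow> w \<in> W \<Longrightarrow> r g w \<in> W" "\<And>w. w \<in> W \<Longrightarrow> S w \<in> W" for W
    using that
  proof (induction "dim W" arbitrary: W rule: less_induct)
    case less
    note W = less.prems
    show ?case
    proof (cases "W = {0}")
      case True
      then have "orthogonal_embeddings G \<rho> \<beta> bb W {..<0::nat} c \<iota> \<epsilon>" for c \<iota> \<epsilon>
        by (simp add: orthogonal_embeddings_def)
      then show ?thesis
        by blast
    next
      case False
      interpret W: inner_space W b
        by (rule i.subspace_inner[OF W(1,2)])
      have WV: "w \<in> V" if "w \<in> W" for w
        using W(2) that by auto
      have "lin W W S"
        using W(4) WV by (intro linI) (auto simp: lin_add[OF lS] lin_scale[OF lS])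
      moreover have "b (S u) v = b u (S v)" if "u \<in> W" "v \<in> W" for u v
        using that WV by (simp add: S S' form.sym)
      ultimately obtain k w where w: "w \<in> W" "w \<noteq> 0" "S w = k *\<^sub>R w"
        using W.eigenvector_ex[OF _ _ False] by metis
      \<comment> \<open>Zero is no eigenvalue because \<open>\<beta>\<close> is non-degenerate on
        all of \<open>V\<close>; hence \<open>\<beta>\<close> does not vanish on the new
        summand.\<close>
      have k: "k \<noteq> 0"
      proof
        assume "k = 0"
        then have "\<beta> w u = 0" if "u \<in> V" for u
          using S(2)[OF that WV[OF w(1)]] w(3) i.form_0[OF that] by simp
        then show False
          using form.nondeg[OF WV[OF w(1)]] w(2) by blast
      qed
      define X where "X = {x \<in> W. S x = k *\<^sub>R x}"
      have XV: "x \<in> V" "S x = k *\<^sub>R x" if "x \<in> X" for x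
        using that WV by (auto simp: X_def)
      have "\<exists>Y. Y \<subseteq> X \<and> irreducible_rep G \<lparr>rep_space = Y, rep_act = r\<rparr>"
      proof (rule irreducible_sub)
        show "subspace X"
          unfolding subspace_def X_def using subspace_0[OF W(1)] subspace_add[OF W(1)] subspace_scale[OF W(1)] WV
          by (auto simp: lin_0[OF lS subV] lin_add[OF lS] lin_scale[OF lS] scaleR_add_right)
        show "r g x \<in> X" if "g \<in> carrier G" "x \<in> X" for g x
          using that W(3) WV by (auto simp: X_def Sr lin_scale[OF act_linear])
        show "X \<noteq> {0}"
          using w by (auto simp: X_def)
      qed (use XV in auto)
      then obtain Y where Y: "Y \<subseteq> X" "irreducible_rep G \<lparr>rep_space = Y, rep_act = r\<rparr>"
        by blast
      let ?Y = "\<lparr>rep_space = Y, rep_act = r\<rparr>"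
      have YV: "y \<in> V" "y \<in> W" "S y = k *\<^sub>R y" if "y \<in> Y" for y
        using subsetD[OF Y(1) that] WV unfolding X_def by blast+
      interpret Y: real_rep G ?Y
        by (rule irreducibleD(1)[OF Y(2)])
      have sY: "subspace Y"
        using findim_subspace[OF Y.space_fin_dim] by simp
      have rY: "r g y \<in> Y" if "g \<in> carrier G" "y \<in> Y" for g y
        using lin_mem[OF Y.act_linear[OF that(1)], of y] that(2) by simp
      obtain c0 where c0: "c0 \<in> Irr G" "rep_isomorphic G (representative c0) ?Y"
        by (rule Irr_ex[OF Y(2)])
      obtain f where f: "intertwiner G (representative c0) ?Y f" "bij_betw f (Vr c0) (rep_space ?Y)"
        by (rule rep_isomorphicE[OF c0(2)])
      have lf: "lin (Vr c0) Y f" and fr: "\<And>g v. g \<in> carrier G \<Longrightarrow> v \<in> Vr c0 \<Longrightarrow> f (rep_act (representative c0) g v) = r g (f v)"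
        using intertwinerD[OF f(1)] by auto
      have fY: "f v \<in> Y" "f v \<in> V" if "v \<in> Vr c0" for v
        using lin_mem[OF lf that] YV by auto
      interpret C: irr_form G "representative c0" "bb c0"
        by (rule bb[OF c0(1)])
      have "\<exists>t. \<forall>u\<in>Vr c0. \<forall>v\<in>Vr c0. \<beta> (f u) (f v) = t * bb c0 u v"
      proof (rule C.invariant_form_proportional)
        show "lin (Vr c0) UNIV (\<lambda>v. \<beta> (f u) (f v))" if "u \<in> Vr c0" for u
          using fY by (intro linI) (auto simp: lin_add[OF lf] lin_scale[OF lf] form.add_r form.scale_r that)
        show "\<beta> (f (rep_act (representative c0) g u)) (f (rep_act (representative c0) g v)) = \<beta> (f u) (f v)"
          if "g \<in> carrier G" "u \<in> Vr c0" "v \<in> Vr c0" for g u v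
          using that fY form_shift[of g "f u" "r g (f v)"] by (simp add: fr r_mem r_inv)
      qed (use fY form.sym in auto)
      then obtain t where t: "\<And>u v. u \<in> Vr c0 \<Longrightarrow> v \<in> Vr c0 \<Longrightarrow> \<beta> (f u) (f v) = t * bb c0 u v"
        by blast
      have t0: "t \<noteq> 0"
      proof -
        obtain v where v: "v \<in> Vr c0" "v \<noteq> 0"
          using irreducibleD(2)[OF C.irr] subspace_0[OF C.subV] by blast
        then have "f v \<noteq> 0"
          using f(2) lin_0[OF lf C.subV] subspace_0[OF C.subV] inj_onD[of f "Vr c0" v 0] by (auto simp: bij_betw_def)
        then have "b (f v) (f v) \<noteq> 0"
          using i.pos[OF fY(2)[OF v(1)]] by simp
        moreover have "\<beta> (f v) (f v) = k * b (f v) (f v)"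
          using S'[OF fY(2)[OF v(1)] fY(2)[OF v(1)]] YV(3)[OF fY(1)[OF v(1)]] fY(2)[OF v(1)] by (simp add: i.scale_r)
        ultimately show ?thesis
          using t[OF v(1) v(1)] k by auto
      qed
      \<comment> \<open>Rescaling the embedding by a real number removes the absolute value of
        \<open>t\<close> and leaves its sign.\<close>
      define s where "s = 1 / sqrt \<bar>t\<bar>"
      define f' where "f' = (\<lambda>v. s *\<^sub>R f v)"
      have s: "s * s * t = sgn t" "s \<noteq> 0"
        using t0 by (auto simp: s_def sgn_if)
      have f'Y: "f' v \<in> Y" "f' v \<in> V" if "v \<in> Vr c0" for v
        using fY[OF that] sY subV by (auto simp: f'_def subspace_scale)
      have lf': "lin (Vr c0) V f'"
        unfolding f'_def using fY by (intro lin_scale_fun subV) (auto intro!: linI simp: lin_add[OF lf] lin_scale[OF lf])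
      have if': "intertwiner G (representative c0) \<rho> f'"
        using lf' fr fY by (auto simp: intertwiner_def f'_def lin_scale[OF act_linear])
      have nf': "\<beta> (f' u) (f' v) = sgn t * bb c0 u v" if "u \<in> Vr c0" "v \<in> Vr c0" for u v
        using t[OF that] fY that s(1) by (simp add: f'_def form.scale_l form.scale_r subspace_scale[OF subV])
      define W2 where "W2 = {x \<in> W. \<forall>y\<in>Y. b y x = 0}"
      have W2W: "x \<in> W" "x \<in> V" if "x \<in> W2" for x
        using that WV by (auto simp: W2_def)
      have sW2: "subspace W2"
        unfolding subspace_def W2_def using subspace_0[OF W(1)] subspace_add[OF W(1)] subspace_scale[OF W(1)] WV YV
        by (auto simp: i.add_r i.scale_r i.form_0)
      have "W2 \<noteq> W"
      proof
        assume eq: "W2 = W"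
        have "y = 0" if "y \<in> Y" for y
          using that eq YV[OF that] i.pos[OF YV(1)[OF that]] by (force simp: W2_def)
        then show False
          using irreducibleD(2)[OF Y(2)] subspace_0[OF sY] by auto
      qed
      then have "W2 \<subset> W"
        by (auto simp: W2_def)
      then have dim: "dim W2 < dim W"
        by (rule dim_less_subspace[OF findim_subset[OF fdV W(1,2)] sW2])
      have "\<exists>(m::nat) c \<iota> \<epsilon>. orthogonal_embeddings G \<rho> \<beta> bb W2 {..<m} c \<iota> \<epsilon>"
      proof (rule less.hyps[OF dim sW2])
        show "W2 \<subseteq> V"
          using W2W by auto
        show "r g x \<in> W2" if g: "g \<in> carrier G" and x: "x \<in> W2" for g x
        proof -
          have "b y (r g x) = 0" if y: "y \<in> Y" for y
            using j.form_shift[of "inv g" y x] rY[of "inv g" y] g x y W2W[OF x] YV(1)[OF y] by (simp add: W2_def)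
          then show ?thesis
            using W(3)[OF g W2W(1)[OF x]] by (simp add: W2_def)
        qed
        show "S x \<in> W2" if x: "x \<in> W2" for x
        proof -
          have "b y (S x) = 0" if y: "y \<in> Y" for y
          proof -
            have "b y (S x) = b (S y) x"
              using S'[OF YV(1)[OF y] W2W(2)[OF x]] S(2)[OF W2W(2)[OF x] YV(1)[OF y]] by simp
            then show ?thesis
              using x y YV[OF y] W2W[OF x] by (simp add: i.scale_l W2_def)
          qed
          then show ?thesis
            using W(4)[OF W2W(1)[OF x]] by (simp add: W2_def)
        qed
      qed
      then obtain m :: nat and c \<iota> \<epsilon> where O: "orthogonal_embeddings G \<rho> \<beta> bb W2 {..<m} c \<iota> \<epsilon>"
        by blast
      have cross: "\<beta> x y = 0" "\<beta> y x = 0" if "x \<in> W2" "y \<in> Y" for x y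
      proof -
        have "\<beta> x y = k * b x y"
          using S'[OF W2W(2)[OF that(1)] YV(1)[OF that(2)]] YV[OF that(2)] W2W[OF that(1)] by (simp add: i.scale_r)
        also have "b x y = 0"
          using that i.sym[OF W2W(2)[OF that(1)] YV(1)[OF that(2)]] by (simp add: W2_def)
        finally show "\<beta> x y = 0" "\<beta> y x = 0"
          using form.sym[OF W2W(2)[OF that(1)] YV(1)[OF that(2)]] by auto
      qed
      let ?c = "c(m := c0)" and ?\<iota> = "\<iota>(m := f')" and ?\<epsilon> = "\<epsilon>(m := sgn t)"
      have old: "c k \<in> Irr G" "intertwiner G (representative (c k)) \<rho> (\<iota> k)" "u \<in> Vr (c k) \<Longrightarrow> \<iota> k u \<in> W2"
        "\<epsilon> k \<in> {1, -1}" "u \<in> Vr (c k) \<Longrightarrow> v \<in> Vr (c k) \<Longrightarrow> \<beta> (\<iota> k u) (\<iota> k v) = \<epsilon> k * bb (c k) u v"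
        if "k < m" for k u v
        using O that unfolding orthogonal_embeddings_def by (blast, blast, blast, blast, blast)
      have old_orth: "\<beta> (\<iota> k u) (\<iota> l v) = 0"
        if "k < m" "l < m" "k \<noteq> l" "u \<in> Vr (c k)" "v \<in> Vr (c l)" for k l u v
        using O that unfolding orthogonal_embeddings_def by blast
      have "orthogonal_embeddings G \<rho> \<beta> bb W {..<Suc m} ?c ?\<iota> ?\<epsilon>"
        unfolding orthogonal_embeddings_def
      proof (intro conjI ballI impI)
        show "finite {..<Suc m}"
          by simp
        fix l assume l: "l \<in> {..<Suc m}"
        show "?c l \<in> Irr G" "intertwiner G (representative (?c l)) \<rho> (?\<iota> l)" "?\<epsilon> l \<in> {1, -1}"
          using old[of l] l c0(1) if' t0 by (auto simp: less_Suc_eq sgn_if)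
        show "?\<iota> l ` Vr (?c l) \<subseteq> W"
          using old(3)[of l] l f'Y(1) W2W(1) YV(2) by (cases "l = m") (auto simp: less_Suc_eq)
        show "\<beta> (?\<iota> l u) (?\<iota> l v) = ?\<epsilon> l * bb (?c l) u v" if "u \<in> Vr (?c l)" "v \<in> Vr (?c l)" for u v
          using that old(5)[of l u v] l nf' by (cases "l = m") (auto simp: less_Suc_eq)
        fix l' u v assume l': "l' \<in> {..<Suc m}" "l \<noteq> l'" "u \<in> Vr (?c l)" "v \<in> Vr (?c l')"
        show "\<beta> (?\<iota> l u) (?\<iota> l' v) = 0"
          using l l' old_orth[of l l' u v] cross old(3)[of l u] old(3)[of l' v] f'Y(1)
          by (cases "l = m"; cases "l' = m") (auto simp: less_Suc_eq)
      next
        fix w assume w: "w \<in> W"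
        have YW: "Y \<subseteq> W"
          using YV by auto
        obtain y where y: "y \<in> Y" "\<forall>u\<in>Y. b u (w - y) = 0"
          using W.orth_decomp[OF sY YW w] by blast
        have "w - y \<in> W2"
          using y w YV subspace_diff[OF W(1)] by (auto simp: W2_def)
        then obtain p where p: "\<forall>i\<in>{..<m}. p i \<in> Vr (c i)" "w - y = (\<Sum>i\<in>{..<m}. \<iota> i (p i))"
          using O unfolding orthogonal_embeddings_def by blast
        obtain v where v: "v \<in> Vr c0" "f v = y"
          using f(2) y(1) by (auto simp: bij_betw_def)
        have v': "(1 / s) *\<^sub>R v \<in> Vr c0" "f' ((1 / s) *\<^sub>R v) = y"
          using v s(2) by (auto simp: f'_def lin_scale[OF lf] subspace_scale[OF C.subV])
        have "(\<Sum>i\<in>{..<m}. ?\<iota> i ((p(m := (1 / s) *\<^sub>R v)) i)) = (\<Sum>i\<in>{..<m}. \<iota> i (p i))"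
          by (intro sum.cong) auto
        then have "w = (\<Sum>i\<in>{..<Suc m}. ?\<iota> i ((p(m := (1 / s) *\<^sub>R v)) i))"
          using p(2) v'(2) by (simp add: lessThan_Suc algebra_simps)
        then show "\<exists>f. (\<forall>i\<in>{..<Suc m}. f i \<in> Vr (?c i)) \<and> w = (\<Sum>i\<in>{..<Suc m}. ?\<iota> i (f i))"
          using p(1) v'(1) by (intro exI[of _ "p(m := (1 / s) *\<^sub>R v)"]) (auto simp: less_Suc_eq)
      qed
      then show ?thesis
        by blast
    qed
  qed
  from this[of V] show ?thesis
    using subV r_mem S(1) by blast
qed

text \<open>Summands are regrouped as pairs of a class and a running number; the numbers become the
  row and column indices of one matrix block per class.\<close>

lemma orthogonal_embeddings_pairs:
  assumes bb: "\<And>c. c \<in> Irr G \<Longrightarrow> irr_form G (representative c) (bb c)"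
  shows "\<exists>(n :: 'g model_rep set \<Rightarrow> nat) \<iota> \<epsilon>. orthogonal_embeddings G \<rho> \<beta> bb V (SIGMA c:Irr G. {..<n c}) fst \<iota> \<epsilon>"
proof -
  obtain m :: nat and c \<iota> \<epsilon> where O: "orthogonal_embeddings G \<rho> \<beta> bb V {..<m} c \<iota> \<epsilon>"
    using orthogonal_embeddings_ex[OF bb] by blast
  have c: "c k \<in> Irr G" if "k < m" for k
    using O that by (auto simp: orthogonal_embeddings_def)
  define n where "n = (\<lambda>a. card {k. k < m \<and> c k = a})"
  have "\<exists>h. bij_betw h {..<n a} {k. k < m \<and> c k = a}" for a
    using ex_bij_betw_nat_finite[of "{k. k < m \<and> c k = a}"] by (auto simp: n_def atLeast0LessThan)
  then obtain h where h: "\<And>a. bij_betw (h a) {..<n a} {k. k < m \<and> c k = a}"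
    by metis
  let ?I = "SIGMA c:Irr G. {..<n c}"
  have hm: "h a k < m" "c (h a k) = a" if "k < n a" for a k
    using bij_betw_apply[OF h, of k a] that by auto
  have "bij_betw (\<lambda>(a, k). h a k) ?I {..<m}"
  proof (rule bij_betw_imageI)
    show "inj_on (\<lambda>(a, k). h a k) ?I"
    proof (rule inj_onI)
      fix p q assume pq: "p \<in> ?I" "q \<in> ?I" "(\<lambda>(a, k). h a k) p = (\<lambda>(a, k). h a k) q"
      obtain a k a' k' where e: "p = (a, k)" "q = (a', k')"
        by (cases p; cases q)
      have k: "k < n a" "k' < n a'" "h a k = h a' k'"
        using pq by (auto simp: e)
      then have "a = a'"
        using hm(2)[of k a] hm(2)[of k' a'] by simp
      moreover from this have "k = k'"
        using k h[of a] by (auto simp: bij_betw_def inj_on_def)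
      ultimately show "p = q"
        by (simp add: e)
    qed
    show "(\<lambda>(a, k). h a k) ` ?I = {..<m}"
    proof (intro equalityI subsetI)
      fix l assume l: "l \<in> {..<m}"
      then have "l \<in> h (c l) ` {..<n (c l)}"
        using bij_betw_imp_surj_on[OF h, of "c l"] by simp
      then show "l \<in> (\<lambda>(a, k). h a k) ` ?I"
        using c l by force
    qed (use hm in auto)
  qed
  from orthogonal_embeddings_reindex[OF O this]
  have O': "orthogonal_embeddings G \<rho> \<beta> bb V ?I (\<lambda>j. c (case j of (a, k) \<Rightarrow> h a k))
      (\<lambda>j. \<iota> (case j of (a, k) \<Rightarrow> h a k)) (\<lambda>j. \<epsilon> (case j of (a, k) \<Rightarrow> h a k))" .
  have "c (case j of (a, k) \<Rightarrow> h a k) = fst j" if "j \<in> ?I" for j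
    using that hm by auto
  then have "orthogonal_embeddings G \<rho> \<beta> bb V ?I fst
      (\<lambda>j. \<iota> (case j of (a, k) \<Rightarrow> h a k)) (\<lambda>j. \<epsilon> (case j of (a, k) \<Rightarrow> h a k))"
    by (rule orthogonal_embeddings_cong[OF O'])
  then show ?thesis
    by blast
qed

end

section \<open>Fourier inversion on the centre of the group algebra\<close>

lemma intertwiner_act:
  assumes "real_rep G \<pi>" "intertwiner G \<pi> \<sigma> f" "v \<in> rep_space \<pi>"
  shows "f (group_alg_act G \<pi> x v) = group_alg_act G \<sigma> x (f v)"
proof -
  interpret real_rep G \<pi>
    by fact
  note s = findim_subspace[OF space_fin_dim]
  show ?thesis
    unfolding group_alg_act_def using assms(3) lin_mem[OF act_linear]
    by (subst lin_combination[OF intertwinerD(1)[OF assms(2)] s])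
      (auto simp: intertwinerD(2)[OF assms(2)] intro!: sum.cong)
qed

context fin_group
begin

text \<open>The left regular representation. An element of the group algebra is recovered from its
  action on the unit element, which makes the Fourier transform injective.\<close>

definition reg :: "('a, 'a \<Rightarrow> real) rep" where
  "reg = \<lparr>rep_space = RG, rep_act = (\<lambda>g x. group_elem g \<star> x)\<rparr>"

lemma reg_rep: "fin_rep G reg"
proof (intro fin_rep.intro real_rep.intro real_rep_axioms.intro)
  interpret D: fin_dim_algebra "group_alg G"
    by (rule group_alg_fin_dim)
  show "fin_group G" "group G"
    by unfold_locales
  show "findim (rep_space reg)"
    using findim_frame[OF frame_RG subspace_RG] by (simp add: reg_def)
  show "lin (rep_space reg) (rep_space reg) (rep_act reg g)" if "g \<in> carrier G" for g
    using that D.distrib_left D.scale_mult_right by (intro linI) (auto simp: reg_def)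
  show "rep_act reg \<one> v = v" if "v \<in> rep_space reg" for v
    using that by (simp add: reg_def conv_one)
  show "rep_act reg (g \<otimes> h) v = rep_act reg g (rep_act reg h v)"
    if gh: "g \<in> carrier G" "h \<in> carrier G" for g h v
  proof -
    have "group_elem (g \<otimes> h) \<star> v = group_elem g \<star> (group_elem h \<star> v)"
      using gh by (intro RG_eqI) (auto simp: conv_elem_left inv_mult_group m_assoc)
    then show ?thesis
      by (simp add: reg_def)
  qed
qed

lemma reg_act: "group_alg_act G reg a x = a \<star> x"
proof (rule ext)
  fix g
  show "group_alg_act G reg a x g = (a \<star> x) g"
  proof (cases "g \<in> carrier G")
    case True
    then show ?thesis
      unfolding conv_apply[OF True, of a x]
      by (simp add: group_alg_act_def reg_def sum_fun_apply conv_elem_left cong: sum.cong)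
  next
    case False
    then show ?thesis
      using conv_closed unfolding RG_iff by (simp add: group_alg_act_def reg_def sum_fun_apply)
  qed
qed

end

lemma (in fin_rep) lin_act_coeff: "lin UNIV UNIV (\<lambda>x. act x v)"
  by (rule linI) (auto simp: act_add act_scale)

text \<open>Fixes for every class a positive invariant form, a division algebra and an
  identification of the commutant, so that all later coordinates refer to the same choices.\<close>

locale irr_choice = fin_group G
  for G :: "('g, 'm) monoid_scheme" (structure) +
  fixes bb :: "'g model_rep set \<Rightarrow> (nat \<Rightarrow> real) \<Rightarrow> (nat \<Rightarrow> real) \<Rightarrow> real"
    and DD :: "'g model_rep set \<Rightarrow> divalg"
    and tt :: "'g model_rep set \<Rightarrow> quat \<Rightarrow> (nat \<Rightarrow> real) \<Rightarrow> (nat \<Rightarrow> real)"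
  assumes irr_data: "c \<in> Irr G \<Longrightarrow> irr_data G (representative c) (bb c) (DD c) (tt c)"

lemma (in fin_group) irr_choice_ex: "\<exists>bb DD tt. irr_choice G bb DD tt"
proof -
  have "\<exists>b D \<theta>. irr_data G (representative c) b D \<theta>" if c: "c \<in> Irr G" for c :: "'a model_rep set"
  proof -
    note ir = representative_in(2)[OF c]
    interpret fin_rep G "representative c"
      using irreducibleD(1)[OF ir] by (intro fin_rep.intro fin_group_axioms)
    obtain b where "irr_form G (representative c) b"
      using irr_form_ex[OF ir] by blast
    then interpret I: irr_form G "representative c" b .
    obtain D \<theta> where "I.star_iso D \<theta>"
      using I.star_iso_ex by blast
    then have "irr_data G (representative c) b D \<theta>"
      by unfold_locales
    then show ?thesis
      by blast
  qed
  then obtain bb DD tt where "\<And>c :: 'a model_rep set. c \<in> Irr G \<Longrightarrow> irr_data G (representative c) (bb c) (DD c) (tt c)"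
    by metis
  then have "irr_choice G bb DD tt"
    by (intro irr_choice.intro irr_choice_axioms.intro fin_group_axioms)
  then show ?thesis
    by blast
qed

context irr_choice
begin

abbreviation actc :: "'g model_rep set \<Rightarrow> ('g \<Rightarrow> real) \<Rightarrow> (nat \<Rightarrow> real) \<Rightarrow> nat \<Rightarrow> real" where
  "actc c \<equiv> group_alg_act G (representative c)"

abbreviation chc :: "'g model_rep set \<Rightarrow> quat \<Rightarrow> 'g \<Rightarrow> real" where
  "chc c q \<equiv> fin_rep.chr G (representative c) (tt c q)"

abbreviation dmc :: "'g model_rep set \<Rightarrow> real" where
  "dmc c \<equiv> real (dim (Vr c))"

abbreviation dd :: "'g model_rep set \<Rightarrow> real" where
  "dd c \<equiv> div_dim (DD c)"

abbreviation ZD :: "'g model_rep set \<Rightarrow> quat set" where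
  "ZD c \<equiv> center (div_alg (DD c))"

lemma dd_pos: "dd c > 0"
  by (cases "DD c") auto

lemma dmc_pos: "c \<in> Irr G \<Longrightarrow> dmc c > 0"
  by (rule irr_form.dm_pos[OF irr_data.axioms(1)[OF irr_data]])

lemma ZD_D: "q \<in> ZD c \<Longrightarrow> q \<in> div_carrier (DD c)"
  by (simp add: center_def div_alg_def)

lemma one_ZD: "1 \<in> ZD c"
  by (simp add: center_def div_alg_def)

lemma chc_cf: "c \<in> Irr G \<Longrightarrow> q \<in> div_carrier (DD c) \<Longrightarrow> chc c q \<in> cf"
proof -
  assume c: "c \<in> Irr G" and q: "q \<in> div_carrier (DD c)"
  interpret C: irr_data G "representative c" "bb c" "DD c" "tt c"
    by (rule irr_data[OF c])
  show ?thesis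
    by (rule C.chr_cf[OF C.theta_E[OF q]])
qed

lemma actc_chc:
  assumes c: "c \<in> Irr G" "c' \<in> Irr G" and q: "q \<in> ZD c" and w: "w \<in> Vr c'"
  shows "actc c' (chc c q) w = (if c = c' then (N / dmc c * dd c) *\<^sub>R tt c q w else 0)"
proof -
  interpret C: irr_data G "representative c" "bb c" "DD c" "tt c"
    by (rule irr_data[OF c(1)])
  show ?thesis
    using C.act_chr_central[OF q] w C.act_chr_other[OF C.theta_E[OF ZD_D[OF q]] representative_in(2)[OF c(2)] _ w]
      representative_eq[OF c] by auto
qed

text \<open>The elements \<open>chc c 1\<close> act by a non-zero scalar on the class
  \<open>c\<close> and by zero on the others. They are therefore independent in the group algebra,
  which has a finite basis.\<close>

lemma finite_Irr: "finite (Irr G)"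
proof -
  let ?X = "\<lambda>c. chc c 1"
  have sep: "u c' = 0"
    if T: "finite T" "T \<subseteq> Irr G" and z: "(\<Sum>c\<in>T. u c *\<^sub>R ?X c) = 0" and c': "c' \<in> T" for T u c'
  proof -
    have cI: "c' \<in> Irr G"
      using T c' by auto
    interpret C: irr_data G "representative c'" "bb c'" "DD c'" "tt c'"
      by (rule irr_data[OF cI])
    obtain w where w: "w \<in> Vr c'" "w \<noteq> 0"
      using irreducibleD(2)[OF C.irr] subspace_0[OF C.subV] by blast
    have "0 = actc c' (\<Sum>c\<in>T. u c *\<^sub>R ?X c) w"
      unfolding z by (simp add: group_alg_act_def)
    also have "\<dots> = (\<Sum>c\<in>T. u c *\<^sub>R actc c' (?X c) w)"
      by (rule lin_combination[OF C.lin_act_coeff]) auto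
    also have "\<dots> = (\<Sum>c\<in>T. if c = c' then (u c' * (N / dmc c' * dd c')) *\<^sub>R w else 0)"
      using T(2) w(1) cI by (intro sum.cong refl) (auto simp: actc_chc one_ZD C.theta_one C.one_apply subset_iff)
    also have "\<dots> = (u c' * (N / dmc c' * dd c')) *\<^sub>R w"
      using T(1) c' by simp
    finally show ?thesis
      using w(2) N_pos dmc_pos[OF cI] dd_pos[of c'] by simp
  qed
  have inj: "inj_on ?X (Irr G)"
  proof (rule inj_onI, rule ccontr)
    fix c c' assume cc: "c \<in> Irr G" "c' \<in> Irr G" "?X c = ?X c'" "c \<noteq> c'"
    have "(\<Sum>a\<in>{c, c'}. (if a = c then 1 else -1) *\<^sub>R ?X a) = 0"
      using cc by simp
    from sep[OF _ _ this, of c] show False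
      using cc by simp
  qed
  have "independent (?X ` Irr G)"
    unfolding real_vector.independent_explicit_finite_subsets
  proof (intro allI impI ballI)
    fix S u v assume S: "S \<subseteq> ?X ` Irr G" "finite S" "(\<Sum>v\<in>S. u v *\<^sub>R v) = 0" "v \<in> S"
    obtain T where T: "T \<subseteq> Irr G" "finite T" "S = ?X ` T"
      using finite_subset_image[OF S(2,1)] by blast
    obtain c where c: "c \<in> T" "v = ?X c"
      using S(4) T(3) by blast
    have "(\<Sum>c\<in>T. u (?X c) *\<^sub>R ?X c) = 0"
      using S(3) unfolding T(3) by (subst (asm) sum.reindex[OF inj_on_subset[OF inj T(1)]]) simp
    from sep[OF T(2,1) this c(1)] show "u v = 0"
      unfolding c(2) .
  qed
  moreover have "?X ` Irr G \<subseteq> span (group_elem ` carrier G)"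
  proof
    fix x assume "x \<in> ?X ` Irr G"
    then have "x \<in> RG"
      using chc_cf cfD(1) by auto
    then have "x = (\<Sum>g\<in>carrier G. x g *\<^sub>R group_elem g)"
      using frameD(4)[OF frame_RG] by simp
    also have "\<dots> \<in> span (group_elem ` carrier G)"
      by (intro span_sum span_scale span_base imageI)
    finally show "x \<in> span (group_elem ` carrier G)" .
  qed
  ultimately have "finite (?X ` Irr G)"
    using independent_span_bound[of "group_elem ` carrier G"] fin by blast
  then show ?thesis
    using finite_imageD[OF _ inj] by blast
qed

text \<open>The regular representation splits into irreducibles, so elements that act alike on all
  classes act alike on the unit element of the group algebra, where their action returns the
  elements themselves.\<close>

lemma cf_eqI:
  assumes x: "x \<in> cf" and y: "y \<in> cf" and eq: "\<And>c w. c \<in> Irr G \<Longrightarrow> w \<in> Vr c \<Longrightarrow> actc c x w = actc c y w"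
  shows "x = y"
proof -
  interpret R: fin_rep G reg
    by (rule reg_rep)
  obtain b where b: "inner_space RG b"
    "\<forall>g\<in>carrier G. \<forall>u\<in>RG. \<forall>v\<in>RG. b (rep_act reg g u) (rep_act reg g v) = b u v"
    using R.invariant_inner_ex by (auto simp: reg_def)
  interpret i: inner_space RG b
    by fact
  interpret F: form_rep G reg b
    using b(2) i.nondeg i.sym i.lin_b by unfold_locales (auto simp: invariant_form_def lin_real reg_def)
  obtain m :: nat and c \<iota> \<epsilon> where O: "orthogonal_embeddings G reg b bb (rep_space reg) {..<m} c \<iota> \<epsilon>"
    using F.orthogonal_embeddings_ex[of bb] irr_data.axioms(1)[OF irr_data] by blast
  then have O': "c k \<in> Irr G" "intertwiner G (representative (c k)) reg (\<iota> k)" if "k < m" for k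
    using that by (auto simp: orthogonal_embeddings_def)
  obtain f where f: "\<forall>k\<in>{..<m}. f k \<in> Vr (c k)" "group_elem \<one> = (\<Sum>k\<in>{..<m}. \<iota> k (f k))"
  proof -
    have "group_elem \<one> \<in> rep_space reg"
      by (simp add: reg_def)
    then show thesis
      using O that unfolding orthogonal_embeddings_def by blast
  qed
  have exp: "z = (\<Sum>k\<in>{..<m}. \<iota> k (actc (c k) z (f k)))" if z: "z \<in> cf" for z
  proof -
    have mem: "\<iota> k (f k) \<in> rep_space reg" if "k < m" for k
      using lin_mem[OF intertwinerD(1)[OF O'(2)[OF that]]] f(1) that by auto
    have "z = group_alg_act G reg z (\<Sum>k\<in>{..<m}. \<iota> k (f k))"
      using z by (simp add: f(2)[symmetric] reg_act conv_one cfD)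
    also have "\<dots> = (\<Sum>k\<in>{..<m}. group_alg_act G reg z (\<iota> k (f k)))"
      using mem by (intro lin_sum[OF R.lin_act R.subV]) auto
    also have "\<dots> = (\<Sum>k\<in>{..<m}. \<iota> k (actc (c k) z (f k)))"
    proof (rule sum.cong[OF refl])
      fix k assume "k \<in> {..<m}"
      then show "group_alg_act G reg z (\<iota> k (f k)) = \<iota> k (actc (c k) z (f k))"
        using O'[of k] f(1) intertwiner_act[OF irreducibleD(1)[OF representative_in(2)[OF O'(1)]] O'(2)] by simp
    qed
    finally show ?thesis .
  qed
  have "(\<Sum>k\<in>{..<m}. \<iota> k (actc (c k) x (f k))) = (\<Sum>k\<in>{..<m}. \<iota> k (actc (c k) y (f k)))"
    using eq O'(1) f(1) by (intro sum.cong) auto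
  then show ?thesis
    using exp[OF x] exp[OF y] by simp
qed

text \<open>The inverse of \<open>tt c\<close>, for maps that are prescribed on \<open>Vr c\<close>
  alone; \<open>extend_zero\<close> turns such a map into an element of the commutant.\<close>

definition coord :: "'g model_rep set \<Rightarrow> ((nat \<Rightarrow> real) \<Rightarrow> nat \<Rightarrow> real) \<Rightarrow> quat" where
  "coord c x = the_inv_into (div_carrier (DD c)) (tt c) (extend_zero (Vr c) x)"

lemma coord_div: "c \<in> Irr G \<Longrightarrow> intertwiner G (representative c) (representative c) x \<Longrightarrow> coord c x \<in> div_carrier (DD c)"
  and tt_coord: "c \<in> Irr G \<Longrightarrow> intertwiner G (representative c) (representative c) x \<Longrightarrow> w \<in> Vr c \<Longrightarrow> tt c (coord c x) w = x w"
proof -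
  assume c: "c \<in> Irr G" and x: "intertwiner G (representative c) (representative c) x"
  interpret C: irr_data G "representative c" "bb c" "DD c" "tt c"
    by (rule irr_data[OF c])
  note l = lin_inverse[OF C.theta_lin C.theta_bij subspace_div_carrier]
  show "coord c x \<in> div_carrier (DD c)"
    unfolding coord_def by (rule l(3)[OF C.E_extend[OF x]])
  show "tt c (coord c x) w = x w" if "w \<in> Vr c"
    unfolding coord_def using l(4)[OF C.E_extend[OF x]] that by (simp add: extend_zero_def)
qed

lemma coord_eqI:
  assumes c: "c \<in> Irr G" and q: "q \<in> div_carrier (DD c)" and eq: "\<And>w. w \<in> Vr c \<Longrightarrow> x w = tt c q w"
  shows "coord c x = q"
proof -
  interpret C: irr_data G "representative c" "bb c" "DD c" "tt c"
    by (rule irr_data[OF c])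
  have "extend_zero (Vr c) x = tt c q"
    using eq End_setD(2)[OF C.ED(1)[OF C.theta_E[OF q]]] by (auto simp: extend_zero_def fun_eq_iff)
  then show ?thesis
    unfolding coord_def using lin_inverse(2)[OF C.theta_lin C.theta_bij subspace_div_carrier q] by simp
qed

abbreviation ev :: "'g model_rep set \<Rightarrow> ('g \<Rightarrow> real) \<Rightarrow> quat" where
  "ev c a \<equiv> coord c (actc c a)"

lemma actc_intertwiner:
  assumes "c \<in> Irr G" "a \<in> cf"
  shows "intertwiner G (representative c) (representative c) (actc c a)"
proof -
  interpret C: irr_data G "representative c" "bb c" "DD c" "tt c"
    by (rule irr_data[OF assms(1)])
  show ?thesis
    using C.act_cf_commute[OF assms(2)] C.lin_act by (simp add: intertwiner_def)
qed

lemma tt_ev: "c \<in> Irr G \<Longrightarrow> a \<in> cf \<Longrightarrow> w \<in> Vr c \<Longrightarrow> tt c (ev c a) w = actc c a w"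
  by (rule tt_coord[OF _ actc_intertwiner])

lemma ev_ZD:
  assumes c: "c \<in> Irr G" and a: "a \<in> cf"
  shows "ev c a \<in> ZD c"
proof -
  interpret C: irr_data G "representative c" "bb c" "DD c" "tt c"
    by (rule irr_data[OF c])
  obtain q where q: "q \<in> ZD c" "tt c q = extend_zero (Vr c) (actc c a)"
    by (rule C.theta_act[OF a])
  have "ev c a = q"
    using q by (intro coord_eqI[OF c ZD_D]) (auto simp: extend_zero_def)
  then show ?thesis
    using q(1) by simp
qed

lemma ev_conv:
  assumes c: "c \<in> Irr G" and a: "a \<in> cf" "a' \<in> cf"
  shows "ev c (a \<star> a') = ev c a * ev c a'"
proof (rule coord_eqI[OF c])
  interpret C: irr_data G "representative c" "bb c" "DD c" "tt c"
    by (rule irr_data[OF c])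
  note e = ZD_D[OF ev_ZD[OF c a(1)]] ZD_D[OF ev_ZD[OF c a(2)]]
  show "ev c a * ev c a' \<in> div_carrier (DD c)"
    using e by simp
  show "actc c (a \<star> a') w = tt c (ev c a * ev c a') w" if "w \<in> Vr c" for w
    using that a by (simp add: C.theta_mult[OF e] tt_ev[OF c] C.act_mem C.act_conv)
qed

lemma ev_add: "c \<in> Irr G \<Longrightarrow> a \<in> cf \<Longrightarrow> a' \<in> cf \<Longrightarrow> ev c (a + a') = ev c a + ev c a'"
  and ev_scale: "c \<in> Irr G \<Longrightarrow> a \<in> cf \<Longrightarrow> ev c (k *\<^sub>R a) = k *\<^sub>R ev c a"
  and ev_one: "c \<in> Irr G \<Longrightarrow> ev c (group_elem \<one>) = 1"
  and ev_flip: "c \<in> Irr G \<Longrightarrow> a \<in> cf \<Longrightarrow> ev c (flip a) = qcnj (ev c a)"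
  and ev_squares: "c \<in> Irr G \<Longrightarrow> ev c squares = of_real (N / dmc c * (2 - dd c))"
proof -
  assume c: "c \<in> Irr G"
  interpret C: irr_data G "representative c" "bb c" "DD c" "tt c"
    by (rule irr_data[OF c])
  have e: "ev c a \<in> div_carrier (DD c)" if "a \<in> cf" for a
    by (rule ZD_D[OF ev_ZD[OF c that]])
  show "ev c (a + a') = ev c a + ev c a'" if a: "a \<in> cf" "a' \<in> cf"
    using e a by (intro coord_eqI[OF c]) (auto simp: lin_add[OF C.theta_lin] tt_ev[OF c] C.act_add)
  show "ev c (k *\<^sub>R a) = k *\<^sub>R ev c a" if a: "a \<in> cf"
    using e a by (intro coord_eqI[OF c]) (auto simp: lin_scale[OF C.theta_lin] tt_ev[OF c] C.act_scale)
  show "ev c (group_elem \<one>) = 1"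
    by (intro coord_eqI[OF c]) (auto simp: C.theta_one C.one_apply C.act_group_one)
  show "ev c (flip a) = qcnj (ev c a)" if a: "a \<in> cf"
  proof (rule coord_eqI[OF c])
    have "tt c (ev c a) = extend_zero (Vr c) (actc c a)"
      using C.theta_E[OF e[OF a]] a by (intro C.E_eqI C.act_E) (auto simp: extend_zero_def tt_ev[OF c])
    then have "tt c (qcnj (ev c a)) = extend_zero (Vr c) (actc c (flip a))"
      using e[OF a] C.adj_act[OF a] by (simp add: C.theta_cnj)
    then show "actc c (flip a) w = tt c (qcnj (ev c a)) w" if "w \<in> Vr c" for w
      using that by (simp add: extend_zero_def)
  qed (use e a in auto)
  show "ev c squares = of_real (N / dmc c * (2 - dd c))"
  proof (rule coord_eqI[OF c])
    show "actc c squares w = tt c (of_real (N / dmc c * (2 - dd c))) w" if "w \<in> Vr c" for w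
      using that by (simp add: of_real_def lin_scale[OF C.theta_lin] C.theta_one C.one_apply C.act_squares_scalar)
  qed (simp add: of_real_def)
qed

text \<open>The coefficients invert the factor \<open>N / dmc c * dd c\<close> by which a central
  character element acts on its own class.\<close>

definition fourier :: "('g model_rep set \<Rightarrow> quat) \<Rightarrow> 'g \<Rightarrow> real" where
  "fourier q = (\<Sum>c\<in>Irr G. (dmc c / (N * dd c)) *\<^sub>R chc c (q c))"

lemma fourier_cf: "(\<And>c. c \<in> Irr G \<Longrightarrow> q c \<in> ZD c) \<Longrightarrow> fourier q \<in> cf"
  unfolding fourier_def by (intro subspace_sum subspace_scale subspace_cf chc_cf ZD_D)

lemma ev_fourier:
  assumes q: "\<And>c. c \<in> Irr G \<Longrightarrow> q c \<in> ZD c" and c': "c' \<in> Irr G"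
  shows "ev c' (fourier q) = q c'"
proof (rule coord_eqI[OF c' ZD_D[OF q[OF c']]])
  interpret C: irr_data G "representative c'" "bb c'" "DD c'" "tt c'"
    by (rule irr_data[OF c'])
  fix w assume w: "w \<in> Vr c'"
  have "actc c' (fourier q) w = (\<Sum>c\<in>Irr G. (dmc c / (N * dd c)) *\<^sub>R actc c' (chc c (q c)) w)"
    unfolding fourier_def by (rule lin_combination[OF C.lin_act_coeff]) auto
  also have "\<dots> = (\<Sum>c\<in>Irr G. if c = c' then tt c' (q c') w else 0)"
  proof (intro sum.cong refl)
    fix c assume c: "c \<in> Irr G"
    have "dmc c / (N * dd c) * (N / dmc c * dd c) = 1"
      using N_pos dmc_pos[OF c] dd_pos[of c] by simp
    then show "(dmc c / (N * dd c)) *\<^sub>R actc c' (chc c (q c)) w = (if c = c' then tt c' (q c') w else 0)"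
      by (simp only: actc_chc[OF c c' q[OF c] w] if_distrib[of "\<lambda>t. _ *\<^sub>R t"] scaleR_scaleR) auto
  qed
  finally show "actc c' (fourier q) w = tt c' (q c') w"
    using finite_Irr c' by simp
qed

lemma fourier_ev: "a \<in> cf \<Longrightarrow> fourier (\<lambda>c. ev c a) = a"
proof (rule cf_eqI)
  assume a: "a \<in> cf"
  show F: "fourier (\<lambda>c. ev c a) \<in> cf"
    by (rule fourier_cf[OF ev_ZD[OF _ a]])
  show "actc c (fourier (\<lambda>c. ev c a)) w = actc c a w" if "c \<in> Irr G" "w \<in> Vr c" for c w
    using tt_ev[OF that(1) F that(2)] ev_fourier[OF ev_ZD[OF _ a] that(1)] tt_ev[OF that(1) a that(2)] by simp
qed

text \<open>At the unit element the character sees only the real part of a coordinate, with factor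
  \<open>dmc c\<close>. The \<open>dd c\<close> in the denominator is the origin of the division by
  d in the functional on the centre of D.\<close>

lemma value_at_one:
  assumes a: "a \<in> cf"
  shows "a \<one> = (\<Sum>c\<in>Irr G. (dmc c)\<^sup>2 / (N * dd c) * qRe (ev c a))"
proof -
  have "a \<one> = fourier (\<lambda>c. ev c a) \<one>"
    by (simp add: fourier_ev[OF a])
  also have "\<dots> = (\<Sum>c\<in>Irr G. dmc c / (N * dd c) * chc c (ev c a) \<one>)"
    by (simp add: fourier_def sum_fun_apply)
  also have "\<dots> = (\<Sum>c\<in>Irr G. (dmc c)\<^sup>2 / (N * dd c) * qRe (ev c a))"
  proof (rule sum.cong[OF refl])
    fix c assume c: "c \<in> Irr G"
    interpret C: irr_data G "representative c" "bb c" "DD c" "tt c"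
      by (rule irr_data[OF c])
    note e = ZD_D[OF ev_ZD[OF c a]]
    have "chc c (ev c a) \<one> = tr (Vr c) (\<lambda>v. tt c (ev c a) (rep_act (representative c) \<one> v))"
      by (simp add: C.chr_def extend_zero_def)
    also have "\<dots> = dmc c * qRe (ev c a)"
      using C.tr_theta[OF e] trace_cong[OF C.fdV C.ED(2)[OF C.theta_E[OF e]],
          of "\<lambda>v. tt c (ev c a) (rep_act (representative c) \<one> v)"] by (simp add: C.act_one)
    finally show "dmc c / (N * dd c) * chc c (ev c a) \<one> = (dmc c)\<^sup>2 / (N * dd c) * qRe (ev c a)"
      by (simp add: power2_eq_square)
  qed
  finally show ?thesis .
qed

text \<open>A commutant is isomorphic to exactly one of the three algebras, so the index pairs of
  the direct sum correspond to the classes.\<close>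

lemma Irr_div_iff: "c \<in> Irr_div G D \<longleftrightarrow> c \<in> Irr G \<and> DD c = D"
proof (cases "c \<in> Irr G")
  case True
  interpret C: irr_data G "representative c" "bb c" "DD c" "tt c"
    by (rule irr_data[OF True])
  show ?thesis
    using C.alg_iso_div[of D] C.alg_iso_div_ex True by (auto simp: Irr_div_def)
qed (simp add: Irr_div_def)

lemma sum_Irr_div:
  "(\<Sum>i\<in>(SIGMA D:UNIV. Irr_div G D). F i) = (\<Sum>c\<in>Irr G. F (DD c, c))"
  by (rule sum.reindex_bij_witness[of _ "\<lambda>c. (DD c, c)" snd]) (auto simp: Irr_div_iff)

end

section \<open>Block matrices\<close>

lemma (in fin_rep) intertwiner_sum:
  assumes "\<And>i. i \<in> I \<Longrightarrow> intertwiner G \<rho> \<rho> (f i)"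
  shows "intertwiner G \<rho> \<rho> (\<lambda>v. \<Sum>i\<in>I. f i v)"
  unfolding intertwiner_def
proof (intro conjI ballI)
  show "lin V V (\<lambda>v. \<Sum>i\<in>I. f i v)"
    by (intro lin_sum_fun subV intertwinerD(1)[OF assms])
  fix g v assume "g \<in> carrier G" "v \<in> V"
  then show "(\<Sum>i\<in>I. f i (r g v)) = r g (\<Sum>i\<in>I. f i v)"
    using lin_mem[OF intertwinerD(1)[OF assms]]
    by (simp add: lin_sum[OF act_linear subV] intertwinerD(2)[OF assms])
qed

lemma qcnj_0 [simp]: "qcnj 0 = 0"
  by (simp add: quat_eq_iff)

lemma qRe_sum: "qRe (\<Sum>i\<in>I. f i) = (\<Sum>i\<in>I. qRe (f i))"
  by (induction I rule: infinite_finite_induct) auto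

text \<open>
  The involution that an indefinite invariant form induces on matrices; the signs \<open>e\<close> are those of
  the form on the summands.
\<close>

definition H_signed :: "divalg \<Rightarrow> nat \<Rightarrow> real \<Rightarrow> (nat \<Rightarrow> real) \<Rightarrow> (real, quat, nat \<Rightarrow> nat \<Rightarrow> quat) ecf" where
  "H_signed D n m e = (H_div D n m)\<lparr>starB := (\<lambda>x i j. (e i * e j) *\<^sub>R qcnj (x j i))\<rparr>"

lemma H_div_simps [simp]:
  "algA (H_div D n m) = center_alg (div_alg D)" "funA (H_div D n m) = (\<lambda>a. m\<^sup>2 * qRe a / div_dim D)"
  "algB (H_div D n m) = mat_alg n D" "funB (H_div D n m) = (\<lambda>x. m * qRe (\<Sum>i<n. x i i))"
  "phi (H_div D n m) = scalar_mat n" "elemU (H_div D n m) = of_real ((2 - div_dim D) / m)"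
  "starA (H_div D n m) = qcnj" "starB (H_div D n m) = (\<lambda>x i j. qcnj (x j i))"
  by (simp_all add: H_div_def Let_def dim_div_carrier)

lemma H_signed_simps [simp]:
  "algA (H_signed D n m e) = center_alg (div_alg D)" "funA (H_signed D n m e) = (\<lambda>a. m\<^sup>2 * qRe a / div_dim D)"
  "algB (H_signed D n m e) = mat_alg n D" "funB (H_signed D n m e) = (\<lambda>x. m * qRe (\<Sum>i<n. x i i))"
  "phi (H_signed D n m e) = scalar_mat n" "elemU (H_signed D n m e) = of_real ((2 - div_dim D) / m)"
  "starA (H_signed D n m e) = qcnj" "starB (H_signed D n m e) = (\<lambda>x i j. (e i * e j) *\<^sub>R qcnj (x j i))"
  by (simp_all add: H_signed_def)

lemma mat_alg_simps:
  "x \<in> carrier (mat_alg n D) \<longleftrightarrow> (\<forall>i j. if i < n \<and> j < n then x i j \<in> div_carrier D else x i j = 0)"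
  "mult (mat_alg n D) = (\<lambda>x y i j. \<Sum>k<n. x i k * y k j)" "one (mat_alg n D) = scalar_mat n 1"
  "scale (mat_alg n D) = (*\<^sub>R)"
  by (simp_all add: mat_alg_def)

lemma div_alg_simps [simp]:
  "carrier (div_alg D) = div_carrier D" "mult (div_alg D) = (*)" "one (div_alg D) = 1" "scale (div_alg D) = (*\<^sub>R)"
  by (simp_all add: div_alg_def)

lemma alg_sum_simps:
  "x \<in> carrier (alg_sum I C) \<longleftrightarrow> (\<forall>i\<in>I. x i \<in> carrier (C i)) \<and> (\<forall>i. i \<notin> I \<longrightarrow> x i = 0)"
  "mult (alg_sum I C) = (\<lambda>x y i. if i \<in> I then x i \<otimes>\<^bsub>C i\<^esub> y i else 0)"
  "one (alg_sum I C) = (\<lambda>i. if i \<in> I then \<one>\<^bsub>C i\<^esub> else 0)"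
  "scale (alg_sum I C) = (\<lambda>c x i. scale (C i) c (x i))"
  by (simp_all add: alg_sum_def)

text \<open>Surjectivity is asked for pointwise, since the bijectivity of the maps onto direct sums
  is shown by giving preimages.\<close>

lemma alg_isoI:
  assumes "\<And>x. x \<in> carrier C \<Longrightarrow> f x \<in> carrier D"
    and "\<And>x y. x \<in> carrier C \<Longrightarrow> y \<in> carrier C \<Longrightarrow> f (x + y) = f x + f y"
    and "\<And>c x. x \<in> carrier C \<Longrightarrow> f (scale C c x) = scale D c (f x)"
    and "\<And>x y. x \<in> carrier C \<Longrightarrow> y \<in> carrier C \<Longrightarrow> f (x \<otimes>\<^bsub>C\<^esub> y) = f x \<otimes>\<^bsub>D\<^esub> f y"
    and "f \<one>\<^bsub>C\<^esub> = \<one>\<^bsub>D\<^esub>"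
    and "inj_on f (carrier C)" and "\<And>y. y \<in> carrier D \<Longrightarrow> \<exists>x\<in>carrier C. f x = y"
  shows "alg_iso C D f"
proof -
  have "f ` carrier C = carrier D"
    using assms(1,7) by (metis (no_types, lifting) imageI image_subsetI subsetI subset_antisym)
  then show ?thesis
    using assms(1-6) by (simp add: alg_iso_def alg_hom_def linear_on_def hom_def bij_betw_def)
qed

section \<open>Matrices of intertwiners in an orthogonal decomposition\<close>

locale rep_decomp = rep_data G \<rho> \<beta> \<mu> + irr_choice G bb DD tt
  for G :: "('g, 'm) monoid_scheme" (structure) and \<rho> :: "('g, 'v::real_vector) rep" and \<beta> \<mu> bb DD tt +
  fixes n :: "'g model_rep set \<Rightarrow> nat" and \<iota> \<epsilon>
  assumes embeddings: "orthogonal_embeddings G \<rho> \<beta> bb V (SIGMA c:Irr G. {..<n c}) fst \<iota> \<epsilon>"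
begin

abbreviation I :: "('g model_rep set \<times> nat) set" where
  "I \<equiv> SIGMA c:Irr G. {..<n c}"

lemma finite_I: "finite I"
  and Irr_fst: "i \<in> I \<Longrightarrow> fst i \<in> Irr G"
  and emb: "i \<in> I \<Longrightarrow> intertwiner G (representative (fst i)) \<rho> (\<iota> i)"
  and eps: "i \<in> I \<Longrightarrow> \<epsilon> i = 1 \<or> \<epsilon> i = -1"
  and emb_norm: "i \<in> I \<Longrightarrow> u \<in> Vr (fst i) \<Longrightarrow> w \<in> Vr (fst i) \<Longrightarrow> \<beta> (\<iota> i u) (\<iota> i w) = \<epsilon> i * bb (fst i) u w"
  and emb_orth: "i \<in> I \<Longrightarrow> j \<in> I \<Longrightarrow> i \<noteq> j \<Longrightarrow> u \<in> Vr (fst i) \<Longrightarrow> w \<in> Vr (fst j) \<Longrightarrow> \<beta> (\<iota> i u) (\<iota> j w) = 0"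
  and emb_span: "v \<in> V \<Longrightarrow> \<exists>f. (\<forall>i\<in>I. f i \<in> Vr (fst i)) \<and> v = (\<Sum>i\<in>I. \<iota> i (f i))"
  using embeddings unfolding orthogonal_embeddings_def by (blast, blast, blast, blast, blast, blast, blast)

lemma eps_sq: "i \<in> I \<Longrightarrow> \<epsilon> i * \<epsilon> i = 1"
  using eps[of i] by auto

lemma emb_mem: "i \<in> I \<Longrightarrow> u \<in> Vr (fst i) \<Longrightarrow> \<iota> i u \<in> V"
  by (rule lin_mem[OF intertwinerD(1)[OF emb]])

text \<open>The component of \<open>v\<close> in a decomposition picked by choice. That the choice
  is forced, and hence linear and equivariant, follows from \<open>p_form\<close>.\<close>

definition p :: "'g model_rep set \<times> nat \<Rightarrow> 'v \<Rightarrow> nat \<Rightarrow> real" where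
  "p i v = (SOME f. (\<forall>i\<in>I. f i \<in> Vr (fst i)) \<and> v = (\<Sum>i\<in>I. \<iota> i (f i))) i"

lemma p_mem: "i \<in> I \<Longrightarrow> v \<in> V \<Longrightarrow> p i v \<in> Vr (fst i)"
  and p_expand: "v \<in> V \<Longrightarrow> (\<Sum>i\<in>I. \<iota> i (p i v)) = v"
  using someI_ex[OF emb_span, of v] unfolding p_def by auto

text \<open>Orthogonality leaves one summand, and a sign is its own inverse. Since the right side is
  linear in \<open>v\<close>, this identifies the chosen component through the non-degenerate form
  of its class.\<close>

lemma p_form:
  assumes i: "i \<in> I" and u: "u \<in> Vr (fst i)" and v: "v \<in> V"
  shows "bb (fst i) u (p i v) = \<epsilon> i * \<beta> (\<iota> i u) v"
proof -
  have "\<beta> (\<iota> i u) v = \<beta> (\<iota> i u) (\<Sum>j\<in>I. \<iota> j (p j v))"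
    using p_expand[OF v] by simp
  also have "\<dots> = (\<Sum>j\<in>I. \<beta> (\<iota> i u) (\<iota> j (p j v)))"
    by (intro form.sum_r emb_mem p_mem i u v)
  also have "\<dots> = (\<Sum>j\<in>I. if j = i then \<epsilon> i * bb (fst i) u (p i v) else 0)"
    using emb_norm emb_orth i u p_mem[OF _ v] by (intro sum.cong refl) auto
  also have "\<dots> = \<epsilon> i * bb (fst i) u (p i v)"
    using i finite_I by simp
  finally show ?thesis
    using eps_sq[OF i] by (simp add: mult.assoc[symmetric])
qed

lemma p_emb:
  assumes i: "i \<in> I" "j \<in> I" and u: "u \<in> Vr (fst j)"
  shows "p i (\<iota> j u) = (if i = j then u else 0)"
proof -
  interpret C: irr_data G "representative (fst i)" "bb (fst i)" "DD (fst i)" "tt (fst i)"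
    by (rule irr_data[OF Irr_fst[OF i(1)]])
  note m = emb_mem[OF i(2) u]
  show ?thesis
  proof (rule C.form.eqI)
    show "p i (\<iota> j u) \<in> Vr (fst i)"
      by (rule p_mem[OF i(1) m])
    show "(if i = j then u else 0) \<in> Vr (fst i)"
      using u subspace_0[OF C.subV] by simp
    fix v assume v: "v \<in> Vr (fst i)"
    show "bb (fst i) v (p i (\<iota> j u)) = bb (fst i) v (if i = j then u else 0)"
      using p_form[OF i(1) v m] emb_norm[OF i(1) v] emb_orth[OF i _ v u] eps_sq[OF i(1)] u C.form.form_0[OF v]
      by (auto simp: mult.assoc[symmetric])
  qed
qed

lemma p_intertwiner:
  assumes i: "i \<in> I"
  shows "intertwiner G \<rho> (representative (fst i)) (p i)"
proof -
  interpret C: irr_data G "representative (fst i)" "bb (fst i)" "DD (fst i)" "tt (fst i)"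
    by (rule irr_data[OF Irr_fst[OF i]])
  note pm = p_mem[OF i] and pf = p_form[OF i]
  have "lin V (Vr (fst i)) (p i)"
  proof (rule linI)
    fix x y c assume xy: "x \<in> V" "y \<in> V"
    show "p i x \<in> Vr (fst i)"
      by (rule pm[OF xy(1)])
    show "p i (x + y) = p i x + p i y"
      using xy pm subspace_add[OF subV] subspace_add[OF C.subV]
      by (intro C.form.eqI) (auto simp: C.form.add_r pf form.add_r emb_mem[OF i] distrib_left)
    show "p i (c *\<^sub>R x) = c *\<^sub>R p i x"
      using xy pm subspace_scale[OF subV] subspace_scale[OF C.subV]
      by (intro C.form.eqI) (auto simp: C.form.scale_r pf form.scale_r emb_mem[OF i])
  qed
  moreover have "p i (r g v) = rep_act (representative (fst i)) g (p i v)" if g: "g \<in> carrier G" and v: "v \<in> V" for g v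
  proof (rule C.form.eqI)
    fix u assume u: "u \<in> Vr (fst i)"
    have "bb (fst i) u (rep_act (representative (fst i)) g (p i v)) =
        bb (fst i) (rep_act (representative (fst i)) (inv g) u) (p i v)"
      using C.form_shift[of "inv g" u "p i v"] g u pm[OF v] by simp
    also have "\<dots> = \<epsilon> i * \<beta> (r (inv g) (\<iota> i u)) v"
      using g u v C.r_mem intertwinerD(2)[OF emb[OF i]] by (simp add: pf)
    also have "\<dots> = bb (fst i) u (p i (r g v))"
      using g u v r_mem emb_mem[OF i] form_shift[of "inv g" "\<iota> i u" v] by (simp add: pf)
    finally show "bb (fst i) u (p i (r g v)) = bb (fst i) u (rep_act (representative (fst i)) g (p i v))" ..
  qed (use g v pm r_mem C.r_mem in auto)
  ultimately show ?thesis
    by (simp add: intertwiner_def)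
qed

lemma block_intertwiner:
  "x \<in> E \<Longrightarrow> i \<in> I \<Longrightarrow> j \<in> I \<Longrightarrow>
    intertwiner G (representative (fst j)) (representative (fst i)) (\<lambda>w. p i (x (\<iota> j w)))"
  by (rule intertwiner_comp[OF intertwiner_comp[OF emb ED(5)] p_intertwiner])

lemma block_zero:
  assumes "x \<in> E" "i \<in> I" "j \<in> I" "fst i \<noteq> fst j" "w \<in> Vr (fst j)"
  shows "p i (x (\<iota> j w)) = 0"
  using schur_zero[OF representative_in(2)[OF Irr_fst[OF assms(3)]] representative_in(2)[OF Irr_fst[OF assms(2)]] _
      block_intertwiner[OF assms(1-3)] assms(5)]
    representative_eq[OF Irr_fst[OF assms(3)] Irr_fst[OF assms(2)]] assms(4) by auto

definition mat :: "('v \<Rightarrow> 'v) \<Rightarrow> 'g model_rep set \<Rightarrow> nat \<Rightarrow> nat \<Rightarrow> quat" where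
  "mat x c a b = (if a < n c \<and> b < n c then coord c (\<lambda>w. p (c, a) (x (\<iota> (c, b) w))) else 0)"

lemma mat_div: "x \<in> E \<Longrightarrow> c \<in> Irr G \<Longrightarrow> a < n c \<Longrightarrow> b < n c \<Longrightarrow> mat x c a b \<in> div_carrier (DD c)"
  and tt_mat: "x \<in> E \<Longrightarrow> c \<in> Irr G \<Longrightarrow> a < n c \<Longrightarrow> b < n c \<Longrightarrow> w \<in> Vr c \<Longrightarrow>
    tt c (mat x c a b) w = p (c, a) (x (\<iota> (c, b) w))"
  using coord_div[OF _ block_intertwiner[of x "(c, a)" "(c, b)", simplified]]
    tt_coord[OF _ block_intertwiner[of x "(c, a)" "(c, b)", simplified]] by (auto simp: mat_def)

lemma mat_eqI:
  assumes "c \<in> Irr G" "a < n c" "b < n c" "q \<in> div_carrier (DD c)"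
    "\<And>w. w \<in> Vr c \<Longrightarrow> p (c, a) (x (\<iota> (c, b) w)) = tt c q w"
  shows "mat x c a b = q"
  using coord_eqI[OF assms(1,4,5)] assms(2,3) by (simp add: mat_def)

lemma sum_I_single:
  fixes F :: "'g model_rep set \<times> nat \<Rightarrow> 'c::comm_monoid_add"
  assumes "c \<in> Irr G" "\<And>i. i \<in> I \<Longrightarrow> fst i \<noteq> c \<Longrightarrow> F i = 0"
  shows "(\<Sum>i\<in>I. F i) = (\<Sum>k<n c. F (c, k))"
proof -
  have "(\<Sum>i\<in>I. F i) = (\<Sum>i\<in>{c} \<times> {..<n c}. F i)"
  proof (intro sum.mono_neutral_right finite_I ballI)
    show "{c} \<times> {..<n c} \<subseteq> I"
      using assms(1) by auto
    fix i assume i: "i \<in> I - {c} \<times> {..<n c}"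
    then have "fst i \<noteq> c"
      by (cases i) auto
    then show "F i = 0"
      using assms(2) i by blast
  qed
  also have "\<dots> = (\<Sum>k<n c. F (c, k))"
    by (rule sum.reindex_bij_witness[of _ "\<lambda>k. (c, k)" snd]) auto
  finally show ?thesis .
qed

text \<open>By Schur's lemma the components in all other classes vanish.\<close>

lemma column_expand:
  assumes x: "x \<in> E" and c: "c \<in> Irr G" and b: "b < n c" and w: "w \<in> Vr c"
  shows "x (\<iota> (c, b) w) = (\<Sum>k<n c. \<iota> (c, k) (tt c (mat x c k b) w))"
proof -
  have cb: "(c, b) \<in> I"
    using c b by simp
  have m: "x (\<iota> (c, b) w) \<in> V"
    using ED(3)[OF x emb_mem[OF cb]] w by simp
  have "x (\<iota> (c, b) w) = (\<Sum>i\<in>I. \<iota> i (p i (x (\<iota> (c, b) w))))"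
    using p_expand[OF m] by simp
  also have "\<dots> = (\<Sum>k<n c. \<iota> (c, k) (p (c, k) (x (\<iota> (c, b) w))))"
  proof (rule sum_I_single[OF c])
    fix i assume i: "i \<in> I" "fst i \<noteq> c"
    interpret C: real_rep G "representative (fst i)"
      by (rule irreducibleD(1)[OF representative_in(2)[OF Irr_fst[OF i(1)]]])
    show "\<iota> i (p i (x (\<iota> (c, b) w))) = 0"
      using block_zero[OF x i(1) cb] i(2) w lin_0[OF intertwinerD(1)[OF emb[OF i(1)]] findim_subspace[OF C.space_fin_dim]]
      by simp
  qed
  also have "\<dots> = (\<Sum>k<n c. \<iota> (c, k) (tt c (mat x c k b) w))"
    using x c b w by (intro sum.cong refl) (simp add: tt_mat)
  finally show ?thesis .
qed

lemma E_eq_mat: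
  assumes x: "x \<in> E" and y: "y \<in> E" and eq: "\<And>c a b. c \<in> Irr G \<Longrightarrow> mat x c a b = mat y c a b"
  shows "x = y"
proof (rule E_eqI[OF x y])
  fix v assume v: "v \<in> V"
  have "x (\<iota> i (p i v)) = y (\<iota> i (p i v))" if i: "i \<in> I" for i
    using column_expand[OF x, of "fst i" "snd i"] column_expand[OF y, of "fst i" "snd i"] eq[OF Irr_fst[OF i]]
      i p_mem[OF i v] by auto
  then have "(\<Sum>i\<in>I. x (\<iota> i (p i v))) = (\<Sum>i\<in>I. y (\<iota> i (p i v)))"
    by simp
  then have "x (\<Sum>i\<in>I. \<iota> i (p i v)) = y (\<Sum>i\<in>I. \<iota> i (p i v))"
    using emb_mem p_mem[OF _ v] by (simp add: lin_sum[OF ED(2)[OF x] subV] lin_sum[OF ED(2)[OF y] subV])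
  then show "x v = y v"
    by (simp add: p_expand[OF v])
qed

lemma mat_comp:
  assumes x: "x \<in> E" and y: "y \<in> E" and c: "c \<in> Irr G"
  shows "mat (x \<circ> y) c a b = (\<Sum>k<n c. mat x c a k * mat y c k b)"
proof (cases "a < n c \<and> b < n c")
  case True
  interpret C: irr_data G "representative c" "bb c" "DD c" "tt c"
    by (rule irr_data[OF c])
  have ab: "(c, a) \<in> I" "(c, b) \<in> I"
    using c True by auto
  show ?thesis
  proof (rule mat_eqI[OF c])
    fix w assume w: "w \<in> Vr c"
    have px: "lin V (Vr c) (\<lambda>v. p (c, a) (x v))"
      using lin_comp[OF ED(2)[OF x] intertwinerD(1)[OF p_intertwiner[OF ab(1)]]] by simp
    have mem: "\<iota> (c, k) (tt c (mat y c k b) w) \<in> V" "tt c (mat y c k b) w \<in> Vr c" if "k < n c" for k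
      using emb_mem[of "(c, k)"] C.theta_apply[OF mat_div[OF y c that] w] that c True by auto
    have "p (c, a) ((x \<circ> y) (\<iota> (c, b) w)) = p (c, a) (x (\<Sum>k<n c. \<iota> (c, k) (tt c (mat y c k b) w)))"
      using column_expand[OF y c _ w] True by simp
    also have "\<dots> = (\<Sum>k<n c. p (c, a) (x (\<iota> (c, k) (tt c (mat y c k b) w))))"
      using mem by (intro lin_sum[OF px subV]) auto
    also have "\<dots> = (\<Sum>k<n c. tt c (mat x c a k * mat y c k b) w)"
      using mem True w by (intro sum.cong refl) (simp add: tt_mat[OF x c, symmetric] C.theta_mult mat_div[OF x c] mat_div[OF y c])
    also have "\<dots> = tt c (\<Sum>k<n c. mat x c a k * mat y c k b) w"
      using True by (subst lin_sum[OF C.theta_lin subspace_div_carrier])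
        (auto simp: sum_fun_apply mat_div[OF x c] mat_div[OF y c])
    finally show "p (c, a) ((x \<circ> y) (\<iota> (c, b) w)) = tt c (\<Sum>k<n c. mat x c a k * mat y c k b) w" .
  qed (use True mat_div[OF x c] mat_div[OF y c] in \<open>auto intro!: subspace_sum[OF subspace_div_carrier]\<close>)
qed (auto simp: mat_def)

lemma mat_add: "x \<in> E \<Longrightarrow> y \<in> E \<Longrightarrow> c \<in> Irr G \<Longrightarrow> mat (x + y) c a b = mat x c a b + mat y c a b"
  and mat_scale: "x \<in> E \<Longrightarrow> c \<in> Irr G \<Longrightarrow> mat (k *\<^sub>R x) c a b = k *\<^sub>R mat x c a b"
  and mat_ph: "z \<in> cf \<Longrightarrow> c \<in> Irr G \<Longrightarrow> mat (ph z) c = scalar_mat (n c) (ev c z)"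
  and mat_adj: "x \<in> E \<Longrightarrow> c \<in> Irr G \<Longrightarrow> mat (form.adj x) c a b = (\<epsilon> (c, a) * \<epsilon> (c, b)) *\<^sub>R qcnj (mat x c b a)"
proof -
  assume c: "c \<in> Irr G"
  interpret C: irr_data G "representative c" "bb c" "DD c" "tt c"
    by (rule irr_data[OF c])
  have cI: "(c, a) \<in> I" if "a < n c" for a
    using c that by simp
  have im: "\<iota> (c, b) w \<in> V" if "b < n c" "w \<in> Vr c" for b w
    using emb_mem[OF cI[OF that(1)]] that(2) by simp
  have lp: "lin V (Vr c) (p (c, a))" if "a < n c" for a
    using intertwinerD(1)[OF p_intertwiner[OF cI[OF that]]] by simp
  show "mat (x + y) c a b = mat x c a b + mat y c a b" if x: "x \<in> E" "y \<in> E"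
  proof (cases "a < n c \<and> b < n c")
    case True
    then show ?thesis
      using mat_div[OF x(1) c] mat_div[OF x(2) c] ED(3)[OF x(1) im] ED(3)[OF x(2) im]
      by (intro mat_eqI[OF c])
        (auto simp: lin_add[OF C.theta_lin] tt_mat[OF x(1) c] tt_mat[OF x(2) c] lin_add[OF lp])
  qed (auto simp: mat_def)
  show "mat (k *\<^sub>R x) c a b = k *\<^sub>R mat x c a b" if x: "x \<in> E"
  proof (cases "a < n c \<and> b < n c")
    case True
    then show ?thesis
      using mat_div[OF x c] ED(3)[OF x im]
      by (intro mat_eqI[OF c]) (auto simp: lin_scale[OF C.theta_lin] tt_mat[OF x c] lin_scale[OF lp])
  qed (auto simp: mat_def)
  show "mat (ph z) c = scalar_mat (n c) (ev c z)" if z: "z \<in> cf"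
  proof (intro ext)
    fix a b
    show "mat (ph z) c a b = scalar_mat (n c) (ev c z) a b"
    proof (cases "a < n c \<and> b < n c")
      case True
      show ?thesis
      proof (rule mat_eqI[OF c])
        fix w assume w: "w \<in> Vr c"
        have "p (c, a) (ph z (\<iota> (c, b) w)) = actc c z (p (c, a) (\<iota> (c, b) w))"
          using True im w intertwiner_act[OF real_rep_axioms p_intertwiner[OF cI], of a "\<iota> (c, b) w"]
          by (simp add: ph_apply)
        also have "\<dots> = tt c (scalar_mat (n c) (ev c z) a b) w"
          using True w p_emb[OF cI cI, of a b w] tt_ev[OF c z w] lin_0[OF C.lin_act C.subV]
            lin_0[OF C.theta_lin subspace_div_carrier] by (simp add: scalar_mat_def)
        finally show "p (c, a) (ph z (\<iota> (c, b) w)) = tt c (scalar_mat (n c) (ev c z) a b) w" .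
      qed (use True ZD_D[OF ev_ZD[OF c z]] in \<open>auto simp: scalar_mat_def\<close>)
    qed (auto simp: mat_def scalar_mat_def)
  qed
  \<comment> \<open>One sign comes from projecting onto row \<open>a\<close>, the other from
    expanding in row \<open>b\<close> after the adjoint has been moved to the other side. In
    between, the adjoint for \<open>\<beta>\<close> has become the adjoint for the positive form of
    the class, which is conjugation in the coordinates.\<close>
  show "mat (form.adj x) c a b = (\<epsilon> (c, a) * \<epsilon> (c, b)) *\<^sub>R qcnj (mat x c b a)" if x: "x \<in> E"
  proof (cases "a < n c \<and> b < n c")
    case True
    note ab = cI[of a] cI[of b]
    note d = mat_div[OF x c, of b a]
    have dE: "tt c (mat x c b a) \<in> End_set (Vr c)"
      using C.ED(1)[OF C.theta_E[OF d]] True by simp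
    show ?thesis
    proof (rule mat_eqI[OF c])
      fix w assume w: "w \<in> Vr c"
      have m: "form.adj x (\<iota> (c, b) w) \<in> V"
        using ED(3)[OF adj_E[OF x] im] True w by simp
      show "p (c, a) (form.adj x (\<iota> (c, b) w)) = tt c ((\<epsilon> (c, a) * \<epsilon> (c, b)) *\<^sub>R qcnj (mat x c b a)) w"
      proof (rule C.form.eqI)
        show "p (c, a) (form.adj x (\<iota> (c, b) w)) \<in> Vr c"
          using p_mem[OF ab(1) m] True by simp
        show "tt c ((\<epsilon> (c, a) * \<epsilon> (c, b)) *\<^sub>R qcnj (mat x c b a)) w \<in> Vr c"
          using C.theta_apply w d True by simp
        fix u assume u: "u \<in> Vr c"
        have "bb c u (p (c, a) (form.adj x (\<iota> (c, b) w))) = \<epsilon> (c, a) * \<beta> (\<iota> (c, a) u) (form.adj x (\<iota> (c, b) w))"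
          using p_form[OF ab(1) _ m] u True by simp
        also have "\<beta> (\<iota> (c, a) u) (form.adj x (\<iota> (c, b) w)) = \<beta> (\<iota> (c, b) w) (x (\<iota> (c, a) u))"
          using True im u w form.adj[OF ED(1)[OF x]] form.sym ED(3)[OF x] by simp
        also have "\<dots> = \<epsilon> (c, b) * bb c w (p (c, b) (x (\<iota> (c, a) u)))"
          using p_form[OF ab(2), of w "x (\<iota> (c, a) u)"] eps_sq[OF ab(2)] True w u im ED(3)[OF x]
          by (simp add: mult.assoc[symmetric])
        also have "bb c w (p (c, b) (x (\<iota> (c, a) u))) = bb c u (C.form.adj (tt c (mat x c b a)) w)"
          using tt_mat[OF x c, of b a u] True u w C.form.adj[OF dE u w] lin_mem[OF End_setD(1)[OF dE] u] by (simp add: C.form.sym)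
        also have "C.form.adj (tt c (mat x c b a)) w = tt c (qcnj (mat x c b a)) w"
          using C.theta_cnj[OF d] True by simp
        finally show "bb c u (p (c, a) (form.adj x (\<iota> (c, b) w))) =
            bb c u (tt c ((\<epsilon> (c, a) * \<epsilon> (c, b)) *\<^sub>R qcnj (mat x c b a)) w)"
          using d True u w C.theta_apply[of "qcnj (mat x c b a)" w] by (simp add: lin_scale[OF C.theta_lin] C.form.scale_r)
      qed
    qed (use True d in auto)
  qed (auto simp: mat_def)
qed

lemma mat_one: "c \<in> Irr G \<Longrightarrow> mat (extend_zero V (\<lambda>v. v)) c = scalar_mat (n c) 1"
proof -
  assume c: "c \<in> Irr G"
  have "ph (group_elem \<one>) = extend_zero V (\<lambda>v. v)"
    by (auto simp: ph_def extend_zero_def fun_eq_iff act_group_one)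
  then show ?thesis
    using mat_ph[OF one_cf c] ev_one[OF c] by simp
qed

lemma mat_surj:
  assumes M: "\<And>c a b. c \<in> Irr G \<Longrightarrow> a < n c \<Longrightarrow> b < n c \<Longrightarrow> M c a b \<in> div_carrier (DD c)"
  shows "\<exists>x\<in>E. \<forall>c\<in>Irr G. \<forall>a<n c. \<forall>b<n c. mat x c a b = M c a b"
proof -
  \<comment> \<open>\<open>F j\<close> reads the component \<open>j\<close> of a vector and
    distributes it over the copies of the same class according to column \<open>snd j\<close> of the
    matrix.\<close>
  define F where "F = (\<lambda>j v. \<Sum>a<n (fst j). \<iota> (fst j, a) (tt (fst j) (M (fst j) a (snd j)) (p j v)))"
  define x where "x = extend_zero V (\<lambda>v. \<Sum>j\<in>I. F j v)"
  have ttE: "tt c (M c a b) \<in> carrier (End_alg G (representative c))"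
    "intertwiner G (representative c) (representative c) (tt c (M c a b))" if "c \<in> Irr G" "a < n c" "b < n c" for c a b
  proof -
    interpret C: irr_data G "representative c" "bb c" "DD c" "tt c"
      by (rule irr_data[OF that(1)])
    show "tt c (M c a b) \<in> C.E" "intertwiner G (representative c) (representative c) (tt c (M c a b))"
      using C.theta_E[OF M[OF that]] C.ED(5) by auto
  qed
  have "intertwiner G \<rho> \<rho> (F j)" if j: "j \<in> I" for j
    unfolding F_def
  proof (rule intertwiner_sum)
    fix a assume "a \<in> {..<n (fst j)}"
    then have a: "(fst j, a) \<in> I" "a < n (fst j)" "snd j < n (fst j)"
      using j by auto
    show "intertwiner G \<rho> \<rho> (\<lambda>v. \<iota> (fst j, a) (tt (fst j) (M (fst j) a (snd j)) (p j v)))"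
      using intertwiner_comp[OF intertwiner_comp[OF p_intertwiner[OF j] ttE(2)[OF Irr_fst[OF j] a(2,3)]] emb[OF a(1), simplified]] .
  qed
  then have x: "x \<in> E"
    unfolding x_def by (intro E_extend intertwiner_sum)
  have "mat x c a b = M c a b" if c: "c \<in> Irr G" and ab: "a < n c" "b < n c" for c a b
  proof (rule mat_eqI[OF c ab M[OF c ab]])
    interpret C: irr_data G "representative c" "bb c" "DD c" "tt c"
      by (rule irr_data[OF c])
    fix w assume w: "w \<in> Vr c"
    have cI: "(c, k) \<in> I" if "k < n c" for k
      using c that by simp
    have im: "\<iota> (c, k) u \<in> V" if "k < n c" "u \<in> Vr c" for k u
      using emb_mem[OF cI[OF that(1)]] that(2) by simp
    have tw: "tt c (M c k b) w \<in> Vr c" if "k < n c" for k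
      using C.theta_apply[OF M[OF c that ab(2)] w] .
    have F0: "F j 0 = 0" if j: "j \<in> I" for j
    proof -
      interpret J: irr_data G "representative (fst j)" "bb (fst j)" "DD (fst j)" "tt (fst j)"
        by (rule irr_data[OF Irr_fst[OF j]])
      have "\<iota> (fst j, a) (tt (fst j) (M (fst j) a (snd j)) (p j 0)) = 0" if "a < n (fst j)" for a
      proof -
        have a: "(fst j, a) \<in> I" "snd j < n (fst j)"
          using j that by auto
        show ?thesis
          using lin_0[OF intertwinerD(1)[OF p_intertwiner[OF j]] subV]
            lin_0[OF J.ED(2)[OF ttE(1)[OF Irr_fst[OF j] that a(2)]] J.subV]
            lin_0[OF intertwinerD(1)[OF emb[OF a(1)]]] J.subV by simp
      qed
      then show ?thesis
        by (simp add: F_def)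
    qed
    have pj: "p j (\<iota> (c, b) w) = (if j = (c, b) then w else 0)" if "j \<in> I" for j
      using p_emb[OF that cI[OF ab(2)]] w by simp
    have Fj: "F j (\<iota> (c, b) w) = (if j = (c, b) then (\<Sum>k<n c. \<iota> (c, k) (tt c (M c k b) w)) else 0)"
      if j: "j \<in> I" for j
    proof (cases "j = (c, b)")
      case False
      have "F j (\<iota> (c, b) w) = F j 0"
        using pj[OF j] False lin_0[OF intertwinerD(1)[OF p_intertwiner[OF j]] subV] by (simp add: F_def)
      then show ?thesis
        using F0[OF j] False by simp
    next
      case True
      then show ?thesis
        using pj[OF j] by (simp add: F_def)
    qed
    have "x (\<iota> (c, b) w) = (\<Sum>j\<in>I. F j (\<iota> (c, b) w))"
      using im[OF ab(2) w] by (simp add: x_def extend_zero_def)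
    also have "\<dots> = (\<Sum>k<n c. \<iota> (c, k) (tt c (M c k b) w))"
      using Fj cI[OF ab(2)] finite_I by (simp cong: sum.cong)
    finally have "p (c, a) (x (\<iota> (c, b) w)) = (\<Sum>k<n c. p (c, a) (\<iota> (c, k) (tt c (M c k b) w)))"
      using im tw lin_sum[OF intertwinerD(1)[OF p_intertwiner[OF cI[OF ab(1)]]] subV,
          of "{..<n c}" "\<lambda>k. \<iota> (c, k) (tt c (M c k b) w)"] by simp
    also have "\<dots> = (\<Sum>k<n c. if a = k then tt c (M c a b) w else 0)"
      using tw p_emb[OF cI[OF ab(1)] cI] by (intro sum.cong refl) auto
    finally show "p (c, a) (x (\<iota> (c, b) w)) = tt c (M c a b) w"
      using ab by simp
  qed
  then show ?thesis
    using x by blast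
qed

section \<open>The functionals and the element U, block by block\<close>

definition sc :: "'g model_rep set \<Rightarrow> real" where
  "sc c = qRe (ev c \<mu>)"

text \<open>Invariance under inversion makes the coordinate of \<open>\<mu>\<close> equal to its own
  conjugate, so the scalar is real also when the commutant is complex.\<close>

lemma ev_mu: "c \<in> Irr G \<Longrightarrow> ev c \<mu> = of_real (sc c)"
  using ev_flip[OF _ mu_cf(1), of c] by (simp add: flip_mu quat_eq_iff sc_def of_real_def)

lemma act_mu: "c \<in> Irr G \<Longrightarrow> w \<in> Vr c \<Longrightarrow> actc c \<mu> w = sc c *\<^sub>R w"
proof -
  assume c: "c \<in> Irr G" and w: "w \<in> Vr c"
  interpret C: irr_data G "representative c" "bb c" "DD c" "tt c"
    by (rule irr_data[OF c])
  show ?thesis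
    using tt_ev[OF c mu_cf(1) w] lin_scale[OF C.theta_lin, of 1 "sc c"] w
    by (simp add: ev_mu[OF c] of_real_def C.theta_one C.one_apply)
qed

lemma scalar_on_mu: "c \<in> Irr G \<Longrightarrow> scalar_on G \<mu> (representative c) = sc c"
  unfolding scalar_on_def
proof (rule the_equality)
  assume c: "c \<in> Irr G"
  interpret C: irr_data G "representative c" "bb c" "DD c" "tt c"
    by (rule irr_data[OF c])
  show "\<forall>v\<in>Vr c. actc c \<mu> v = sc c *\<^sub>R v"
    using act_mu[OF c] by simp
  fix k assume k: "\<forall>v\<in>Vr c. actc c \<mu> v = k *\<^sub>R v"
  obtain w where "w \<in> Vr c" "w \<noteq> 0"
    using irreducibleD(2)[OF C.irr] subspace_0[OF C.subV] by blast
  then show "k = sc c"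
    using k act_mu[OF c] by (metis scaleR_cancel_right)
qed

lemma ev_nu: "c \<in> Irr G \<Longrightarrow> of_real (sc c) * ev c \<nu> = 1"
  using ev_conv[OF _ mu_cf, of c] ev_mu[of c] by (simp add: mu_nu ev_one)

lemma sc_nonzero: "c \<in> Irr G \<Longrightarrow> sc c \<noteq> 0"
  using ev_nu[of c] by auto

abbreviation mm :: "'g model_rep set \<Rightarrow> real" where
  "mm c \<equiv> scalar_on G \<mu> (representative c) * dmc c / N"

text \<open>\<open>squares\<close> has the coordinate \<open>N / dmc c * (2 - dd c)\<close>;
  dividing by the scalar of \<open>\<mu>\<close> absorbs \<open>N / dmc c\<close> into
  \<open>mm c\<close>.\<close>

lemma ev_U: "c \<in> Irr G \<Longrightarrow> ev c (\<nu> \<star> squares) = of_real ((2 - dd c) / mm c)"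
proof -
  assume c: "c \<in> Irr G"
  have "ev c \<nu> = of_real (1 / sc c)"
  proof -
    have "ev c \<nu> = of_real (1 / sc c) * (of_real (sc c) * ev c \<nu>)"
      using sc_nonzero[OF c] by (simp add: mult.assoc[symmetric] of_real_mult[symmetric] del: of_real_mult)
    then show ?thesis
      by (simp add: ev_nu[OF c])
  qed
  then have "ev c (\<nu> \<star> squares) = of_real (1 / sc c * (N / dmc c * (2 - dd c)))"
    by (simp only: ev_conv[OF c mu_cf(2) squares_cf] ev_squares[OF c] of_real_mult)
  then show ?thesis
    by (simp add: scalar_on_mu[OF c] mult.commute)
qed

text \<open>\<open>value_at_one\<close> gives the weight \<open>(dmc c)\<^sup>2\<close>, and
  \<open>\<mu>\<close> enters \<open>lA\<close> twice. With the two factors \<open>1 / N\<close>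
  these form the square of \<open>mm c\<close>.\<close>

lemma lA_eq:
  assumes a: "a \<in> cf"
  shows "lA a = (\<Sum>c\<in>Irr G. (mm c)\<^sup>2 * qRe (ev c a) / dd c)"
proof -
  have "lA a = (\<Sum>c\<in>Irr G. (dmc c)\<^sup>2 / (N * dd c) * qRe (ev c (\<mu> \<star> \<mu> \<star> a)) / N)"
    using a mu_cf by (simp add: lA_def value_at_one conv_cf sum_divide_distrib)
  also have "\<dots> = (\<Sum>c\<in>Irr G. (mm c)\<^sup>2 * qRe (ev c a) / dd c)"
  proof (rule sum.cong[OF refl])
    fix c assume c: "c \<in> Irr G"
    have "ev c (\<mu> \<star> \<mu> \<star> a) = (sc c)\<^sup>2 *\<^sub>R ev c a"
      using c a mu_cf by (simp add: ev_conv conv_cf ev_mu of_real_def power2_eq_square)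
    then show "(dmc c)\<^sup>2 / (N * dd c) * qRe (ev c (\<mu> \<star> \<mu> \<star> a)) / N = (mm c)\<^sup>2 * qRe (ev c a) / dd c"
      by (simp add: scalar_on_mu[OF c] power2_eq_square mult.commute mult.left_commute)
  qed
  finally show ?thesis .
qed

text \<open>The trace splits over the summands, and cyclicity moves each part to the representative.
  There a diagonal entry contributes its real part times the dimension and the scalar of
  \<open>\<mu>\<close>.\<close>

lemma lB_mat:
  assumes x: "x \<in> E"
  shows "lB x = (\<Sum>c\<in>Irr G. mm c * qRe (\<Sum>k<n c. mat x c k k))"
proof -
  let ?y = "\<lambda>v. act \<mu> (x v)"
  have ly: "lin V V ?y"
    by (rule lin_act_comp[OF x])
  have lp: "lin V (Vr (fst i)) (\<lambda>v. p i (?y v))" if "i \<in> I" for i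
    by (rule lin_comp[OF ly intertwinerD(1)[OF p_intertwiner[OF that]]])
  have le: "lin (Vr (fst i)) V (\<iota> i)" if "i \<in> I" for i
    by (rule intertwinerD(1)[OF emb[OF that]])
  have "tr V ?y = tr V (\<lambda>v. \<Sum>i\<in>I. \<iota> i (p i (?y v)))"
    using p_expand lin_mem[OF ly] by (intro trace_cong[OF fdV ly]) simp
  also have "\<dots> = (\<Sum>i\<in>I. tr V (\<lambda>v. \<iota> i (p i (?y v))))"
    by (intro trace_sum[OF fdV] lin_comp[OF lp le])
  also have "\<dots> = (\<Sum>i\<in>I. sc (fst i) * dmc (fst i) * qRe (mat x (fst i) (snd i) (snd i)))"
  proof (rule sum.cong[OF refl])
    fix i assume i: "i \<in> I"
    obtain c k where ck: "i = (c, k)"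
      by (cases i)
    have c: "c \<in> Irr G" "k < n c"
      using i ck by auto
    interpret C: irr_data G "representative c" "bb c" "DD c" "tt c"
      by (rule irr_data[OF c(1)])
    note d = mat_div[OF x c c(2)]
    have "tr V (\<lambda>v. \<iota> i (p i (?y v))) = tr (Vr c) (\<lambda>w. p i (?y (\<iota> i w)))"
      using trace_comm[OF fdV C.fdV, of "\<lambda>v. p i (?y v)" "\<iota> i"] lp[OF i] le[OF i] by (simp add: ck)
    also have "\<dots> = tr (Vr c) (\<lambda>w. sc c *\<^sub>R tt c (mat x c k k) w)"
    proof (rule trace_cong[OF C.fdV, symmetric])
      show "lin (Vr c) (Vr c) (\<lambda>w. sc c *\<^sub>R tt c (mat x c k k) w)"
        by (intro lin_scale_fun C.subV C.ED(2) C.theta_E d)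
      fix w assume w: "w \<in> Vr c"
      have m: "x (\<iota> i w) \<in> V"
        using ED(3)[OF x emb_mem[OF i]] w ck by simp
      have "p i (?y (\<iota> i w)) = actc c \<mu> (p i (x (\<iota> i w)))"
        using intertwiner_act[OF real_rep_axioms p_intertwiner[OF i] m, of \<mu>] ck by simp
      also have "\<dots> = sc c *\<^sub>R tt c (mat x c k k) w"
        using act_mu[OF c(1)] p_mem[OF i m] tt_mat[OF x c c(2) w] ck by simp
      finally show "sc c *\<^sub>R tt c (mat x c k k) w = p i (?y (\<iota> i w))" ..
    qed
    also have "\<dots> = sc c * (dmc c * qRe (mat x c k k))"
      by (simp add: trace_scale[OF C.fdV C.ED(2)[OF C.theta_E[OF d]]] C.tr_theta[OF d])
    finally show "tr V (\<lambda>v. \<iota> i (p i (?y v))) = sc (fst i) * dmc (fst i) * qRe (mat x (fst i) (snd i) (snd i))"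
      by (simp add: ck)
  qed
  also have "\<dots> = (\<Sum>c\<in>Irr G. \<Sum>k<n c. sc c * dmc c * qRe (mat x c k k))"
    using finite_Irr by (subst sum.Sigma) (auto simp: case_prod_beta)
  also have "\<dots> = (\<Sum>c\<in>Irr G. sc c * dmc c * qRe (\<Sum>k<n c. mat x c k k))"
    by (simp add: qRe_sum sum_distrib_left)
  finally have "tr V ?y = (\<Sum>c\<in>Irr G. sc c * dmc c * qRe (\<Sum>k<n c. mat x c k k))" .
  then show ?thesis
    by (simp add: lB_eq[OF x] sum_divide_distrib scalar_on_mu)
qed

lemma rep_isomorphic_sum: "rep_isomorphic G \<rho> (rep_sum I (\<lambda>(c, k). representative c))"
proof -
  let ?S = "rep_sum I (\<lambda>(c, k). representative c)"
  let ?f = "\<lambda>v i. if i \<in> I then p i v else 0"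
  have S: "w \<in> rep_space ?S \<longleftrightarrow> (\<forall>i\<in>I. w i \<in> Vr (fst i)) \<and> (\<forall>i. i \<notin> I \<longrightarrow> w i = 0)" for w
  proof -
    have "finite {i. w i \<noteq> 0}" if "\<forall>i. i \<notin> I \<longrightarrow> w i = 0"
      using that by (intro finite_subset[OF _ finite_I]) blast
    then show ?thesis
      by (auto simp: rep_sum_def case_prod_beta)
  qed
  have lp: "lin V (Vr (fst i)) (p i)" if "i \<in> I" for i
    by (rule intertwinerD(1)[OF p_intertwiner[OF that]])
  have "intertwiner G \<rho> ?S ?f"
    unfolding intertwiner_def
  proof (intro conjI ballI)
    show "lin V (rep_space ?S) ?f"
      by (rule linI) (auto simp: S p_mem fun_eq_iff lin_add[OF lp] lin_scale[OF lp])
    show "?f (r g v) = rep_act ?S g (?f v)" if "g \<in> carrier G" "v \<in> V" for g v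
      using that intertwinerD(2)[OF p_intertwiner] by (auto simp: rep_sum_def fun_eq_iff)
  qed
  moreover have "bij_betw ?f V (rep_space ?S)"
    unfolding bij_betw_def
  proof (intro conjI inj_onI equalityI subsetI)
    fix u v assume uv: "u \<in> V" "v \<in> V" "?f u = ?f v"
    have "p i u = p i v" if "i \<in> I" for i
      using fun_cong[OF uv(3), of i] that by simp
    then have "(\<Sum>i\<in>I. \<iota> i (p i u)) = (\<Sum>i\<in>I. \<iota> i (p i v))"
      by simp
    then show "u = v"
      by (simp add: p_expand uv)
  next
    fix w assume w: "w \<in> rep_space ?S"
    define v where "v = (\<Sum>i\<in>I. \<iota> i (w i))"
    have m: "\<iota> i (w i) \<in> V" if "i \<in> I" for i
      using emb_mem[OF that] w that by (auto simp: S)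
    then have v: "v \<in> V"
      unfolding v_def by (intro subspace_sum subV)
    have "p i v = w i" if i: "i \<in> I" for i
    proof -
      have "p i v = (\<Sum>j\<in>I. p i (\<iota> j (w j)))"
        unfolding v_def using m by (intro lin_sum[OF lp[OF i] subV])
      also have "\<dots> = (\<Sum>j\<in>I. if i = j then w i else 0)"
        using w p_emb[OF i] by (intro sum.cong refl) (auto simp: S)
      finally show ?thesis
        using i finite_I by simp
    qed
    then have "?f v = w"
      using w by (auto simp: S fun_eq_iff)
    then show "w \<in> ?f ` V"
      using v by blast
  next
    fix w assume "w \<in> ?f ` V"
    then show "w \<in> rep_space ?S"
      unfolding S using p_mem[of "(_, _)", simplified] by auto
  qed
  ultimately show ?thesis
    by (rule intertwiner_isomorphic)
qed

abbreviation J :: "(divalg \<times> 'g model_rep set) set" where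
  "J \<equiv> SIGMA D:UNIV. Irr_div G D"

lemma J_iff: "i \<in> J \<longleftrightarrow> snd i \<in> Irr G \<and> fst i = DD (snd i)"
  by (cases i) (auto simp: Irr_div_iff)

text \<open>The decomposition holds already over the reals when each block carries the signed
  involution; complex scalars are used afterwards to remove the signs.\<close>

theorem real_decomposition:
  "ecf_isomorphic (H_rep G \<rho> \<beta> \<mu>)
     (ecf_sum J (\<lambda>(D, c). H_signed D (n c) (mm c) (\<lambda>k. \<epsilon> (c, k))))"
proof -
  let ?K = "\<lambda>i. H_signed (fst i) (n (snd i)) (mm (snd i)) (\<lambda>k. \<epsilon> (snd i, k))"
  let ?f = "\<lambda>a i. if i \<in> J then ev (snd i) a else 0"
  let ?g = "\<lambda>x i. if i \<in> J then mat x (snd i) else 0"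
  have A: "alg_iso ZG (alg_sum J (\<lambda>i. center_alg (div_alg (fst i)))) ?f"
  proof (rule alg_isoI, unfold center_alg_simps center_group_alg alg_sum_simps scale_group_alg div_alg_simps)
    show "(\<forall>i\<in>J. ?f x i \<in> center (div_alg (fst i))) \<and> (\<forall>i. i \<notin> J \<longrightarrow> ?f x i = 0)" if "x \<in> cf" for x
      using ev_ZD[OF _ that] by (auto simp: J_iff)
    show "inj_on ?f cf"
    proof (rule inj_onI)
      fix x y assume xy: "x \<in> cf" "y \<in> cf" "?f x = ?f y"
      have "ev c x = ev c y" if "c \<in> Irr G" for c
        using fun_cong[OF xy(3), of "(DD c, c)"] that by (simp add: Irr_div_iff)
      then have "fourier (\<lambda>c. ev c x) = fourier (\<lambda>c. ev c y)"
        by (simp add: fourier_def)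
      then show "x = y"
        by (simp add: fourier_ev xy)
    qed
    show "\<exists>x\<in>cf. ?f x = y"
      if y: "(\<forall>i\<in>J. y i \<in> center (div_alg (fst i))) \<and> (\<forall>i. i \<notin> J \<longrightarrow> y i = 0)" for y
    proof -
      have q: "y (DD c, c) \<in> ZD c" if "c \<in> Irr G" for c
        using bspec[OF conjunct1[OF y], of "(DD c, c)"] that by (simp add: Irr_div_iff)
      have "?f (fourier (\<lambda>c. y (DD c, c))) i = y i" for i
        using y ev_fourier[OF q] by (cases i) (auto simp: Irr_div_iff)
      then show ?thesis
        using fourier_cf[OF q] by (intro bexI[of _ "fourier (\<lambda>c. y (DD c, c))"]) auto
    qed
  qed (auto simp: fun_eq_iff J_iff ev_add ev_scale ev_conv ev_one one_group_alg)
  have B: "alg_iso (End_alg G \<rho>) (alg_sum J (\<lambda>i. mat_alg (n (snd i)) (fst i))) ?g"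
  proof (rule alg_isoI)
    show "?g x \<in> carrier (alg_sum J (\<lambda>i. mat_alg (n (snd i)) (fst i)))" if "x \<in> E" for x
      unfolding alg_sum_simps mat_alg_simps using mat_div[OF that] by (auto simp: J_iff) (auto simp: mat_def)
    show "inj_on ?g E"
    proof (rule inj_onI)
      fix x y assume xy: "x \<in> E" "y \<in> E" "?g x = ?g y"
      have "mat x c a b = mat y c a b" if "c \<in> Irr G" for c a b
        using fun_cong[OF xy(3), of "(DD c, c)"] that by (simp add: Irr_div_iff fun_eq_iff)
      then show "x = y"
        by (rule E_eq_mat[OF xy(1,2)])
    qed
    show "\<exists>x\<in>E. ?g x = y"
      if y': "y \<in> carrier (alg_sum J (\<lambda>i. mat_alg (n (snd i)) (fst i)))" for y
    proof -
      have y: "(\<forall>i\<in>J. \<forall>a b. if a < n (snd i) \<and> b < n (snd i) then y i a b \<in> div_carrier (fst i) else y i a b = 0) \<and>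
          (\<forall>i. i \<notin> J \<longrightarrow> y i = 0)"
        using y' unfolding alg_sum_simps mat_alg_simps .
      have y1: "if a < n c \<and> b < n c then y (DD c, c) a b \<in> div_carrier (DD c) else y (DD c, c) a b = 0"
        if "c \<in> Irr G" for c a b
        using spec[OF spec[OF bspec[OF conjunct1[OF y], of "(DD c, c)"], of a], of b] that
        by (simp add: Irr_div_iff split: if_splits)
      obtain x where x: "x \<in> E" "\<forall>c\<in>Irr G. \<forall>a<n c. \<forall>b<n c. mat x c a b = y (DD c, c) a b"
        using mat_surj[of "\<lambda>c. y (DD c, c)"] y1 by metis
      have "mat x c a b = y (DD c, c) a b" if "c \<in> Irr G" for c a b
        using x(2) y1[OF that, of a b] that by (cases "a < n c \<and> b < n c") (auto simp: mat_def)
      then have "?g x i = y i" for i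
      proof (cases "i \<in> J")
        case True
        then obtain c where "i = (DD c, c)" "c \<in> Irr G"
          unfolding J_iff by (metis prod.collapse)
        then show ?thesis
          using \<open>\<And>c a b. c \<in> Irr G \<Longrightarrow> mat x c a b = y (DD c, c) a b\<close> True by (simp add: fun_eq_iff)
      next
        case False
        then show ?thesis
          using spec[OF conjunct2[OF y], of i] by simp
      qed
      then have "?g x = y"
        by (rule ext)
      then show ?thesis
        using x(1) by blast
    qed
  qed (auto simp: alg_sum_simps mat_alg_simps fun_eq_iff J_iff mat_add mat_scale mat_comp mat_one)
  have "ecf_isomorphic (H_rep G \<rho> \<beta> \<mu>) (ecf_sum J ?K)"
    unfolding ecf_isomorphic_def H_simps
  proof (intro exI[of _ ?f] exI[of _ ?g] conjI ballI)
    fix a assume "a \<in> carrier ZG"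
    then have a: "a \<in> cf"
      by (simp add: center_group_alg)
    show "funA (ecf_sum J ?K) (?f a) = lA a"
      using a by (simp add: ecf_sum_def sum_Irr_div lA_eq Irr_div_iff)
    show "phi (ecf_sum J ?K) (?f a) = ?g (ph a)"
      using mat_ph[OF a] by (auto simp: ecf_sum_def fun_eq_iff J_iff)
    show "starA (ecf_sum J ?K) (?f a) = ?f (flip a)"
      using ev_flip[OF _ a] by (auto simp: ecf_sum_def fun_eq_iff J_iff)
  next
    fix x assume x: "x \<in> E"
    show "funB (ecf_sum J ?K) (?g x) = lB x"
      using x by (simp add: ecf_sum_def sum_Irr_div lB_mat Irr_div_iff)
    show "starB (ecf_sum J ?K) (?g x) = ?g (form.adj x)"
      using mat_adj[OF x] by (auto simp: ecf_sum_def fun_eq_iff J_iff)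
  next
    show "?f (\<nu> \<star> squares) = elemU (ecf_sum J ?K)"
      by (auto simp: ecf_sum_def fun_eq_iff J_iff ev_U)
  qed (use A B in \<open>simp_all add: ecf_sum_def\<close>)
  then show ?thesis
    by (simp add: case_prod_beta')
qed

end

section \<open>Isomorphisms, direct sums and complexification\<close>

lemma alg_isoD:
  assumes "alg_iso C D f"
  shows "x \<in> carrier C \<Longrightarrow> f x \<in> carrier D"
    and "x \<in> carrier C \<Longrightarrow> y \<in> carrier C \<Longrightarrow> f (x + y) = f x + f y"
    and "x \<in> carrier C \<Longrightarrow> f (scale C c x) = scale D c (f x)"
    and "x \<in> carrier C \<Longrightarrow> y \<in> carrier C \<Longrightarrow> f (x \<otimes>\<^bsub>C\<^esub> y) = f x \<otimes>\<^bsub>D\<^esub> f y"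
    and "f \<one>\<^bsub>C\<^esub> = \<one>\<^bsub>D\<^esub>"
    and "inj_on f (carrier C)" and "f ` carrier C = carrier D"
  using assms by (auto simp: alg_iso_def alg_hom_def linear_on_def hom_def bij_betw_def)

lemma alg_iso_comp:
  assumes f: "alg_iso C D f" and g: "alg_iso D E g"
  shows "alg_iso C E (\<lambda>x. g (f x))"
proof (rule alg_isoI)
  note F = alg_isoD[OF f] and G = alg_isoD[OF g]
  show "inj_on (\<lambda>x. g (f x)) (carrier C)"
    using comp_inj_on[OF F(6), of g] G(6) F(7) by (simp add: comp_def)
  show "\<exists>x\<in>carrier C. g (f x) = y" if "y \<in> carrier E" for y
    using that unfolding G(7)[symmetric] F(7)[symmetric] by auto
qed (simp_all add: alg_isoD[OF f] alg_isoD[OF g])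

lemma ecf_isomorphic_trans:
  assumes "ecf_isomorphic H K" "ecf_isomorphic K L"
  shows "ecf_isomorphic H L"
proof -
  obtain f g where fg: "alg_iso (algA H) (algA K) f" "alg_iso (algB H) (algB K) g"
    "\<forall>a\<in>carrier (algA H). funA K (f a) = funA H a" "\<forall>b\<in>carrier (algB H). funB K (g b) = funB H b"
    "\<forall>a\<in>carrier (algA H). phi K (f a) = g (phi H a)" "f (elemU H) = elemU K"
    "\<forall>a\<in>carrier (algA H). starA K (f a) = f (starA H a)"
    "\<forall>b\<in>carrier (algB H). starB K (g b) = g (starB H b)"
    using assms(1) unfolding ecf_isomorphic_def by blast
  obtain f' g' where fg': "alg_iso (algA K) (algA L) f'" "alg_iso (algB K) (algB L) g'"
    "\<forall>a\<in>carrier (algA K). funA L (f' a) = funA K a" "\<forall>b\<in>carrier (algB K). funB L (g' b) = funB K b"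
    "\<forall>a\<in>carrier (algA K). phi L (f' a) = g' (phi K a)" "f' (elemU K) = elemU L"
    "\<forall>a\<in>carrier (algA K). starA L (f' a) = f' (starA K a)"
    "\<forall>b\<in>carrier (algB K). starB L (g' b) = g' (starB K b)"
    using assms(2) unfolding ecf_isomorphic_def by blast
  show ?thesis
    unfolding ecf_isomorphic_def
  proof (intro exI[of _ "\<lambda>x. f' (f x)"] exI[of _ "\<lambda>x. g' (g x)"] conjI)
    show "alg_iso (algA H) (algA L) (\<lambda>x. f' (f x))" "alg_iso (algB H) (algB L) (\<lambda>x. g' (g x))"
      using alg_iso_comp fg fg' by blast+
  qed (use fg fg' alg_isoD(1)[OF fg(1)] alg_isoD(1)[OF fg(2)] in auto)
qed

text \<open>Scalars of a direct sum act at every index, also outside \<open>I\<close>, where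
  families vanish; \<open>sc\<close> keeps them zero there.\<close>

lemma alg_sum_iso:
  assumes f: "\<And>i. i \<in> I \<Longrightarrow> alg_iso (C i) (D i) (f i)"
    and sc: "\<And>i c. i \<notin> I \<Longrightarrow> scale (D i) c 0 = 0"
  shows "alg_iso (alg_sum I C) (alg_sum I D) (\<lambda>x i. if i \<in> I then f i (x i) else 0)"
proof (rule alg_isoI)
  note F = alg_isoD[OF f]
  show "inj_on (\<lambda>x i. if i \<in> I then f i (x i) else 0) (carrier (alg_sum I C))"
  proof (rule inj_onI, rule ext)
    fix x y i assume xy: "x \<in> carrier (alg_sum I C)" "y \<in> carrier (alg_sum I C)"
      "(\<lambda>i. if i \<in> I then f i (x i) else 0) = (\<lambda>i. if i \<in> I then f i (y i) else 0)"
    show "x i = y i"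
    proof (cases "i \<in> I")
      case True
      then show ?thesis
        using fun_cong[OF xy(3), of i] xy(1,2) inj_onD[OF F(6)[OF True], of "x i" "y i"] by (simp add: alg_sum_simps)
    qed (use xy in \<open>simp add: alg_sum_simps\<close>)
  qed
  show "\<exists>x\<in>carrier (alg_sum I C). (\<lambda>i. if i \<in> I then f i (x i) else 0) = y"
    if y: "y \<in> carrier (alg_sum I D)" for y
  proof -
    have "\<forall>i\<in>I. \<exists>z\<in>carrier (C i). f i z = y i"
    proof
      fix i assume i: "i \<in> I"
      then have "y i \<in> f i ` carrier (C i)"
        using y F(7)[OF i] by (simp add: alg_sum_simps)
      then show "\<exists>z\<in>carrier (C i). f i z = y i"
        by auto
    qed
    then obtain x where "\<And>i. i \<in> I \<Longrightarrow> x i \<in> carrier (C i) \<and> f i (x i) = y i"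
      by metis
    then show ?thesis
      using y by (intro bexI[of _ "\<lambda>i. if i \<in> I then x i else 0"]) (auto simp: alg_sum_simps fun_eq_iff)
  qed
qed (auto simp: alg_sum_simps fun_eq_iff alg_isoD[OF f] sc)

lemma ecf_sum_iso:
  assumes iso: "\<And>i. i \<in> I \<Longrightarrow> ecf_isomorphic (H i) (K i)"
    and sc: "\<And>i c. i \<notin> I \<Longrightarrow> scale (algA (K i)) c 0 = 0" "\<And>i c. i \<notin> I \<Longrightarrow> scale (algB (K i)) c 0 = 0"
  shows "ecf_isomorphic (ecf_sum I H) (ecf_sum I K)"
proof -
  have "\<forall>i\<in>I. \<exists>f g. alg_iso (algA (H i)) (algA (K i)) f \<and> alg_iso (algB (H i)) (algB (K i)) g \<and>
      (\<forall>a\<in>carrier (algA (H i)). funA (K i) (f a) = funA (H i) a) \<and>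
      (\<forall>b\<in>carrier (algB (H i)). funB (K i) (g b) = funB (H i) b) \<and>
      (\<forall>a\<in>carrier (algA (H i)). phi (K i) (f a) = g (phi (H i) a)) \<and> f (elemU (H i)) = elemU (K i) \<and>
      (\<forall>a\<in>carrier (algA (H i)). starA (K i) (f a) = f (starA (H i) a)) \<and>
      (\<forall>b\<in>carrier (algB (H i)). starB (K i) (g b) = g (starB (H i) b))"
    using iso unfolding ecf_isomorphic_def by blast
  then obtain f g where fg: "\<And>i. i \<in> I \<Longrightarrow> alg_iso (algA (H i)) (algA (K i)) (f i) \<and> alg_iso (algB (H i)) (algB (K i)) (g i) \<and>
      (\<forall>a\<in>carrier (algA (H i)). funA (K i) (f i a) = funA (H i) a) \<and>
      (\<forall>b\<in>carrier (algB (H i)). funB (K i) (g i b) = funB (H i) b) \<and>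
      (\<forall>a\<in>carrier (algA (H i)). phi (K i) (f i a) = g i (phi (H i) a)) \<and> f i (elemU (H i)) = elemU (K i) \<and>
      (\<forall>a\<in>carrier (algA (H i)). starA (K i) (f i a) = f i (starA (H i) a)) \<and>
      (\<forall>b\<in>carrier (algB (H i)). starB (K i) (g i b) = g i (starB (H i) b))"
    by metis
  show ?thesis
    unfolding ecf_isomorphic_def
  proof (intro exI[of _ "\<lambda>x i. if i \<in> I then f i (x i) else 0"] exI[of _ "\<lambda>x i. if i \<in> I then g i (x i) else 0"] conjI)
    show "alg_iso (algA (ecf_sum I H)) (algA (ecf_sum I K)) (\<lambda>x i. if i \<in> I then f i (x i) else 0)"
      "alg_iso (algB (ecf_sum I H)) (algB (ecf_sum I K)) (\<lambda>x i. if i \<in> I then g i (x i) else 0)"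
      using alg_sum_iso[of I "\<lambda>i. algA (H i)" "\<lambda>i. algA (K i)" f] alg_sum_iso[of I "\<lambda>i. algB (H i)" "\<lambda>i. algB (K i)" g]
        fg sc by (auto simp: ecf_sum_def)
  qed (use fg in \<open>auto simp: ecf_sum_def alg_sum_simps fun_eq_iff intro!: sum.cong\<close>)
qed

section \<open>Complexification of isomorphisms and of direct sums\<close>

lemma alg_complexify_simps:
  "carrier (alg_complexify C) = carrier C \<times> carrier C"
  "mult (alg_complexify C) = (\<lambda>(x, y) (z, w). (x \<otimes>\<^bsub>C\<^esub> z - y \<otimes>\<^bsub>C\<^esub> w, x \<otimes>\<^bsub>C\<^esub> w + y \<otimes>\<^bsub>C\<^esub> z))"
  "one (alg_complexify C) = (\<one>\<^bsub>C\<^esub>, 0)"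
  "scale (alg_complexify C) = (\<lambda>c (x, y). (scale C (Re c) x - scale C (Im c) y,
     scale C (Re c) y + scale C (Im c) x))"
  by (simp_all add: alg_complexify_def)

lemma alg_complexify_iso:
  fixes C :: "(real, 'a::real_vector) alg" and D :: "(real, 'b::real_vector) alg"
  assumes f: "alg_iso C D f" and sub: "subspace (carrier C)" and sc: "scale C = (*\<^sub>R)"
    and mult: "\<And>x y. x \<in> carrier C \<Longrightarrow> y \<in> carrier C \<Longrightarrow> x \<otimes>\<^bsub>C\<^esub> y \<in> carrier C"
  shows "alg_iso (alg_complexify C) (alg_complexify D) (map_prod f f)"
proof (rule alg_isoI)
  note F = alg_isoD[OF f]
  have diff: "f (x - y) = f x - f y" if "x \<in> carrier C" "y \<in> carrier C" for x y
    using F(2)[OF subspace_diff[OF sub that] that(2)] by (simp add: eq_diff_eq)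
  have f0: "f 0 = 0"
    using diff[OF subspace_0[OF sub] subspace_0[OF sub]] by simp
  note cl = subspace_diff[OF sub] subspace_add[OF sub] subspace_scale[OF sub] mult
  note F3 = F(3)[unfolded sc]
  show "map_prod f f x \<in> carrier (alg_complexify D)" if "x \<in> carrier (alg_complexify C)" for x
    using that F(1) by (auto simp: alg_complexify_simps)
  show "map_prod f f (x + y) = map_prod f f x + map_prod f f y"
    if "x \<in> carrier (alg_complexify C)" "y \<in> carrier (alg_complexify C)" for x y
    using that F(2) by (auto simp: alg_complexify_simps)
  show "map_prod f f (scale (alg_complexify C) c x) = scale (alg_complexify D) c (map_prod f f x)"
    if "x \<in> carrier (alg_complexify C)" for c x
    using that by (auto simp: alg_complexify_simps sc diff F(2) F3 cl)
  show "map_prod f f (x \<otimes>\<^bsub>alg_complexify C\<^esub> y) = map_prod f f x \<otimes>\<^bsub>alg_complexify D\<^esub> map_prod f f y"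
    if "x \<in> carrier (alg_complexify C)" "y \<in> carrier (alg_complexify C)" for x y
    using that by (auto simp: alg_complexify_simps diff F(2,4) cl)
  show "map_prod f f \<one>\<^bsub>alg_complexify C\<^esub> = \<one>\<^bsub>alg_complexify D\<^esub>"
    by (simp add: alg_complexify_simps F(5) f0)
  show "inj_on (map_prod f f) (carrier (alg_complexify C))"
    unfolding alg_complexify_simps by (rule map_prod_inj_on[OF F(6) F(6)])
  show "\<exists>x\<in>carrier (alg_complexify C). map_prod f f x = y" if "y \<in> carrier (alg_complexify D)" for y
    using that unfolding alg_complexify_simps F(7)[symmetric] by (auto simp: map_prod_def)
qed

lemma ecf_complexify_iso:
  fixes H :: "(real, 'a::real_vector, 'b::real_vector) ecf"
    and K :: "(real, 'c::real_vector, 'd::real_vector) ecf"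
  assumes iso: "ecf_isomorphic H K"
    and A: "subspace (carrier (algA H))" "scale (algA H) = (*\<^sub>R)"
      "\<And>x y. x \<in> carrier (algA H) \<Longrightarrow> y \<in> carrier (algA H) \<Longrightarrow> x \<otimes>\<^bsub>algA H\<^esub> y \<in> carrier (algA H)"
    and B: "subspace (carrier (algB H))" "scale (algB H) = (*\<^sub>R)"
      "\<And>x y. x \<in> carrier (algB H) \<Longrightarrow> y \<in> carrier (algB H) \<Longrightarrow> x \<otimes>\<^bsub>algB H\<^esub> y \<in> carrier (algB H)"
  shows "ecf_isomorphic (ecf_complexify H) (ecf_complexify K)"
proof -
  obtain f g where fg: "alg_iso (algA H) (algA K) f" "alg_iso (algB H) (algB K) g"
    "\<forall>a\<in>carrier (algA H). funA K (f a) = funA H a" "\<forall>b\<in>carrier (algB H). funB K (g b) = funB H b"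
    "\<forall>a\<in>carrier (algA H). phi K (f a) = g (phi H a)" "f (elemU H) = elemU K"
    "\<forall>a\<in>carrier (algA H). starA K (f a) = f (starA H a)"
    "\<forall>b\<in>carrier (algB H). starB K (g b) = g (starB H b)"
    using iso unfolding ecf_isomorphic_def by blast
  have f0: "f 0 = 0"
    using alg_isoD(2)[OF fg(1) subspace_0[OF A(1)] subspace_0[OF A(1)]] by simp
  show ?thesis
    unfolding ecf_isomorphic_def
  proof (intro exI[of _ "map_prod f f"] exI[of _ "map_prod g g"] conjI)
    show "alg_iso (algA (ecf_complexify H)) (algA (ecf_complexify K)) (map_prod f f)"
      "alg_iso (algB (ecf_complexify H)) (algB (ecf_complexify K)) (map_prod g g)"
      using alg_complexify_iso[OF fg(1) A] alg_complexify_iso[OF fg(2) B] by (simp_all add: ecf_complexify_def)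
  qed (use fg f0 in \<open>auto simp: ecf_complexify_def alg_complexify_simps\<close>)
qed

lemma complex_sum: "(\<Sum>i\<in>I. Complex (f i) (g i)) = Complex (\<Sum>i\<in>I. f i) (\<Sum>i\<in>I. g i)"
  by (simp add: complex_eq_iff)

lemma alg_complexify_sum:
  fixes C :: "'i \<Rightarrow> (real, 'a::real_vector) alg"
  shows "alg_iso (alg_complexify (alg_sum I C)) (alg_sum I (\<lambda>i. alg_complexify (C i))) (\<lambda>(x, y) i. (x i, y i))"
proof (rule alg_isoI)
  show "\<exists>z\<in>carrier (alg_complexify (alg_sum I C)). (\<lambda>(x, y) i. (x i, y i)) z = y"
    if "y \<in> carrier (alg_sum I (\<lambda>i. alg_complexify (C i)))" for y
    using that by (intro bexI[of _ "(\<lambda>i. fst (y i), \<lambda>i. snd (y i))"])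
      (auto simp: alg_sum_simps alg_complexify_simps fun_eq_iff zero_prod_def)
qed (auto simp: alg_sum_simps alg_complexify_simps fun_eq_iff zero_prod_def inj_on_def)

lemma ecf_complexify_sum:
  fixes H :: "'i \<Rightarrow> (real, 'a::real_vector, 'b::real_vector) ecf"
  shows "ecf_isomorphic (ecf_complexify (ecf_sum I H)) (ecf_sum I (\<lambda>i. ecf_complexify (H i)))"
  unfolding ecf_isomorphic_def
proof (intro exI[of _ "\<lambda>(x, y) i. (x i, y i)"] conjI)
  show "alg_iso (algA (ecf_complexify (ecf_sum I H))) (algA (ecf_sum I (\<lambda>i. ecf_complexify (H i)))) (\<lambda>(x, y) i. (x i, y i))"
    "alg_iso (algB (ecf_complexify (ecf_sum I H))) (algB (ecf_sum I (\<lambda>i. ecf_complexify (H i)))) (\<lambda>(x, y) i. (x i, y i))"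
    using alg_complexify_sum[of I "\<lambda>i. algA (H i)"] alg_complexify_sum[of I "\<lambda>i. algB (H i)"]
    by (simp_all add: ecf_sum_def ecf_complexify_def)
qed (auto simp: ecf_sum_def ecf_complexify_def fun_eq_iff complex_sum zero_prod_def alg_complexify_simps)

section \<open>Removing the signs over the complex numbers\<close>

text \<open>A square root of \<open>e\<close> when \<open>e\<close> is 1 or -1.\<close>

definition sroot :: "real \<Rightarrow> complex" where
  "sroot e = (if e = 1 then 1 else \<i>)"

text \<open>Multiplication by a complex scalar on pairs, where the second component is the
  coefficient of the imaginary unit of the complexification, not of the quaternion i.\<close>

definition cscale :: "complex \<Rightarrow> quat \<times> quat \<Rightarrow> quat \<times> quat" where
  "cscale z p = (Re z *\<^sub>R fst p - Im z *\<^sub>R snd p, Re z *\<^sub>R snd p + Im z *\<^sub>R fst p)"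

text \<open>Conjugation by the diagonal matrix of square roots of the signs.\<close>

definition unsign :: "(nat \<Rightarrow> real) \<Rightarrow> (nat \<Rightarrow> nat \<Rightarrow> quat) \<times> (nat \<Rightarrow> nat \<Rightarrow> quat) \<Rightarrow>
    (nat \<Rightarrow> nat \<Rightarrow> quat) \<times> (nat \<Rightarrow> nat \<Rightarrow> quat)" where
  "unsign e = (\<lambda>(x, y). (\<lambda>i j. fst (cscale (sroot (e i) / sroot (e j)) (x i j, y i j)),
     \<lambda>i j. snd (cscale (sroot (e i) / sroot (e j)) (x i j, y i j))))"

lemma cscale_mult: "cscale z (cscale w p) = cscale (z * w) p"
  and cscale_1 [simp]: "cscale 1 p = p"
  and cscale_0 [simp]: "cscale z (0, 0) = (0, 0)"
  by (simp_all add: cscale_def algebra_simps)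

lemma cscale_prod:
  "cscale (z * w) (a * c - b * d, a * d + b * c) =
    (fst (cscale z (a, b)) * fst (cscale w (c, d)) - snd (cscale z (a, b)) * snd (cscale w (c, d)),
     fst (cscale z (a, b)) * snd (cscale w (c, d)) + snd (cscale z (a, b)) * fst (cscale w (c, d)))"
  by (simp add: cscale_def algebra_simps)

lemma sroot_nonzero [simp]: "sroot e \<noteq> 0"
  by (simp add: sroot_def)

definition resign :: "(nat \<Rightarrow> real) \<Rightarrow> (nat \<Rightarrow> nat \<Rightarrow> quat) \<times> (nat \<Rightarrow> nat \<Rightarrow> quat) \<Rightarrow>
    (nat \<Rightarrow> nat \<Rightarrow> quat) \<times> (nat \<Rightarrow> nat \<Rightarrow> quat)" where
  "resign e = (\<lambda>(x, y). (\<lambda>i j. fst (cscale (sroot (e j) / sroot (e i)) (x i j, y i j)),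
     \<lambda>i j. snd (cscale (sroot (e j) / sroot (e i)) (x i j, y i j))))"

lemma unsign_resign: "unsign e (resign e p) = p" "resign e (unsign e p) = p"
  by (cases p; simp add: unsign_def resign_def cscale_mult)+

lemma div_carrier_diff [simp]: "x \<in> div_carrier D \<Longrightarrow> y \<in> div_carrier D \<Longrightarrow> x - y \<in> div_carrier D"
  by (rule subspace_diff[OF subspace_div_carrier])

lemma unsign_carrier:
  "p \<in> carrier (alg_complexify (mat_alg n D)) \<Longrightarrow> unsign e p \<in> carrier (alg_complexify (mat_alg n D))"
  "p \<in> carrier (alg_complexify (mat_alg n D)) \<Longrightarrow> resign e p \<in> carrier (alg_complexify (mat_alg n D))"
  by (cases p; auto simp: alg_complexify_simps mat_alg_simps unsign_def resign_def cscale_def)+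

lemma unsign_iso:
  "alg_iso (alg_complexify (mat_alg n D)) (alg_complexify (mat_alg n D)) (unsign e)"
proof (rule alg_isoI)
  let ?C = "alg_complexify (mat_alg n D)"
  show "unsign e x \<in> carrier ?C" if "x \<in> carrier ?C" for x
    using unsign_carrier(1)[OF that] .
  show "inj_on (unsign e) (carrier ?C)"
    by (rule inj_on_inverseI[of _ "resign e"]) (rule unsign_resign)
  show "\<exists>x\<in>carrier ?C. unsign e x = y" if "y \<in> carrier ?C" for y
    using unsign_carrier(2)[OF that] unsign_resign(1) by blast
  show "unsign e (x + y) = unsign e x + unsign e y" for x y
    by (cases x; cases y) (simp add: unsign_def cscale_def fun_eq_iff algebra_simps)
  show "unsign e (scale ?C c x) = scale ?C c (unsign e x)" for c x
    by (cases x) (simp add: unsign_def cscale_def alg_complexify_simps mat_alg_simps fun_eq_iff algebra_simps)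
  show "unsign e \<one>\<^bsub>?C\<^esub> = \<one>\<^bsub>?C\<^esub>"
    by (auto simp: unsign_def cscale_def alg_complexify_simps mat_alg_simps scalar_mat_def fun_eq_iff)
  show "unsign e (x \<otimes>\<^bsub>?C\<^esub> y) = unsign e x \<otimes>\<^bsub>?C\<^esub> unsign e y" for x y
  proof -
    obtain x1 x2 y1 y2 where xy: "x = (x1, x2)" "y = (y1, y2)"
      by (cases x; cases y)
    have lin: "cscale z (\<Sum>k<n. f k, \<Sum>k<n. h k) = (\<Sum>k<n. fst (cscale z (f k, h k)), \<Sum>k<n. snd (cscale z (f k, h k)))"
      for z and f h :: "nat \<Rightarrow> quat"
      by (simp add: cscale_def scaleR_sum_right sum_subtractf sum.distrib)
    \<comment> \<open>The factors of the entries \<open>(i, k)\<close> and \<open>(k, j)\<close>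
      telescope, as for any conjugation by a diagonal matrix.\<close>
    have "cscale (sroot (e i) / sroot (e j)) (x1 i k * y1 k j - x2 i k * y2 k j, x1 i k * y2 k j + x2 i k * y1 k j) =
        (fst (cscale (sroot (e i) / sroot (e k)) (x1 i k, x2 i k)) * fst (cscale (sroot (e k) / sroot (e j)) (y1 k j, y2 k j)) -
           snd (cscale (sroot (e i) / sroot (e k)) (x1 i k, x2 i k)) * snd (cscale (sroot (e k) / sroot (e j)) (y1 k j, y2 k j)),
         fst (cscale (sroot (e i) / sroot (e k)) (x1 i k, x2 i k)) * snd (cscale (sroot (e k) / sroot (e j)) (y1 k j, y2 k j)) +
           snd (cscale (sroot (e i) / sroot (e k)) (x1 i k, x2 i k)) * fst (cscale (sroot (e k) / sroot (e j)) (y1 k j, y2 k j)))"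
      for i j k
      using cscale_prod[of "sroot (e i) / sroot (e k)" "sroot (e k) / sroot (e j)" "x1 i k" "y1 k j" "x2 i k" "y2 k j"]
      by simp
    then show ?thesis
      unfolding xy unsign_def alg_complexify_simps mat_alg_simps prod.case prod.inject
      by (simp only: minus_apply plus_fun_apply fun_eq_iff sum_subtractf[symmetric] sum.distrib[symmetric] lin fst_conv snd_conv) simp
  qed
qed

text \<open>The involution is extended complex linearly, so transposition replaces the factor
  \<open>sroot (e i) / sroot (e j)\<close> by its inverse without complex conjugation. The inverse
  differs from the factor itself by \<open>e i * e j\<close>, because the squares of the roots are
  the signs.\<close>

lemma unsign_star:
  assumes "\<And>i. i < n \<Longrightarrow> e i = 1 \<or> e i = -1" and x: "p \<in> carrier (alg_complexify (mat_alg n D))"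
  shows "map_prod (\<lambda>x i j. qcnj (x j i)) (\<lambda>x i j. qcnj (x j i)) (unsign e p) =
    unsign e (map_prod (\<lambda>x i j. (e i * e j) *\<^sub>R qcnj (x j i)) (\<lambda>x i j. (e i * e j) *\<^sub>R qcnj (x j i)) p)"
proof -
  obtain x y where p: "p = (x, y)"
    by (cases p)
  have z: "x i j = 0 \<and> y i j = 0" if "\<not> (i < n \<and> j < n)" for i j
    using assms(2) that by (auto simp: p alg_complexify_simps mat_alg_simps split: if_splits)
  have cnj: "qcnj (a - b) = qcnj a - qcnj b" "qcnj (a + b) = qcnj a + qcnj b" "qcnj (k *\<^sub>R a) = k *\<^sub>R qcnj a" for a b k
    by (simp_all add: quat_eq_iff)
  have "qcnj (fst (cscale (sroot (e j) / sroot (e i)) (x j i, y j i))) =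
        fst (cscale (sroot (e i) / sroot (e j)) ((e i * e j) *\<^sub>R qcnj (x j i), (e i * e j) *\<^sub>R qcnj (y j i))) \<and>
      qcnj (snd (cscale (sroot (e j) / sroot (e i)) (x j i, y j i))) =
        snd (cscale (sroot (e i) / sroot (e j)) ((e i * e j) *\<^sub>R qcnj (x j i), (e i * e j) *\<^sub>R qcnj (y j i)))" for i j
  proof (cases "i < n \<and> j < n")
    case True
    then show ?thesis
      using assms(1)[of i] assms(1)[of j] by (auto simp: cscale_def sroot_def cnj)
  next
    case False
    then have "x j i = 0" "y j i = 0"
      using z[of j i] by auto
    then show ?thesis
      by (simp add: cscale_def)
  qed
  then show ?thesis
    by (simp add: p unsign_def fun_eq_iff)
qed

lemma H_signed_complexify:
  assumes e: "\<And>i. i < n \<Longrightarrow> e i = 1 \<or> e i = -1"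
  shows "ecf_isomorphic (ecf_complexify (H_signed D n m e)) (ecf_complexify (H_div D n m))"
proof -
  \<comment> \<open>Diagonal entries are multiplied by 1, so the images of scalars under
    \<open>scalar_mat\<close> are not changed.\<close>
  have diag: "unsign e p = p'" if "p = (x, y)" "p' = (x, y)" "\<And>i j. i \<noteq> j \<Longrightarrow> x i j = 0 \<and> y i j = 0" for p p' x y
  proof -
    have "cscale (sroot (e i) / sroot (e j)) (x i j, y i j) = (x i j, y i j)" for i j
      using that(3)[of i j] by (cases "i = j") (auto simp: cscale_def)
    then show ?thesis
      by (simp add: that(1,2) unsign_def)
  qed
  show ?thesis
    unfolding ecf_isomorphic_def
  proof (rule exI[of _ "\<lambda>x. x"], rule exI[of _ "unsign e"], intro conjI ballI)
    show "alg_iso (algA (ecf_complexify (H_signed D n m e))) (algA (ecf_complexify (H_div D n m))) (\<lambda>x. x)"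
      by (rule alg_isoI) (auto simp: ecf_complexify_def)
    show "alg_iso (algB (ecf_complexify (H_signed D n m e))) (algB (ecf_complexify (H_div D n m))) (unsign e)"
      using unsign_iso[of n D e] by (simp add: ecf_complexify_def)
    show "phi (ecf_complexify (H_div D n m)) a = unsign e (phi (ecf_complexify (H_signed D n m e)) a)" for a
      by (cases a) (auto simp: ecf_complexify_def scalar_mat_def intro!: diag[symmetric])
    show "funB (ecf_complexify (H_div D n m)) (unsign e p) = funB (ecf_complexify (H_signed D n m e)) p" for p
      by (cases p) (simp add: ecf_complexify_def unsign_def)
    show "starB (ecf_complexify (H_div D n m)) (unsign e p) = unsign e (starB (ecf_complexify (H_signed D n m e)) p)"
      if "p \<in> carrier (algB (ecf_complexify (H_signed D n m e)))" for p
      using unsign_star[OF e that[unfolded ecf_complexify_def ecf.simps H_signed_simps]] that by (simp add: ecf_complexify_def)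
  qed (auto simp: ecf_complexify_def)
qed

theorem theorem7:
  fixes G :: "('g, 'm) monoid_scheme"
    and \<rho> :: "('g, 'v::real_vector) rep"
    and \<beta> :: "'v \<Rightarrow> 'v \<Rightarrow> real"
    and \<mu> :: "'g \<Rightarrow> real"
  assumes "group G" and "finite (carrier G)"
    and "real_rep G \<rho>"
    and "invariant_form G \<rho> \<beta>"
    and "\<mu> \<in> Units (center_alg (group_alg G))"
    and "\<forall>g\<in>carrier G. \<mu> g = \<mu> (inv\<^bsub>G\<^esub> g)"
  shows "semisimple_ecf (H_rep G \<rho> \<beta> \<mu>) \<and>
    (\<exists>n :: 'g model_rep set \<Rightarrow> nat.
       rep_isomorphic G \<rho>
         (rep_sum (SIGMA c:Irr G. {..<n c}) (\<lambda>(c, k). representative c)) \<and>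
       ecf_isomorphic
         (ecf_complexify (H_rep G \<rho> \<beta> \<mu>))
         (ecf_sum (SIGMA D:UNIV. Irr_div G D)
           (\<lambda>(D, c). ecf_complexify
             (H_div D (n c)
               (scalar_on G \<mu> (representative c) *
                 real (dim (rep_space (representative c))) / real (card (carrier G)))))))"
proof
  interpret fin_group G
    by (intro fin_group.intro fin_group_axioms.intro assms)
  interpret rep_data G \<rho> \<beta> \<mu>
    by (intro rep_data.intro form_rep.intro fin_rep.intro rep_data_axioms.intro form_rep_axioms.intro fin_group_axioms assms)
  show "semisimple_ecf (H_rep G \<rho> \<beta> \<mu>)"
    by (rule semisimple)
  \<comment> \<open>The classes receive their forms and commutants first, since the embeddings into
    \<open>\<rho>\<close> are normalised against these forms.\<close>
  obtain bb DD tt where "irr_choice G bb DD tt"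
    using irr_choice_ex by blast
  then interpret irr_choice G bb DD tt .
  obtain n :: "'g model_rep set \<Rightarrow> nat" and \<iota> \<epsilon>
    where "orthogonal_embeddings G \<rho> \<beta> bb V (SIGMA c:Irr G. {..<n c}) fst \<iota> \<epsilon>"
    using orthogonal_embeddings_pairs[of bb] irr_data.axioms(1)[OF irr_data] by blast
  then interpret rep_decomp G \<rho> \<beta> \<mu> bb DD tt n \<iota> \<epsilon>
    by unfold_locales
  let ?K = "\<lambda>(D, c). H_signed D (n c) (mm c) (\<lambda>k. \<epsilon> (c, k))"
  let ?L = "\<lambda>(D, c). ecf_complexify (H_div D (n c) (mm c))"
  interpret Z: fin_dim_algebra ZG
    by (rule ZG_fin_dim)
  \<comment> \<open>The real isomorphism with signed blocks is complexified; after passing to a sum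
    of complexifications the signs are removed block by block.\<close>
  have 1: "ecf_isomorphic (ecf_complexify (H_rep G \<rho> \<beta> \<mu>)) (ecf_complexify (ecf_sum J ?K))"
    using Z.m_closed subspace_cf subspace_E E_comp
    by (intro ecf_complexify_iso[OF real_decomposition]) (auto simp: H_simps center_group_alg conv_cf)
  have 2: "ecf_isomorphic (ecf_sum J (\<lambda>i. ecf_complexify (?K i))) (ecf_sum J ?L)"
  proof (rule ecf_sum_iso)
    show "ecf_isomorphic (ecf_complexify (?K i)) (?L i)" if i: "i \<in> J" for i
    proof -
      obtain D c where "i = (D, c)" "c \<in> Irr G"
        using i J_iff by (metis prod.collapse)
      moreover have "\<epsilon> (c, k) = 1 \<or> \<epsilon> (c, k) = -1" if "k < n c" "c \<in> Irr G" for k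
        using eps[of "(c, k)"] that by simp
      ultimately show ?thesis
        using H_signed_complexify by simp
    qed
  qed (auto simp: ecf_complexify_def alg_complexify_simps mat_alg_simps zero_prod_def)
  show "\<exists>n :: 'g model_rep set \<Rightarrow> nat.
       rep_isomorphic G \<rho>
         (rep_sum (SIGMA c:Irr G. {..<n c}) (\<lambda>(c, k). representative c)) \<and>
       ecf_isomorphic
         (ecf_complexify (H_rep G \<rho> \<beta> \<mu>))
         (ecf_sum (SIGMA D:UNIV. Irr_div G D)
           (\<lambda>(D, c). ecf_complexify
             (H_div D (n c)
               (scalar_on G \<mu> (representative c) *
                 real (dim (rep_space (representative c))) / real (card (carrier G))))))"
    using rep_isomorphic_sum ecf_isomorphic_trans[OF 1 ecf_isomorphic_trans[OF ecf_complexify_sum 2]] by blast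
qed

end
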